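(* Let $d\ge 3$ and $r\ge2$. Suppose $\mathcal T\in\mathbb C^{n\times\cdots\times n}$ ($d$ modes) satisfies $$T(\alpha_1,\dots,\alpha_d)=\operatorname{tr}\bigl(Q^{(\alpha_1)}Q^{(\alpha_2)}\cdots Q^{(\alpha_d)}\bigr),\qquad (\alpha_1,\dots,\alpha_d)\in[n]^d,$$ with $n\ge r^2$. Assume that the elements of the core $\mathcal Q\in\mathbb C^{n\times r\times r}$ are randomly drawn from a measure $\mu$ that is absolutely continuous with respect to the standard Euclidean measure. Then with probability one, $\mathcal Q$ can be identified up to gauge invariance by the BLOSTR-S algorithm described in the context, run with any index pairs $(\alpha,\beta)$, $(\alpha',\beta')$ satisfying $\alpha\ne\beta$, $\alpha'\ne\beta'$, $\{\alpha,\beta\}\ne\{\alpha',\beta'\}$. That is, its output $\tilde{\mathcal Q}$ satisfies, for some $L_1,\dots,L_d\in\mathrm{GL}(r,\mathbb C)$, $$\tilde Q^{(a)}=L_k^{-1}Q^{(a)}L_{k+1}\quad\text{for all }k\in[d],\ a\in[n],\qquad L_{d+1}:=L_1 .$$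
   Context: **Notation.** $[n]=\{1,\dots,n\}$. For a core $\mathcal Q\in\mathbb C^{n\times r\times r}$, $Q^{(a)}\in\mathbb C^{r\times r}$ is its $a$-th slice, $Q^{(a)}_{i,j}=\mathcal Q_{a,i,j}$. Its two unfoldings $Q_{\langle1\rangle},Q_{[1]}\in\mathbb C^{n\times r^2}$ are, for $i,j\in[r]$, $$Q_{\langle 1\rangle}(a,(i-1)r+j)=Q^{(a)}_{i,j},\qquad Q_{[1]}(a,(i-1)r+j)=Q^{(a)}_{j,i}.$$ $A^\top$ is the transpose, $A^\dagger$ the Moore–Penrose inverse, $\otimes$ the Kronecker product. For an $r^2\times r^2$ matrix $X$, $\Pi(X)$ is the $r^2\times r^2$ matrix with $$\Pi(X)_{(j_2-1)r+j_1,(k_2-1)r+k_1}=X_{(j_1-1)r+j_2,(k_1-1)r+k_2},\qquad j_1,j_2,k_1,k_2\in[r].$$ For a tuple $\alpha=(\alpha_2,\dots,\alpha_{d-1})\in[n]^{d-2}$ and $\Gamma\subseteq[n]$ with $|\Gamma|=r^2$, $T(:,\alpha,\Gamma)$ is the $n\times r^2$ matrix with columns $T(:,\alpha_2,\dots,\alpha_{d-1},a)$, $a\in\Gamma$. **BLOSTR-S algorithm.** Input: the TR rank $r$ and the entries of $\mathcal T$ used below. Here $\Gamma_\alpha,\Gamma_\beta,\Gamma_{\alpha'},\Gamma_{\beta'},\Gamma_\gamma\subseteq[n]$ are index subsets of cardinality $r^2$ and $\gamma=(m,\dots,m)\in[n]^{d-2}$ for some $m\in[n]$. 1. Choose two index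 pairs $(\alpha,\beta)$ and $(\alpha',\beta')$ in $([n]^{d-2})^2$ with $\alpha\ne\beta$, $\alpha'\ne\beta'$, $\{\alpha,\beta\}\ne\{\alpha',\beta'\}$. Compute the eigendecompositions of $T(:,\alpha,\Gamma_\alpha)\,T(:,\beta,\Gamma_\beta)^\dagger$ and $T(:,\alpha',\Gamma_{\alpha'})\,T(:,\beta',\Gamma_{\beta'})^\dagger$, and stack the eigenvectors for the nonzero spectrum as $E,E'\in\mathbb C^{n\times r^2}$ respectively. Arrange the columns of $E$ (resp. $E'$) in $r$ consecutive blocks of size $r$ so that each block contains eigenvectors corresponding to the $r$ distinct nonzero eigenvalues in a fixed order (so column $(j-1)r+k$ belongs to the $k$-th eigenvalue, $j,k\in[r]$). 2. Let $F=E^\dagger E'$ and, for $j,k\in[r]$, let $F^{(j,k)}\in\mathbb C^{r\times r}$, $F^{(j,k)}_{p,q}=F_{(p-1)r+j,(q-1)r+k}$. Set $\hat K_1=I_r$, $\hat K_\ell=F^{(1,1)}(F^{(\ell,1)})^{-1}$ for $2\le\ell\le r$, $\hat K=\mathrm{blockdiag}(\hat K_1,\dots,\hat K_r)$, and let $\hat{\mathcal Q}_1$ be the core with $\hat Q_{1\langle1\rangle}=E\,(\Pi(\hat K))^{-1}$. 3. Let $S=T(:,\gamma,\Gamma_\gamma)$. For $k=2,\dots,d$, successively let $\hat{\mathcal Q}_k$ be the core with $$\hat Q_{k\langle1\rangle}=S\Bigl(\bigl(I_r\otimes(\hat Q_1^{(m)}\cdots\hat Q_{k-2}^{(m)})\bigr)\,\bigl(\hat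 Q_{(k-1)[1]}^\top\bigr)(:,\Gamma_\gamma)\Bigr)^\dagger,$$ where the product in parentheses is $I_r$ if $k=2$, and $(\cdot)(:,\Gamma_\gamma)$ denotes restriction to the columns in $\Gamma_\gamma$. 4. Take an eigendecomposition $\hat Q_1^{(1)}\hat Q_2^{(1)}\cdots\hat Q_d^{(1)}=Y_1\Lambda_1Y_1^{-1}$, $\Lambda_1=\mathrm{diag}(\lambda_{1,1},\dots,\lambda_{1,r})$, and write $\lambda_{1,t}=\ell_te^{\mathrm i\theta_t}$ with $\ell_t\ge0$, $\theta_t\in[0,2\pi)$. 5. Repeat: choose $(k_2,\dots,k_r)\in\{0,1,\dots,d-1\}^{r-1}$, set $$\Omega=\mathrm{diag}\bigl(\ell_1^{1/d}e^{\mathrm i\theta_1/d},\ \ell_2^{1/d}e^{\mathrm i(\theta_2+2k_2\pi)/d},\dots,\ell_r^{1/d}e^{\mathrm i(\theta_r+2k_r\pi)/d}\bigr),$$ $\bar Q^{(1)}=Y_1\Omega Y_1^{-1}$, and $\bar Q^{(j)}=(\bar Q^{(1)})^{-(d-1)}\hat Q_1^{(1)}\cdots\hat Q_{d-1}^{(1)}\hat Q_d^{(j)}$ for $2\le j\le n$; until $$\hat Q_1^{(\alpha_1)}\hat Q_2^{(\alpha_2)}\cdots\hat Q_d^{(\alpha_d)}=\bar Q^{(\alpha_1)}\bar Q^{(\alpha_2)}\cdots\bar Q^{(\alpha_d)}\quad\text{for all }(\alpha_1,\dots,\alpha_d)\in[n]^d.$$ Output: $\tilde{\mathcal Q}=\bar{\mathcal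 Q}$.
   Formalization: Every output is shown gauge equivalent to Q for all admissible pairs; that the algorithm yields an output is claimed only if Γ_α=Γ_β, Γ_α'=Γ_β' and steps 1–2 can be carried out for at least one core (automatic for index pairs if d=3), since otherwise it breaks down almost surely. *)

theory Defs
  imports
    "HOL-Analysis.Complex_Transcendental"
    "HOL-Probability.Probability_Measure"
    "Jordan_Normal_Form.Schur_Decomposition"
    "Jordan_Normal_Form.Gauss_Jordan_Elimination"
    "Jordan_Normal_Form.DL_Submatrix"
begin

text \<open>
  All indices are shifted to start at 0: \<open>[n]\<close> is \<open>{..<n}\<close>, slice 1 is slice 0, and the composite
  index \<open>(i - 1) r + j\<close> with \<open>i, j \<in> [r]\<close> becomes \<open>i * r + j\<close> with \<open>i, j < r\<close>.
  Modes and cores keep their numbers \<open>1, \<dots>, d\<close>.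
\<close>

section \<open>Matrices\<close>

definition minv :: "complex mat \<Rightarrow> complex mat" where
  "minv A = the (mat_inverse A)"

definition mtrace :: "complex mat \<Rightarrow> complex" where
  "mtrace A = (\<Sum>i<dim_row A. A $$ (i, i))"

definition is_pinv :: "complex mat \<Rightarrow> complex mat \<Rightarrow> bool" where
  "is_pinv A X \<longleftrightarrow>
     X \<in> carrier_mat (dim_col A) (dim_row A) \<and>
     A * X * A = A \<and> X * A * X = X \<and>
     mat_adjoint (A * X) = A * X \<and> mat_adjoint (X * A) = X * A"

definition pinv :: "complex mat \<Rightarrow> complex mat" where
  "pinv A = (THE X. is_pinv A X)"

definition kron :: "complex mat \<Rightarrow> complex mat \<Rightarrow> complex mat" where
  "kron A B = Matrix.mat (dim_row A * dim_row B) (dim_col A * dim_col B)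
     (\<lambda>(i, j). A $$ (i div dim_row B, j div dim_col B) * B $$ (i mod dim_row B, j mod dim_col B))"

definition mprod :: "nat \<Rightarrow> complex mat list \<Rightarrow> complex mat" where
  "mprod r As = foldr (*) As (1\<^sub>m r)"

text \<open>Swaps the two components of the composite row index and of the composite column index.\<close>

definition block_perm :: "nat \<Rightarrow> complex mat \<Rightarrow> complex mat" where
  "block_perm r X = Matrix.mat (r * r) (r * r)
     (\<lambda>(p, q). X $$ ((p mod r) * r + p div r, (q mod r) * r + q div r))"

section \<open>Cores and the tensor ring tensor\<close>

text \<open>
  The entries of a core are a point of \<open>\<complex>\<^bsup>n \<times> r \<times> r\<^esup>\<close>, given by coordinates. The algorithm works with
  the family of slices of a core.
\<close>

type_synonym core = "nat \<times> nat \<times> nat \<Rightarrow> complex"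
type_synonym slices = "nat \<Rightarrow> complex mat"

definition core_lebesgue :: "nat \<Rightarrow> nat \<Rightarrow> core measure" where
  "core_lebesgue n r = Pi\<^sub>M ({..<n} \<times> {..<r} \<times> {..<r}) (\<lambda>_. lborel)"

definition slice :: "nat \<Rightarrow> core \<Rightarrow> slices" where
  "slice r Q a = Matrix.mat r r (\<lambda>(i, j). Q (a, i, j))"

definition unfold_angle :: "nat \<Rightarrow> nat \<Rightarrow> slices \<Rightarrow> complex mat" where
  "unfold_angle n r S = Matrix.mat n (r * r) (\<lambda>(a, c). S a $$ (c div r, c mod r))"

definition unfold_square :: "nat \<Rightarrow> nat \<Rightarrow> slices \<Rightarrow> complex mat" where
  "unfold_square n r S = Matrix.mat n (r * r) (\<lambda>(a, c). S a $$ (c mod r, c div r))"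

text \<open>The core with a prescribed first unfolding, i.e. the inverse of \<open>unfold_angle\<close>.\<close>

definition fold_angle :: "nat \<Rightarrow> complex mat \<Rightarrow> slices" where
  "fold_angle r X a = Matrix.mat r r (\<lambda>(i, j). X $$ (a, i * r + j))"

definition tr_tensor :: "nat \<Rightarrow> core \<Rightarrow> nat list \<Rightarrow> complex" where
  "tr_tensor r Q as = mtrace (mprod r (map (slice r Q) as))"

definition gauge_equiv :: "nat \<Rightarrow> nat \<Rightarrow> nat \<Rightarrow> slices \<Rightarrow> slices \<Rightarrow> bool" where
  "gauge_equiv n r d S R \<longleftrightarrow>
     (\<exists>L :: nat \<Rightarrow> complex mat.
        (\<forall>k \<in> {1..d}. L k \<in> carrier_mat r r \<and> invertible_mat (L k)) \<and>
        L (d + 1) = L 1 \<and>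
        (\<forall>k \<in> {1..d}. \<forall>a<n. R a = minv (L k) * S a * L (k + 1)))"

section \<open>The algorithm\<close>

text \<open>
  The index data of a run; \<open>idx_m\<close> is the entry \<open>m\<close> of the constant tuple \<open>\<gamma> = (m, \<dots>, m)\<close>.
\<close>

record blostr_choice =
  idx_alpha :: "nat list"
  idx_beta :: "nat list"
  idx_alpha' :: "nat list"
  idx_beta' :: "nat list"
  cols_alpha :: "nat set"
  cols_beta :: "nat set"
  cols_alpha' :: "nat set"
  cols_beta' :: "nat set"
  cols_gamma :: "nat set"
  idx_m :: nat

definition tuples :: "nat \<Rightarrow> nat \<Rightarrow> nat list set" where
  "tuples n l = {as. length as = l \<and> set as \<subseteq> {..<n}}"

definition valid_choice :: "nat \<Rightarrow> nat \<Rightarrow> nat \<Rightarrow> blostr_choice \<Rightarrow> bool" where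
  "valid_choice n r d c \<longleftrightarrow>
     {idx_alpha c, idx_beta c, idx_alpha' c, idx_beta' c} \<subseteq> tuples n (d - 2) \<and>
     idx_alpha c \<noteq> idx_beta c \<and> idx_alpha' c \<noteq> idx_beta' c \<and>
     {idx_alpha c, idx_beta c} \<noteq> {idx_alpha' c, idx_beta' c} \<and>
     (\<forall>\<Gamma> \<in> {cols_alpha c, cols_beta c, cols_alpha' c, cols_beta' c, cols_gamma c}.
        \<Gamma> \<subseteq> {..<n} \<and> card \<Gamma> = r\<^sup>2) \<and>
     idx_m c < n"

text \<open>The matrix \<open>T(:, \<alpha>, \<Gamma>)\<close>, with its columns in increasing order of the index in \<open>\<Gamma>\<close>.\<close>

definition tensor_mat :: "nat \<Rightarrow> (nat list \<Rightarrow> complex) \<Rightarrow> nat list \<Rightarrow> nat set \<Rightarrow> complex mat" where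
  "tensor_mat n T \<alpha> \<Gamma> = submatrix (Matrix.mat n n (\<lambda>(a, b). T (a # \<alpha> @ [b]))) UNIV \<Gamma>"

definition eigendecomposition :: "complex mat \<Rightarrow> complex mat \<Rightarrow> complex mat \<Rightarrow> complex mat \<Rightarrow> bool" where
  "eigendecomposition A Y D Y' \<longleftrightarrow> similar_mat_wit A D Y Y' \<and> diagonal_mat D"

text \<open>
  \<open>E\<close> collects the eigenvectors for the nonzero spectrum from an eigendecomposition of \<open>M\<close>, whose
  columns are ordered such that these come first. There have to be exactly \<open>r\<close> distinct nonzero
  eigenvalues \<open>ev 0, \<dots>, ev (r - 1)\<close>, each represented once in each of the \<open>r\<close> blocks of columns.
\<close>

definition eigvec_stack :: "nat \<Rightarrow> nat \<Rightarrow> complex mat \<Rightarrow> complex mat \<Rightarrow> bool" where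
  "eigvec_stack n r M E \<longleftrightarrow>
     (\<exists>P D P' (ev :: nat \<Rightarrow> complex).
        M \<in> carrier_mat n n \<and> eigendecomposition M P D P' \<and>
        inj_on ev {..<r} \<and> (\<forall>k<r. ev k \<noteq> 0) \<and>
        (\<forall>j<r. \<forall>k<r. D $$ (j * r + k, j * r + k) = ev k) \<and>
        (\<forall>i \<in> {r * r..<n}. D $$ (i, i) = 0) \<and>
        E = Matrix.mat n (r * r) (\<lambda>(i, c). P $$ (i, c)))"

definition step1 :: "nat \<Rightarrow> nat \<Rightarrow> (nat list \<Rightarrow> complex) \<Rightarrow> blostr_choice \<Rightarrow> complex mat \<Rightarrow> complex mat \<Rightarrow> bool" where
  "step1 n r T c E E' \<longleftrightarrow>
     eigvec_stack n r
       (tensor_mat n T (idx_alpha c) (cols_alpha c) * pinv (tensor_mat n T (idx_beta c) (cols_beta c))) E \<and>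
     eigvec_stack n r
       (tensor_mat n T (idx_alpha' c) (cols_alpha' c) * pinv (tensor_mat n T (idx_beta' c) (cols_beta' c))) E'"

definition F_block :: "nat \<Rightarrow> complex mat \<Rightarrow> complex mat \<Rightarrow> nat \<Rightarrow> nat \<Rightarrow> complex mat" where
  "F_block r E E' j k = Matrix.mat r r (\<lambda>(p, q). (pinv E * E') $$ (p * r + j, q * r + k))"

definition K_hat :: "nat \<Rightarrow> complex mat \<Rightarrow> complex mat \<Rightarrow> complex mat" where
  "K_hat r E E' = diag_block_mat
     (map (\<lambda>l. if l = 0 then 1\<^sub>m r else F_block r E E' 0 0 * minv (F_block r E E' l 0)) [0..<r])"

text \<open>All matrices that are inverted in the second step are invertible.\<close>

definition step2_defined :: "nat \<Rightarrow> complex mat \<Rightarrow> complex mat \<Rightarrow> bool" where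
  "step2_defined r E E' \<longleftrightarrow>
     (\<forall>l \<in> {1..<r}. invertible_mat (F_block r E E' l 0)) \<and>
     invertible_mat (block_perm r (K_hat r E E'))"

definition first_core :: "nat \<Rightarrow> complex mat \<Rightarrow> complex mat \<Rightarrow> slices" where
  "first_core r E E' = fold_angle r (E * minv (block_perm r (K_hat r E E')))"

text \<open>The core following a nonempty list \<open>H\<close> of \<open>k - 1\<close> cores; \<open>butlast H\<close> are the first \<open>k - 2\<close>.\<close>

definition next_core :: "nat \<Rightarrow> nat \<Rightarrow> complex mat \<Rightarrow> nat \<Rightarrow> nat set \<Rightarrow> slices list \<Rightarrow> slices" where
  "next_core n r S m \<Gamma> H = fold_angle r
     (S * pinv (kron (1\<^sub>m r) (mprod r (map (\<lambda>X. X m) (butlast H))) *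
                submatrix (transpose_mat (unfold_square n r (last H))) UNIV \<Gamma>))"

primrec cores :: "nat \<Rightarrow> nat \<Rightarrow> complex mat \<Rightarrow> nat \<Rightarrow> nat set \<Rightarrow> slices \<Rightarrow> nat \<Rightarrow> slices list" where
  "cores n r S m \<Gamma> Q\<^sub>1 0 = [Q\<^sub>1]"
| "cores n r S m \<Gamma> Q\<^sub>1 (Suc k) =
     cores n r S m \<Gamma> Q\<^sub>1 k @ [next_core n r S m \<Gamma> (cores n r S m \<Gamma> Q\<^sub>1 k)]"

definition hat_cores ::
  "nat \<Rightarrow> nat \<Rightarrow> nat \<Rightarrow> (nat list \<Rightarrow> complex) \<Rightarrow> blostr_choice \<Rightarrow> complex mat \<Rightarrow> complex mat \<Rightarrow> slices list" where
  "hat_cores n r d T c E E' =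
     cores n r (tensor_mat n T (replicate (d - 2) (idx_m c)) (cols_gamma c)) (idx_m c) (cols_gamma c)
       (first_core r E E') (d - 1)"

text \<open>The product of the slices selected by \<open>as\<close> from the list \<open>H\<close> of cores.\<close>

definition slice_prod :: "nat \<Rightarrow> slices list \<Rightarrow> nat list \<Rightarrow> complex mat" where
  "slice_prod r H as = mprod r (map2 (\<lambda>X a. X a) H as)"

definition root_diag :: "nat \<Rightarrow> nat \<Rightarrow> complex mat \<Rightarrow> (nat \<Rightarrow> nat) \<Rightarrow> complex mat" where
  "root_diag r d D k = mat_diag r (\<lambda>t.
     of_real (root d (cmod (D $$ (t, t)))) * cis ((Arg2pi (D $$ (t, t)) + 2 * real (k t) * pi) / real d))"

definition bar_core :: "nat \<Rightarrow> nat \<Rightarrow> slices list \<Rightarrow> complex mat \<Rightarrow> slices" where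
  "bar_core r d H B j =
     (if j = 0 then B else minv B ^\<^sub>m (d - 1) * slice_prod r H (replicate (d - 1) 0 @ [j]))"

text \<open>
  \<open>R\<close> is a core with which the loop of the last step stops, for the eigendecomposition
  \<open>Y D Y'\<close> and a choice \<open>k\<close> of branches of the roots; the first branch is the principal one.
\<close>

definition step5 :: "nat \<Rightarrow> nat \<Rightarrow> nat \<Rightarrow> slices list \<Rightarrow> complex mat \<Rightarrow> complex mat \<Rightarrow> complex mat \<Rightarrow> slices \<Rightarrow> bool" where
  "step5 n r d H Y D Y' R \<longleftrightarrow>
     (\<exists>k :: nat \<Rightarrow> nat. k 0 = 0 \<and> (\<forall>t<r. k t < d) \<and>
        (let B = Y * root_diag r d D k * Y' in
           invertible_mat B \<and> R = bar_core r d H B \<and>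
           (\<forall>as \<in> tuples n d. slice_prod r H as = slice_prod r (replicate d R) as)))"

definition blostr_output ::
  "nat \<Rightarrow> nat \<Rightarrow> nat \<Rightarrow> (nat list \<Rightarrow> complex) \<Rightarrow> blostr_choice \<Rightarrow> slices \<Rightarrow> bool" where
  "blostr_output n r d T c R \<longleftrightarrow>
     (\<exists>E E' Y D Y'.
        step1 n r T c E E' \<and> step2_defined r E E' \<and>
        (let H = hat_cores n r d T c E E' in
           eigendecomposition (slice_prod r H (replicate d 0)) Y D Y' \<and>
           step5 n r d H Y D Y' R))"

text \<open>
  The first two steps can be carried out, regardless of how the eigenvectors and the order of the
  eigenvalues are chosen.
\<close>

definition steps12_executable ::
  "nat \<Rightarrow> nat \<Rightarrow> (nat list \<Rightarrow> complex) \<Rightarrow> blostr_choice \<Rightarrow> bool" where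
  "steps12_executable n r T c \<longleftrightarrow>
     (\<exists>E E'. step1 n r T c E E') \<and>
     (\<forall>E E'. step1 n r T c E E' \<longrightarrow> step2_defined r E E')"

text \<open>
  The algorithm produces an output, regardless of how the eigenvectors and the order of the
  eigenvalues are chosen.
\<close>

definition blostr_completes ::
  "nat \<Rightarrow> nat \<Rightarrow> nat \<Rightarrow> (nat list \<Rightarrow> complex) \<Rightarrow> blostr_choice \<Rightarrow> bool" where
  "blostr_completes n r d T c \<longleftrightarrow>
     steps12_executable n r T c \<and>
     (\<forall>E E'. step1 n r T c E E' \<longrightarrow>
        (let H = hat_cores n r d T c E E'; A = slice_prod r H (replicate d 0) in
           (\<exists>Y D Y'. eigendecomposition A Y D Y') \<and>
           (\<forall>Y D Y'. eigendecomposition A Y D Y' \<longrightarrow> (\<exists>R. step5 n r d H Y D Y' R))))"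

section \<open>Index pairs for which the algorithm completes\<close>

text \<open>
  The matrices of the first step are governed by the slice products
  \<open>Q\<^bsup>(\<alpha>)\<^esup> (Q\<^bsup>(\<beta>)\<^esup>)\<^sup>-\<^sup>1\<close> and \<open>Q\<^bsup>(\<alpha>')\<^esup> (Q\<^bsup>(\<beta>')\<^esup>)\<^sup>-\<^sup>1\<close>. For tuples of length at least 2 these can coincide
  for every core although the pairs of tuples are different: for \<open>\<alpha> = (1, 2)\<close>, \<open>\<beta> = (2, 2)\<close>,
  \<open>\<alpha>' = (1, 1)\<close>, \<open>\<beta>' = (2, 1)\<close> both are \<open>Q\<^bsup>(1)\<^esup> (Q\<^bsup>(2)\<^esup>)\<^sup>-\<^sup>1\<close>. Then some \<open>F\<^bsup>(l,1)\<^esup>\<close> vanishes and the second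
  step breaks down. The following condition excludes such coincidences.
\<close>

definition separated :: "blostr_choice \<Rightarrow> bool" where
  "separated c \<longleftrightarrow>
     (\<exists>e. count_list (idx_alpha c @ idx_beta c) e = 1) \<and>
     (\<exists>e'. count_list (idx_alpha' c @ idx_beta' c) e' = 1 \<and> e' \<notin> set (idx_alpha c @ idx_beta c))"

text \<open>For tensors of order 3 it is no restriction.\<close>

lemma separated_order_3:
  assumes "valid_choice n r 3 c"
  shows "separated c"
proof -
  have *: "\<exists>a. x = [a]" if "x \<in> tuples n (3 - 2)" for x
    using that by (auto simp: tuples_def length_Suc_conv)
  obtain a b a' b' where ab: "idx_alpha c = [a]" "idx_beta c = [b]" "idx_alpha' c = [a']" "idx_beta' c = [b']"
    using assms * unfolding valid_choice_def by (metis insert_subset)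
  have ne: "a \<noteq> b" "a' \<noteq> b'" "{[a], [b]} \<noteq> {[a'], [b']}"
    using assms ab by (auto simp: valid_choice_def)
  then have "(a' \<noteq> a \<and> a' \<noteq> b) \<or> (b' \<noteq> a \<and> b' \<noteq> b)"
    by (auto simp: doubleton_eq_iff)
  then have "\<exists>e'. count_list [a', b'] e' = 1 \<and> e' \<notin> {a, b}"
    using ne(2) by (elim disjE) (rule exI[of _ a'], simp, rule exI[of _ b'], simp)
  moreover have "count_list [a, b] a = 1"
    using ne(1) by simp
  ultimately show ?thesis
    unfolding separated_def ab by auto
qed

end

theory Submission
  imports
    Defs
    "Subresultants.Subresultant_Gcd"
    "HOL-Computational_Algebra.Field_as_Ring"
begin

text \<open>
  Let \<open>U\<close> be the unfolding \<open>Q\<^sub>\<langle>\<^sub>1\<^sub>\<rangle>\<close>. For a generic core the matrices of the first step are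
  \<open>U (I \<otimes> Z) U\<^sup>\<dagger>\<close> with \<open>Z = Q\<^bsup>(\<alpha>)\<^esup> (Q\<^bsup>(\<beta>)\<^esup>)\<^sup>-\<^sup>1\<close>, so that \<open>E = U (I \<otimes> X) K\<close>, where \<open>X\<close> diagonalizes \<open>Z\<close>
  and \<open>K\<close> is the free choice of bases of the eigenspaces. With \<open>W = X\<^sup>-\<^sup>1 X'\<close> the blocks
  are \<open>F\<^bsup>(j,k)\<^esup> = W\<^sub>j\<^sub>k K\<^sub>j\<^sup>-\<^sup>1 K'\<^sub>k\<close>. Hence the second step works iff the first column of \<open>W\<close> has no zero, and
  then \<open>K\<close> is eliminated up to a gauge. The third step turns the gauge of the first core into gauges of all cores
  that telescope, and the last step fixes the remaining gauge up to a common scalar.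

  All genericity conditions are nonvanishing conditions for polynomials in the entries of the core. That \<open>Z\<close> has
  distinct eigenvalues is expressed by a discriminant, and that \<open>W\<close> has no zero by a Krylov determinant.
  For different column sets the first step fails, because generically the eigenvalues do not have
  multiplicity \<open>r\<close>.
\<close>

section \<open>Matrix algebra\<close>

text \<open>Two obstacles shape the proof: the exceptional null set may depend neither on the index
  data nor on the choices made during a run, and inverses and eigenvectors are not polynomial in the
  core. There are finitely many index data, so each may contribute its own null set. The other
  choices are absorbed by conditions that do not see them: an adjugate differs from the inverse by a
  scalar, which changes no eigenvectors, and the Krylov determinant tests \<open>W\<close> without
  naming an eigenbasis. Each such condition needs one core at which it holds. For separated pairs
  this core is written down. Otherwise it is a core on which the first two steps succeed for all
  choices: success forces every condition there, since reordering the second set of eigenvalues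
  brings any column of \<open>W\<close> to the front. For the correctness of an output the run
  itself certifies that the first column of \<open>W\<close> has no zero. The stopping test of the
  last step at the tuples (a, 0, ..., 0) leaves only a scalar, and at (0, ..., 0) it makes this
  scalar a d-th root of unity, so that the ring of gauges closes.\<close>

unbundle no vec_syntax

lemma mult_index:
  assumes "A \<in> carrier_mat n m" "B \<in> carrier_mat m k" "i < n" "j < k"
  shows "(A * B) $$ (i, j) = (\<Sum>t<m. A $$ (i, t) * B $$ (t, j))"
  using assms by (auto simp: scalar_prod_def atLeast0LessThan intro!: sum.cong)

declare index_mult_mat(1) [simp del]

text \<open>Side conditions on dimensions rather than on carriers let the simplifier normalize
  products of rectangular matrices.\<close>

lemma mat_assoc:
  "dim_col A = dim_row B \<Longrightarrow> dim_col B = dim_row C \<Longrightarrow> A * B * C = A * (B * (C :: 'a :: semiring_0 mat))"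
  by (rule assoc_mult_mat[of A "dim_row A" "dim_row B" B "dim_row C" C "dim_col C"]) auto

lemma mult_vec_index:
  assumes "A \<in> carrier_mat n m" "v \<in> carrier_vec m" "i < n"
  shows "(A *\<^sub>v v) $ i = (\<Sum>t<m. A $$ (i, t) * v $ t)"
  using assms by (auto simp: scalar_prod_def atLeast0LessThan intro!: sum.cong)

text \<open>For square matrices a right inverse is two-sided, so \<open>A\<close> is a unit of the
  matrix ring and \<open>mat_inverse\<close> returns some matrix; uniqueness of inverses identifies
  it with \<open>B\<close>.\<close>

lemma invertible_mat_and_minv:
  assumes "A \<in> carrier_mat n n" "B \<in> carrier_mat n n" "A * B = 1\<^sub>m n"
  shows "invertible_mat A" "minv A = B"
proof -
  have BA: "B * A = 1\<^sub>m n"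
    using mat_mult_left_right_inverse assms by blast
  then show inv: "invertible_mat A"
    using assms unfolding invertible_mat_def inverts_mat_def by auto
  have "A \<in> Units (ring_mat TYPE(complex) n ())"
    using assms BA by (auto simp: Units_def ring_mat_def)
  then obtain C where C: "mat_inverse A = Some C"
    using mat_inverse(1)[OF assms(1), of "()"] by (cases "mat_inverse A") auto
  then have "A * C = 1\<^sub>m n" "C \<in> carrier_mat n n"
    using mat_inverse(2)[OF assms(1) C] by auto
  then have "B * (A * C) = B" using assms by auto
  then have "B = C" using BA assms \<open>C \<in> _\<close>
    by (metis assoc_mult_mat left_mult_one_mat)
  then show "minv A = B" by (simp add: minv_def C)
qed

lemma minv:
  assumes "A \<in> carrier_mat n n" "invertible_mat A"
  shows "minv A \<in> carrier_mat n n" "A * minv A = 1\<^sub>m n" "minv A * A = 1\<^sub>m n"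
proof -
  obtain B where B: "A * B = 1\<^sub>m n" "B * A = 1\<^sub>m (dim_row B)"
    using assms unfolding invertible_mat_def inverts_mat_def by auto
  have "dim_row B = n"
    using arg_cong[OF B(2), of dim_col] assms by auto
  moreover have "dim_col B = n"
    using arg_cong[OF B(1), of dim_col] assms by auto
  ultimately have "B \<in> carrier_mat n n" by auto
  then show "minv A \<in> carrier_mat n n" "A * minv A = 1\<^sub>m n" "minv A * A = 1\<^sub>m n"
    using B invertible_mat_and_minv(2)[OF assms(1) _ B(1)] by auto
qed

text \<open>The bridge from invertibility to the nonvanishing of a polynomial in the
  entries.\<close>

lemma invertible_mat_iff_det:
  assumes "A \<in> carrier_mat n n"
  shows "invertible_mat A \<longleftrightarrow> det A \<noteq> (0 :: complex)"
proof
  assume "invertible_mat A"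
  then have "det A * det (minv A) = 1"
    using minv[OF assms] det_mult[of A n "minv A"] assms by auto
  then show "det A \<noteq> 0" by auto
next
  assume "det A \<noteq> 0"
  then obtain B where "B \<in> carrier_mat n n" "A * B = 1\<^sub>m n"
    using det_non_zero_imp_unit[OF assms, of "()"] by (auto simp: Units_def ring_mat_def)
  then show "invertible_mat A" using invertible_mat_and_minv[OF assms] by auto
qed

lemma invertible_mat_mult_iff:
  assumes "A \<in> carrier_mat n n" "B \<in> carrier_mat n n"
  shows "invertible_mat (A * B) \<longleftrightarrow> invertible_mat A \<and> invertible_mat (B :: complex mat)"
  using assms by (simp add: invertible_mat_iff_det[of _ n] det_mult[of A n B])

lemma invertible_mat_minv:
  assumes "A \<in> carrier_mat n n" "invertible_mat A"
  shows "invertible_mat (minv A)" "minv (minv A) = A"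
  using invertible_mat_and_minv[of "minv A" n A] minv[OF assms] assms by auto

lemma invertible_mat_transpose:
  assumes "A \<in> carrier_mat n n" "invertible_mat (A :: complex mat)"
  shows "invertible_mat (transpose_mat A)"
  using assms by (simp add: invertible_mat_iff_det[of _ n] det_transpose)

lemma mult_minv_cancel:
  assumes "A \<in> carrier_mat n n" "invertible_mat A"
  shows "B \<in> carrier_mat n k \<Longrightarrow> A * (minv A * B) = B"
    "B \<in> carrier_mat n k \<Longrightarrow> minv A * (A * B) = B"
    "C \<in> carrier_mat k n \<Longrightarrow> C * A * minv A = C"
    "C \<in> carrier_mat k n \<Longrightarrow> C * minv A * A = C"
proof -
  note m = minv[OF assms]
  show "A * (minv A * B) = B" if "B \<in> carrier_mat n k"
    using that m assms by (subst assoc_mult_mat[symmetric, of _ n n _ n]) auto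
  show "minv A * (A * B) = B" if "B \<in> carrier_mat n k"
    using that m assms by (subst assoc_mult_mat[symmetric, of _ n n _ n]) auto
  show "C * A * minv A = C" if "C \<in> carrier_mat k n"
    using that m assms by (subst assoc_mult_mat[of _ k n _ n]) auto
  show "C * minv A * A = C" if "C \<in> carrier_mat k n"
    using that m assms by (subst assoc_mult_mat[of _ k n _ n]) auto
qed

lemma minv_mult:
  assumes "A \<in> carrier_mat n n" "B \<in> carrier_mat n n" "invertible_mat A" "invertible_mat B"
  shows "minv (A * B) = minv B * minv A"
proof -
  note m = minv[OF assms(1,3)] minv[OF assms(2,4)]
  have "A * B * (minv B * minv A) = A * (B * (minv B * minv A))"
    using assms m by (subst assoc_mult_mat[of _ n n _ n]) auto
  also have "\<dots> = 1\<^sub>m n" using mult_minv_cancel(1)[OF assms(2,4), of "minv A" n] m by auto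
  finally show ?thesis
    using assms m by (intro invertible_mat_and_minv(2)[of _ n]) auto
qed

lemma invertible_mat_smult:
  assumes "A \<in> carrier_mat n n" "invertible_mat A" "c \<noteq> (0 :: complex)"
  shows "invertible_mat (c \<cdot>\<^sub>m A)" "minv (c \<cdot>\<^sub>m A) = (1 / c) \<cdot>\<^sub>m minv A"
proof -
  have "(c \<cdot>\<^sub>m A) * ((1 / c) \<cdot>\<^sub>m minv A) = 1\<^sub>m n"
    using assms minv[OF assms(1,2)]
    by (simp add: mult_smult_assoc_mat[of _ n n _ n] mult_smult_distrib[of _ n n _ n])
      (auto intro!: eq_matI)
  then show "invertible_mat (c \<cdot>\<^sub>m A)" "minv (c \<cdot>\<^sub>m A) = (1 / c) \<cdot>\<^sub>m minv A"
    using assms minv[OF assms(1,2)] invertible_mat_and_minv[of "c \<cdot>\<^sub>m A" n "(1 / c) \<cdot>\<^sub>m minv A"] by auto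
qed

lemma mtrace_eq: "A \<in> carrier_mat n n \<Longrightarrow> mtrace A = (\<Sum>i<n. A $$ (i, i))"
  by (simp add: mtrace_def)

lemma mprod_Nil [simp]: "mprod r [] = 1\<^sub>m r"
  and mprod_Cons [simp]: "mprod r (A # As) = A * mprod r As"
  by (simp_all add: mprod_def)

lemma mprod_carrier: "(\<And>A. A \<in> set As \<Longrightarrow> A \<in> carrier_mat r r) \<Longrightarrow> mprod r As \<in> carrier_mat r r"
proof (induction As)
  case (Cons A As)
  then show ?case using mult_carrier_mat[of A r r "mprod r As" r] by simp
qed simp

lemma mprod_append:
  assumes "\<And>A. A \<in> set As \<Longrightarrow> A \<in> carrier_mat r r" "\<And>A. A \<in> set Bs \<Longrightarrow> A \<in> carrier_mat r r"
  shows "mprod r (As @ Bs) = mprod r As * mprod r Bs"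
  using assms
proof (induction As)
  case Nil
  then show ?case using mprod_carrier[of Bs r] by auto
next
  case (Cons A As)
  then show ?case using mprod_carrier[of Bs r] mprod_carrier[of As r]
    by (simp add: assoc_mult_mat[of _ r r _ r _ r])
qed

lemma invertible_mprod:
  "(\<And>A. A \<in> set As \<Longrightarrow> A \<in> carrier_mat r r \<and> invertible_mat A) \<Longrightarrow> invertible_mat (mprod r As)"
proof (induction As)
  case Nil
  show ?case by (simp add: invertible_mat_iff_det[of _ r])
next
  case (Cons A As)
  then show ?case using mprod_carrier[of As r] by (simp add: invertible_mat_mult_iff[of _ r])
qed

lemma mprod_replicate:
  assumes "A \<in> carrier_mat r r"
  shows "mprod r (replicate k A) = A ^\<^sub>m k"
proof (induction k)
  case (Suc k)
  have "A * A ^\<^sub>m k = A ^\<^sub>m k * A"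
  proof (induction k)
    case (Suc k)
    then show ?case
      using assms by (simp flip: assoc_mult_mat[of A r r "A ^\<^sub>m k" r A r])
  qed (use assms in simp)
  with Suc show ?case by simp
qed (use assms in simp)

section \<open>Moore--Penrose inverses\<close>

lemma mat_adjoint_carrier: "A \<in> carrier_mat n m \<Longrightarrow> mat_adjoint A \<in> carrier_mat m n"
  by (auto simp: mat_adjoint_def)

lemma mat_adjoint_index:
  "A \<in> carrier_mat n m \<Longrightarrow> i < m \<Longrightarrow> j < n \<Longrightarrow> mat_adjoint A $$ (i, j) = cnj (A $$ (j, i))"
  by (auto simp: mat_adjoint_def mat_of_rows_index)

lemma mat_adjoint_adjoint: "A \<in> carrier_mat n m \<Longrightarrow> mat_adjoint (mat_adjoint A) = (A :: complex mat)"
  using mat_adjoint_carrier[of A n m]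
  by (intro eq_matI) (auto simp: mat_adjoint_index[of _ n m] mat_adjoint_index[of _ m n] dest: mat_adjoint_carrier)

lemma mat_adjoint_mult:
  assumes "A \<in> carrier_mat n m" "B \<in> carrier_mat m k"
  shows "mat_adjoint (A * B) = mat_adjoint B * (mat_adjoint A :: complex mat)"
proof (rule eq_matI)
  note c = mat_adjoint_carrier[OF assms(1)] mat_adjoint_carrier[OF assms(2)]
    mult_carrier_mat[OF assms] mat_adjoint_carrier[OF mult_carrier_mat[OF assms]]
  show "dim_row (mat_adjoint (A * B)) = dim_row (mat_adjoint B * mat_adjoint A)"
    "dim_col (mat_adjoint (A * B)) = dim_col (mat_adjoint B * mat_adjoint A)"
    using c by auto
  fix i j assume "i < dim_row (mat_adjoint B * mat_adjoint A)" "j < dim_col (mat_adjoint B * mat_adjoint A)"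
  then have ij: "i < k" "j < n" using c by auto
  show "mat_adjoint (A * B) $$ (i, j) = (mat_adjoint B * mat_adjoint A) $$ (i, j)"
    using ij assms by (simp add: mat_adjoint_index[OF c(3)] mult_index[OF assms] mult_index[OF c(2,1)]
      mat_adjoint_index[OF assms(1)] mat_adjoint_index[OF assms(2)] mult.commute)
qed

text \<open>The diagonal entries of the Gram matrix are the squared norms of the columns of
  \<open>A\<close>.\<close>

lemma adjoint_mult_self_eq_0:
  assumes A: "A \<in> carrier_mat n m" and "mat_adjoint A * A = 0\<^sub>m m m"
  shows "A = (0\<^sub>m n m :: complex mat)"
proof (rule eq_matI)
  fix i j assume ij: "i < dim_row (0\<^sub>m n m :: complex mat)" "j < dim_col (0\<^sub>m n m :: complex mat)"
  have "0 = (mat_adjoint A * A) $$ (j, j)" using assms ij by simp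
  also have "\<dots> = (\<Sum>t<n. A $$ (t, j) * cnj (A $$ (t, j)))"
    using ij by (simp add: mult_index[OF mat_adjoint_carrier[OF A] A] mat_adjoint_index[OF A] mult.commute)
  also have "\<dots> = of_real (\<Sum>t<n. (cmod (A $$ (t, j)))\<^sup>2)"
    unfolding of_real_sum by (intro sum.cong refl) (rule complex_norm_square[symmetric])
  finally have "(\<Sum>t<n. (cmod (A $$ (t, j)))\<^sup>2) = 0" using of_real_eq_0_iff by metis
  then show "A $$ (i, j) = 0\<^sub>m n m $$ (i, j)"
    using ij by (subst (asm) sum_nonneg_eq_0_iff) auto
qed (use A in auto)

text \<open>For the difference \<open>D\<close> of the two right factors, the equation makes the
  Gram matrix of \<open>A * D\<close> vanish.\<close>

lemma adjoint_mult_cancel: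
  assumes A: "A \<in> carrier_mat n m" and B: "B \<in> carrier_mat m k" and C: "C \<in> carrier_mat m k"
    and eq: "mat_adjoint A * A * B = mat_adjoint A * A * C"
  shows "A * B = A * (C :: complex mat)"
proof -
  note As = mat_adjoint_carrier[OF A]
  define D where "D = B - C"
  have D: "D \<in> carrier_mat m k" using B C by (auto simp: D_def)
  note Ds = mat_adjoint_carrier[OF D]
  have "mat_adjoint A * A * D = 0\<^sub>m m k"
    unfolding D_def using As A B C eq by (subst mult_minus_distrib_mat[of _ m m _ k]) auto
  then have "mat_adjoint D * (mat_adjoint A * A * D) = 0\<^sub>m k k" using Ds by auto
  moreover have "mat_adjoint D * (mat_adjoint A * A * D) = mat_adjoint (A * D) * (A * D)"
    using A D As Ds by (simp add: mat_adjoint_mult[OF A D] assoc_mult_mat[of _ m n _ m _ k]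
      assoc_mult_mat[of _ k m _ n _ k])
  ultimately have "A * D = 0\<^sub>m n k"
    using adjoint_mult_self_eq_0[of "A * D" n k] A D by auto
  then have "A * B - A * C = 0\<^sub>m n k"
    unfolding D_def using A B C by (simp add: mult_minus_distrib_mat[of _ n m _ k])
  then have "\<And>i j. i < n \<Longrightarrow> j < k \<Longrightarrow> (A * B) $$ (i, j) - (A * C) $$ (i, j) = 0"
    using A B C by (metis index_minus_mat(1) index_zero_mat(1) mult_carrier_mat carrier_matD)
  then show ?thesis using A B C by (intro eq_matI) auto
qed

lemma dim_mat_adjoint [simp]: "dim_row (mat_adjoint A) = dim_col A" "dim_col (mat_adjoint A) = dim_row A"
  using mat_adjoint_carrier[of A "dim_row A" "dim_col A"] by auto

lemma mat_adjoint_mult_dim: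
  "dim_col A = dim_row B \<Longrightarrow> mat_adjoint (A * B) = mat_adjoint B * (mat_adjoint A :: complex mat)"
  by (rule mat_adjoint_mult[of _ "dim_row A" "dim_row B" _ "dim_col B"]) auto

text \<open>Both products on the left are Hermitian for every \<open>M\<close>, so either equation
  makes the adjoint of \<open>M\<close> Hermitian.\<close>

lemma hermitian_if_mult_adjoint:
  assumes M: "M \<in> carrier_mat n n"
    and "M * mat_adjoint M = mat_adjoint M \<or> mat_adjoint M * M = mat_adjoint M"
  shows "mat_adjoint M = (M :: complex mat)"
  using assms(2)
proof
  assume eq: "M * mat_adjoint M = mat_adjoint M"
  have "mat_adjoint (M * mat_adjoint M) = M * mat_adjoint M"
    by (subst mat_adjoint_mult_dim) (use mat_adjoint_adjoint[OF M] in auto)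
  then show ?thesis by (simp add: eq mat_adjoint_adjoint[OF M])
next
  assume eq: "mat_adjoint M * M = mat_adjoint M"
  have "mat_adjoint (mat_adjoint M * M) = mat_adjoint M * M"
    by (subst mat_adjoint_mult_dim) (use mat_adjoint_adjoint[OF M] in auto)
  then show ?thesis by (simp add: eq mat_adjoint_adjoint[OF M])
qed

text \<open>Penrose's argument: the adjoint of \<open>X * A = (X * A) * (Y * A)\<close> swaps the
  two Hermitian projections, which gives \<open>X * A = Y * A\<close>, and likewise
  \<open>A * X = A * Y\<close>. Then \<open>X * A * X\<close> can be rewritten to
  \<open>Y * A * Y\<close>.\<close>

lemma is_pinv_unique:
  assumes A: "A \<in> carrier_mat n m" and X: "is_pinv A X" and Y: "is_pinv A Y"
  shows "X = Y"
proof -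
  have c: "X \<in> carrier_mat m n" "Y \<in> carrier_mat m n" using A X Y by (auto simp: is_pinv_def)
  have "X * A = mat_adjoint (X * (A * Y * A))" using X Y by (simp add: is_pinv_def)
  also have "\<dots> = mat_adjoint ((X * A) * (Y * A))" using A c by (simp add: mat_assoc)
  also have "\<dots> = (Y * A) * (X * A)" 
    using X Y A c by (subst mat_adjoint_mult[of _ m m _ m]) (auto simp: is_pinv_def)
  also have "\<dots> = Y * (A * X * A)" using A c by (simp add: mat_assoc)
  also have "\<dots> = Y * A" using X by (simp add: is_pinv_def)
  finally have XA: "X * A = Y * A" .
  have "A * X = mat_adjoint ((A * Y * A) * X)" using X Y by (simp add: is_pinv_def)
  also have "\<dots> = mat_adjoint ((A * Y) * (A * X))" using A c by (simp add: mat_assoc)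
  also have "\<dots> = (A * X) * (A * Y)"
    using X Y A c by (subst mat_adjoint_mult[of _ n n _ n]) (auto simp: is_pinv_def)
  also have "\<dots> = (A * X * A) * Y" using A c by (simp add: mat_assoc)
  also have "\<dots> = A * Y" using X by (simp add: is_pinv_def)
  finally have AX: "A * X = A * Y" .
  have "X = X * A * X" using X by (simp add: is_pinv_def)
  also have "\<dots> = Y * A * Y" using A c by (simp only: XA) (simp add: mat_assoc AX)
  finally show ?thesis using Y by (simp add: is_pinv_def)
qed

lemma pinv_eqI: "A \<in> carrier_mat n m \<Longrightarrow> is_pinv A X \<Longrightarrow> pinv A = X"
  unfolding pinv_def using is_pinv_unique by blast

text \<open>The reduced row echelon form \<open>C = P * A\<close> has unit vectors as pivot columns,
  so sending each row index to its pivot position inverts \<open>C\<close> on its range. Undoing the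
  row operations turns this into an inner inverse of \<open>A\<close>.\<close>

lemma ex_inner_inverse:
  assumes A: "(A :: complex mat) \<in> carrier_mat n m"
  shows "\<exists>G \<in> carrier_mat m n. A * G * A = A"
proof -
  obtain C D where gj: "gauss_jordan A (0\<^sub>m n 0) = (C, D)" by fastforce
  obtain P where P: "P \<in> Units (ring_mat TYPE(complex) n ())" and C: "C = P * A"
    using gauss_jordan_transform[OF A _ gj, of 0 "()"] by auto
  obtain P' where P': "P \<in> carrier_mat n n" "P' \<in> carrier_mat n n" "P' * P = 1\<^sub>m n"
    using P by (auto simp: Units_def ring_mat_def)
  have Cc: "C \<in> carrier_mat n m" using C P' A by auto
  obtain f where f: "pivot_fun C f m"
    using gauss_jordan_row_echelon[OF A gj] Cc by (auto simp: row_echelon_form_def)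
  note piv = pivot_funD[OF carrier_matD(1)[OF Cc] f]
  \<comment> \<open>For a zero row the pivot function has the value \<open>m\<close>, which is out
    of range, so the corresponding column of \<open>G\<close> is zero.\<close>
  define G where "G = Matrix.mat m n (\<lambda>(t, i). if t = f i then 1 else 0 :: complex)"
  have G: "G \<in> carrier_mat m n" by (simp add: G_def)
  have CG: "(C * G) $$ (i, j) = (if i = j \<and> f j < m then 1 else 0)" if "i < n" "j < n" for i j
  proof -
    have "(C * G) $$ (i, j) = (\<Sum>t<m. if t = f j then C $$ (i, t) else 0)"
      using that by (subst mult_index[OF Cc G]) (auto simp: G_def if_distrib[where f = "(*) _"] cong: if_cong)
    also have "\<dots> = (if f j < m then C $$ (i, f j) else 0)" by simp
    also have "\<dots> = (if i = j \<and> f j < m then 1 else 0)" using piv(4,5) that by auto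
    finally show ?thesis .
  qed
  have "C * G * C = C"
  proof (rule eq_matI)
    fix i j assume "i < dim_row C" "j < dim_col C"
    then have ij: "i < n" "j < m" using Cc by auto
    have "(C * G * C) $$ (i, j) = (\<Sum>t<n. if t = i \<and> f i < m then C $$ (t, j) else 0)"
      using ij by (subst mult_index[OF _ Cc]) (auto simp: CG intro!: sum.cong mult_carrier_mat[OF Cc G])
    also have "\<dots> = (if f i < m then C $$ (i, j) else 0)" using ij by simp
    also have "\<dots> = C $$ (i, j)" using piv(1,2)[of i] ij by (cases "f i < m") auto
    finally show "(C * G * C) $$ (i, j) = C $$ (i, j)" .
  qed (use Cc G in auto)
  have PA: "P' * (P * A) = A"
    using P' A by (subst assoc_mult_mat[of P' n n P n A m, symmetric]) auto
  have "A * (G * P) * A = P' * (P * A) * (G * P) * A" unfolding PA ..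
  also have "\<dots> = P' * (C * G * C)"
    using P' A G unfolding C by (simp add: mat_assoc)
  also have "\<dots> = A" unfolding \<open>C * G * C = C\<close> by (simp only: C PA)
  finally show ?thesis using G P' by (intro bexI[of _ "G * P"]) auto
qed

text \<open>Zlobec's formula: \<open>A\<^sup>* H A\<^sup>*\<close> is the Moore--Penrose inverse for every inner inverse \<open>H\<close> of \<open>A\<^sup>* A A\<^sup>*\<close>.\<close>

lemma is_pinv_pinv:
  assumes A: "A \<in> carrier_mat n m"
  shows "is_pinv A (pinv A)"
proof -
  define B where "B = mat_adjoint A"
  have B: "B \<in> carrier_mat m n" using mat_adjoint_carrier[OF A] by (simp add: B_def)
  have adjB: "mat_adjoint B = A" using mat_adjoint_adjoint[OF A] by (simp add: B_def)
  obtain H where H: "H \<in> carrier_mat n m" and "B * A * B * H * (B * A * B) = B * A * B"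
    using ex_inner_inverse[of "B * A * B" m n] A B by auto
  moreover have BAB: "B * A * B \<in> carrier_mat m n" using A B by auto
  ultimately have eq: "B * A * B * H * (B * A * B) = B * A * B" by simp
  define X where "X = B * H * B"
  have X: "X \<in> carrier_mat m n" using B H by (auto simp: X_def)
  \<comment> \<open>Here \<open>B * A\<close> is the Gram matrix of \<open>A\<close>, so the factor
    \<open>B\<close> can be cancelled on the left of the equation for \<open>H\<close>.\<close>
  have "B * A * (X * (A * B)) = B * A * B"
    using eq A B H unfolding X_def by (simp add: mat_assoc)
  then have "A * (X * (A * B)) = A * B"
    using adjoint_mult_cancel[OF A, of "X * (A * B)" n B] A B X by (auto simp: B_def)
  then have 1: "A * X * A * B = A * B" using A B X by (simp add: mat_assoc)
  have "mat_adjoint (A * X * A * B) = mat_adjoint (A * B)" using 1 by simp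
  then have "A * mat_adjoint (A * X * A) = A * B"
    using A B X by (simp add: mat_adjoint_mult[of _ n m _ n] adjB) (simp add: B_def)
  define Y where "Y = mat_adjoint (A * X * A)"
  have Y: "Y \<in> carrier_mat m n" unfolding Y_def using A X by (intro mat_adjoint_carrier) auto
  have "mat_adjoint B * Y = mat_adjoint B * B"
    using \<open>A * mat_adjoint (A * X * A) = A * B\<close> by (simp add: adjB Y_def)
  \<comment> \<open>The second cancellation: \<open>Y\<close> is \<open>B\<close> times the adjoint
    of \<open>A * X\<close>, so the preceding equation has the Gram matrix of \<open>B\<close> in
    front.\<close>
  have "Y = B"
  proof -
    define Dm where "Dm = A * X * A"
    have Dm: "Dm \<in> carrier_mat n m" using A X by (auto simp: Dm_def)
    have Ym: "Y = B * (mat_adjoint (A * X))"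
      unfolding Y_def B_def using A X by (subst mat_adjoint_mult[of "A * X" n n A m]) auto
    have c: "mat_adjoint (A * X) \<in> carrier_mat n n" using A X by (intro mat_adjoint_carrier) auto
    have "mat_adjoint B * B * mat_adjoint (A * X) = mat_adjoint B * B * 1\<^sub>m n"
      using \<open>mat_adjoint B * Y = mat_adjoint B * B\<close> A B c by (simp add: Ym adjB mat_assoc)
    then have "B * mat_adjoint (A * X) = B * 1\<^sub>m n"
      using adjoint_mult_cancel[OF B c, of "1\<^sub>m n"] by auto
    then show ?thesis using B by (simp add: Ym)
  qed
  then have AXA: "A * X * A = A"
    using adjB mat_adjoint_adjoint[of "A * X * A" n m] A X unfolding Y_def by auto
  \<comment> \<open>The adjoint of \<open>A * X\<close> starts with a factor \<open>A\<close>, on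
    which \<open>A * X\<close> acts as the identity. The other projection is symmetric: the adjoint
    of \<open>X * A\<close> ends with a factor \<open>A\<close>.\<close>
  have herm_l: "mat_adjoint (A * X) = A * X"
  proof -
    have c: "mat_adjoint (A * X) \<in> carrier_mat n n" using A X by (intro mat_adjoint_carrier) auto
    have L: "mat_adjoint (A * X) = A * mat_adjoint (A * (B * H))"
      unfolding X_def using A B H by (simp add: mat_adjoint_mult_dim adjB mat_assoc flip: B_def)
    have c': "mat_adjoint (A * (B * H)) \<in> carrier_mat m n" using A B H by (intro mat_adjoint_carrier) auto
    have "A * X * mat_adjoint (A * X) = A * X * A * mat_adjoint (A * (B * H))"
      unfolding L using A B H X by (simp add: mat_assoc)
    also have "\<dots> = mat_adjoint (A * X)" unfolding AXA L ..
    finally have 2: "A * X * mat_adjoint (A * X) = mat_adjoint (A * X)" .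
    show ?thesis using A X 2 by (intro hermitian_if_mult_adjoint[of _ n]) auto
  qed
  have herm_r: "mat_adjoint (X * A) = X * A"
  proof -
    have c: "mat_adjoint (X * A) \<in> carrier_mat m m" using A X by (intro mat_adjoint_carrier) auto
    have L: "mat_adjoint (X * A) = mat_adjoint (H * B * A) * A"
      unfolding X_def using A B H by (simp add: mat_adjoint_mult_dim adjB mat_assoc flip: B_def)
    have c': "mat_adjoint (H * B * A) \<in> carrier_mat m n" using A B H by (intro mat_adjoint_carrier) auto
    have "mat_adjoint (X * A) * (X * A) = mat_adjoint (H * B * A) * (A * X * A)"
      unfolding L using A B H X by (simp add: mat_assoc)
    also have "\<dots> = mat_adjoint (X * A)" unfolding AXA L ..
    finally have 2: "mat_adjoint (X * A) * (X * A) = mat_adjoint (X * A)" .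
    show ?thesis using A X 2 by (intro hermitian_if_mult_adjoint[of _ m]) auto
  qed
  have "X * A * B = mat_adjoint (A * (X * A))"
    using A X by (simp add: mat_adjoint_mult[of A n m _ m] herm_r B_def)
  also have "\<dots> = B" using A X AXA by (simp add: B_def mat_assoc)
  finally have XAB: "X * A * B = B" .
  have "X * A * X = X * A * B * (H * B)"
    using A B H by (simp add: X_def mat_assoc)
  also have "\<dots> = X"
    unfolding XAB using B H by (simp add: X_def mat_assoc)
  finally have "X * A * X = X" .
  then have "is_pinv A X"
    using A X AXA herm_l herm_r by (auto simp: is_pinv_def)
  then show ?thesis using pinv_eqI[OF A] by simp
qed

lemma pinv_carrier: "A \<in> carrier_mat n m \<Longrightarrow> pinv A \<in> carrier_mat m n"
  using is_pinv_pinv[of A n m] by (auto simp: is_pinv_def)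

text \<open>Full column rank is always expressed by a left inverse \<open>L\<close>; multiplying the
  first Penrose equation by \<open>L\<close> cancels its leading \<open>A\<close>.\<close>

lemma pinv_left_inverse:
  assumes A: "A \<in> carrier_mat n m" and L: "L \<in> carrier_mat m n" "L * A = 1\<^sub>m m"
  shows "pinv A * A = 1\<^sub>m m"
proof -
  note X = pinv_carrier[OF A]
  have "L * (A * pinv A * A) = 1\<^sub>m m" using is_pinv_pinv[OF A] L by (simp add: is_pinv_def)
  moreover have "L * (A * pinv A * A) = L * A * (pinv A * A)"
    using A L(1) X by (simp add: mat_assoc)
  ultimately show ?thesis using L(2) A X by simp
qed

text \<open>The reversal rule fails for general factors. It holds here since \<open>A\<close> has
  full column rank: \<open>W\<close> does not change the projection onto the range of
  \<open>A\<close>, and the other projection is the identity.\<close>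

lemma pinv_mult_invertible:
  assumes A: "A \<in> carrier_mat n m" and L: "L \<in> carrier_mat m n" "L * A = 1\<^sub>m m"
    and W: "W \<in> carrier_mat m m" "invertible_mat W"
  shows "pinv (A * W) = minv W * pinv A"
proof -
  note X = pinv_carrier[OF A] and V = minv[OF W] and LA = pinv_left_inverse[OF A L]
  have "is_pinv A (pinv A)" by (rule is_pinv_pinv[OF A])
  then have herm: "mat_adjoint (A * pinv A) = A * pinv A" by (simp add: is_pinv_def)
  have 1: "A * W * (minv W * pinv A) = A * pinv A"
    using A W X V mult_minv_cancel(1)[OF W X] by (simp add: mat_assoc)
  have 2: "minv W * pinv A * (A * W) = 1\<^sub>m m"
  proof -
    have "minv W * pinv A * (A * W) = minv W * ((pinv A * A) * W)"
      using A W X V by (simp add: mat_assoc)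
    then show ?thesis using LA W V by simp
  qed
  have "mat_adjoint (1\<^sub>m m) = (1\<^sub>m m :: complex mat)"
    using mat_adjoint_carrier[of "1\<^sub>m m :: complex mat" m m]
    by (intro eq_matI) (auto simp: mat_adjoint_index[of _ m m])
  moreover have "A * pinv A * (A * W) = A * W"
  proof -
    have "A * pinv A * (A * W) = A * (pinv A * A) * W" using A W X by (simp add: mat_assoc)
    then show ?thesis using A W by (simp add: LA)
  qed
  moreover have "1\<^sub>m m * (minv W * pinv A) = minv W * pinv A" using V X by simp
  ultimately have "is_pinv (A * W) (minv W * pinv A)"
    using A W X V herm unfolding is_pinv_def 1 2 by auto
  then show ?thesis using A W by (intro pinv_eqI[of _ n m]) auto
qed

lemma pinv_invertible:
  assumes "W \<in> carrier_mat m m" "invertible_mat W"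
  shows "pinv W = minv W"
proof -
  have "mat_adjoint (1\<^sub>m m) = (1\<^sub>m m :: complex mat)"
    using mat_adjoint_carrier[of "1\<^sub>m m :: complex mat" m m]
    by (intro eq_matI) (auto simp: mat_adjoint_index[of _ m m])
  then show ?thesis
    using assms minv[OF assms] by (intro pinv_eqI[of _ m m]) (auto simp: is_pinv_def)
qed

section \<open>Kronecker products and composite indices\<close>

lemma composite_less: "i < a \<Longrightarrow> j < b \<Longrightarrow> i * b + j < a * (b :: nat)"
proof -
  assume "i < a" "j < b"
  then have "i * b + j < Suc i * b" by simp
  also have "\<dots> \<le> a * b" using \<open>i < a\<close> by (intro mult_le_mono1) auto
  finally show ?thesis .
qed

lemma composite_split:
  assumes "t < a * (b :: nat)"
  shows "t div b < a" "t mod b < b"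
  using assms by (auto simp: less_mult_imp_div_less) (metis gr_zeroI mult_0_right mod_less_divisor not_less_zero)

lemma sum_composite: "(\<Sum>t<a * b. f (t div b) (t mod b)) = (\<Sum>i<a. \<Sum>j<b. f i (j :: nat))"
proof -
  have "(\<Sum>i<a. \<Sum>j<b. f i j) = (\<Sum>(i, j)\<in>{..<a} \<times> {..<b}. f i j)"
    by (rule sum.cartesian_product)
  also have "\<dots> = (\<Sum>t<a * b. f (t div b) (t mod b))"
    by (rule sum.reindex_bij_witness[of _ "\<lambda>t. (t div b, t mod b)" "\<lambda>(i, j). i * b + j"])
      (auto simp: composite_less composite_split)
  finally show ?thesis ..
qed

lemma dim_kron [simp]:
  "dim_row (kron A B) = dim_row A * dim_row B" "dim_col (kron A B) = dim_col A * dim_col B"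
  by (auto simp: kron_def)

lemma kron_carrier [simp]:
  "A \<in> carrier_mat n m \<Longrightarrow> B \<in> carrier_mat p q \<Longrightarrow> kron A B \<in> carrier_mat (n * p) (m * q)"
  by (auto simp: kron_def)

lemma kron_index:
  "i < dim_row A * dim_row B \<Longrightarrow> j < dim_col A * dim_col B \<Longrightarrow>
    kron A B $$ (i, j) = A $$ (i div dim_row B, j div dim_col B) * B $$ (i mod dim_row B, j mod dim_col B)"
  by (auto simp: kron_def)

lemma kron_mult:
  assumes "dim_col A = dim_row C" "dim_col B = dim_row D"
  shows "kron A B * kron C D = kron (A * C) (B * D)"
proof (rule eq_matI)
  fix i j assume "i < dim_row (kron (A * C) (B * D))" "j < dim_col (kron (A * C) (B * D))"
  then have i: "i < dim_row A * dim_row B" and j: "j < dim_col C * dim_col D" by auto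
  note i' = composite_split[OF i] and j' = composite_split[OF j]
  have AB: "kron A B \<in> carrier_mat (dim_row A * dim_row B) (dim_row C * dim_row D)"
    and CD: "kron C D \<in> carrier_mat (dim_row C * dim_row D) (dim_col C * dim_col D)"
    using assms by auto
  have "(kron A B * kron C D) $$ (i, j) =
      (\<Sum>t<dim_row C * dim_row D. (A $$ (i div dim_row B, t div dim_row D) * B $$ (i mod dim_row B, t mod dim_row D)) *
        (C $$ (t div dim_row D, j div dim_col D) * D $$ (t mod dim_row D, j mod dim_col D)))"
    using i j assms by (subst mult_index[OF AB CD]) (auto simp: kron_index intro!: sum.cong)
  also have "\<dots> = (\<Sum>t<dim_row C. \<Sum>u<dim_row D. (A $$ (i div dim_row B, t) * B $$ (i mod dim_row B, u)) *
        (C $$ (t, j div dim_col D) * D $$ (u, j mod dim_col D)))"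
    by (rule sum_composite)
  also have "\<dots> = (A * C) $$ (i div dim_row B, j div dim_col D) * (B * D) $$ (i mod dim_row B, j mod dim_col D)"
  proof -
    have A: "A \<in> carrier_mat (dim_row A) (dim_row C)" and C: "C \<in> carrier_mat (dim_row C) (dim_col C)"
      and B: "B \<in> carrier_mat (dim_row B) (dim_row D)" and D: "D \<in> carrier_mat (dim_row D) (dim_col D)"
      using assms by auto
    show ?thesis
      unfolding mult_index[OF A C i'(1) j'(1)] mult_index[OF B D i'(2) j'(2)] sum_product
      by (intro sum.cong refl) (simp only: mult_ac)
  qed
  also have "\<dots> = kron (A * C) (B * D) $$ (i, j)" using i j by (simp add: kron_index)
  finally show "(kron A B * kron C D) $$ (i, j) = kron (A * C) (B * D) $$ (i, j)" .
qed (use assms in auto)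

lemma kron_one: "kron (1\<^sub>m n) (1\<^sub>m m) = 1\<^sub>m (n * m)"
proof (rule eq_matI)
  fix i j assume "i < dim_row (1\<^sub>m (n * m))" "j < dim_col (1\<^sub>m (n * m))"
  then have i: "i < n * m" and j: "j < n * m" by auto
  have "i = j \<longleftrightarrow> i div m = j div m \<and> i mod m = j mod m" by (metis div_mult_mod_eq)
  then show "kron (1\<^sub>m n) (1\<^sub>m m) $$ (i, j) = 1\<^sub>m (n * m) $$ (i, j)"
    using i j composite_split[OF i] composite_split[OF j] by (auto simp: kron_index)
qed auto

lemma kron_invertible:
  assumes "A \<in> carrier_mat n n" "B \<in> carrier_mat m m" "invertible_mat A" "invertible_mat B"
  shows "invertible_mat (kron A B)" "minv (kron A B) = kron (minv A) (minv B)"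
proof -
  note m = minv[OF assms(1,3)] minv[OF assms(2,4)]
  have "kron A B * kron (minv A) (minv B) = 1\<^sub>m (n * m)"
    using assms m by (subst kron_mult) (auto simp: kron_one)
  then show "invertible_mat (kron A B)" "minv (kron A B) = kron (minv A) (minv B)"
    using invertible_mat_and_minv[of "kron A B" "n * m" "kron (minv A) (minv B)"] assms m by auto
qed

text \<open>The leading \<open>r\<close> by \<open>r\<close> block of an inverse of the Kronecker
  product inverts \<open>B\<close>.\<close>

lemma invertible_kron_oneD:
  assumes B: "B \<in> carrier_mat r r" and inv: "invertible_mat (kron (1\<^sub>m r) B)"
  shows "invertible_mat B"
proof (cases "r = 0")
  case True
  then show ?thesis using B by (simp add: invertible_mat_iff_det[of _ 0])
next
  case False
  define R where "R = minv (kron (1\<^sub>m r) B)"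
  have kc: "kron (1\<^sub>m r) B \<in> carrier_mat (r * r) (r * r)" using B by simp
  have R: "R \<in> carrier_mat (r * r) (r * r)" "kron (1\<^sub>m r) B * R = 1\<^sub>m (r * r)"
    using minv[OF kc inv] by (auto simp: R_def)
  define C where "C = Matrix.mat r r (\<lambda>(i, j). R $$ (i, j))"
  have C: "C \<in> carrier_mat r r" by (simp add: C_def)
  have "B * C = 1\<^sub>m r"
  proof (rule eq_matI)
    fix i j assume "i < dim_row (1\<^sub>m r)" "j < dim_col (1\<^sub>m r)"
    then have ij: "i < r" "j < r" by auto
    have lt: "t < r * r" if "t < r" for t using composite_less[of 0 r t r] that by simp
    have "(kron (1\<^sub>m r) B * R) $$ (i, j) = (\<Sum>t<r * r. (if t div r = 0 then B $$ (i, t mod r) * R $$ ((t div r) * r + t mod r, j) else 0))"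
    proof (subst mult_index[OF kc R(1)])
      have div: "t div r < r" "t mod r < r" "t div r * r + t mod r = t" if "t < r * r" for t
        using composite_split[OF that] by auto
      show "(\<Sum>t<r * r. kron (1\<^sub>m r) B $$ (i, t) * R $$ (t, j)) =
          (\<Sum>t<r * r. (if t div r = 0 then B $$ (i, t mod r) * R $$ ((t div r) * r + t mod r, j) else 0))"
        using ij B lt[of i] div by (intro sum.cong refl) (auto simp: kron_index mod_eq_self_iff_div_eq_0[THEN iffD2])
    qed (use ij lt in auto)
    also have "\<dots> = (\<Sum>a<r. \<Sum>b<r. if a = 0 then B $$ (i, b) * R $$ (a * r + b, j) else 0)"
      by (rule sum_composite)
    also have "\<dots> = (\<Sum>a<r. if a = 0 then \<Sum>b<r. B $$ (i, b) * R $$ (b, j) else 0)"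
      by (intro sum.cong) auto
    also have "\<dots> = (B * C) $$ (i, j)"
      unfolding mult_index[OF B C ij] using False ij by (simp add: C_def)
    finally show "(B * C) $$ (i, j) = 1\<^sub>m r $$ (i, j)" using ij lt by (simp add: R(2))
  qed (use B C in auto)
  then show ?thesis using invertible_mat_and_minv[OF B C] by simp
qed

text \<open>\<open>block_perm\<close> turns a block-diagonal matrix into this form.\<close>

definition interleave :: "nat \<Rightarrow> (nat \<Rightarrow> complex mat) \<Rightarrow> complex mat" where
  "interleave r K = Matrix.mat (r * r) (r * r)
     (\<lambda>(x, y). if x mod r = y mod r then K (x mod r) $$ (x div r, y div r) else 0)"

lemma interleave_carrier [simp]: "interleave r K \<in> carrier_mat (r * r) (r * r)"
  by (simp add: interleave_def)

lemma interleave_index: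
  "x < r * r \<Longrightarrow> y < r * r \<Longrightarrow>
    interleave r K $$ (x, y) = (if x mod r = y mod r then K (x mod r) $$ (x div r, y div r) else 0)"
  by (simp add: interleave_def)

lemma interleave_cong: "(\<And>l. l < r \<Longrightarrow> K l = K' l) \<Longrightarrow> interleave r K = interleave r K'"
  by (intro eq_matI) (auto simp: interleave_def composite_split)

lemma interleave_mult:
  assumes "\<And>l. l < r \<Longrightarrow> K l \<in> carrier_mat r r" "\<And>l. l < r \<Longrightarrow> L l \<in> carrier_mat r r"
  shows "interleave r K * interleave r L = interleave r (\<lambda>l. K l * L l)"
proof (rule eq_matI)
  fix x y assume "x < dim_row (interleave r (\<lambda>l. K l * L l))" "y < dim_col (interleave r (\<lambda>l. K l * L l))"
  then have x: "x < r * r" and y: "y < r * r" by (auto simp: interleave_def)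
  note x' = composite_split[OF x] and y' = composite_split[OF y]
  have "(interleave r K * interleave r L) $$ (x, y) =
     (\<Sum>t<r * r. (if x mod r = t mod r then K (x mod r) $$ (x div r, t div r) else 0) *
        (if t mod r = y mod r then L (t mod r) $$ (t div r, y div r) else 0))"
    using x y by (subst mult_index[OF interleave_carrier interleave_carrier])
      (auto simp: interleave_index intro!: sum.cong)
  also have "\<dots> = (\<Sum>i<r. \<Sum>j<r. (if x mod r = j then K (x mod r) $$ (x div r, i) else 0) *
        (if j = y mod r then L j $$ (i, y div r) else 0))"
    by (rule sum_composite)
  also have "\<dots> = (\<Sum>i<r. \<Sum>j<r. if j = x mod r then
      K (x mod r) $$ (x div r, i) * (if x mod r = y mod r then L (x mod r) $$ (i, y div r) else 0) else 0)"
    by (intro sum.cong) auto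
  also have "\<dots> = (\<Sum>i<r. K (x mod r) $$ (x div r, i) * (if x mod r = y mod r then L (x mod r) $$ (i, y div r) else 0))"
    using x' by simp
  also have "\<dots> = interleave r (\<lambda>l. K l * L l) $$ (x, y)"
    using x y x' y' by (simp add: interleave_index mult_index[OF assms])
  finally show "(interleave r K * interleave r L) $$ (x, y) = interleave r (\<lambda>l. K l * L l) $$ (x, y)" .
qed (auto simp: interleave_def)

lemma interleave_one: "interleave r (\<lambda>l. 1\<^sub>m r) = 1\<^sub>m (r * r)"
proof (rule eq_matI)
  fix i j assume "i < dim_row (1\<^sub>m (r * r))" "j < dim_col (1\<^sub>m (r * r))"
  then have i: "i < r * r" and j: "j < r * r" by auto
  have "i = j \<longleftrightarrow> i div r = j div r \<and> i mod r = j mod r" by (metis div_mult_mod_eq)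
  then show "interleave r (\<lambda>l. 1\<^sub>m r) $$ (i, j) = 1\<^sub>m (r * r) $$ (i, j)"
    using i j composite_split[OF i] composite_split[OF j] by (auto simp: interleave_index)
qed (auto simp: interleave_def)

lemma interleave_invertible:
  assumes "\<And>l. l < r \<Longrightarrow> K l \<in> carrier_mat r r" "\<And>l. l < r \<Longrightarrow> invertible_mat (K l)"
  shows "invertible_mat (interleave r K)" "minv (interleave r K) = interleave r (\<lambda>l. minv (K l))"
proof -
  have "interleave r K * interleave r (\<lambda>l. minv (K l)) = interleave r (\<lambda>l. 1\<^sub>m r)"
    using assms minv by (subst interleave_mult) (auto intro!: interleave_cong)
  then show "invertible_mat (interleave r K)" "minv (interleave r K) = interleave r (\<lambda>l. minv (K l))"
    using invertible_mat_and_minv[of "interleave r K" "r * r" "interleave r (\<lambda>l. minv (K l))"]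
    by (auto simp: interleave_one)
qed

text \<open>A kernel vector of one block, placed at the indices congruent to \<open>l\<close> modulo
  \<open>r\<close>, is a kernel vector of the whole matrix.\<close>

lemma invertible_interleaveD:
  assumes l: "l < r" and K: "\<And>l. l < r \<Longrightarrow> K l \<in> carrier_mat r r" and inv: "invertible_mat (interleave r K)"
  shows "invertible_mat (K l)"
proof (rule ccontr)
  assume "\<not> invertible_mat (K l)"
  then obtain v where v: "v \<in> carrier_vec r" "v \<noteq> 0\<^sub>v r" "K l *\<^sub>v v = 0\<^sub>v r"
    using invertible_mat_iff_det[OF K[OF l]] det_0_iff_vec_prod_zero[OF K[OF l]] by auto
  \<comment> \<open>The vector is repeated in every column to stay with products of square blocks;
    the diagonal of \<open>C\<close> still lists all its coordinates.\<close>
  define C where "C = Matrix.mat r r (\<lambda>(i, j). v $ i)"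
  have C: "C \<in> carrier_mat r r" by (simp add: C_def)
  have KC: "K l * C = 0\<^sub>m r r"
  proof (rule eq_matI)
    fix i j assume "i < dim_row (0\<^sub>m r r :: complex mat)" "j < dim_col (0\<^sub>m r r :: complex mat)"
    then have ij: "i < r" "j < r" by auto
    have "(K l * C) $$ (i, j) = (K l *\<^sub>v v) $ i"
      unfolding mult_index[OF K[OF l] C ij] mult_vec_index[OF K[OF l] v(1) ij(1)] using ij by (simp add: C_def)
    then show "(K l * C) $$ (i, j) = 0\<^sub>m r r $$ (i, j)" using ij by (simp add: v(3))
  qed (use K[OF l] C in auto)
  define P where "P = interleave r (\<lambda>i. if i = l then C else 0\<^sub>m r r)"
  have P: "P \<in> carrier_mat (r * r) (r * r)" by (simp add: P_def)
  have "interleave r K * P = interleave r (\<lambda>i. 0\<^sub>m r r)"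
    unfolding P_def using K C KC
    by (subst interleave_mult) (auto intro!: interleave_cong right_mult_zero_mat)
  also have "\<dots> = 0\<^sub>m (r * r) (r * r)"
    by (intro eq_matI) (auto simp: interleave_def composite_split)
  finally have P0: "P = 0\<^sub>m (r * r) (r * r)"
    using mult_minv_cancel(2)[OF interleave_carrier inv, of P "r * r"] P minv[OF interleave_carrier inv] by simp
  have "v $ i = 0" if "i < r" for i
  proof -
    have lt: "i * r + l < r * r" using that l by (rule composite_less)
    have "P $$ (i * r + l, i * r + l) = v $ i"
      using that l lt by (simp add: P_def interleave_index C_def)
    then show ?thesis using lt by (simp add: P0)
  qed
  then have "v = 0\<^sub>v r" using v(1) by (intro eq_vecI) auto
  then show False using v(2) by simp
qed

text \<open>Proportional blocks give a pure Kronecker product, which acts on the slices as a gauge.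
  The second step aims at exactly this situation.\<close>

lemma interleave_kron:
  assumes A: "A \<in> carrier_mat r r"
  shows "interleave r (\<lambda>l. w l \<cdot>\<^sub>m A) = kron A (mat_diag r w)"
  using A by (intro eq_matI) (auto simp: interleave_def kron_def mat_diag_def composite_split)

lemma diag_block_mat_index:
  assumes "\<And>l. l < m \<Longrightarrow> K l \<in> carrier_mat r r" "i < m * r" "j < m * r"
  shows "diag_block_mat (map K [0..<m]) $$ (i, j) =
    (if i div r = j div r then K (i div r) $$ (i mod r, j mod r) else (0 :: complex))"
  using assms
proof (induction m arbitrary: i j)
  case (Suc m)
  define D where "D = diag_block_mat (map K [0..<m])"
  have "map dim_row (map K [0..<m]) = replicate m r" "map dim_col (map K [0..<m]) = replicate m r"
    using carrier_matD[OF Suc.prems(1)] by (auto intro!: nth_equalityI)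
  then have D: "D \<in> carrier_mat (m * r) (m * r)"
    by (auto simp: D_def dim_diag_block_mat sum_list_replicate)
  have K: "K m \<in> carrier_mat r r" using Suc.prems(1) by simp
  have eq: "diag_block_mat (map K [0..<Suc m]) =
      four_block_mat D (0\<^sub>m (m * r) r) (0\<^sub>m r (m * r)) (K m)"
    using D K by (simp add: diag_block_mat_last D_def[symmetric])
  have div_eq: "t div r = m" "t mod r = t - m * r" if "t < Suc m * r" "\<not> t < m * r" for t
  proof -
    define s where "s = t - m * r"
    have s: "t = m * r + s" "s < r" using that by (auto simp: s_def)
    then show "t div r = m" "t mod r = t - m * r" by auto
  qed
  have div_less: "t div r < m" if "t < m * r" for t using that by (rule composite_split)
  have "diag_block_mat (map K [0..<Suc m]) $$ (i, j) =
      (if i < m * r then if j < m * r then D $$ (i, j) else 0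
       else if j < m * r then 0 else K m $$ (i - m * r, j - m * r))"
    unfolding eq using Suc.prems(2,3) D K by (subst index_mat_four_block) auto
  then show ?case
    using Suc.prems(2,3) div_eq[of i] div_eq[of j] div_less[of i] div_less[of j]
      Suc.IH[of i j, folded D_def] Suc.prems(1)
    by (cases "i < m * r"; cases "j < m * r") simp_all
qed simp

lemma block_perm_diag_block_mat:
  assumes "\<And>l. l < r \<Longrightarrow> K l \<in> carrier_mat r r"
  shows "block_perm r (diag_block_mat (map K [0..<r])) = interleave r K"
proof (rule eq_matI)
  fix x y assume "x < dim_row (interleave r K)" "y < dim_col (interleave r K)"
  then have x: "x < r * r" and y: "y < r * r" by (auto simp: interleave_def)
  note x' = composite_split[OF x] and y' = composite_split[OF y]
  have s: "x mod r * r + x div r < r * r" "y mod r * r + y div r < r * r"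
    using x' y' by (auto intro: composite_less)
  show "block_perm r (diag_block_mat (map K [0..<r])) $$ (x, y) = interleave r K $$ (x, y)"
    using x y x' y' by (simp add: block_perm_def diag_block_mat_index[OF assms s] interleave_index)
qed (auto simp: interleave_def block_perm_def)

section \<open>Distinct eigenvalues\<close>

text \<open>The coefficients of the polynomial that vanishes at all nodes except \<open>ev k\<close>
  combine the power sums into a nonzero multiple of \<open>c k\<close>.\<close>

lemma vandermonde_zero:
  fixes c ev :: "nat \<Rightarrow> complex"
  assumes inj: "inj_on ev {..<m}" and zero: "\<And>i. i < m \<Longrightarrow> (\<Sum>k<m. c k * ev k ^ i) = 0" and k: "k < m"
  shows "c k = 0"
proof -
  define p where "p = (\<Prod>j\<in>{..<m} - {k}. [:- ev j, 1:])"
  have "degree p \<le> (\<Sum>j\<in>{..<m} - {k}. degree [:- ev j, 1:])"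
    unfolding p_def using degree_prod_sum_le[of "{..<m} - {k}" "\<lambda>j. [:- ev j, 1:]"] by (simp add: o_def)
  then have deg: "degree p < m" using k by auto
  have p_ev: "poly p (ev j) = 0" if "j < m" "j \<noteq> k" for j
    using that unfolding p_def poly_prod by (intro prod_zero) auto
  have p_k: "poly p (ev k) \<noteq> 0"
    using inj k unfolding p_def poly_prod by (auto simp: prod_zero_iff dest: inj_onD)
  have "0 = (\<Sum>i\<le>degree p. coeff p i * (\<Sum>j<m. c j * ev j ^ i))"
    using deg by (simp add: zero)
  also have "\<dots> = (\<Sum>j<m. c j * poly p (ev j))"
    unfolding poly_altdef sum_distrib_left by (subst sum.swap) (simp add: mult_ac)
  also have "\<dots> = c k * poly p (ev k)"
    using k p_ev by (subst sum.remove[of _ k]) auto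
  finally show ?thesis using p_k by simp
qed

lemma eigenvectors_power:
  assumes Z: "(Z :: complex mat) \<in> carrier_mat r r" and X: "X \<in> carrier_mat r r" and eq: "Z * X = X * mat_diag r ev"
  shows "Z ^\<^sub>m i * X = X * mat_diag r (\<lambda>k. ev k ^ i)"
proof (induction i)
  case (Suc i)
  have D: "mat_diag r f \<in> carrier_mat r r" for f :: "nat \<Rightarrow> complex" by simp
  have Zi: "Z ^\<^sub>m i \<in> carrier_mat r r" using Z by simp
  have "Z ^\<^sub>m Suc i * X = Z ^\<^sub>m i * (Z * X)" by (simp add: assoc_mult_mat[OF Zi Z X])
  also have "\<dots> = Z ^\<^sub>m i * X * mat_diag r ev"
    unfolding eq using assoc_mult_mat[OF Zi X D] by simp
  also have "\<dots> = X * mat_diag r (\<lambda>k. ev k ^ Suc i)"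
    unfolding Suc using assoc_mult_mat[OF X D D] by (simp add: mult.commute)
  finally show ?case .
qed (use Z X in simp)

text \<open>If \<open>v\<close> is in the kernel of \<open>X\<close>, applying the powers of
  \<open>Z\<close> to \<open>X *\<^sub>v v\<close> yields vanishing power sums of the eigenvalues
  with weights \<open>X $$ (q, k) * v $ k\<close>, so all these weights vanish.\<close>

lemma eigenvectors_invertible:
  assumes Z: "(Z :: complex mat) \<in> carrier_mat r r" and X: "X \<in> carrier_mat r r" and eq: "Z * X = X * mat_diag r ev"
    and inj: "inj_on ev {..<r}" and nz: "\<And>k. k < r \<Longrightarrow> \<exists>q<r. X $$ (q, k) \<noteq> 0"
  shows "invertible_mat X"
proof (rule ccontr)
  assume "\<not> invertible_mat X"
  then obtain v where v: "v \<in> carrier_vec r" "v \<noteq> 0\<^sub>v r" "X *\<^sub>v v = 0\<^sub>v r"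
    using invertible_mat_iff_det[OF X] det_0_iff_vec_prod_zero[OF X] by auto
  have "X $$ (q, k) * v $ k = 0" if "q < r" "k < r" for q k
  proof (rule vandermonde_zero[OF inj _ that(2)])
    fix i
    have "(X * mat_diag r (\<lambda>k. ev k ^ i)) *\<^sub>v v = 0\<^sub>v r"
      unfolding eigenvectors_power[OF Z X eq, symmetric]
    proof -
      have Zi: "Z ^\<^sub>m i \<in> carrier_mat r r" using Z by simp
      have "Z ^\<^sub>m i *\<^sub>v 0\<^sub>v r = 0\<^sub>v r" 
        using Zi mult_vec_index[OF Zi zero_carrier_vec] by (intro eq_vecI) (auto simp del: index_mult_mat_vec)
      then show "(Z ^\<^sub>m i * X) *\<^sub>v v = 0\<^sub>v r"
        using assoc_mult_mat_vec[OF Zi X v(1)] v(3) by simp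
    qed
    then have "0 = ((X * mat_diag r (\<lambda>k. ev k ^ i)) *\<^sub>v v) $ q" using that by simp
    also have "\<dots> = (\<Sum>t<r. X $$ (q, t) * v $ t * ev t ^ i)"
      using that X v by (subst mult_vec_index[of _ r r])
        (auto simp: mat_diag_mult_right[OF X] mult_ac intro!: sum.cong)
    finally show "(\<Sum>k<r. X $$ (q, k) * v $ k * ev k ^ i) = 0" by simp
  qed
  then have "v $ k = 0" if "k < r" for k using nz[OF that] that by auto
  then have "v = 0\<^sub>v r" using v(1) by (intro eq_vecI) auto
  then show False using v(2) by simp
qed

section \<open>Unfoldings\<close>

definition square_cols :: "nat \<Rightarrow> nat \<Rightarrow> slices \<Rightarrow> nat set \<Rightarrow> complex mat" where
  "square_cols n r S \<Gamma> = submatrix (transpose_mat (unfold_square n r S)) UNIV \<Gamma>"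

lemma card_Int_lessThan: "\<Gamma> \<subseteq> {..<n} \<Longrightarrow> {j. j < n \<and> j \<in> \<Gamma>} = \<Gamma>"
  by auto

lemma pick_less:
  assumes "\<Gamma> \<subseteq> {..<n}" "j < card \<Gamma>"
  shows "pick \<Gamma> j < n" "pick \<Gamma> j \<in> \<Gamma>"
  using assms pick_in_set_le[of j \<Gamma>] by auto

lemma square_cols_carrier:
  "\<Gamma> \<subseteq> {..<n} \<Longrightarrow> square_cols n r S \<Gamma> \<in> carrier_mat (r * r) (card \<Gamma>)"
  by (auto simp: square_cols_def submatrix_def unfold_square_def card_Int_lessThan)

lemma square_cols_index:
  "\<Gamma> \<subseteq> {..<n} \<Longrightarrow> c < r * r \<Longrightarrow> j < card \<Gamma> \<Longrightarrow>
    square_cols n r S \<Gamma> $$ (c, j) = S (pick \<Gamma> j) $$ (c mod r, c div r)"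
  using pick_less[of \<Gamma> n j]
  by (auto simp: square_cols_def submatrix_def unfold_square_def card_Int_lessThan pick_UNIV)

lemma unfold_angle_carrier [simp]: "unfold_angle n r S \<in> carrier_mat n (r * r)"
  by (simp add: unfold_angle_def)

text \<open>The vectorization identity for a product of three matrices. It translates every right
  multiplication of an unfolding into a two-sided multiplication of the slices; the transpose arises
  because \<open>A\<close> is contracted with the row index.\<close>

lemma unfold_angle_gauge:
  assumes S: "\<And>a. a < n \<Longrightarrow> S a \<in> carrier_mat r r" and A: "A \<in> carrier_mat r r" and B: "B \<in> carrier_mat r r"
  shows "unfold_angle n r S * kron A B = unfold_angle n r (\<lambda>a. transpose_mat A * S a * B)"
proof (rule eq_matI)
  fix a c assume "a < dim_row (unfold_angle n r (\<lambda>a. transpose_mat A * S a * B))"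
    "c < dim_col (unfold_angle n r (\<lambda>a. transpose_mat A * S a * B))"
  then have a: "a < n" and c: "c < r * r" by (auto simp: unfold_angle_def)
  note c' = composite_split[OF c]
  have At: "transpose_mat A \<in> carrier_mat r r" using A by simp
  have ASc: "transpose_mat A * S a \<in> carrier_mat r r" using A S[OF a] by simp
  have "(unfold_angle n r S * kron A B) $$ (a, c) =
      (\<Sum>t<r * r. S a $$ (t div r, t mod r) * (A $$ (t div r, c div r) * B $$ (t mod r, c mod r)))"
    using a c A B by (subst mult_index[of _ n "r * r" _ "r * r"]) (auto simp: unfold_angle_def kron_index intro!: sum.cong)
  also have "\<dots> = (\<Sum>p<r. \<Sum>q<r. S a $$ (p, q) * (A $$ (p, c div r) * B $$ (q, c mod r)))"
    by (rule sum_composite)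
  also have "\<dots> = (\<Sum>q<r. \<Sum>p<r. S a $$ (p, q) * (A $$ (p, c div r) * B $$ (q, c mod r)))"
    by (rule sum.swap)
  also have "\<dots> = (transpose_mat A * S a * B) $$ (c div r, c mod r)"
    unfolding mult_index[OF ASc B c']
    using A c' by (intro sum.cong refl) (simp add: mult_index[OF At S[OF a]] sum_distrib_left mult_ac)
  finally show "(unfold_angle n r S * kron A B) $$ (a, c) = unfold_angle n r (\<lambda>a. transpose_mat A * S a * B) $$ (a, c)"
    using a c by (simp add: unfold_angle_def)
qed (use A B in \<open>auto simp: unfold_angle_def\<close>)

text \<open>The same identity for the transposed second unfolding. Its composite index has the
  column of the slice as major part, hence the swapped factors.\<close>

lemma square_cols_gauge:
  assumes S: "\<And>a. a < n \<Longrightarrow> S a \<in> carrier_mat r r" and A: "A \<in> carrier_mat r r" and B: "B \<in> carrier_mat r r"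
    and H: "\<And>a. a < n \<Longrightarrow> H a = A * S a * B" and \<Gamma>: "\<Gamma> \<subseteq> {..<n}"
  shows "square_cols n r H \<Gamma> = kron (transpose_mat B) A * square_cols n r S \<Gamma>"
proof (rule eq_matI)
  fix c j assume "c < dim_row (kron (transpose_mat B) A * square_cols n r S \<Gamma>)"
    "j < dim_col (kron (transpose_mat B) A * square_cols n r S \<Gamma>)"
  then have c: "c < r * r" and j: "j < card \<Gamma>" using A B square_cols_carrier[OF \<Gamma>, of r S] by auto
  note c' = composite_split[OF c]
  define b where "b = pick \<Gamma> j"
  have b: "b < n" using pick_less[OF \<Gamma> j] by (simp add: b_def)
  have ASc: "A * S b \<in> carrier_mat r r" using A S[OF b] by simp
  have Bt: "kron (transpose_mat B) A \<in> carrier_mat (r * r) (r * r)" using A B by simp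
  have "(kron (transpose_mat B) A * square_cols n r S \<Gamma>) $$ (c, j) =
      (\<Sum>t<r * r. (B $$ (t div r, c div r) * A $$ (c mod r, t mod r)) * S b $$ (t mod r, t div r))"
    using c j A B c' by (subst mult_index[OF Bt square_cols_carrier[OF \<Gamma>]])
      (auto simp: kron_index square_cols_index[OF \<Gamma>] b_def composite_split intro!: sum.cong)
  also have "\<dots> = (\<Sum>q<r. \<Sum>p<r. (B $$ (q, c div r) * A $$ (c mod r, p)) * S b $$ (p, q))"
    by (rule sum_composite)
  also have "\<dots> = (A * S b * B) $$ (c mod r, c div r)"
    unfolding mult_index[OF ASc B c'(2,1)]
    using c' by (intro sum.cong refl) (simp add: mult_index[OF A S[OF b]] sum_distrib_left mult_ac)
  finally show "square_cols n r H \<Gamma> $$ (c, j) = (kron (transpose_mat B) A * square_cols n r S \<Gamma>) $$ (c, j)"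
    using c j by (simp add: square_cols_index[OF \<Gamma>] H[OF b, unfolded b_def] b_def)
qed (use A B square_cols_carrier[OF \<Gamma>, of r S] square_cols_carrier[OF \<Gamma>, of r H] in auto)

lemma fold_angle_unfold_angle:
  assumes "S a \<in> carrier_mat r r" "a < n"
  shows "fold_angle r (unfold_angle n r S) a = S a"
  using assms by (intro eq_matI) (auto simp: fold_angle_def unfold_angle_def composite_less)

lemma slice_carrier [simp]: "slice r Q a \<in> carrier_mat r r"
  by (simp add: slice_def)

definition slice_word :: "nat \<Rightarrow> slices \<Rightarrow> nat list \<Rightarrow> complex mat" where
  "slice_word r S as = mprod r (map S as)"

lemma slice_word_carrier:
  "(\<And>a. a \<in> set as \<Longrightarrow> S a \<in> carrier_mat r r) \<Longrightarrow> slice_word r S as \<in> carrier_mat r r"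
  unfolding slice_word_def by (rule mprod_carrier) auto

lemma slice_word_slice_carrier [simp]: "slice_word r (slice r Q) as \<in> carrier_mat r r"
  by (rule slice_word_carrier) simp

text \<open>The only place where the entries of the tensor enter: \<open>T(:, \<alpha>, \<Gamma>) = Q\<^sub>\<langle>\<^sub>1\<^sub>\<rangle> (I \<otimes> Q\<^bsup>(\<alpha>)\<^esup>) Q\<^sub>[\<^sub>1\<^sub>]\<^sup>T(:, \<Gamma>)\<close>.\<close>

lemma tensor_mat_tr_tensor:
  assumes \<Gamma>: "\<Gamma> \<subseteq> {..<n}" and "\<alpha> \<in> tuples n l"
    and T: "\<And>as. as \<in> tuples n (l + 2) \<Longrightarrow> T as = tr_tensor r Q as"
  defines "S \<equiv> slice r Q"
  shows "tensor_mat n T \<alpha> \<Gamma> = unfold_angle n r S * kron (1\<^sub>m r) (slice_word r S \<alpha>) * square_cols n r S \<Gamma>"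
proof -
  define P where "P = slice_word r S \<alpha>"
  have P: "P \<in> carrier_mat r r" and S: "\<And>a. S a \<in> carrier_mat r r" by (auto simp: P_def S_def)
  have V: "square_cols n r S \<Gamma> \<in> carrier_mat (r * r) (card \<Gamma>)" by (rule square_cols_carrier[OF \<Gamma>])
  define S' where "S' = (\<lambda>a. transpose_mat (1\<^sub>m r) * S a * P)"
  have U': "unfold_angle n r S * kron (1\<^sub>m r) P = unfold_angle n r S'"
    unfolding S'_def using S P by (intro unfold_angle_gauge) auto
  have S': "S' a = S a * P" for a using S[of a] by (simp add: S'_def)
  have "tensor_mat n T \<alpha> \<Gamma> = unfold_angle n r S' * square_cols n r S \<Gamma>"
  proof (rule eq_matI)
    fix a j assume "a < dim_row (unfold_angle n r S' * square_cols n r S \<Gamma>)"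
      "j < dim_col (unfold_angle n r S' * square_cols n r S \<Gamma>)"
    then have a: "a < n" and j: "j < card \<Gamma>" using V unfold_angle_carrier[of n r S'] by auto
    define b where "b = pick \<Gamma> j"
    have b: "b < n" using pick_less[OF \<Gamma> j] by (simp add: b_def)
    have SaP: "S a * P \<in> carrier_mat r r" using S[of a] P by auto
    have "tensor_mat n T \<alpha> \<Gamma> $$ (a, j) = T (a # \<alpha> @ [b])"
      using a b j by (simp add: tensor_mat_def submatrix_def card_Int_lessThan[OF \<Gamma>] pick_UNIV b_def)
    also have "\<dots> = tr_tensor r Q (a # \<alpha> @ [b])"
      using assms(2) a b by (intro T) (auto simp: tuples_def)
    also have "\<dots> = mtrace (S a * (P * S b))"
    proof -
      have "mprod r (map S \<alpha> @ [S b]) = P * S b"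
        using S right_mult_one_mat[OF S] by (subst mprod_append) (auto simp: P_def slice_word_def)
      then show ?thesis by (simp add: tr_tensor_def S_def)
    qed
    also have "\<dots> = mtrace (S a * P * S b)" using S[of a] S[of b] P by (simp add: mat_assoc)
    also have "\<dots> = (\<Sum>i<r. \<Sum>k<r. (S a * P) $$ (i, k) * S b $$ (k, i))"
      using SaP S[of b] by (simp add: mtrace_eq[of _ r] mult_index[OF SaP S[of b]] del: assoc_mult_mat)
    also have "\<dots> = (\<Sum>t<r * r. (S a * P) $$ (t div r, t mod r) * S b $$ (t mod r, t div r))"
      by (rule sum_composite[symmetric])
    also have "\<dots> = (unfold_angle n r S' * square_cols n r S \<Gamma>) $$ (a, j)"
      unfolding mult_index[OF unfold_angle_carrier V a j]
      using a j by (intro sum.cong refl) (simp add: unfold_angle_def square_cols_index[OF \<Gamma>] S' b_def)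
    finally show "tensor_mat n T \<alpha> \<Gamma> $$ (a, j) = (unfold_angle n r S' * square_cols n r S \<Gamma>) $$ (a, j)" .
  qed (use V unfold_angle_carrier[of n r S'] in \<open>auto simp: tensor_mat_def submatrix_def unfold_angle_def card_Int_lessThan[OF \<Gamma>]\<close>)
  then show ?thesis unfolding U'[unfolded P_def] .
qed

section \<open>The eigenvector matrices of the first step\<close>

lemma dim_mat_diag [simp]: "dim_row (mat_diag n f) = n" "dim_col (mat_diag n f) = n"
  by (simp_all add: mat_diag_def)

lemma mat_diag_index: "i < n \<Longrightarrow> j < n \<Longrightarrow> mat_diag n f $$ (i, j) = (if i = j then f i else 0)"
  by (auto simp: mat_diag_def)

lemma mat_diag_invertible:
  assumes "\<And>k. k < r \<Longrightarrow> f k \<noteq> (0 :: complex)"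
  shows "invertible_mat (mat_diag r f)"
proof -
  have "mat_diag r (\<lambda>k. f k * inverse (f k)) = 1\<^sub>m r"
    using assms by (intro eq_matI) (auto simp: mat_diag_index)
  then have "mat_diag r f * mat_diag r (\<lambda>k. inverse (f k)) = 1\<^sub>m r" by simp
  then show ?thesis
    using invertible_mat_and_minv(1)[of "mat_diag r f" r "mat_diag r (\<lambda>k. inverse (f k))"] by simp
qed

lemma kron_one_diag:
  assumes "x < r * r" "y < r * r"
  shows "kron (1\<^sub>m r) (mat_diag r ev) $$ (x, y) = (if x = y then ev (x mod r) else 0)"
proof -
  have "x = y \<longleftrightarrow> x div r = y div r \<and> x mod r = y mod r" by (metis div_mult_mod_eq)
  then show ?thesis
    using assms composite_split[OF assms(1)] composite_split[OF assms(2)]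
    by (auto simp: kron_index mat_diag_index mat_diag_def)
qed

lemma mult_kron_one_diag:
  assumes "A \<in> carrier_mat n (r * r)" "x < n" "y < r * r"
  shows "(A * kron (1\<^sub>m r) (mat_diag r ev)) $$ (x, y) = A $$ (x, y) * ev (y mod r)"
proof -
  have k: "kron (1\<^sub>m r) (mat_diag r ev) \<in> carrier_mat (r * r) (r * r)" by simp
  have "(A * kron (1\<^sub>m r) (mat_diag r ev)) $$ (x, y) = (\<Sum>t<r * r. if t = y then A $$ (x, y) * ev (y mod r) else 0)"
    unfolding mult_index[OF assms(1) k assms(2,3)] using assms by (intro sum.cong refl) (auto simp: kron_one_diag)
  then show ?thesis using assms by simp
qed

lemma kron_one_diag_mult:
  assumes "A \<in> carrier_mat (r * r) n" "x < r * r" "y < n"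
  shows "(kron (1\<^sub>m r) (mat_diag r ev) * A) $$ (x, y) = ev (x mod r) * A $$ (x, y)"
proof -
  have k: "kron (1\<^sub>m r) (mat_diag r ev) \<in> carrier_mat (r * r) (r * r)" by simp
  have "(kron (1\<^sub>m r) (mat_diag r ev) * A) $$ (x, y) = (\<Sum>t<r * r. if t = x then ev (x mod r) * A $$ (x, y) else 0)"
    unfolding mult_index[OF k assms] using assms by (intro sum.cong refl) (auto simp: kron_one_diag)
  then show ?thesis using assms by simp
qed

text \<open>The coordinate inclusions of the first \<open>m\<close> and, with
  \<open>incl_right\<close>, of the last \<open>n - m\<close> coordinates. Products with them split
  an eigenbasis while all reasoning stays associative.\<close>

definition incl_left :: "nat \<Rightarrow> nat \<Rightarrow> complex mat" where
  "incl_left n m = Matrix.mat n m (\<lambda>(i, c). if i = c then 1 else 0)"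

definition incl_right :: "nat \<Rightarrow> nat \<Rightarrow> complex mat" where
  "incl_right n m = Matrix.mat n (n - m) (\<lambda>(i, c). if i = c + m then 1 else 0)"

lemma incl_carrier [simp]:
  "incl_left n m \<in> carrier_mat n m" "incl_right n m \<in> carrier_mat n (n - m)"
  "transpose_mat (incl_left n m) \<in> carrier_mat m n" "transpose_mat (incl_right n m) \<in> carrier_mat (n - m) n"
  by (auto simp: incl_left_def incl_right_def)

lemma mult_incl_left:
  assumes "m \<le> n" "A \<in> carrier_mat k n" "i < k" "j < m"
  shows "(A * incl_left n m) $$ (i, j) = A $$ (i, j)"
proof -
  have "(A * incl_left n m) $$ (i, j) = (\<Sum>t<n. if t = j then A $$ (i, t) else 0)"
    unfolding mult_index[OF assms(2) incl_carrier(1) assms(3,4)] using assms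
    by (intro sum.cong refl) (auto simp: incl_left_def)
  then show ?thesis using assms by simp
qed

lemma mult_incl_right:
  assumes "m \<le> n" "A \<in> carrier_mat k n" "i < k" "j < n - m"
  shows "(A * incl_right n m) $$ (i, j) = A $$ (i, j + m)"
proof -
  have "(A * incl_right n m) $$ (i, j) = (\<Sum>t<n. if t = j + m then A $$ (i, t) else 0)"
    unfolding mult_index[OF assms(2) incl_carrier(2) assms(3,4)] using assms
    by (intro sum.cong refl) (auto simp: incl_right_def)
  then show ?thesis using assms by simp
qed

lemma incl_orthogonal:
  assumes le: "m \<le> n"
  shows "transpose_mat (incl_left n m) * incl_left n m = 1\<^sub>m m"
    "transpose_mat (incl_right n m) * incl_left n m = 0\<^sub>m (n - m) m"
    "transpose_mat (incl_right n m) * incl_right n m = 1\<^sub>m (n - m)"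
    "transpose_mat (incl_left n m) * incl_right n m = 0\<^sub>m m (n - m)"
proof -
  show "transpose_mat (incl_left n m) * incl_left n m = 1\<^sub>m m"
  proof (rule eq_matI)
    fix i j assume "i < dim_row (1\<^sub>m m :: complex mat)" "j < dim_col (1\<^sub>m m :: complex mat)"
    then have ij: "i < m" "j < m" by auto
    show "(transpose_mat (incl_left n m) * incl_left n m) $$ (i, j) = 1\<^sub>m m $$ (i, j)"
      unfolding mult_incl_left[OF le incl_carrier(3) ij] using ij le by (auto simp: incl_left_def)
  qed (auto simp: incl_left_def)
  show "transpose_mat (incl_right n m) * incl_left n m = 0\<^sub>m (n - m) m"
  proof (rule eq_matI)
    fix i j assume "i < dim_row (0\<^sub>m (n - m) m :: complex mat)" "j < dim_col (0\<^sub>m (n - m) m :: complex mat)"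
    then have ij: "i < n - m" "j < m" by auto
    show "(transpose_mat (incl_right n m) * incl_left n m) $$ (i, j) = 0\<^sub>m (n - m) m $$ (i, j)"
      unfolding mult_incl_left[OF le incl_carrier(4) ij] using ij le by (auto simp: incl_right_def)
  qed (auto simp: incl_left_def incl_right_def)
  show "transpose_mat (incl_right n m) * incl_right n m = 1\<^sub>m (n - m)"
  proof (rule eq_matI)
    fix i j assume "i < dim_row (1\<^sub>m (n - m) :: complex mat)" "j < dim_col (1\<^sub>m (n - m) :: complex mat)"
    then have ij: "i < n - m" "j < n - m" by auto
    show "(transpose_mat (incl_right n m) * incl_right n m) $$ (i, j) = 1\<^sub>m (n - m) $$ (i, j)"
      unfolding mult_incl_right[OF le incl_carrier(4) ij] using ij le by (auto simp: incl_right_def)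
  qed (auto simp: incl_right_def)
  show "transpose_mat (incl_left n m) * incl_right n m = 0\<^sub>m m (n - m)"
  proof (rule eq_matI)
    fix i j assume "i < dim_row (0\<^sub>m m (n - m) :: complex mat)" "j < dim_col (0\<^sub>m m (n - m) :: complex mat)"
    then have ij: "i < m" "j < n - m" by auto
    show "(transpose_mat (incl_left n m) * incl_right n m) $$ (i, j) = 0\<^sub>m m (n - m) $$ (i, j)"
      unfolding mult_incl_right[OF le incl_carrier(3) ij] using ij le by (auto simp: incl_left_def)
  qed (auto simp: incl_left_def incl_right_def)
qed

text \<open>\<open>R\<close> and \<open>J\<close> are the first \<open>r * r\<close> and the
  remaining rows of \<open>P'\<close>, and \<open>K\<close> consists of the remaining columns of
  \<open>P\<close>. So \<open>R\<close> gives the full column rank of the stack, while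
  \<open>J\<close> and \<open>K\<close> describe a complement of its range.\<close>

lemma eigvec_stackD:
  assumes st: "eigvec_stack n r M E" and le: "r * r \<le> n"
  obtains R J K ev where "E \<in> carrier_mat n (r * r)" "R \<in> carrier_mat (r * r) n" "R * E = 1\<^sub>m (r * r)"
    "J \<in> carrier_mat (n - r * r) n" "K \<in> carrier_mat n (n - r * r)"
    "J * E = 0\<^sub>m (n - r * r) (r * r)" "J * K = 1\<^sub>m (n - r * r)"
    "M * E = E * kron (1\<^sub>m r) (mat_diag r ev)" "inj_on ev {..<r}" "\<And>k. k < r \<Longrightarrow> ev k \<noteq> 0"
proof -
  define m where "m = r * r"
  obtain P D P' ev where M: "M \<in> carrier_mat n n" and sim: "similar_mat_wit M D P P'" and D: "diagonal_mat D"
    and ev: "inj_on ev {..<r}" "\<And>k. k < r \<Longrightarrow> ev k \<noteq> 0"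
    and Dev: "\<And>j k. j < r \<Longrightarrow> k < r \<Longrightarrow> D $$ (j * r + k, j * r + k) = ev k"
    and E: "E = Matrix.mat n m (\<lambda>(i, c). P $$ (i, c))"
    using st unfolding eigvec_stack_def eigendecomposition_def m_def by blast
  note w = similar_mat_witD2[OF M sim]
  have c: "P \<in> carrier_mat n n" "P' \<in> carrier_mat n n" "D \<in> carrier_mat n n"
    and PP: "P * P' = 1\<^sub>m n" "P' * P = 1\<^sub>m n" and MD: "M = P * D * P'" using w by auto
  define I1 where "I1 = incl_left n m"
  define I2 where "I2 = incl_right n m"
  have le: "m \<le> n" using le by (simp add: m_def)
  have I: "I1 \<in> carrier_mat n m" "I2 \<in> carrier_mat n (n - m)" by (auto simp: I1_def I2_def)
  then have It: "transpose_mat I1 \<in> carrier_mat m n" "transpose_mat I2 \<in> carrier_mat (n - m) n" by auto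
  note AI1 = mult_incl_left[OF le, folded I1_def]
  note I11 = incl_orthogonal(1)[OF le, folded I1_def] and I21 = incl_orthogonal(2)[OF le, folded I1_def I2_def]
    and I22 = incl_orthogonal(3)[OF le, folded I2_def]
  have E': "E = P * I1" using c I AI1[OF c(1)] by (intro eq_matI) (auto simp: E)
  have cancel: "P' * (P * A) = A" if "A \<in> carrier_mat n k" for A k
    using assoc_mult_mat[OF c(2,1) that] PP that by simp
  show thesis
  proof (rule that[of "transpose_mat I1 * P'" "transpose_mat I2 * P'" "P * I2" ev, folded m_def])
    show "E \<in> carrier_mat n m" using c I by (simp add: E')
    show "transpose_mat I1 * P' * E = 1\<^sub>m m"
      unfolding E' using c I cancel[OF I(1)] by (simp add: mat_assoc I11)
    show "transpose_mat I2 * P' * E = 0\<^sub>m (n - m) m"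
      unfolding E' using c I cancel[OF I(1)] by (simp add: mat_assoc I21)
    show "transpose_mat I2 * P' * (P * I2) = 1\<^sub>m (n - m)"
      using c I cancel[OF I(2)] by (simp add: mat_assoc I22)
    have k: "kron (1\<^sub>m r) (mat_diag r ev) \<in> carrier_mat m m" by (simp add: m_def)
    have "D * I1 = I1 * kron (1\<^sub>m r) (mat_diag r ev)"
    proof (rule eq_matI)
      fix i j assume "i < dim_row (I1 * kron (1\<^sub>m r) (mat_diag r ev))" "j < dim_col (I1 * kron (1\<^sub>m r) (mat_diag r ev))"
      then have i: "i < n" and j: "j < m" using I k by auto
      have "D $$ (j, j) = ev (j mod r)"
        using Dev[of "j div r" "j mod r"] composite_split[of j r r] j by (auto simp: m_def)
      then have "D $$ (i, j) = I1 $$ (i, j) * ev (j mod r)"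
        using D i j le c by (auto simp: diagonal_mat_def I1_def incl_left_def)
      then show "(D * I1) $$ (i, j) = (I1 * kron (1\<^sub>m r) (mat_diag r ev)) $$ (i, j)"
        using i j I by (simp add: AI1[OF c(3)] mult_kron_one_diag[of _ n] m_def)
    qed (use c I k in auto)
    then show "M * E = E * kron (1\<^sub>m r) (mat_diag r ev)"
      unfolding MD E' using c I k cancel[OF I(1)] by (simp add: mat_assoc)
  qed (use c I ev in auto)
qed

text \<open>As the eigenvalues are nonzero, \<open>E\<close> is the matrix times \<open>E\<close>
  times an inverse diagonal matrix, so its columns lie in the range of \<open>U\<close>. The left
  inverse \<open>L\<close> moves the eigenvalue equation to \<open>N\<close>, and the full column
  rank of \<open>E\<close> makes \<open>G\<close> invertible.\<close>

lemma eigvec_stack_factor: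
  assumes st: "eigvec_stack n r (U * N * pinv U) E" and le: "r * r \<le> n"
    and U: "U \<in> carrier_mat n (r * r)" and L: "L \<in> carrier_mat (r * r) n" "L * U = 1\<^sub>m (r * r)"
    and N: "N \<in> carrier_mat (r * r) (r * r)"
  obtains G ev where "G \<in> carrier_mat (r * r) (r * r)" "invertible_mat G" "E = U * G"
    "N * G = G * kron (1\<^sub>m r) (mat_diag r ev)" "inj_on ev {..<r}" "\<And>k. k < r \<Longrightarrow> ev k \<noteq> 0"
proof -
  define m where "m = r * r"
  note U = U[folded m_def] and L = L[folded m_def] and N = N[folded m_def]
  obtain R ev where E: "E \<in> carrier_mat n m" and R: "R \<in> carrier_mat m n" "R * E = 1\<^sub>m m"
    and ME: "U * N * pinv U * E = E * kron (1\<^sub>m r) (mat_diag r ev)"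
    and ev: "inj_on ev {..<r}" "\<And>k. k < r \<Longrightarrow> ev k \<noteq> 0"
    using eigvec_stackD[OF st le] unfolding m_def by metis
  define \<Lambda> where "\<Lambda> = kron (1\<^sub>m r) (mat_diag r ev)"
  have \<Lambda>: "\<Lambda> \<in> carrier_mat m m" "invertible_mat \<Lambda>"
    using kron_invertible(1)[of "1\<^sub>m r" r "mat_diag r ev" r] mat_diag_invertible[of r ev] ev
    by (auto simp: \<Lambda>_def m_def invertible_mat_iff_det[of "1\<^sub>m r" r])
  note i = minv[OF \<Lambda>]
  note pU = pinv_carrier[OF U] and pUU = pinv_left_inverse[OF U L]
  define G where "G = N * pinv U * E * minv \<Lambda>"
  have G: "G \<in> carrier_mat m m" using N pU E i by (auto simp: G_def)
  have E_eq: "E = U * G"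
  proof -
    have "U * G = E * \<Lambda> * minv \<Lambda>"
      unfolding \<Lambda>_def[symmetric] ME[folded \<Lambda>_def, symmetric] G_def using N U pU E i by (simp add: mat_assoc)
    then show ?thesis using mult_minv_cancel(3)[OF \<Lambda> E] by simp
  qed
  have "pinv U * E = G" 
    unfolding E_eq using assoc_mult_mat[OF pU U G] pUU G by simp
  have "U * (N * G) = U * (G * \<Lambda>)"
    using ME[folded \<Lambda>_def] N U pU E G \<Lambda> \<open>pinv U * E = G\<close> by (simp add: E_eq mat_assoc)
  then have "L * (U * (N * G)) = L * (U * (G * \<Lambda>))" by simp
  then have NG: "N * G = G * \<Lambda>"
    using assoc_mult_mat[OF L(1) U, of "N * G" m] assoc_mult_mat[OF L(1) U, of "G * \<Lambda>" m] L(2) N G \<Lambda> by simp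
  have "R * U * G = 1\<^sub>m m" using R U G by (simp add: mat_assoc flip: E_eq)
  then have "invertible_mat G"
    using invertible_mat_mult_iff[of "R * U" m G] R U G by (simp add: invertible_mat_iff_det[of "1\<^sub>m m" m])
  then show thesis using that[folded m_def] G E_eq NG ev unfolding \<Lambda>_def by blast
qed

text \<open>Every block of an eigenvector of \<open>kron (1\<^sub>m r) Z\<close> is zero or an
  eigenvector of \<open>Z\<close>, so one nonzero block per eigenvalue supplies \<open>X\<close>.
  What is left of \<open>G\<close> commutes with a diagonal matrix whose distinct entries repeat
  with period \<open>r\<close>, which forces the interleaved shape.\<close>

lemma eigenvectors_kron:
  assumes Z: "Z \<in> carrier_mat r r"
    and G: "G \<in> carrier_mat (r * r) (r * r)" "invertible_mat G"
    and NG: "kron (1\<^sub>m r) Z * G = G * kron (1\<^sub>m r) (mat_diag r ev)" and inj: "inj_on ev {..<r}"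
  obtains X K where "X \<in> carrier_mat r r" "invertible_mat X" "Z * X = X * mat_diag r ev"
    "\<And>l. l < r \<Longrightarrow> K l \<in> carrier_mat r r" "\<And>l. l < r \<Longrightarrow> invertible_mat (K l)"
    "G = kron (1\<^sub>m r) X * interleave r K"
proof -
  define m where "m = r * r"
  have lt: "k < m" if "k < r" for k
    using composite_less[of 0 r k r] that by (simp add: m_def)
  have kZ: "kron (1\<^sub>m r) Z \<in> carrier_mat m m" using Z by (simp add: m_def)
  \<comment> \<open>The columns \<open>k < r\<close> form the first block of the stack, with one
    eigenvector for every eigenvalue; none is zero since \<open>G\<close> is invertible.\<close>
  have "\<exists>p<r. \<exists>q<r. G $$ (p * r + q, k) \<noteq> 0" if k: "k < r" for k
  proof (rule ccontr)
    assume neg: "\<not> ?thesis"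
    have "G $$ (x, k) = 0" if "x < m" for x
      using neg composite_split[of x r r] that unfolding m_def by (metis div_mult_mod_eq)
    then have "(minv G * G) $$ (k, k) = 0"
      using lt[OF k] by (subst mult_index[OF minv(1)[OF G] G(1)]) (auto simp: m_def)
    then show False using minv(3)[OF G] lt[OF k] by (simp add: m_def)
  qed
  then obtain p q where pq: "\<And>k. k < r \<Longrightarrow> p k < r \<and> q k < r \<and> G $$ (p k * r + q k, k) \<noteq> 0"
    by metis
  define X where "X = Matrix.mat r r (\<lambda>(i, k). G $$ (p k * r + i, k))"
  have X: "X \<in> carrier_mat r r" by (simp add: X_def)
  have eq: "Z * X = X * mat_diag r ev"
  proof (rule eq_matI)
    fix i k assume "i < dim_row (X * mat_diag r ev)" "k < dim_col (X * mat_diag r ev)"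
    then have ik: "i < r" "k < r" using X by auto
    have x: "p k * r + i < r * r" using pq[OF ik(2)] ik by (auto intro: composite_less)
    have "(kron (1\<^sub>m r) Z * G) $$ (p k * r + i, k) =
       (\<Sum>t<r * r. (if t div r = p k then Z $$ (i, t mod r) * G $$ (t, k) else 0))"
    proof (subst mult_index[OF kZ[unfolded m_def] G(1) x])
      have "kron (1\<^sub>m r) Z $$ (p k * r + i, t) = (if t div r = p k then Z $$ (i, t mod r) else 0)"
        if "t < r * r" for t
        using that x ik(1) Z pq[OF ik(2)] composite_split[OF that] by (simp add: kron_index)
      then show "(\<Sum>t<r * r. kron (1\<^sub>m r) Z $$ (p k * r + i, t) * G $$ (t, k)) =
          (\<Sum>t<r * r. (if t div r = p k then Z $$ (i, t mod r) * G $$ (t, k) else 0))"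
        by (intro sum.cong refl) simp
    qed (use lt[OF ik(2)] in \<open>simp_all add: m_def\<close>)
    also have "\<dots> = (\<Sum>t<r * r. (if t div r = p k then Z $$ (i, t mod r) * G $$ (t div r * r + t mod r, k) else 0))"
      by (simp only: div_mult_mod_eq)
    also have "\<dots> = (\<Sum>a<r. \<Sum>b<r. (if a = p k then Z $$ (i, b) * G $$ (a * r + b, k) else 0))"
      by (rule sum_composite)
    also have "\<dots> = (\<Sum>a<r. if a = p k then (\<Sum>b<r. Z $$ (i, b) * G $$ (p k * r + b, k)) else 0)"
      by (intro sum.cong) auto
    also have "\<dots> = (Z * X) $$ (i, k)"
      unfolding mult_index[OF Z X ik] using pq[OF ik(2)] ik by (simp add: X_def)
    finally have "(Z * X) $$ (i, k) = (G * kron (1\<^sub>m r) (mat_diag r ev)) $$ (p k * r + i, k)"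
      unfolding NG by simp
    also have "\<dots> = X $$ (i, k) * ev k"
      using x lt[OF ik(2)] ik by (subst mult_kron_one_diag[OF G(1)]) (auto simp: m_def X_def)
    finally show "(Z * X) $$ (i, k) = (X * mat_diag r ev) $$ (i, k)"
      using ik by (simp add: mat_diag_mult_right[OF X])
  qed (use Z X in auto)
  have "\<exists>i<r. X $$ (i, k) \<noteq> 0" if "k < r" for k
    using pq[OF that] that by (auto simp: X_def intro!: exI[of _ "q k"])
  then have invX: "invertible_mat X" using eigenvectors_invertible[OF Z X eq inj] by blast
  define H where "H = kron (1\<^sub>m r) (minv X) * G"
  note mX = minv[OF X invX]
  have kX: "kron (1\<^sub>m r) X \<in> carrier_mat m m" "kron (1\<^sub>m r) (minv X) \<in> carrier_mat m m"
    using X mX by (auto simp: m_def)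
  have one: "1\<^sub>m r \<in> carrier_mat r r" "invertible_mat (1\<^sub>m r :: complex mat)"
    by (auto simp: invertible_mat_iff_det[of "1\<^sub>m r" r])
  have one': "minv (1\<^sub>m r) = 1\<^sub>m r" by (rule invertible_mat_and_minv(2)[of _ r]) auto
  note kinv = kron_invertible[OF one(1) X one(2) invX, unfolded one']
  have H: "H \<in> carrier_mat m m" using kX G by (auto simp: H_def m_def)
  have GH: "G = kron (1\<^sub>m r) X * H"
    unfolding H_def kinv(2)[symmetric]
    by (rule mult_minv_cancel(1)[symmetric]) (use kX G kinv in \<open>auto simp: m_def\<close>)
  define \<Lambda> where "\<Lambda> = kron (1\<^sub>m r) (mat_diag r ev)"
  have \<Lambda>: "\<Lambda> \<in> carrier_mat m m" by (simp add: \<Lambda>_def m_def)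
  have "\<Lambda> * H = H * \<Lambda>"
  proof -
    have "mat_diag r ev * minv X = minv X * Z"
    proof -
      have d: "mat_diag r ev \<in> carrier_mat r r" by simp
      have "minv X * (Z * X) * minv X = minv X * Z"
        using mult_minv_cancel(3)[OF X invX, of "minv X * Z" r] mX(1) X Z by (simp add: mat_assoc)
      moreover have "minv X * (Z * X) * minv X = mat_diag r ev * minv X"
        unfolding eq using mult_minv_cancel(2)[OF X invX d] by simp
      ultimately show ?thesis by simp
    qed
    then have "\<Lambda> * kron (1\<^sub>m r) (minv X) = kron (1\<^sub>m r) (minv X) * kron (1\<^sub>m r) Z"
      unfolding \<Lambda>_def using mX(1) Z by (simp add: kron_mult)
    then have "\<Lambda> * H = kron (1\<^sub>m r) (minv X) * (kron (1\<^sub>m r) Z * G)"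
      using assoc_mult_mat[OF \<Lambda> kX(2) G(1)[folded m_def]] assoc_mult_mat[OF kX(2) kZ G(1)[folded m_def]]
      by (simp add: H_def)
    also have "\<dots> = H * \<Lambda>"
      unfolding NG H_def \<Lambda>_def[symmetric] using \<Lambda> kX G(1)[folded m_def] by (simp add: mat_assoc)
    finally show ?thesis .
  qed
  \<comment> \<open>An entry of \<open>H\<close> can be nonzero only where the eigenvalues of its
    row and column agree, that is, where the indices are congruent modulo \<open>r\<close>.\<close>
  then have comm: "ev (x mod r) * H $$ (x, y) = H $$ (x, y) * ev (y mod r)" if "x < m" "y < m" for x y
    using that H kron_one_diag_mult[of H r m x y ev] mult_kron_one_diag[of H m r x y ev]
    unfolding m_def \<Lambda>_def by auto
  define K where "K = (\<lambda>l. Matrix.mat r r (\<lambda>(i, j). H $$ (i * r + l, j * r + l)))"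
  have K: "K l \<in> carrier_mat r r" for l by (simp add: K_def)
  have HK: "H = interleave r K"
  proof (rule eq_matI)
    fix x y assume "x < dim_row (interleave r K)" "y < dim_col (interleave r K)"
    then have xy: "x < r * r" "y < r * r" by (auto simp: interleave_def)
    note xy' = composite_split[OF xy(1)] composite_split[OF xy(2)]
    have "H $$ (x, y) = 0" if "x mod r \<noteq> y mod r"
      using comm[of x y] xy xy' that inj by (auto simp: m_def dest: inj_onD)
    moreover have "K (x mod r) $$ (x div r, y div r) = H $$ (x, y)" if "x mod r = y mod r"
      using xy' that by (simp add: K_def) (simp flip: that)
    ultimately show "H $$ (x, y) = interleave r K $$ (x, y)"
      using xy by (simp add: interleave_index)
  qed (use H in \<open>auto simp: m_def interleave_def\<close>)
  have "invertible_mat H"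
    using invertible_mat_mult_iff[OF kX(1) H] G(2) unfolding GH by simp
  then have "invertible_mat (K l)" if "l < r" for l
    using invertible_interleaveD[of l r K] K that unfolding HK by blast
  then show thesis using that[OF X invX eq K _ GH[unfolded HK]] by blast
qed

section \<open>The first core\<close>

lemma invertible_one [simp]: "invertible_mat (1\<^sub>m r :: complex mat)"
  and minv_one [simp]: "minv (1\<^sub>m r) = 1\<^sub>m r"
  using invertible_mat_and_minv[of "1\<^sub>m r" r "1\<^sub>m r"] by auto

text \<open>By full column rank the pseudoinverse of \<open>E\<close> splits and \<open>U\<close>
  cancels, which leaves \<open>kron (1\<^sub>m r) (minv X * X')\<close> between two interleaved
  matrices. The outer factors preserve the residue of an index modulo \<open>r\<close> and the
  middle one preserves its quotient, so a block with fixed residues sees a single entry of the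
  middle factor.\<close>

lemma F_block_eq:
  assumes U: "U \<in> carrier_mat n (r * r)" and L: "L \<in> carrier_mat (r * r) n" "L * U = 1\<^sub>m (r * r)"
    and X: "X \<in> carrier_mat r r" "invertible_mat X" and X': "X' \<in> carrier_mat r r"
    and K: "\<And>l. l < r \<Longrightarrow> K l \<in> carrier_mat r r" "\<And>l. l < r \<Longrightarrow> invertible_mat (K l)"
    and K': "\<And>l. l < r \<Longrightarrow> K' l \<in> carrier_mat r r"
    and E: "E = U * (kron (1\<^sub>m r) X * interleave r K)" and E': "E' = U * (kron (1\<^sub>m r) X' * interleave r K')"
    and jk: "j < r" "k < r"
  shows "F_block r E E' j k = (minv X * X') $$ (j, k) \<cdot>\<^sub>m (minv (K j) * K' k)"
proof -
  define m where "m = r * r"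
  define W where "W = minv X * X'"
  note mX = minv[OF X]
  have W: "W \<in> carrier_mat r r" using mX X' by (simp add: W_def)
  have Kc: "interleave r f \<in> carrier_mat m m" for f by (simp add: m_def)
  have kc: "kron (1\<^sub>m r) Y \<in> carrier_mat m m" if "Y \<in> carrier_mat r r" for Y using that by (simp add: m_def)
  note kX = kron_invertible[OF one_carrier_mat X(1) invertible_one X(2), unfolded minv_one]
  have iK: "invertible_mat (interleave r K)" "minv (interleave r K) = interleave r (\<lambda>l. minv (K l))"
    using interleave_invertible[of r K] K by auto
  note pU = pinv_carrier[OF U, folded m_def] and pUU = pinv_left_inverse[OF U L, folded m_def]
  define A where "A = interleave r (\<lambda>l. minv (K l))"
  have A: "A \<in> carrier_mat m m" by (simp add: A_def m_def)
  have inv: "invertible_mat (kron (1\<^sub>m r) X * interleave r K)"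
    using kX(1) iK(1) kc[OF X(1)] Kc[of K] by (simp add: invertible_mat_mult_iff[of _ m])
  have "pinv E = minv (kron (1\<^sub>m r) X * interleave r K) * pinv U"
    unfolding E using inv kc[OF X(1)] Kc[of K] by (intro pinv_mult_invertible[OF U L]) (auto simp: m_def)
  also have "minv (kron (1\<^sub>m r) X * interleave r K) = A * kron (1\<^sub>m r) (minv X)"
    using minv_mult[OF kc[OF X(1)] Kc[of K] kX(1) iK(1)] kX(2) iK(2) by (simp add: A_def)
  finally have pE: "pinv E = A * kron (1\<^sub>m r) (minv X) * pinv U" .
  have "pinv E * E' = A * (kron (1\<^sub>m r) (minv X) * (pinv U * U) * kron (1\<^sub>m r) X' * interleave r K')"
  proof -
    have "A * B * P * (U * (C * D)) = A * (B * (P * U) * C * D)"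
      if "B \<in> carrier_mat m m" "C \<in> carrier_mat m m" "D \<in> carrier_mat m m" "P \<in> carrier_mat m n" for B C D P
      using that A U[folded m_def] by (simp add: mat_assoc)
    then show ?thesis unfolding pE E' using kc[OF mX(1)] kc[OF X'] Kc[of K'] pU by blast
  qed
  also have "\<dots> = A * (kron (1\<^sub>m r) W * interleave r K')"
    unfolding pUU using right_mult_one_mat[OF kc[OF mX(1)]] mX(1) X' by (simp add: W_def kron_mult)
  finally have F: "pinv E * E' = A * (kron (1\<^sub>m r) W * interleave r K')" .
  have kW_index: "(kron (1\<^sub>m r) W * interleave r K') $$ (p * r + i, q * r + k) = W $$ (i, k) * K' k $$ (p, q)"
    if pq: "p < r" "q < r" "i < r" for p q i
  proof -
    have x: "p * r + i < m" "q * r + k < m" using pq jk by (auto simp: m_def intro: composite_less)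
    have "(kron (1\<^sub>m r) W * interleave r K') $$ (p * r + i, q * r + k) =
      (\<Sum>t<r * r. (if t div r = p \<and> t mod r = k then W $$ (i, t mod r) * K' k $$ (t div r, q) else 0))"
    proof (subst mult_index[OF kc[OF W] Kc x], unfold m_def, intro sum.cong refl)
      fix t assume "t \<in> {..<r * r}"
      then have t: "t < r * r" "t div r < r" "t mod r < r" using composite_split by auto
      have 1: "kron (1\<^sub>m r) W $$ (p * r + i, t) = (if t div r = p then W $$ (i, t mod r) else 0)"
        using t x pq W by (simp add: kron_index m_def)
      have 2: "interleave r K' $$ (t, q * r + k) = (if t mod r = k then K' k $$ (t div r, q) else 0)"
        using t x pq jk by (simp add: interleave_index m_def)
      show "kron (1\<^sub>m r) W $$ (p * r + i, t) * interleave r K' $$ (t, q * r + k) =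
         (if t div r = p \<and> t mod r = k then W $$ (i, t mod r) * K' k $$ (t div r, q) else 0)"
        unfolding 1 2 by simp
    qed
    also have "\<dots> = (\<Sum>a<r. \<Sum>b<r. (if a = p \<and> b = k then W $$ (i, b) * K' k $$ (a, q) else 0))"
      by (rule sum_composite)
    also have "\<dots> = (\<Sum>a<r. if a = p then W $$ (i, k) * K' k $$ (p, q) else 0)"
    proof (intro sum.cong refl)
      fix a
      have "(\<Sum>b<r. (if a = p \<and> b = k then W $$ (i, b) * K' k $$ (a, q) else 0)) =
          (\<Sum>b<r. if b = k then (if a = p then W $$ (i, k) * K' k $$ (p, q) else 0) else 0)"
        by (intro sum.cong) auto
      then show "(\<Sum>b<r. (if a = p \<and> b = k then W $$ (i, b) * K' k $$ (a, q) else 0)) =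
          (if a = p then W $$ (i, k) * K' k $$ (p, q) else 0)" using jk by simp
    qed
    finally show ?thesis using pq by simp
  qed
  have mKc: "minv (K j) \<in> carrier_mat r r" using minv K jk by blast
  have "(A * (kron (1\<^sub>m r) W * interleave r K')) $$ (p * r + j, q * r + k) =
      W $$ (j, k) * (minv (K j) * K' k) $$ (p, q)" if pq: "p < r" "q < r" for p q
  proof -
    have x: "p * r + j < m" "q * r + k < m" using pq jk by (auto simp: m_def intro: composite_less)
    have kWc: "kron (1\<^sub>m r) W * interleave r K' \<in> carrier_mat m m" using kc[OF W] Kc[of K'] by simp
    have "(A * (kron (1\<^sub>m r) W * interleave r K')) $$ (p * r + j, q * r + k) =
      (\<Sum>t<r * r. (if t mod r = j then minv (K j) $$ (p, t div r) *
         (W $$ (t mod r, k) * K' k $$ (t div r, q)) else 0))"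
    proof (subst mult_index[OF A kWc x], unfold m_def, intro sum.cong refl)
      fix t assume "t \<in> {..<r * r}"
      then have t: "t < r * r" "t div r < r" "t mod r < r" using composite_split by auto
      have 1: "A $$ (p * r + j, t) = (if t mod r = j then minv (K j) $$ (p, t div r) else 0)"
        using t x jk by (simp add: A_def interleave_index m_def)
      show "A $$ (p * r + j, t) * (kron (1\<^sub>m r) W * interleave r K') $$ (t, q * r + k) =
         (if t mod r = j then minv (K j) $$ (p, t div r) * (W $$ (t mod r, k) * K' k $$ (t div r, q)) else 0)"
        using kW_index[of "t div r" q "t mod r"] t pq unfolding 1 by simp
    qed
    also have "\<dots> = (\<Sum>a<r. \<Sum>b<r. (if b = j then minv (K j) $$ (p, a) *
         (W $$ (b, k) * K' k $$ (a, q)) else 0))"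
      by (rule sum_composite)
    also have "\<dots> = (\<Sum>a<r. minv (K j) $$ (p, a) * (W $$ (j, k) * K' k $$ (a, q)))"
      using jk by simp
    also have "\<dots> = W $$ (j, k) * (minv (K j) * K' k) $$ (p, q)"
      unfolding mult_index[OF mKc K'[OF jk(2)] pq] by (simp add: sum_distrib_left mult_ac)
    finally show ?thesis .
  qed
  then show ?thesis
    unfolding F_block_def F W_def[symmetric] using mKc K'[OF jk(2)] by (intro eq_matI) auto
qed

lemma minv_smult_mult:
  assumes "A \<in> carrier_mat r r" "invertible_mat A" "B \<in> carrier_mat r r" "invertible_mat B" "c \<noteq> 0"
  shows "minv (c \<cdot>\<^sub>m (minv A * B)) = (1 / c) \<cdot>\<^sub>m (minv B * A)"
    "invertible_mat (c \<cdot>\<^sub>m (minv A * B))"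
proof -
  note mA = minv[OF assms(1,2)] and iA = invertible_mat_minv[OF assms(1,2)]
  have inv: "invertible_mat (minv A * B)"
    using iA mA assms by (simp add: invertible_mat_mult_iff[of _ r])
  have c: "minv A * B \<in> carrier_mat r r" using mA assms by simp
  show "invertible_mat (c \<cdot>\<^sub>m (minv A * B))" using invertible_mat_smult(1)[OF c inv assms(5)] .
  show "minv (c \<cdot>\<^sub>m (minv A * B)) = (1 / c) \<cdot>\<^sub>m (minv B * A)"
    using invertible_mat_smult(2)[OF c inv assms(5)] minv_mult[OF mA(1) assms(3) iA(1) assms(4)] iA(2) by simp
qed

text \<open>
  \<open>W\<close> is the change of basis between the two eigenbases. The blocks of \<open>F\<close> carry one entry of
  \<open>W\<close> each, so the second step needs the entries of its first column to be nonzero.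
\<close>

locale step2_setting =
  fixes n r U L X X' K K' E E' W
  assumes U: "U \<in> carrier_mat n (r * r)" and L: "L \<in> carrier_mat (r * r) n" "L * U = 1\<^sub>m (r * r)"
    and X: "X \<in> carrier_mat r r" "invertible_mat X" and X': "X' \<in> carrier_mat r r"
    and K: "\<And>l. l < r \<Longrightarrow> K l \<in> carrier_mat r r" "\<And>l. l < r \<Longrightarrow> invertible_mat (K l)"
    and K': "\<And>l. l < r \<Longrightarrow> K' l \<in> carrier_mat r r" "\<And>l. l < r \<Longrightarrow> invertible_mat (K' l)"
    and E: "E = U * (kron (1\<^sub>m r) X * interleave r K)" and E': "E' = U * (kron (1\<^sub>m r) X' * interleave r K')"
    and r: "r \<ge> 2"
  defines "W \<equiv> minv X * X'"
begin

lemma F_eq: "j < r \<Longrightarrow> k < r \<Longrightarrow> F_block r E E' j k = W $$ (j, k) \<cdot>\<^sub>m (minv (K j) * K' k)"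
  unfolding W_def by (rule F_block_eq[OF U L X X' K K'(1) E E'])

definition K_blocks :: "nat \<Rightarrow> complex mat" where
  "K_blocks l = (if l = 0 then 1\<^sub>m r else F_block r E E' 0 0 * minv (F_block r E E' l 0))"

text \<open>The basis choice for the second stack enters both factors only through
  \<open>K' 0\<close>, which cancels; a ratio of entries of \<open>W\<close> is all that remains of
  the second stack. The identity prescribed for \<open>l = 0\<close> fits the formula.\<close>

lemma K_blocks_eq:
  assumes "l < r" "W $$ (l, 0) \<noteq> 0" "W $$ (0, 0) \<noteq> 0"
  shows "K_blocks l = (W $$ (0, 0) / W $$ (l, 0)) \<cdot>\<^sub>m (minv (K 0) * K l)"
proof (cases "l = 0")
  case True
  have "minv (K 0) * K 0 = 1\<^sub>m r" using minv(3)[OF K(1) K(2)] r by simp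
  then show ?thesis using assms by (auto simp: K_blocks_def True intro!: eq_matI)
next
  case False
  have r0: "0 < r" using r by simp
  note m0 = minv[OF K(1)[OF r0] K(2)[OF r0]] and ml = minv[OF K(1)[OF assms(1)] K(2)[OF assms(1)]]
  have c: "minv (K 0) * K' 0 \<in> carrier_mat r r" "minv (K' 0) * K l \<in> carrier_mat r r"
    using m0 K'[OF r0] K(1)[OF assms(1)] minv[OF K'[OF r0]] by auto
  have "K_blocks l = (W $$ (0, 0) \<cdot>\<^sub>m (minv (K 0) * K' 0)) * ((1 / W $$ (l, 0)) \<cdot>\<^sub>m (minv (K' 0) * K l))"
    using False minv_smult_mult(1)[OF K(1)[OF assms(1)] K(2)[OF assms(1)] K'[OF r0] assms(2)]
    by (simp add: K_blocks_def F_eq r0 assms)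
  also have "\<dots> = (W $$ (0, 0) / W $$ (l, 0)) \<cdot>\<^sub>m ((minv (K 0) * K' 0) * (minv (K' 0) * K l))"
    using c by (simp add: mult_smult_assoc_mat[OF c(1), of _ r] mult_smult_distrib[OF c] del: assoc_mult_mat)
      (auto intro!: eq_matI)
  also have "(minv (K 0) * K' 0) * (minv (K' 0) * K l) = minv (K 0) * K l"
    using mult_minv_cancel(1)[OF K'[OF r0] K(1)[OF assms(1)]] m0 K'[OF r0] minv[OF K'[OF r0]] K(1)[OF assms(1)]
    by (simp add: mat_assoc)
  finally show ?thesis .
qed

lemma invertible_F_iff:
  assumes "j < r" "k < r"
  shows "invertible_mat (F_block r E E' j k) \<longleftrightarrow> W $$ (j, k) \<noteq> 0"
proof
  have c: "minv (K j) * K' k \<in> carrier_mat r r"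
    using minv(1)[OF K[OF assms(1)]] K'(1)[OF assms(2)] by auto
  show "W $$ (j, k) \<noteq> 0" if inv: "invertible_mat (F_block r E E' j k)"
  proof
    assume "W $$ (j, k) = 0"
    then have "F_block r E E' j k = 0\<^sub>m r r"
      using minv(1)[OF K[OF assms(1)]] K'(1)[OF assms(2)] assms by (auto simp: F_eq intro!: eq_matI)
    then show False using inv r by (simp add: invertible_mat_iff_det[of _ r])
  qed
  show "invertible_mat (F_block r E E' j k)" if "W $$ (j, k) \<noteq> 0"
    using minv_smult_mult(2)[OF K(1,2)[OF assms(1)] K'[OF assms(2)] that] by (simp add: F_eq assms)
qed

lemma block_perm_K_hat:
  assumes "\<And>l. l \<in> {1..<r} \<Longrightarrow> W $$ (l, 0) \<noteq> 0"
  shows "block_perm r (K_hat r E E') = interleave r K_blocks" and "\<And>l. l < r \<Longrightarrow> K_blocks l \<in> carrier_mat r r"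
proof -
  show c: "K_blocks l \<in> carrier_mat r r" if "l < r" for l
  proof (cases "l = 0")
    case False
    have Fc: "F_block r E E' j k \<in> carrier_mat r r" for j k by (simp add: F_block_def)
    show ?thesis
      using minv(1)[OF Fc, of l 0] invertible_F_iff[of l 0] assms[of l] that False Fc[of 0 0] r
      by (simp add: K_blocks_def)
  qed (simp add: K_blocks_def)
  have "K_hat r E E' = diag_block_mat (map K_blocks [0..<r])"
    unfolding K_hat_def K_blocks_def ..
  then show "block_perm r (K_hat r E E') = interleave r K_blocks"
    using block_perm_diag_block_mat[of r K_blocks] c by simp
qed

text \<open>The inverted blocks have \<open>l \<ge> 1\<close>, which covers all entries of the
  column but the first. The first one is governed by \<open>F_block r E E' 0 0\<close>, a factor of
  the block of \<open>K_hat\<close> at index 1; that this block exists uses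
  \<open>r \<ge> 2\<close>.\<close>

lemma step2_defined_iff: "step2_defined r E E' \<longleftrightarrow> (\<forall>l<r. W $$ (l, 0) \<noteq> 0)"
proof
  assume st: "step2_defined r E E'"
  have nz: "W $$ (l, 0) \<noteq> 0" if "l \<in> {1..<r}" for l
    using st that invertible_F_iff[of l 0] r by (auto simp: step2_defined_def)
  note b = block_perm_K_hat[OF nz]
  have "invertible_mat (interleave r K_blocks)"
    using st b(1) by (simp add: step2_defined_def)
  then have "invertible_mat (K_blocks 1)"
    using invertible_interleaveD[of 1 r K_blocks] b(2) r by auto
  moreover have Fc: "F_block r E E' j k \<in> carrier_mat r r" for j k by (simp add: F_block_def)
  moreover have "minv (F_block r E E' 1 0) \<in> carrier_mat r r"
    using minv(1)[OF Fc, of 1 0] invertible_F_iff[of 1 0] nz[of 1] r by simp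
  ultimately have "invertible_mat (F_block r E E' 0 0)"
    by (simp add: K_blocks_def invertible_mat_mult_iff[of _ r])
  then have "W $$ (0, 0) \<noteq> 0" using invertible_F_iff[of 0 0] r by simp
  then show "\<forall>l<r. W $$ (l, 0) \<noteq> 0" using nz by (metis atLeastLessThan_iff less_one not_less)
next
  assume nz: "\<forall>l<r. W $$ (l, 0) \<noteq> 0"
  have "block_perm r (K_hat r E E') = interleave r K_blocks" by (rule block_perm_K_hat) (use nz in auto)
  moreover have "invertible_mat (K_blocks l)" "K_blocks l \<in> carrier_mat r r" if "l < r" for l
  proof -
    have 0: "0 < r" using r by simp
    show "invertible_mat (K_blocks l)"
      unfolding K_blocks_eq[OF that nz[rule_format, OF that] nz[rule_format, OF 0]]
      by (intro minv_smult_mult(2)[of _ r] K that 0) (use nz that 0 in auto)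
    show "K_blocks l \<in> carrier_mat r r" using nz that by (intro block_perm_K_hat) auto
  qed
  ultimately show "step2_defined r E E'"
    using interleave_invertible(1)[of r K_blocks] nz invertible_F_iff[of _ 0] r
    by (auto simp: step2_defined_def)
qed

text \<open>\<open>K l\<close> times the inverse of its block is a multiple of \<open>K 0\<close>
  for every \<open>l\<close>. The unknown bases thus collapse to the Kronecker product of
  \<open>K 0\<close> and a diagonal matrix, which acts on the slices from both sides.\<close>

lemma first_core_gauge:
  assumes nz: "\<And>l. l < r \<Longrightarrow> W $$ (l, 0) \<noteq> 0"
    and S: "\<And>a. a < n \<Longrightarrow> S a \<in> carrier_mat r r" and US: "U = unfold_angle n r S"
  obtains A B where "A \<in> carrier_mat r r" "B \<in> carrier_mat r r" "invertible_mat A" "invertible_mat B"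
    "\<And>a. a < n \<Longrightarrow> first_core r E E' a = minv A * S a * B"
proof -
  define m where "m = r * r"
  have r0: "0 < r" using r by simp
  define w where "w = (\<lambda>l. W $$ (l, 0) / W $$ (0, 0))"
  have w: "w l \<noteq> 0" if "l < r" for l using nz[OF that] nz[OF r0] by (simp add: w_def)
  have b: "block_perm r (K_hat r E E') = interleave r K_blocks" by (rule block_perm_K_hat) (use nz in auto)
  have Kb: "K_blocks l \<in> carrier_mat r r" if "l < r" for l using nz that by (intro block_perm_K_hat) auto
  have inv: "invertible_mat (K_blocks l)" and minv_Kb: "minv (K_blocks l) = w l \<cdot>\<^sub>m (minv (K l) * K 0)" if "l < r" for l
    unfolding K_blocks_eq[OF that nz[OF that] nz[OF r0]]
    using minv_smult_mult[OF K[OF r0] K[OF that], of "W $$ (0, 0) / W $$ (l, 0)"] nz[OF that] nz[OF r0]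
    by (auto simp: w_def)
  have "minv (interleave r K_blocks) = interleave r (\<lambda>l. minv (K_blocks l))"
    using interleave_invertible(2)[of r K_blocks] Kb inv by auto
  moreover have "interleave r K * interleave r (\<lambda>l. minv (K_blocks l)) = interleave r (\<lambda>l. w l \<cdot>\<^sub>m K 0)"
  proof (subst interleave_mult)
    show "interleave r (\<lambda>l. K l * minv (K_blocks l)) = interleave r (\<lambda>l. w l \<cdot>\<^sub>m K 0)"
    proof (rule interleave_cong)
      fix l assume l: "l < r"
      note ml = minv[OF K[OF l]]
      have "K l * minv (K_blocks l) = w l \<cdot>\<^sub>m (K l * (minv (K l) * K 0))"
        unfolding minv_Kb[OF l] using K(1)[OF l] K(1)[OF r0] ml(1) by (intro mult_smult_distrib) auto
      then show "K l * minv (K_blocks l) = w l \<cdot>\<^sub>m K 0"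
        using mult_minv_cancel(1)[OF K[OF l] K(1)[OF r0]] by simp
    qed
  qed (use K Kb inv minv in auto)
  ultimately have KKb: "interleave r K * minv (block_perm r (K_hat r E E')) = kron (K 0) (mat_diag r w)"
    unfolding b using interleave_kron[OF K(1)[OF r0]] by simp
  have c: "kron (1\<^sub>m r) X \<in> carrier_mat m m" "interleave r K \<in> carrier_mat m m"
    "minv (block_perm r (K_hat r E E')) \<in> carrier_mat m m"
    using X minv(1)[OF interleave_carrier interleave_invertible(1)[of r K_blocks]] Kb inv unfolding b m_def by auto
  have "E * minv (block_perm r (K_hat r E E')) = U * (kron (1\<^sub>m r) X * kron (K 0) (mat_diag r w))"
  proof -
    have "U * (A * B) * C = U * (A * (B * C))"
      if "A \<in> carrier_mat m m" "B \<in> carrier_mat m m" "C \<in> carrier_mat m m" for A B C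
      using that U[folded m_def] by (simp add: mat_assoc)
    then show ?thesis by (subst E) (simp only: c KKb)
  qed
  also have "kron (1\<^sub>m r) X * kron (K 0) (mat_diag r w) = kron (K 0) (X * mat_diag r w)"
    using X K(1)[OF r0] by (simp add: kron_mult)
  also have "U * \<dots> = unfold_angle n r (\<lambda>a. transpose_mat (K 0) * S a * (X * mat_diag r w))"
    unfolding US by (rule unfold_angle_gauge[OF S K(1)[OF r0]]) (use X in auto)
  finally have fc: "first_core r E E' a = transpose_mat (K 0) * S a * (X * mat_diag r w)" if "a < n" for a
    unfolding first_core_def using that X K(1)[OF r0] S[OF that]
    by (simp only:) (rule fold_angle_unfold_angle, auto)
  have Kt: "transpose_mat (K 0) \<in> carrier_mat r r" "invertible_mat (transpose_mat (K 0))"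
    using K[OF r0] invertible_mat_transpose by auto
  show thesis
  proof (rule that[of "minv (transpose_mat (K 0))" "X * mat_diag r w"])
    show "invertible_mat (X * mat_diag r w)"
      using X mat_diag_invertible[of r w] w by (simp add: invertible_mat_mult_iff[of _ r])
    show "first_core r E E' a = minv (minv (transpose_mat (K 0))) * S a * (X * mat_diag r w)" if "a < n" for a
      using fc[OF that] invertible_mat_minv(2)[OF Kt] by simp
  qed (use X Kt minv(1)[OF Kt] invertible_mat_minv(1)[OF Kt] in auto)
qed

end

section \<open>The remaining cores and the extraction of the common core\<close>

lemma pow_invertible:
  assumes "(A :: complex mat) \<in> carrier_mat r r" "invertible_mat A"
  shows "A ^\<^sub>m k \<in> carrier_mat r r" "invertible_mat (A ^\<^sub>m k)"
proof -
  show "A ^\<^sub>m k \<in> carrier_mat r r" using assms by simp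
  show "invertible_mat (A ^\<^sub>m k)"
  proof (induction k)
    case 0
    show ?case using assms by simp
  next
    case (Suc k)
    then show ?case using assms by (simp add: invertible_mat_mult_iff[of _ r])
  qed
qed

lemma pow_add:
  assumes "(A :: complex mat) \<in> carrier_mat r r"
  shows "A ^\<^sub>m (j + k) = A ^\<^sub>m j * A ^\<^sub>m k"
proof (induction k)
  case (Suc k)
  have "A ^\<^sub>m j \<in> carrier_mat r r" "A ^\<^sub>m k \<in> carrier_mat r r" using assms by auto
  then show ?case using Suc assms by (simp add: assoc_mult_mat[of _ r r _ r _ r])
qed (use assms in simp)

lemma slice_prod_telescope:
  assumes "length H = length as"
    and "\<And>i. i \<le> length as \<Longrightarrow> L i \<in> carrier_mat r r \<and> invertible_mat (L i)"
    and "\<And>i. i < length as \<Longrightarrow> S (as ! i) \<in> carrier_mat r r"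
    and "\<And>i. i < length as \<Longrightarrow> (H ! i) (as ! i) = minv (L i) * S (as ! i) * L (Suc i)"
  shows "slice_prod r H as = minv (L 0) * slice_word r S as * L (length as)"
  using assms
proof (induction H as arbitrary: L rule: list_induct2)
  case Nil
  then show ?case using minv[of "L 0" r] by (simp add: slice_prod_def slice_word_def)
next
  case (Cons X H a as)
  have L0: "L 0 \<in> carrier_mat r r" "invertible_mat (L 0)" "L 1 \<in> carrier_mat r r" "invertible_mat (L 1)"
    "L (length (a # as)) \<in> carrier_mat r r"
    using Cons.prems(1)[of 0] Cons.prems(1)[of 1] Cons.prems(1)[of "length (a # as)"] by auto
  have S: "S a \<in> carrier_mat r r" using Cons.prems(2)[of 0] by simp
  have "S b \<in> carrier_mat r r" if "b \<in> set as" for b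
    using Cons.prems(2)[of "Suc i" for i] that by (auto simp: in_set_conv_nth)
  then have w: "slice_word r S as \<in> carrier_mat r r" by (rule slice_word_carrier)
  have IH: "slice_prod r H as = minv (L 1) * slice_word r S as * L (length (a # as))"
    using Cons.IH[of "\<lambda>i. L (Suc i)"] Cons.prems(1)[of "Suc i" for i] Cons.prems(2)[of "Suc i" for i]
      Cons.prems(3)[of "Suc i" for i] by simp
  have "slice_prod r (X # H) (a # as) = minv (L 0) * S a * L 1 * (minv (L 1) * slice_word r S as * L (length (a # as)))"
    using Cons.prems(3)[of 0] IH by (simp add: slice_prod_def)
  also have "\<dots> = minv (L 0) * S a * (L 1 * (minv (L 1) * (slice_word r S as * L (length (a # as)))))"
    using minv(1)[OF L0(1,2)] minv(1)[OF L0(3,4)] L0 S w by (simp add: mat_assoc)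
  also have "\<dots> = minv (L 0) * slice_word r S (a # as) * L (length (a # as))"
    using minv(1)[OF L0(1,2)] mult_minv_cancel(1)[OF L0(3,4), of "slice_word r S as * L (length (a # as))" r] L0 S w
    by (simp add: mat_assoc slice_word_def)
  finally show ?case .
qed

lemma slice_word_replicate:
  "S m \<in> carrier_mat r r \<Longrightarrow> slice_word r S (replicate k m) = S m ^\<^sub>m k"
  by (simp add: slice_word_def mprod_replicate)

lemma map_slice_eq_slice_prod:
  "mprod r (map (\<lambda>X. X m) H) = slice_prod r H (replicate (length H) m)"
  unfolding slice_prod_def by (rule arg_cong[of _ _ "mprod r"]) (induction H; simp)

lemma length_cores [simp]: "length (cores n r S m \<Gamma> Q k) = Suc k"
  by (induction k) auto

lemma minv_transpose:
  assumes "A \<in> carrier_mat r r" "invertible_mat A"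
  shows "minv (transpose_mat A) = transpose_mat (minv A)"
proof -
  note m = minv[OF assms]
  have "transpose_mat A * transpose_mat (minv A) = 1\<^sub>m r"
    using transpose_mult[OF m(1) assms(1)] m(3) by simp
  then show ?thesis using assms m by (intro invertible_mat_and_minv(2)[of _ r]) auto
qed

definition row_selection :: "nat \<Rightarrow> nat \<Rightarrow> nat set \<Rightarrow> complex mat" where
  "row_selection n k \<Gamma> = Matrix.mat k n (\<lambda>(j, a). if a = pick \<Gamma> j then 1 else 0)"

lemma row_selection_carrier [simp]: "row_selection n k \<Gamma> \<in> carrier_mat k n"
  by (simp add: row_selection_def)

lemma row_selection_invertible:
  assumes S: "\<And>a. S a \<in> carrier_mat r r" and \<Gamma>: "\<Gamma> \<subseteq> {..<n}" and card: "card \<Gamma> = r * r"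
    and inv_V: "invertible_mat (square_cols n r S \<Gamma>)"
  shows "\<exists>R \<in> carrier_mat (r * r) (r * r). R * (row_selection n (r * r) \<Gamma> * unfold_angle n r S) = 1\<^sub>m (r * r)"
proof -
  text \<open>Up to a permutation of the columns, \<open>square_cols\<close> consists of rows of the other unfolding.\<close>
  let ?V = "square_cols n r S \<Gamma>"
  define sw where "sw = (\<lambda>c. (c mod r) * r + c div r)"
  have sw: "sw c < r * r" "sw (sw c) = c" if "c < r * r" for c
    using composite_split[OF that] by (auto simp: sw_def intro: composite_less)
  have V: "?V \<in> carrier_mat (r * r) (r * r)"
    using square_cols_carrier[OF \<Gamma>, of r S] card by simp
  define P where "P = row_selection n (r * r) \<Gamma>"
  define R where "R = Matrix.mat (r * r) (r * r) (\<lambda>(c, e). minv ?V $$ (e, sw c))"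
  define Vt where "Vt = Matrix.mat (r * r) (r * r) (\<lambda>(j, c). ?V $$ (sw c, j))"
  have P: "P \<in> carrier_mat (r * r) n" and R: "R \<in> carrier_mat (r * r) (r * r)"
    and Vt: "Vt \<in> carrier_mat (r * r) (r * r)" by (auto simp: P_def R_def Vt_def row_selection_def)
  note mV = minv[OF V inv_V]
  have PU: "P * unfold_angle n r S = Vt"
  proof (rule eq_matI)
    fix j c assume "j < dim_row Vt" "c < dim_col Vt"
    then have jc: "j < r * r" "c < r * r" by (auto simp: Vt_def)
    have pick: "pick \<Gamma> j < n" using pick_less[OF \<Gamma>] jc card by simp
    have "(P * unfold_angle n r S) $$ (j, c) = (\<Sum>t<n. if t = pick \<Gamma> j then S t $$ (c div r, c mod r) else 0)"
      unfolding mult_index[OF P unfold_angle_carrier jc] using jc by (intro sum.cong refl) (auto simp: P_def row_selection_def unfold_angle_def)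
    also have "\<dots> = S (pick \<Gamma> j) $$ (c div r, c mod r)" using pick by simp
    also have "\<dots> = Vt $$ (j, c)"
      using jc sw(1)[OF jc(2)] composite_split[OF jc(2)] card
      by (simp add: Vt_def square_cols_index[OF \<Gamma>]) (simp add: sw_def)
    finally show "(P * unfold_angle n r S) $$ (j, c) = Vt $$ (j, c)" .
  qed (use P Vt in \<open>auto simp: unfold_angle_def\<close>)
  have "R * Vt = 1\<^sub>m (r * r)"
  proof (rule eq_matI)
    fix c c' assume "c < dim_row (1\<^sub>m (r * r))" "c' < dim_col (1\<^sub>m (r * r))"
    then have c: "c < r * r" "c' < r * r" by auto
    have "(R * Vt) $$ (c, c') = (\<Sum>e<r * r. ?V $$ (sw c', e) * minv ?V $$ (e, sw c))"
      unfolding mult_index[OF R Vt c] using c by (intro sum.cong refl) (simp add: R_def Vt_def)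
    also have "\<dots> = (?V * minv ?V) $$ (sw c', sw c)"
      by (rule mult_index[OF V mV(1) sw(1)[OF c(2)] sw(1)[OF c(1)], symmetric])
    also have "\<dots> = 1\<^sub>m (r * r) $$ (c, c')"
      using sw[OF c(1)] sw[OF c(2)] c unfolding mV(2) by (metis index_one_mat(1))
    finally show "(R * Vt) $$ (c, c') = 1\<^sub>m (r * r) $$ (c, c')" .
  qed (use R Vt in auto)
  then show ?thesis using R unfolding PU[unfolded P_def] by blast
qed

locale generic_core =
  fixes n r d :: nat and S :: slices and \<Gamma> :: "nat set" and m :: nat
  assumes S: "\<And>a. S a \<in> carrier_mat r r" and inv_S: "\<And>a. a < n \<Longrightarrow> invertible_mat (S a)"
    and \<Gamma>: "\<Gamma> \<subseteq> {..<n}" "card \<Gamma> = r\<^sup>2" and inv_V: "invertible_mat (square_cols n r S \<Gamma>)"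
    and m: "m < n" and d: "d \<ge> 3" and r: "r \<ge> 2"
begin

lemma V: "square_cols n r S \<Gamma> \<in> carrier_mat (r * r) (r * r)"
  using square_cols_carrier[OF \<Gamma>(1), of r S] \<Gamma>(2) by (simp add: power2_eq_square)

lemma left_inverse: "\<exists>L \<in> carrier_mat (r * r) n. L * unfold_angle n r S = 1\<^sub>m (r * r)"
proof -
  have "card \<Gamma> = r * r" using \<Gamma> by (simp add: power2_eq_square)
  then obtain R where R: "R \<in> carrier_mat (r * r) (r * r)" "R * (row_selection n (r * r) \<Gamma> * unfold_angle n r S) = 1\<^sub>m (r * r)"
    using row_selection_invertible[OF S \<Gamma>(1) _ inv_V] by blast
  then show ?thesis
    by (intro bexI[of _ "R * row_selection n (r * r) \<Gamma>"])
      (auto simp: assoc_mult_mat[OF R(1) row_selection_carrier unfold_angle_carrier])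
qed

text \<open>The tensor contributes \<open>S m ^\<^sub>m (d - 2)\<close>, and the pseudoinverse
  removes the power of \<open>S m\<close> accumulated by the cores before the last known one. The
  surplus stays in the right gauge and shrinks by one factor per step; at index \<open>d\<close> the
  exponent is 0, so the chain ends with the \<open>A\<close> it began with.\<close>

lemma cores_gauge:
  assumes A: "A \<in> carrier_mat r r" "invertible_mat A" and B: "B \<in> carrier_mat r r" "invertible_mat B"
    and H1: "\<And>a. a < n \<Longrightarrow> Q\<^sub>1 a = minv A * S a * B"
    and Smat: "Smat = unfold_angle n r S * kron (1\<^sub>m r) (S m ^\<^sub>m (d - 2)) * square_cols n r S \<Gamma>"
  defines "L \<equiv> (\<lambda>i. if i = 0 then A else if i = 1 then B else S m ^\<^sub>m (d - i) * A)"
  assumes "k < d" "i \<le> k" "a < n"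
  shows "(cores n r Smat m \<Gamma> Q\<^sub>1 k ! i) a = minv (L i) * S a * L (Suc i)"
  using assms(8-10)
proof (induction k arbitrary: i a)
  case 0
  then show ?case using H1 by (simp add: L_def)
next
  case (Suc k)
  note pw = pow_invertible[OF S[of m] inv_S[OF m]]
  have L: "L i \<in> carrier_mat r r" "invertible_mat (L i)" for i
    unfolding L_def using A B pw mult_carrier_mat[OF pw(1) A(1)] by (auto simp: invertible_mat_mult_iff[of _ r])
  define H where "H = cores n r Smat m \<Gamma> Q\<^sub>1 k"
  have IH: "(H ! i) a = minv (L i) * S a * L (Suc i)" if "i \<le> k" "a < n" for i a
    unfolding H_def using Suc.IH[OF _ that] Suc.prems by simp
  show ?case
  proof (cases "i \<le> k")
    case True
    then show ?thesis using IH[OF True] Suc.prems by (simp add: nth_append H_def)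
  next
    case False
    then have i: "i = Suc k" using Suc.prems by simp
    have "length H = Suc k" by (simp add: H_def)
    note mL0 = minv[OF L(1)[of 0] L(2)[of 0]] and iL0 = invertible_mat_minv[OF L(1)[of 0] L(2)[of 0]]
    note mLk = minv[OF L(1)[of k] L(2)[of k]]
    define Lt where "Lt = transpose_mat (L (Suc k))"
    have Lt: "Lt \<in> carrier_mat r r" "invertible_mat Lt"
      using L invertible_mat_transpose unfolding Lt_def by auto
    note mLt = minv[OF Lt] and iLt = invertible_mat_minv[OF Lt]
    \<comment> \<open>Up to the right gauge \<open>L k\<close>, this is the product of the first
      \<open>k\<close> cores at \<open>m\<close>. \<open>L k\<close> then cancels against the left
      gauge of the last core.\<close>
    define C where "C = minv (L 0) * S m ^\<^sub>m k"
    have C: "C \<in> carrier_mat r r" "invertible_mat C"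
      using mL0 iL0 pw by (auto simp: C_def invertible_mat_mult_iff[of _ r])
    note mC = minv[OF C]
    have prod: "mprod r (map (\<lambda>X. X m) (butlast H)) = C * L k"
    proof -
      have "mprod r (map (\<lambda>X. X m) (butlast H)) = slice_prod r (butlast H) (replicate k m)"
        using map_slice_eq_slice_prod[of r m "butlast H"] \<open>length H = _\<close> by simp
      also have "\<dots> = minv (L 0) * slice_word r S (replicate k m) * L k"
        using slice_prod_telescope[of "butlast H" "replicate k m" L r S] \<open>length H = _\<close> L S IH m
        by (simp add: nth_butlast)
      finally show ?thesis by (simp add: C_def slice_word_replicate[OF S])
    qed
    have last: "last H a = minv (L k) * S a * L (Suc k)" if "a < n" for a
      using IH[of k a] \<open>length H = _\<close> that by (subst last_conv_nth) auto
    have sq: "square_cols n r (last H) \<Gamma> = kron Lt (minv (L k)) * square_cols n r S \<Gamma>"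
      unfolding Lt_def using mLk L S last \<Gamma> by (intro square_cols_gauge) auto
    let ?V = "square_cols n r S \<Gamma>"
    define N where "N = r * r"
    note V' = V[folded N_def]
    have kc: "kron X Y \<in> carrier_mat N N" if "X \<in> carrier_mat r r" "Y \<in> carrier_mat r r" for X Y
      using that by (simp add: N_def)
    have "kron (1\<^sub>m r) (C * L k) * (kron Lt (minv (L k)) * ?V) = kron (1\<^sub>m r) (C * L k) * kron Lt (minv (L k)) * ?V"
      using assoc_mult_mat[OF kc kc V', of "1\<^sub>m r" "C * L k" Lt "minv (L k)"] C L Lt mLk by simp
    also have "kron (1\<^sub>m r) (C * L k) * kron Lt (minv (L k)) = kron Lt C"
      using C L[of k] Lt mLk mult_minv_cancel(3)[OF L(1)[of k] L(2)[of k] C(1)] by (simp add: kron_mult del: assoc_mult_mat)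
    finally have arg: "kron (1\<^sub>m r) (mprod r (map (\<lambda>X. X m) (butlast H))) *
        submatrix (transpose_mat (unfold_square n r (last H))) UNIV \<Gamma> = kron Lt C * ?V"
      unfolding prod square_cols_def[symmetric] sq .
    note kinv = kron_invertible[OF Lt(1) C(1) Lt(2) C(2)]
    have "pinv (kron Lt C * ?V) = minv ?V * kron (minv Lt) (minv C)"
      using kinv inv_V V' kc[OF Lt(1) C(1)] pinv_invertible[of "kron Lt C * ?V" N] minv_mult[of "kron Lt C" N ?V]
      by (simp add: invertible_mat_mult_iff[of _ N])
    moreover have "Smat * (minv ?V * kron (minv Lt) (minv C)) =
        unfold_angle n r S * kron (minv Lt) (S m ^\<^sub>m (d - 2) * minv C)"
    proof -
      have "U * K1 * ?V * (minv ?V * K2) = U * (K1 * K2)"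
        if "U \<in> carrier_mat n N" "K1 \<in> carrier_mat N N" "K2 \<in> carrier_mat N N" for U K1 K2
        using that V' minv(1)[OF V' inv_V] mult_minv_cancel(1)[OF V' inv_V that(3)] by (simp add: mat_assoc)
      then have "Smat * (minv ?V * kron (minv Lt) (minv C)) =
          unfold_angle n r S * (kron (1\<^sub>m r) (S m ^\<^sub>m (d - 2)) * kron (minv Lt) (minv C))"
        unfolding Smat using kc[OF mLt(1) mC(1)] kc[OF one_carrier_mat pw(1)]
        by (metis unfold_angle_carrier N_def)
      then show ?thesis using mLt mC pw(1)[of "d - 2"] S[of m] by (simp add: kron_mult)
    qed
    moreover have "S m ^\<^sub>m (d - 2) * minv C = S m ^\<^sub>m (d - 2 - k) * L 0"
    proof -
      have mCeq: "minv C = minv (S m ^\<^sub>m k) * L 0"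
        unfolding C_def using minv_mult[OF mL0(1) pw(1) iL0(1) pw(2)] iL0(2) by simp
      \<comment> \<open>The subtraction does not truncate, because \<open>Suc k < d\<close>.\<close>
      have "S m ^\<^sub>m (d - 2) = S m ^\<^sub>m (d - 2 - k) * S m ^\<^sub>m k"
        using Suc.prems(1) by (subst pow_add[OF S, symmetric]) simp
      then show ?thesis
        unfolding mCeq using pw(1) minv(1)[OF pw(1)[of k] pw(2)[of k]] L(1)[of 0]
          mult_minv_cancel(1)[OF pw(1)[of k] pw(2)[of k] L(1)[of 0]]
        by (simp add: assoc_mult_mat[of _ r r _ r _ r])
    qed
    moreover have "S m ^\<^sub>m (d - 2 - k) * L 0 = L (Suc (Suc k))"
      by (simp add: L_def diff_diff_left)
    ultimately have "Smat * pinv (kron Lt C * ?V) = unfold_angle n r S * kron (minv Lt) (L (Suc (Suc k)))"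
      by simp
    also have "\<dots> = unfold_angle n r (\<lambda>a. transpose_mat (minv Lt) * S a * L (Suc (Suc k)))"
      using mLt L S by (intro unfold_angle_gauge) auto
    also have "transpose_mat (minv Lt) = minv (L (Suc k))"
      unfolding Lt_def using minv_transpose[OF L(1) L(2)] by simp
    finally have "next_core n r Smat m \<Gamma> H a = fold_angle r (unfold_angle n r (\<lambda>a. minv (L (Suc k)) * S a * L (Suc (Suc k)))) a"
      unfolding next_core_def arg by simp
    also have "\<dots> = minv (L (Suc k)) * S a * L (Suc (Suc k))"
      using minv(1)[OF L(1)[of "Suc k"] L(2)[of "Suc k"]] S[of a] L(1)[of "Suc (Suc k)"] Suc.prems
      by (intro fold_angle_unfold_angle) auto
    finally show ?thesis using i \<open>length H = _\<close> by (simp add: nth_append flip: H_def)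
  qed
qed

end

section \<open>The common core: scalar ambiguity and branches of the roots\<close>

lemma dim_unfold_angle [simp]:
  "dim_row (unfold_angle n r S) = n" "dim_col (unfold_angle n r S) = r * r"
  by (simp_all add: unfold_angle_def)

lemma ex_nonzero_entry:
  assumes "A \<in> carrier_mat n m" "A \<noteq> 0\<^sub>m n m"
  shows "\<exists>i<n. \<exists>j<m. A $$ (i, j) \<noteq> 0"
proof (rule ccontr)
  assume "\<not> ?thesis"
  then have "A = 0\<^sub>m n m" using assms(1) by (intro eq_matI) auto
  then show False using assms(2) by simp
qed

text \<open>Compared blockwise, the off-diagonal blocks of \<open>kron (1\<^sub>m r) P\<close>
  vanish and the diagonal ones coincide; a nonzero entry of \<open>P\<close> then determines
  \<open>A\<close>.\<close>

lemma kron_one_eq_scalar: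
  assumes P: "P \<in> carrier_mat r r" "invertible_mat P" and A: "A \<in> carrier_mat r r" and B: "B \<in> carrier_mat r r"
    and r: "r > 0" and eq: "kron (1\<^sub>m r) P = kron A B"
  obtains c where "A = c \<cdot>\<^sub>m 1\<^sub>m r"
proof -
  have e: "(if i = j then P $$ (p, q) else 0) = A $$ (i, j) * B $$ (p, q)" if "i < r" "j < r" "p < r" "q < r" for i j p q
  proof -
    have x: "i * r + p < r * r" "j * r + q < r * r" using that by (auto intro: composite_less)
    show ?thesis
      using arg_cong[OF eq, of "\<lambda>M. M $$ (i * r + p, j * r + q)"] x P A B that
      by (cases "i = j") (simp_all add: kron_index)
  qed
  have "P \<noteq> 0\<^sub>m r r" using P r by (auto simp: invertible_mat_iff_det[of _ r])
  then obtain p q where pq: "p < r" "q < r" "P $$ (p, q) \<noteq> 0" using ex_nonzero_entry[OF P(1)] by blast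
  have "A $$ (i, j) = (P $$ (p, q) / B $$ (p, q)) * (if i = j then 1 else 0)" if "i < r" "j < r" for i j
    using e[OF that pq(1,2)] e[OF that(1,1) pq(1,2)] pq(3) by (auto simp: field_simps)
  then have "A = (P $$ (p, q) / B $$ (p, q)) \<cdot>\<^sub>m 1\<^sub>m r" by (intro eq_matI) (use A in auto)
  then show thesis by (rule that)
qed

lemma smult_smult_mat: "c \<cdot>\<^sub>m (c' \<cdot>\<^sub>m M) = (c * c' :: complex) \<cdot>\<^sub>m M"
  by (intro eq_matI) auto

lemma slice_word_smult:
  assumes "\<And>a. a \<in> set as \<Longrightarrow> S a \<in> carrier_mat r r"
  shows "slice_word r (\<lambda>a. c \<cdot>\<^sub>m S a) as = (c :: complex) ^ length as \<cdot>\<^sub>m slice_word r S as"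
  using assms
proof (induction as)
  case Nil
  show ?case by (auto simp: slice_word_def intro!: eq_matI)
next
  case (Cons a as)
  have w: "slice_word r S as \<in> carrier_mat r r" using Cons.prems by (intro slice_word_carrier) auto
  have Sa: "S a \<in> carrier_mat r r" using Cons.prems by simp
  have "slice_word r (\<lambda>a. c \<cdot>\<^sub>m S a) (a # as) = (c \<cdot>\<^sub>m S a) * (c ^ length as \<cdot>\<^sub>m slice_word r S as)"
    using Cons by (simp add: slice_word_def)
  also have "\<dots> = c \<cdot>\<^sub>m (c ^ length as \<cdot>\<^sub>m (S a * slice_word r S as))"
    using Sa w by (simp add: mult_smult_assoc_mat[of _ r r _ r] mult_smult_distrib[of _ r r _ r] smult_smult_mat mult.commute)
  also have "\<dots> = c ^ length (a # as) \<cdot>\<^sub>m slice_word r S (a # as)"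
    by (simp add: slice_word_def smult_smult_mat)
  finally show ?case .
qed

lemma slice_word_conjugate:
  assumes A: "A \<in> carrier_mat r r" "invertible_mat A" and S: "\<And>a. a \<in> set as \<Longrightarrow> S a \<in> carrier_mat r r"
  shows "slice_word r (\<lambda>a. minv A * S a * A) as = minv A * slice_word r S as * A"
proof -
  have "slice_prod r (replicate (length as) (\<lambda>a. minv A * S a * A)) as = minv A * slice_word r S as * A"
    using slice_prod_telescope[of "replicate (length as) (\<lambda>a. minv A * S a * A)" as "\<lambda>i. A" r S] A S by simp
  moreover have "slice_prod r (replicate (length as) R) as = slice_word r R as" for R
    unfolding slice_prod_def slice_word_def by (rule arg_cong[of _ _ "mprod r"]) (induction as; simp)
  ultimately show ?thesis by simp
qed

lemma slice_prod_replicate: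
  "length as = d \<Longrightarrow> slice_prod r (replicate d R) as = slice_word r R as"
  unfolding slice_prod_def slice_word_def
  by (rule arg_cong[of _ _ "mprod r"]) (induction as arbitrary: d; auto)

lemma commutes_with_distinct_diag:
  assumes T: "T \<in> carrier_mat r r" and comm: "T * mat_diag r f = mat_diag r f * T" and inj: "inj_on f {..<r}"
  shows "T = mat_diag r (\<lambda>t. T $$ (t, t) :: complex)"
proof (rule eq_matI)
  fix i j assume "i < dim_row (mat_diag r (\<lambda>t. T $$ (t, t)))" "j < dim_col (mat_diag r (\<lambda>t. T $$ (t, t)))"
  then have ij: "i < r" "j < r" by auto
  have "T $$ (i, j) * f j = f i * T $$ (i, j)"
    using arg_cong[OF comm, of "\<lambda>M. M $$ (i, j)"] ij by (simp add: mat_diag_mult_right[OF T] mat_diag_mult_left[OF T])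
  then show "T $$ (i, j) = mat_diag r (\<lambda>t. T $$ (t, t)) $$ (i, j)"
    using ij inj by (cases "i = j") (auto simp: mat_diag_index dest: inj_onD)
qed (use T in auto)

text \<open>Carries simple spectrum over to an arbitrary eigendecomposition. If
  \<open>f a = f b\<close>, then the rows \<open>a\<close> and \<open>b\<close> of \<open>V\<close>
  are both supported in the one column \<open>k\<close> with \<open>ev k = f a\<close>, which
  contradicts the right inverse \<open>V'\<close>.\<close>

lemma similar_diag_inj:
  fixes ev f :: "nat \<Rightarrow> complex"
  assumes "V \<in> carrier_mat r r" "V' \<in> carrier_mat r r" "V * V' = 1\<^sub>m r"
    and eq: "mat_diag r f * V = V * mat_diag r ev" and inj: "inj_on ev {..<r}"
  shows "inj_on f {..<r}"
proof (rule inj_onI, rule ccontr)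
  fix a b assume ab: "a \<in> {..<r}" "b \<in> {..<r}" "f a = f b" "a \<noteq> (b :: nat)"
  have e: "f i * V $$ (i, k) = V $$ (i, k) * ev k" if "i < r" "k < r" for i k
    using arg_cong[OF eq, of "\<lambda>M. M $$ (i, k)"] that
    unfolding mat_diag_mult_right[OF assms(1)] mat_diag_mult_left[OF assms(1)] by simp
  have one: "(\<Sum>k<r. V $$ (i, k) * V' $$ (k, j)) = (if i = j then 1 else 0)" if "i < r" "j < r" for i j
    using mult_index[OF assms(1,2) that] that assms(3) by simp
  have "\<exists>k<r. V $$ (i, k) \<noteq> 0" if "i < r" for i
    using one[OF that that] by (metis (mono_tags, lifting) lessThan_iff mult_zero_left sum.neutral zero_neq_one)
  then obtain k l where k: "k < r" "V $$ (a, k) \<noteq> 0" and l: "l < r" "V $$ (b, l) \<noteq> 0"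
    using ab by (meson lessThan_iff)
  have fk: "f a = ev k" using e[of a k] k ab by simp
  have fl: "f b = ev l" using e[of b l] l ab by simp
  have "k = l" using inj_onD[OF inj, of k l] fk fl ab(3) k(1) l(1) by simp
  have z: "V $$ (i, j) = 0" if "j < r" "j \<noteq> k" "i = a \<or> i = b" for i j
  proof -
    have "f i = ev k" "i < r" using that(3) fk ab by auto
    moreover have "ev j \<noteq> ev k" using inj_onD[OF inj, of j k] that(1,2) k(1) by auto
    ultimately show ?thesis using e[of i j] that(1) by auto
  qed
  have sum_k: "(\<Sum>j<r. V $$ (i, j) * V' $$ (j, a)) = V $$ (i, k) * V' $$ (k, a)" if "i = a \<or> i = b" for i
    using k z[OF _ _ that] by (subst sum.remove[of _ k]) auto
  have "V $$ (a, k) * V' $$ (k, a) = 1" "V $$ (b, k) * V' $$ (k, a) = 0"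
    using one[of a a] one[of b a] sum_k[of a] sum_k[of b] ab by auto
  then show False using l \<open>k = l\<close> by auto
qed

text \<open>The quotient by the principal root is a d-th root of unity, and its index is the
  branch.\<close>

lemma complex_root_branch:
  assumes "w ^ d = z" "z \<noteq> 0" "d > 0"
  obtains k where "k < d" "w = of_real (root d (cmod z)) * cis ((Arg2pi z + 2 * real k * pi) / real d)"
proof -
  define w0 where "w0 = of_real (root d (cmod z)) * cis (Arg2pi z / real d)"
  have "w0 ^ d = of_real (root d (cmod z) ^ d) * cis (Arg2pi z)"
    using assms(3) Complex.DeMoivre[of "Arg2pi z / real d" d] by (simp add: w0_def power_mult_distrib del: real_root_pow_pos2)
  also have "root d (cmod z) ^ d = cmod z" using assms(3) by simp
  also have "of_real (cmod z) * cis (Arg2pi z) = z" using Arg2pi_eq[of z] by (simp add: cis_conv_exp)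
  finally have w0: "w0 ^ d = z" .
  then have "w0 \<noteq> 0" using assms by (auto simp: power_0_left)
  then have "(w / w0) ^ d = 1" using w0 assms by (simp add: power_divide)
  then have "w / w0 \<in> (\<lambda>k. cis (2 * pi * real k / real d)) ` {..<d}"
    using bij_betw_imp_surj_on[OF Complex.bij_betw_roots_unity[OF assms(3)]] by simp
  then obtain k where k: "k < d" "w / w0 = cis (2 * pi * real k / real d)" by auto
  have "w = w0 * cis (2 * pi * real k / real d)" using k(2) \<open>w0 \<noteq> 0\<close> by (simp add: field_simps)
  also have "\<dots> = of_real (root d (cmod z)) * cis ((Arg2pi z + 2 * real k * pi) / real d)"
    by (simp add: w0_def cis_mult add_divide_distrib mult_ac)
  finally show thesis using that k(1) by blast
qed

lemma pow_minv_cancel: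
  assumes B: "B \<in> carrier_mat r r" "invertible_mat B"
  shows "minv B ^\<^sub>m k * B ^\<^sub>m k = 1\<^sub>m r"
proof (induction k)
  case (Suc k)
  note mB = minv[OF B]
  have c: "minv B ^\<^sub>m k \<in> carrier_mat r r" "B ^\<^sub>m k \<in> carrier_mat r r" using mB B by auto
  have "B ^\<^sub>m Suc k = B * B ^\<^sub>m k" using pow_add[OF B(1), of 1 k] B by simp
  then have "minv B ^\<^sub>m Suc k * B ^\<^sub>m Suc k = minv B ^\<^sub>m k * (minv B * (B * B ^\<^sub>m k))"
    using c mB(1) B(1) by (simp add: assoc_mult_mat[of _ r r _ r _ r])
  then show ?case using Suc mult_minv_cancel(2)[OF B c(2)] by simp
qed (use B minv[OF B] in simp)

lemma smult_pow:
  assumes "B \<in> carrier_mat r r"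
  shows "(c \<cdot>\<^sub>m B) ^\<^sub>m k = (c :: complex) ^ k \<cdot>\<^sub>m B ^\<^sub>m k"
proof (induction k)
  case (Suc k)
  have "B ^\<^sub>m k \<in> carrier_mat r r" using assms by simp
  then show ?case
    using Suc assms by (simp add: mult_smult_assoc_mat[of _ r r _ r] mult_smult_distrib[of _ r r _ r] smult_smult_mat mult.commute)
qed (use assms in \<open>auto intro!: eq_matI\<close>)

lemma mat_diag_invertibleD:
  assumes "invertible_mat (mat_diag r f)" "t < r"
  shows "f t \<noteq> (0 :: complex)"
proof
  assume "f t = 0"
  have c: "mat_diag r f \<in> carrier_mat r r" by simp
  have "(mat_diag r f * minv (mat_diag r f)) $$ (t, t) = 0"
    unfolding mat_diag_mult_left[OF minv(1)[OF c assms(1)]] using assms(2) \<open>f t = 0\<close> by simp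
  then show False using minv(2)[OF c assms(1)] assms(2) by simp
qed

text \<open>In a product over all modes the gauges telescope and only conjugation by
  \<open>A\<close> survives. The last step can therefore be studied as if every core were
  \<open>conj_slice\<close>.\<close>

locale gauged_cores = generic_core +
  fixes H :: "slices list" and A :: "complex mat"
  assumes A: "A \<in> carrier_mat r r" "invertible_mat A"
    and H: "\<And>as. as \<in> tuples n d \<Longrightarrow> slice_prod r H as = minv A * slice_word r S as * A"
begin

definition conj_slice :: slices where "conj_slice a = minv A * S a * A"

lemma conj_slice_carrier: "conj_slice a \<in> carrier_mat r r"
proof -
  have "minv A * S a \<in> carrier_mat r r" using minv(1)[OF A] S[of a] by (rule mult_carrier_mat)
  then show ?thesis unfolding conj_slice_def using A(1) by (rule mult_carrier_mat)
qed

lemma conj_slice_invertible: "a < n \<Longrightarrow> invertible_mat (conj_slice a)"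
  unfolding conj_slice_def using minv(1)[OF A] invertible_mat_minv(1)[OF A] S[of a] inv_S A
    mult_carrier_mat[OF minv(1)[OF A] S[of a]]
  by (simp add: invertible_mat_mult_iff[of _ r])

lemma slice_prod_H: "as \<in> tuples n d \<Longrightarrow> slice_prod r H as = slice_word r conj_slice as"
  unfolding H conj_slice_def using slice_word_conjugate[OF A S] by simp

lemma replicate_tuples: "replicate d 0 \<in> tuples n d" "a < n \<Longrightarrow> a # replicate (d - 1) 0 \<in> tuples n d"
  "a < n \<Longrightarrow> replicate (d - 1) 0 @ [a] \<in> tuples n d"
  using d m by (auto simp: tuples_def)

lemma slice_prod_0: "slice_prod r H (replicate d 0) = conj_slice 0 ^\<^sub>m d"
  unfolding slice_prod_H[OF replicate_tuples(1)] using conj_slice_carrier by (simp add: slice_word_replicate)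

lemma bar_core_eq:
  assumes "j < n"
  shows "j \<noteq> 0 \<Longrightarrow> bar_core r d H B j = minv B ^\<^sub>m (d - 1) * (conj_slice 0 ^\<^sub>m (d - 1) * conj_slice j)"
proof -
  have "slice_word r conj_slice (replicate (d - 1) 0 @ [j]) = conj_slice 0 ^\<^sub>m (d - 1) * conj_slice j"
    using conj_slice_carrier right_mult_one_mat[OF conj_slice_carrier] mprod_replicate[OF conj_slice_carrier]
    by (simp add: slice_word_def) (subst mprod_append; auto)
  then show "j \<noteq> 0 \<Longrightarrow> bar_core r d H B j = minv B ^\<^sub>m (d - 1) * (conj_slice 0 ^\<^sub>m (d - 1) * conj_slice j)"
    unfolding bar_core_def slice_prod_H[OF replicate_tuples(3)[OF assms]] by simp
qed

text \<open>The construction gives \<open>R a = C * conj_slice a\<close> with a matrix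
  \<open>C\<close> independent of \<open>a\<close>. The stopping test at tuples with one free index
  turns this into an equation linear in the slice, which the full column rank of the unfolding lifts
  to an identity of Kronecker products; so \<open>C\<close> is a scalar \<open>c\<close>, with
  \<open>c ^ d = 1\<close>.\<close>

lemma output_gauge:
  assumes B: "B \<in> carrier_mat r r" "invertible_mat B" and R: "R = bar_core r d H B"
    and eq: "\<And>as. as \<in> tuples n d \<Longrightarrow> slice_prod r H as = slice_prod r (replicate d R) as"
  shows "gauge_equiv n r d S R"
proof -
  have n: "0 < n" using m by simp
  note cc = conj_slice_carrier and ci = conj_slice_invertible
  note p0 = pow_invertible[OF cc[of 0] ci[OF n]] and pB = pow_invertible[OF B]
  note mB = minv[OF B]
  define P where "P = conj_slice 0 ^\<^sub>m (d - 1)"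
  define C where "C = minv B ^\<^sub>m (d - 1) * P"
  have P: "P \<in> carrier_mat r r" "invertible_mat P" unfolding P_def using p0 by auto
  have mBp: "minv B ^\<^sub>m (d - 1) \<in> carrier_mat r r" using mB by simp
  have C: "C \<in> carrier_mat r r" unfolding C_def using mBp P(1) by (rule mult_carrier_mat)
  have R0: "R 0 = B" by (simp add: R bar_core_def)
  have d1: "Suc (d - 1) = d" using d by simp
  have Bd: "conj_slice 0 ^\<^sub>m d = B ^\<^sub>m d"
  proof -
    have "conj_slice 0 ^\<^sub>m d = slice_prod r (replicate d R) (replicate d 0)"
      unfolding slice_prod_0[symmetric] by (rule eq[OF replicate_tuples(1)])
    also have "\<dots> = slice_word r R (replicate d 0)" by (rule slice_prod_replicate) simp
    also have "\<dots> = R 0 ^\<^sub>m d" by (rule slice_word_replicate) (use R0 B in simp)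
    finally show ?thesis unfolding R0 .
  qed
  note inv_pow = pow_minv_cancel[OF B]
  \<comment> \<open>For \<open>a = 0\<close> the formula is not the definition of \<open>R\<close>;
    it follows from \<open>Bd\<close>, the stopping test at the zero tuple.\<close>
  have R_eq: "R a = C * conj_slice a" if "a < n" for a
  proof (cases "a = 0")
    case True
    have "conj_slice 0 ^\<^sub>m Suc (d - 1) = P * conj_slice 0" by (simp add: P_def)
    then have "conj_slice 0 ^\<^sub>m d = P * conj_slice 0" unfolding d1 .
    then have "C * conj_slice 0 = minv B ^\<^sub>m (d - 1) * B ^\<^sub>m d"
      unfolding C_def using assoc_mult_mat[OF mBp P(1) cc] Bd by simp
    also have "B ^\<^sub>m d = B ^\<^sub>m (d - 1) * B" using pow_mat.simps(2)[of B "d - 1"] unfolding d1 .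
    also have "minv B ^\<^sub>m (d - 1) * (B ^\<^sub>m (d - 1) * B) = B"
      using assoc_mult_mat[OF mBp pB(1) B(1), of "d - 1"] inv_pow[of "d - 1"] B by simp
    finally show ?thesis using True R0 by simp
  next
    case False
    have "R a = minv B ^\<^sub>m (d - 1) * (P * conj_slice a)"
      using bar_core_eq[OF that False] by (simp add: R P_def)
    then show ?thesis by (simp only: C_def assoc_mult_mat[OF mBp P(1) cc])
  qed
  have Rc: "R a \<in> carrier_mat r r" if "a < n" for a
    unfolding R_eq[OF that] using C cc by (rule mult_carrier_mat)
  \<comment> \<open>The stopping test at \<open>a\<close> followed by zeros:
    \<open>conj_slice a\<close> is multiplied by fixed matrices on both sides of the
    equation.\<close>
  have key: "conj_slice a * P = C * conj_slice a * B ^\<^sub>m (d - 1)" if "a < n" for a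
  proof -
    have "conj_slice a * P = slice_prod r H (a # replicate (d - 1) 0)"
      unfolding slice_prod_H[OF replicate_tuples(2)[OF that]]
      using slice_word_replicate[where S = conj_slice, OF cc] by (simp add: slice_word_def P_def)
    also have "\<dots> = slice_word r R (a # replicate (d - 1) 0)"
      unfolding eq[OF replicate_tuples(2)[OF that]] using d by (intro slice_prod_replicate) simp
    also have "\<dots> = R a * B ^\<^sub>m (d - 1)"
      using slice_word_replicate[where S = R and m = 0 and r = r] Rc[OF n] R0 by (simp add: slice_word_def)
    finally show ?thesis using R_eq[OF that] by simp
  qed
  \<comment> \<open>All slices at once: two-sided products of the slices are right factors of the
    unfolding, so its left inverse can remove the slices.\<close>
  have "unfold_angle n r conj_slice * kron (1\<^sub>m r) P = unfold_angle n r conj_slice * kron (transpose_mat C) (B ^\<^sub>m (d - 1))"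
  proof -
    have "unfold_angle n r (\<lambda>a. transpose_mat (1\<^sub>m r) * conj_slice a * P) =
        unfold_angle n r (\<lambda>a. transpose_mat (transpose_mat C) * conj_slice a * B ^\<^sub>m (d - 1))"
      unfolding unfold_angle_def using key left_mult_one_mat[OF cc] by (intro cong_mat) auto
    then show ?thesis
      using unfold_angle_gauge[of n conj_slice r "1\<^sub>m r" P] unfold_angle_gauge[of n conj_slice r "transpose_mat C" "B ^\<^sub>m (d - 1)"]
        cc P C pB by simp
  qed
  moreover obtain L where L: "L \<in> carrier_mat (r * r) n" "L * unfold_angle n r conj_slice = 1\<^sub>m (r * r)"
  proof -
    obtain L0 where L0: "L0 \<in> carrier_mat (r * r) n" "L0 * unfold_angle n r S = 1\<^sub>m (r * r)"
      using left_inverse by auto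
    define At where "At = transpose_mat (minv A)"
    have At: "At \<in> carrier_mat r r" "invertible_mat At"
      unfolding At_def using minv(1)[OF A] invertible_mat_transpose[OF minv(1)[OF A] invertible_mat_minv(1)[OF A]] by auto
    define K where "K = kron At A"
    have K: "K \<in> carrier_mat (r * r) (r * r)" "invertible_mat K"
      unfolding K_def using kron_invertible(1)[OF At(1) A(1) At(2) A(2)] At A by auto
    have U: "unfold_angle n r conj_slice = unfold_angle n r S * K"
      unfolding K_def using unfold_angle_gauge[of n S r At A] S At A by (simp add: At_def conj_slice_def[abs_def])
    have "minv K * L0 * (unfold_angle n r S * K) = minv K * (L0 * unfold_angle n r S) * K"
      using minv(1)[OF K] L0(1) K(1) unfold_angle_carrier[of n r S] by (simp add: mat_assoc)
    also have "\<dots> = 1\<^sub>m (r * r)" unfolding L0(2) using minv[OF K] by simp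
    finally show thesis
      using that[of "minv K * L0"] L0(1) minv(1)[OF K] by (simp add: U)
  qed
  ultimately have "kron (1\<^sub>m r) P = kron (transpose_mat C) (B ^\<^sub>m (d - 1))"
  proof -
    have "L * (unfold_angle n r conj_slice * X) = X" if "X \<in> carrier_mat (r * r) (r * r)" for X
      using that unfolding assoc_mult_mat[OF L(1) unfold_angle_carrier that, symmetric] L(2) by simp
    from this[of "kron (1\<^sub>m r) P"] this[of "kron (transpose_mat C) (B ^\<^sub>m (d - 1))"]
    show ?thesis using \<open>unfold_angle n r conj_slice * _ = _\<close> P C pB by simp
  qed
  then obtain c where "transpose_mat C = c \<cdot>\<^sub>m 1\<^sub>m r"
    using kron_one_eq_scalar[OF P, of "transpose_mat C" "B ^\<^sub>m (d - 1)"] C pB(1) r by auto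
  then have "transpose_mat (transpose_mat C) = transpose_mat (c \<cdot>\<^sub>m 1\<^sub>m r)" by (rule arg_cong)
  also have "\<dots> = c \<cdot>\<^sub>m 1\<^sub>m r" by (intro eq_matI) auto
  finally have "C = c \<cdot>\<^sub>m 1\<^sub>m r" by simp
  then have Rc: "R a = c \<cdot>\<^sub>m conj_slice a" if "a < n" for a
    using R_eq[OF that] mult_smult_assoc_mat[of "1\<^sub>m r" r r "conj_slice a" r c] left_mult_one_mat[OF cc] cc by simp
  have "c ^ d = 1"
  proof -
    have "conj_slice 0 ^\<^sub>m d = slice_prod r (replicate d R) (replicate d 0)"
      unfolding slice_prod_0[symmetric] by (rule eq[OF replicate_tuples(1)])
    also have "\<dots> = slice_word r R (replicate d 0)" by (rule slice_prod_replicate) simp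
    also have "\<dots> = slice_word r (\<lambda>a. c \<cdot>\<^sub>m conj_slice a) (replicate d 0)"
      using Rc[OF n] by (simp add: slice_word_def)
    also have "\<dots> = c ^ d \<cdot>\<^sub>m slice_word r conj_slice (replicate d 0)"
      using slice_word_smult[of "replicate d 0" conj_slice r c] cc by simp
    also have "slice_word r conj_slice (replicate d 0) = conj_slice 0 ^\<^sub>m d"
      by (rule slice_word_replicate[OF cc])
    finally have pow: "conj_slice 0 ^\<^sub>m d = c ^ d \<cdot>\<^sub>m conj_slice 0 ^\<^sub>m d" .
    have "conj_slice 0 ^\<^sub>m d \<noteq> 0\<^sub>m r r"
      using p0(2)[of d] r by (auto simp: invertible_mat_iff_det[of _ r])
    then obtain i j where ij: "i < r" "j < r" "(conj_slice 0 ^\<^sub>m d) $$ (i, j) \<noteq> 0"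
      using ex_nonzero_entry[OF p0(1)[of d]] by blast
    define M where "M = conj_slice 0 ^\<^sub>m d"
    have Mc: "M \<in> carrier_mat r r" unfolding M_def by (rule p0(1))
    have "M $$ (i, j) = (c ^ d \<cdot>\<^sub>m M) $$ (i, j)" unfolding M_def by (rule arg_cong[OF pow])
    also have "\<dots> = c ^ d * M $$ (i, j)" using Mc ij by simp
    finally show ?thesis using ij by (simp add: M_def)
  qed
  then have c: "c \<noteq> 0" using d by (auto simp: power_0_left)
  \<comment> \<open>Consecutive gauges differ by the factor \<open>c\<close>, which produces the
    scalar in \<open>R a\<close>; \<open>c ^ d = 1\<close> closes the ring.\<close>
  define Lk where "Lk = (\<lambda>k. c ^ (k - 1) \<cdot>\<^sub>m A)"
  show ?thesis
    unfolding gauge_equiv_def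
  proof (intro exI[of _ Lk] conjI ballI allI impI)
    fix k assume k: "k \<in> {1..d}"
    show "Lk k \<in> carrier_mat r r" "invertible_mat (Lk k)"
      unfolding Lk_def using A c invertible_mat_smult(1)[OF A] by auto
    fix a assume a: "a < n"
    have "minv (Lk k) = (1 / c ^ (k - 1)) \<cdot>\<^sub>m minv A"
      unfolding Lk_def using c invertible_mat_smult(2)[OF A] by simp
    then have "minv (Lk k) * S a * Lk (k + 1) = (1 / c ^ (k - 1)) \<cdot>\<^sub>m (c ^ k \<cdot>\<^sub>m conj_slice a)"
      unfolding Lk_def conj_slice_def using minv(1)[OF A] S[of a] A(1) mult_carrier_mat[OF minv(1)[OF A] S[of a]]
      by (simp add: mult_smult_assoc_mat[of _ r r _ r] mult_smult_distrib[of _ r r _ r] smult_smult_mat mult.commute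
          del: assoc_mult_mat)
    also have "\<dots> = c \<cdot>\<^sub>m conj_slice a"
    proof -
      have "c ^ k = c ^ (k - 1) * c" using k by (cases k) auto
      then show ?thesis using c cc[of a] by (auto intro!: eq_matI)
    qed
    finally show "R a = minv (Lk k) * S a * Lk (k + 1)" using Rc[OF a] by simp
  next
    show "Lk (d + 1) = Lk 1" using \<open>c ^ d = 1\<close> by (simp add: Lk_def)
  qed
qed

end

text \<open>In the basis \<open>Y\<close> the matrix \<open>conj_slice 0\<close> commutes with its
  own power \<open>D\<close>, whose diagonal entries are distinct. It is therefore diagonal itself,
  and its entries are d-th roots of those of \<open>D\<close>, so some choice of branches recovers
  it up to a root of unity.\<close>

lemma (in gauged_cores) ex_output:
  assumes X: "X \<in> carrier_mat r r" "invertible_mat X"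
    and eqX: "S 0 ^\<^sub>m d * X = X * mat_diag r ev" and inj: "inj_on ev {..<r}"
  shows "\<exists>Y D Y'. eigendecomposition (slice_prod r H (replicate d 0)) Y D Y'"
    and "eigendecomposition (slice_prod r H (replicate d 0)) Y D Y' \<Longrightarrow> \<exists>R. step5 n r d H Y D Y' R"
proof -
  have n: "0 < n" using m by simp
  have d0: "0 < d" "d \<noteq> 0" using d by auto
  note cc = conj_slice_carrier and ci = conj_slice_invertible
  define M where "M = slice_prod r H (replicate d 0)"
  have M: "M = conj_slice 0 ^\<^sub>m d" unfolding M_def by (rule slice_prod_0)
  have Mc: "M \<in> carrier_mat r r" "invertible_mat M"
    unfolding M using pow_invertible[OF cc[of 0] ci[OF n]] by auto
  note mA = minv[OF A] and mX = minv[OF X]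
  have S0d: "S 0 ^\<^sub>m d \<in> carrier_mat r r" using S by simp
  have M': "M = minv A * S 0 ^\<^sub>m d * A"
    unfolding M_def H[OF replicate_tuples(1)] using slice_word_replicate[OF S] by simp
  have dg: "mat_diag r f \<in> carrier_mat r r" for f :: "nat \<Rightarrow> complex" by simp
  have S0X: "S 0 ^\<^sub>m d = X * mat_diag r ev * minv X"
    using mult_minv_cancel(3)[OF X S0d] eqX by simp
  have sim: "similar_mat_wit M (mat_diag r ev) (minv A * X) (minv X * A)"
  proof (rule similar_mat_witI)
    show "minv A * X * (minv X * A) = 1\<^sub>m r"
      using mA mX X A mult_minv_cancel(1)[OF X A(1)] by (simp add: mat_assoc)
    show "minv X * A * (minv A * X) = 1\<^sub>m r"
      using mA mX X A mult_minv_cancel(1)[OF A X(1)] by (simp add: mat_assoc)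
    show "M = minv A * X * mat_diag r ev * (minv X * A)"
      unfolding M' S0X using mA mX X A dg by (simp add: mat_assoc)
  qed (use Mc dg mA mX X A in auto)
  have "diagonal_mat (mat_diag r ev)" by (auto simp: diagonal_mat_def mat_diag_index)
  with sim show "\<exists>Y D Y'. eigendecomposition (slice_prod r H (replicate d 0)) Y D Y'"
    unfolding eigendecomposition_def M_def by blast
  assume "eigendecomposition (slice_prod r H (replicate d 0)) Y D Y'"
  then have simD: "similar_mat_wit M D Y Y'" and diagD: "diagonal_mat D"
    by (auto simp: eigendecomposition_def M_def)
  note w = similar_mat_witD2[OF Mc(1) simD]
  have Y: "Y \<in> carrier_mat r r" "Y' \<in> carrier_mat r r" "Y * Y' = 1\<^sub>m r" "Y' * Y = 1\<^sub>m r"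
    and Dc: "D \<in> carrier_mat r r" and MD: "M = Y * D * Y'" using w by auto
  have invY: "invertible_mat Y" "minv Y = Y'"
    using invertible_mat_and_minv[OF Y(1,2,3)] by auto
  have invY': "invertible_mat Y'" "minv Y' = Y"
    using invertible_mat_and_minv[OF Y(2,1,4)] by auto
  define f where "f = (\<lambda>t. D $$ (t, t))"
  have Df: "D = mat_diag r f"
    using diagD Dc by (intro eq_matI) (auto simp: diagonal_mat_def mat_diag_index f_def)
  have cancelY: "Y' * (Y * Z) = Z" if "Z \<in> carrier_mat r k" for Z k
    using assoc_mult_mat[OF Y(2,1) that] Y(4) that by simp
  define V where "V = Y' * (minv A * X)"
  define V' where "V' = (minv X * A) * Y"
  have V: "V \<in> carrier_mat r r" "V' \<in> carrier_mat r r" unfolding V_def V'_def using Y mA X mX A by auto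
  have VV: "V * V' = 1\<^sub>m r"
  proof -
    have "A * Y \<in> carrier_mat r r" using A Y by simp
    then show ?thesis
      unfolding V_def V'_def
      using Y mA(1) X(1) mX(1) A(1) mult_minv_cancel(1)[OF X, of "A * Y" r] mult_minv_cancel(2)[OF A, of Y r]
      by (simp add: mat_assoc)
  qed
  have "M * (minv A * X) = minv A * X * mat_diag r ev"
    unfolding M' using mA X A S0d S[of 0] eqX mult_minv_cancel(1)[OF A X(1)] by (simp add: mat_assoc)
  then have "Y' * (M * (minv A * X)) = V * mat_diag r ev"
    unfolding V_def using Y mA X by (simp add: mat_assoc)
  moreover have "Y' * (M * (minv A * X)) = D * V"
    unfolding MD V_def using Y(1,2) mA X Dc cancelY[of "D * (Y' * (minv A * X))" r] by (simp add: mat_assoc)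
  ultimately have injf: "inj_on f {..<r}"
    using similar_diag_inj[OF V VV _ inj, of f] Df by simp
  define T where "T = Y' * conj_slice 0 * Y"
  have T: "T \<in> carrier_mat r r" unfolding T_def using Y cc[of 0] by auto
  have simT: "similar_mat_wit (conj_slice 0) T Y Y'"
    unfolding T_def using Y cc[of 0] cancelY
    by (intro similar_mat_wit_sym[of "Y' * conj_slice 0 * Y" _ Y' Y] similar_mat_witI[of _ _ r]) auto
  note wT = similar_mat_witD2[OF cc[of 0] simT]
  have Td: "T ^\<^sub>m d = D"
  proof -
    have c: "T ^\<^sub>m d \<in> carrier_mat r r" using T by simp
    have "Y * T ^\<^sub>m d * Y' = Y * D * Y'"
      using similar_mat_wit_pow_id[OF simT, of d] M MD by simp
    then have "Y' * (Y * T ^\<^sub>m d * Y') * Y = Y' * (Y * D * Y') * Y" by simp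
    moreover have "Y' * (Y * Z * Y') * Y = Z" if "Z \<in> carrier_mat r r" for Z
      using Y that cancelY[of "Z * (Y' * Y)" r] by (simp add: mat_assoc)
    ultimately show ?thesis using c Dc by metis
  qed
  have "T * mat_diag r f = mat_diag r f * T"
    using pow_add[OF T, of 1 d] T by (simp flip: Df Td)
  then have Tdiag: "T = mat_diag r (\<lambda>t. T $$ (t, t))"
    by (rule commutes_with_distinct_diag[OF T _ injf])
  define \<tau> where "\<tau> = (\<lambda>t. T $$ (t, t))"
  have T\<tau>: "T = mat_diag r \<tau>" using Tdiag by (simp add: \<tau>_def)
  have "T ^\<^sub>m d * 1\<^sub>m r = 1\<^sub>m r * mat_diag r (\<lambda>k. \<tau> k ^ d)"
    by (rule eigenvectors_power) (use T T\<tau> in auto)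
  then have "mat_diag r f = mat_diag r (\<lambda>k. \<tau> k ^ d)" using Td Df Dc by simp
  then have f\<tau>: "f t = \<tau> t ^ d" if "t < r" for t
    using that by (metis mat_diag_index)
  have "invertible_mat D"
    using Mc(2) invertible_mat_mult_iff[of "Y * D" r Y'] invertible_mat_mult_iff[of Y r D] Y Dc unfolding MD by simp
  then have f0: "f t \<noteq> 0" if "t < r" for t using mat_diag_invertibleD that unfolding Df by blast
  have r0: "0 < r" using r by simp
  define \<rho> where "\<rho> = (\<lambda>t k. of_real (root d (cmod (f t))) * cis ((Arg2pi (f t) + 2 * real k * pi) / real d))"
  have "\<rho> 0 0 ^ d = f 0"
  proof -
    have "\<rho> 0 0 ^ d = of_real (root d (cmod (f 0)) ^ d) * cis (Arg2pi (f 0))"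
      using d0 Complex.DeMoivre[of "Arg2pi (f 0) / real d" d] by (simp add: \<rho>_def power_mult_distrib del: real_root_pow_pos2)
    also have "root d (cmod (f 0)) ^ d = cmod (f 0)" using d0 by simp
    also have "of_real (cmod (f 0)) * cis (Arg2pi (f 0)) = f 0" using Arg2pi_eq[of "f 0"] by (simp add: cis_conv_exp)
    finally show ?thesis .
  qed
  \<comment> \<open>The algorithm fixes the first branch to be the principal one. Multiplying all
    roots by the same root of unity \<zeta> arranges this, and no product of \<open>d\<close> slices
    notices it.\<close>
  define \<zeta> where "\<zeta> = \<rho> 0 0 / \<tau> 0"
  have \<tau>0: "\<tau> 0 \<noteq> 0" using f0[OF r0] f\<tau>[OF r0] d0 by (auto simp: power_0_left)
  have \<zeta>d: "\<zeta> ^ d = 1"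
    using \<open>\<rho> 0 0 ^ d = f 0\<close> f\<tau>[OF r0] f0[OF r0] by (simp add: \<zeta>_def power_divide)
  then have \<zeta>: "\<zeta> \<noteq> 0" using d0 by (auto simp: power_0_left)
  have "\<exists>k. (t < r \<longrightarrow> k < d \<and> \<zeta> * \<tau> t = \<rho> t k) \<and> (t = 0 \<longrightarrow> k = 0)" for t
  proof (cases "t = 0")
    case True
    then show ?thesis using d0 \<tau>0 by (intro exI[of _ 0]) (simp add: \<zeta>_def)
  next
    case False
    have "\<exists>k<d. \<zeta> * \<tau> t = \<rho> t k" if "t < r"
    proof -
      have "(\<zeta> * \<tau> t) ^ d = f t" using \<zeta>d f\<tau>[OF that] by (simp add: power_mult_distrib)
      from complex_root_branch[OF this f0[OF that] d0(1)] show ?thesis unfolding \<rho>_def by metis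
    qed
    then show ?thesis using False by blast
  qed
  then obtain k where k: "\<And>t. t < r \<Longrightarrow> k t < d \<and> \<zeta> * \<tau> t = \<rho> t (k t)" "k 0 = 0" by metis
  define B where "B = Y * root_diag r d D k * Y'"
  have "root_diag r d D k = \<zeta> \<cdot>\<^sub>m T"
    unfolding T\<tau> root_diag_def using k(1) by (intro eq_matI) (auto simp: mat_diag_index \<rho>_def f_def)
  then have B: "B = \<zeta> \<cdot>\<^sub>m conj_slice 0"
    unfolding B_def wT(3) using Y T
    by (simp add: mult_smult_assoc_mat[of _ r r _ r] mult_smult_distrib[of _ r r _ r] del: assoc_mult_mat)
  note Bi = invertible_mat_smult[OF cc[of 0] ci[OF n] \<zeta>, folded B]
  define R where "R = bar_core r d H B"
  have Req: "R a = \<zeta> \<cdot>\<^sub>m conj_slice a" if "a < n" for a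
  proof (cases "a = 0")
    case True
    then show ?thesis by (simp add: R_def bar_core_def B)
  next
    case False
    note mc = minv(1)[OF cc[of 0] ci[OF n]]
    have pc: "minv (conj_slice 0) ^\<^sub>m (d - 1) \<in> carrier_mat r r" "conj_slice 0 ^\<^sub>m (d - 1) \<in> carrier_mat r r"
      using mc cc by auto
    \<comment> \<open>The power of the inverse of \<open>B\<close> in \<open>bar_core\<close> has
      exponent \<open>d - 1\<close>, so the other slices also receive the factor \<zeta>.\<close>
    have "\<zeta> * \<zeta> ^ (d - 1) = 1" using \<zeta>d d0 by (cases d) auto
    then have \<zeta>': "(1 / \<zeta>) ^ (d - 1) = \<zeta>" using \<zeta> by (simp add: field_simps)
    have "R a = ((1 / \<zeta>) ^ (d - 1) \<cdot>\<^sub>m minv (conj_slice 0) ^\<^sub>m (d - 1)) * (conj_slice 0 ^\<^sub>m (d - 1) * conj_slice a)"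
      unfolding R_def bar_core_eq[OF that False] Bi(2) smult_pow[OF mc] ..
    also have "\<dots> = \<zeta> \<cdot>\<^sub>m (minv (conj_slice 0) ^\<^sub>m (d - 1) * (conj_slice 0 ^\<^sub>m (d - 1) * conj_slice a))"
      unfolding \<zeta>' by (rule mult_smult_assoc_mat[OF pc(1) mult_carrier_mat[OF pc(2) cc]])
    also have "minv (conj_slice 0) ^\<^sub>m (d - 1) * (conj_slice 0 ^\<^sub>m (d - 1) * conj_slice a) = conj_slice a"
      unfolding assoc_mult_mat[OF pc cc, symmetric] pow_minv_cancel[OF cc ci[OF n]] by (rule left_mult_one_mat[OF cc])
    finally show ?thesis .
  qed
  have "slice_prod r H as = slice_prod r (replicate d R) as" if as: "as \<in> tuples n d" for as
  proof -
    have len: "length as = d" and sub: "set as \<subseteq> {..<n}" using as by (auto simp: tuples_def)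
    have "slice_word r R as = slice_word r (\<lambda>a. \<zeta> \<cdot>\<^sub>m conj_slice a) as"
      unfolding slice_word_def using Req sub by (intro arg_cong[of _ _ "mprod r"] map_cong) auto
    also have "\<dots> = slice_word r conj_slice as"
      using slice_word_smult[of as conj_slice r \<zeta>] cc \<zeta>d len by (auto intro!: eq_matI)
    finally show ?thesis using slice_prod_replicate[OF len] slice_prod_H[OF as] by simp
  qed
  then show "\<exists>R. step5 n r d H Y D Y' R"
    unfolding step5_def Let_def using k Bi(1) R_def unfolding B_def by blast
qed

section \<open>Polynomial functions vanish almost nowhere\<close>

text \<open>A closure of functions rather than a type of multivariate polynomials: evaluation at
  cores is all that matters, and determinants and characteristic polynomials are reached through the
  introduction rules.\<close>

inductive polyfun :: "'i set \<Rightarrow> (('i \<Rightarrow> complex) \<Rightarrow> complex) \<Rightarrow> bool" for I where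
  polyfun_const: "polyfun I (\<lambda>_. c)"
| polyfun_coord: "i \<in> I \<Longrightarrow> polyfun I (\<lambda>x. x i)"
| polyfun_add: "polyfun I f \<Longrightarrow> polyfun I g \<Longrightarrow> polyfun I (\<lambda>x. f x + g x)"
| polyfun_mult: "polyfun I f \<Longrightarrow> polyfun I g \<Longrightarrow> polyfun I (\<lambda>x. f x * g x)"

lemma polyfun_if: "(c \<Longrightarrow> polyfun I f) \<Longrightarrow> (\<not> c \<Longrightarrow> polyfun I g) \<Longrightarrow> polyfun I (\<lambda>x. if c then f x else g x)"
  by (cases c) auto

lemma polyfun_diff: "polyfun I f \<Longrightarrow> polyfun I g \<Longrightarrow> polyfun I (\<lambda>x. f x - g x)"
  using polyfun_add[of I f "\<lambda>x. (- 1) * g x"] polyfun_mult[OF polyfun_const[of I "- 1"]] by simp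

lemma polyfun_sum: "(\<And>i. i \<in> A \<Longrightarrow> polyfun I (f i)) \<Longrightarrow> polyfun I (\<lambda>x. \<Sum>i\<in>A. f i x)"
  by (induction A rule: infinite_finite_induct) (auto intro: polyfun_const polyfun_add)

lemma polyfun_prod: "(\<And>i. i \<in> A \<Longrightarrow> polyfun I (f i)) \<Longrightarrow> polyfun I (\<lambda>x. \<Prod>i\<in>A. f i x)"
  by (induction A rule: infinite_finite_induct) (auto intro: polyfun_const polyfun_mult)

lemma polyfun_power: "polyfun I f \<Longrightarrow> polyfun I (\<lambda>x. f x ^ k)"
  by (induction k) (auto intro: polyfun_const polyfun_mult)

lemma polyfun_cong_coords:
  "polyfun I f \<Longrightarrow> (\<And>i. i \<in> I \<Longrightarrow> x i = y i) \<Longrightarrow> f x = f y"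
  by (induction rule: polyfun.induct) auto

lemma polyfun_measurable:
  "polyfun I f \<Longrightarrow> f \<in> borel_measurable (Pi\<^sub>M I (\<lambda>_. lborel))"
proof (induction rule: polyfun.induct)
  case (polyfun_coord i)
  then show ?case using measurable_component_singleton[of i I "\<lambda>_. lborel"] by simp
qed auto

text \<open>Univariate polynomials with polynomial functions as coefficients. They serve both for
  the expansion in one coordinate and for characteristic polynomials of matrix families.\<close>

definition polyfun_poly :: "'i set \<Rightarrow> (('i \<Rightarrow> complex) \<Rightarrow> complex poly) \<Rightarrow> bool" where
  "polyfun_poly I F \<longleftrightarrow> (\<forall>k. polyfun I (\<lambda>x. coeff (F x) k))"

lemma polyfun_polyI: "(\<And>k. polyfun I (\<lambda>x. coeff (F x) k)) \<Longrightarrow> polyfun_poly I F"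
  and polyfun_polyD: "polyfun_poly I F \<Longrightarrow> polyfun I (\<lambda>x. coeff (F x) k)"
  by (auto simp: polyfun_poly_def)

lemma polyfun_poly_const: "polyfun_poly I (\<lambda>_. p)"
  by (auto simp: polyfun_poly_def intro: polyfun_const)

lemma polyfun_poly_pCons_0: "polyfun I f \<Longrightarrow> polyfun_poly I (\<lambda>x. [:f x:])"
proof (rule polyfun_polyI)
  fix k assume "polyfun I f"
  then show "polyfun I (\<lambda>x. coeff [:f x:] k)" by (cases k) (auto intro: polyfun_const)
qed

lemma polyfun_poly_add: "polyfun_poly I F \<Longrightarrow> polyfun_poly I G \<Longrightarrow> polyfun_poly I (\<lambda>x. F x + G x)"
  by (auto simp: polyfun_poly_def intro: polyfun_add)

lemma polyfun_poly_mult: "polyfun_poly I F \<Longrightarrow> polyfun_poly I G \<Longrightarrow> polyfun_poly I (\<lambda>x. F x * G x)"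
  by (auto simp: polyfun_poly_def coeff_mult intro!: polyfun_sum polyfun_mult)

lemma polyfun_poly_sum: "(\<And>i. i \<in> A \<Longrightarrow> polyfun_poly I (F i)) \<Longrightarrow> polyfun_poly I (\<lambda>x. \<Sum>i\<in>A. F i x)"
  by (induction A rule: infinite_finite_induct) (auto intro: polyfun_poly_const polyfun_poly_add)

lemma polyfun_poly_prod: "(\<And>i. i \<in> A \<Longrightarrow> polyfun_poly I (F i)) \<Longrightarrow> polyfun_poly I (\<lambda>x. \<Prod>i\<in>A. F i x)"
  by (induction A rule: infinite_finite_induct) (auto intro: polyfun_poly_const polyfun_poly_mult)

lemma polyfun_insert_expand:
  assumes "polyfun (insert i I) f"
  obtains F where "polyfun_poly I F" "\<And>x. f x = poly (F x) (x i)"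
proof -
  have "\<exists>F. polyfun_poly I F \<and> (\<forall>x. f x = poly (F x) (x i))"
    using assms
  proof (induction rule: polyfun.induct)
    case (polyfun_const c)
    show ?case by (intro exI[of _ "\<lambda>x. [:c:]"]) (auto intro: polyfun_poly_const)
  next
    case (polyfun_coord j)
    show ?case
    proof (cases "j = i")
      case True
      then show ?thesis by (intro exI[of _ "\<lambda>x. [:0, 1:]"]) (auto intro: polyfun_poly_const)
    next
      case False
      have "polyfun_poly I (\<lambda>x. [:x j:])"
        using False polyfun_coord by (intro polyfun_poly_pCons_0 polyfun.polyfun_coord) auto
      then show ?thesis by (intro exI[of _ "\<lambda>x. [:x j:]"]) auto
    qed
  next
    case (polyfun_add f g)
    then obtain F G where "polyfun_poly I F \<and> (\<forall>x. f x = poly (F x) (x i))"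
      "polyfun_poly I G \<and> (\<forall>x. g x = poly (G x) (x i))" by blast
    then show ?case by (intro exI[of _ "\<lambda>x. F x + G x"]) (auto intro: polyfun_poly_add)
  next
    case (polyfun_mult f g)
    then obtain F G where "polyfun_poly I F \<and> (\<forall>x. f x = poly (F x) (x i))"
      "polyfun_poly I G \<and> (\<forall>x. g x = poly (G x) (x i))" by blast
    then show ?case by (intro exI[of _ "\<lambda>x. F x * G x"]) (auto intro: polyfun_poly_mult)
  qed
  then show thesis using that by blast
qed

text \<open>Fubini in the new coordinate: some coefficient of the expansion is nonzero at
  \<open>x0\<close>, hence almost everywhere in the other coordinates by induction, and there the
  zeros in the new coordinate form a finite set.\<close>

lemma polyfun_AE_nonzero:
  assumes "finite I" "polyfun I f" "f x0 \<noteq> 0"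
  shows "AE x in Pi\<^sub>M I (\<lambda>_. lborel). f x \<noteq> 0"
  using assms
proof (induction I arbitrary: f x0 rule: finite_induct)
  case empty
  have "f x = f x0" for x by (rule polyfun_cong_coords[OF empty(1)]) simp
  with empty(2) have "f x \<noteq> 0" for x by metis
  then show ?case by simp
next
  case (insert i I)
  interpret product_sigma_finite "\<lambda>_ :: 'a. lborel :: complex measure" by standard
  obtain F where F: "polyfun_poly I F" "\<And>x. f x = poly (F x) (x i)"
    using polyfun_insert_expand[OF insert.prems(1)] by blast
  have "F x0 \<noteq> 0" using insert.prems(2) F(2)[of x0] by auto
  then obtain k where "coeff (F x0) k \<noteq> 0" by (auto simp: poly_eq_iff)
  then have AE: "AE x in Pi\<^sub>M I (\<lambda>_. lborel). coeff (F x) k \<noteq> 0"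
    using insert.IH[OF polyfun_polyD[OF F(1)]] by blast
  have F_upd: "F (x(i := y)) = F x" for x y
    using insert.hyps(2) by (intro poly_eqI polyfun_cong_coords[OF polyfun_polyD[OF F(1)]]) auto
  define N where "N = {x \<in> space (Pi\<^sub>M (insert i I) (\<lambda>_. lborel)). f x = 0}"
  have N: "N \<in> sets (Pi\<^sub>M (insert i I) (\<lambda>_. lborel))"
    unfolding N_def using polyfun_measurable[OF insert.prems(1)] by measurable
  have "emeasure (Pi\<^sub>M (insert i I) (\<lambda>_. lborel)) N =
      (\<integral>\<^sup>+ x. indicator N x \<partial>Pi\<^sub>M (insert i I) (\<lambda>_. lborel))"
    using N by simp
  also have "\<dots> = (\<integral>\<^sup>+ x. (\<integral>\<^sup>+ y. indicator N (x(i := y)) \<partial>lborel) \<partial>Pi\<^sub>M I (\<lambda>_. lborel))"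
    using insert.hyps N by (intro product_nn_integral_insert) auto
  also have "\<dots> = (\<integral>\<^sup>+ x. 0 \<partial>Pi\<^sub>M I (\<lambda>_. lborel :: complex measure))"
  proof (rule nn_integral_cong_AE)
    show "AE x in Pi\<^sub>M I (\<lambda>_. lborel). (\<integral>\<^sup>+ y. indicator N (x(i := y)) \<partial>lborel) = 0"
      using AE
    proof eventually_elim
    fix x assume "coeff (F x) k \<noteq> 0"
    then have "finite {y. poly (F x) y = 0}" by (intro poly_roots_finite) auto
    then have null: "{y. poly (F x) y = 0} \<in> null_sets lborel" by (rule finite_imp_null_set_lborel)
    have "(\<integral>\<^sup>+ y. indicator N (x(i := y)) \<partial>lborel) \<le> (\<integral>\<^sup>+ y. indicator {y. poly (F x) y = 0} y \<partial>lborel)"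
      by (intro nn_integral_mono) (auto simp: N_def F(2) F_upd split: split_indicator)
    also have "\<dots> = 0" using null by (auto simp: null_sets_def)
    finally show "(\<integral>\<^sup>+ y. indicator N (x(i := y)) \<partial>lborel) = 0" by simp
    qed
  qed
  finally have "N \<in> null_sets (Pi\<^sub>M (insert i I) (\<lambda>_. lborel))" using N by auto
  then show ?case by (rule AE_I') (auto simp: N_def)
qed

lemma polyfun_curve:
  assumes "polyfun I f" "\<And>i. i \<in> I \<Longrightarrow> \<exists>p. \<forall>t. y t i = poly p t"
  shows "\<exists>p. \<forall>t. f (y t) = poly p t"
  using assms
proof (induction rule: polyfun.induct)
  case (polyfun_const c)
  show ?case by (intro exI[of _ "[:c:]"]) simp
next
  case (polyfun_add f g)
  then obtain p q where "\<forall>t. f (y t) = poly p t" "\<forall>t. g (y t) = poly q t" by blast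
  then show ?case by (intro exI[of _ "p + q"]) simp
next
  case (polyfun_mult f g)
  then obtain p q where "\<forall>t. f (y t) = poly p t" "\<forall>t. g (y t) = poly q t" by blast
  then show ?case by (intro exI[of _ "p * q"]) simp
qed auto

text \<open>On the line through a good point \<open>x\<close> for the functions in \<open>A\<close>
  and a good point \<open>y\<close> for the new one, all functions are nonzero univariate
  polynomials, and finitely many of these have only finitely many roots.\<close>

lemma polyfun_common_nonzero:
  assumes "finite A" "\<And>a. a \<in> A \<Longrightarrow> polyfun I (f a)" "\<And>a. a \<in> A \<Longrightarrow> \<exists>x. f a x \<noteq> 0"
  shows "\<exists>x. \<forall>a\<in>A. f a x \<noteq> 0"
  using assms
proof (induction A rule: finite_induct)
  case (insert b A)
  then obtain x y where x: "\<forall>a\<in>A. f a x \<noteq> 0" and y: "f b y \<noteq> 0" by fastforce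
  define z where "z = (\<lambda>t i. x i + t * (y i - x i))"
  have zp: "\<exists>p. \<forall>t. z t i = poly p t" for i
    by (intro exI[of _ "[:x i, y i - x i:]"]) (simp add: z_def)
  have z01: "z 0 = x" "z 1 = y" by (auto simp: z_def)
  have "\<exists>p. \<forall>t. f a (z t) = poly p t" if "a \<in> insert b A" for a
    using polyfun_curve[of I "f a" z] insert.prems(1)[OF that] zp by blast
  then obtain p where p: "\<And>a t. a \<in> insert b A \<Longrightarrow> f a (z t) = poly (p a) t" by metis
  have "p a \<noteq> 0" if "a \<in> insert b A" for a
  proof
    assume "p a = 0"
    then have "f a x = 0" "f a y = 0" using p[OF that] z01 by (metis poly_0)+
    then show False using x y that by auto
  qed
  then have "finite (\<Union>a\<in>insert b A. {t. poly (p a) t = 0})"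
    using insert.hyps(1) by (auto intro: poly_roots_finite)
  then obtain t where "t \<notin> (\<Union>a\<in>insert b A. {t. poly (p a) t = 0})"
    using ex_new_if_finite[OF infinite_UNIV_char_0] by blast
  then show ?case using p by (intro exI[of _ "z t"]) auto
qed simp

section \<open>Matrix families with polynomial entries\<close>

definition polymat :: "'i set \<Rightarrow> nat \<Rightarrow> nat \<Rightarrow> (('i \<Rightarrow> complex) \<Rightarrow> complex mat) \<Rightarrow> bool" where
  "polymat I n m A \<longleftrightarrow> (\<forall>x. A x \<in> carrier_mat n m) \<and> (\<forall>i<n. \<forall>j<m. polyfun I (\<lambda>x. A x $$ (i, j)))"

lemma polymatI:
  "(\<And>x. A x \<in> carrier_mat n m) \<Longrightarrow> (\<And>i j. i < n \<Longrightarrow> j < m \<Longrightarrow> polyfun I (\<lambda>x. A x $$ (i, j))) \<Longrightarrow> polymat I n m A"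
  and polymat_carrier: "polymat I n m A \<Longrightarrow> A x \<in> carrier_mat n m"
  and polymat_index: "polymat I n m A \<Longrightarrow> i < n \<Longrightarrow> j < m \<Longrightarrow> polyfun I (\<lambda>x. A x $$ (i, j))"
  by (auto simp: polymat_def)

lemma polymat_const: "M \<in> carrier_mat n m \<Longrightarrow> polymat I n m (\<lambda>_. M)"
  by (auto simp: polymat_def intro: polyfun_const)

lemma polymat_mult:
  assumes A: "polymat I n m A" and B: "polymat I m k B"
  shows "polymat I n k (\<lambda>x. A x * B x)"
proof (rule polymatI)
  show "A x * B x \<in> carrier_mat n k" for x
    using polymat_carrier[OF A] polymat_carrier[OF B] by (rule mult_carrier_mat)
  fix i j assume ij: "i < n" "j < k"
  then show "polyfun I (\<lambda>x. (A x * B x) $$ (i, j))"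
    by (subst mult_index[OF polymat_carrier[OF A] polymat_carrier[OF B] ij])
      (auto intro!: polyfun_sum polyfun_mult polymat_index[OF A] polymat_index[OF B])
qed

lemma polymat_kron:
  assumes A: "polymat I n m A" and B: "polymat I p q B"
  shows "polymat I (n * p) (m * q) (\<lambda>x. kron (A x) (B x))"
proof (rule polymatI)
  show "kron (A x) (B x) \<in> carrier_mat (n * p) (m * q)" for x
    using polymat_carrier[OF A] polymat_carrier[OF B] by simp
  fix i j assume ij: "i < n * p" "j < m * q"
  have "kron (A x) (B x) $$ (i, j) = A x $$ (i div p, j div q) * B x $$ (i mod p, j mod q)" for x
    using ij polymat_carrier[OF A, of x] polymat_carrier[OF B, of x] by (subst kron_index) auto
  then show "polyfun I (\<lambda>x. kron (A x) (B x) $$ (i, j))"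
    using composite_split[OF ij(1)] composite_split[OF ij(2)]
    by (auto intro!: polyfun_mult polymat_index[OF A] polymat_index[OF B])
qed

lemma polymat_add:
  assumes A: "polymat I n m A" and B: "polymat I n m B"
  shows "polymat I n m (\<lambda>x. A x + B x)"
proof (rule polymatI)
  fix i j assume ij: "i < n" "j < m"
  have "(A x + B x) $$ (i, j) = A x $$ (i, j) + B x $$ (i, j)" for x
    using ij polymat_carrier[OF A, of x] polymat_carrier[OF B, of x] by simp
  then show "polyfun I (\<lambda>x. (A x + B x) $$ (i, j))"
    using ij by (auto intro!: polyfun_add polymat_index[OF A] polymat_index[OF B])
qed (use polymat_carrier[OF B] in auto)

lemma polymat_smult:
  assumes A: "polymat I n m A"
  shows "polymat I n m (\<lambda>x. c \<cdot>\<^sub>m A x)"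
proof (rule polymatI)
  fix i j assume ij: "i < n" "j < m"
  have "(c \<cdot>\<^sub>m A x) $$ (i, j) = c * A x $$ (i, j)" for x
    using ij polymat_carrier[OF A, of x] by simp
  then show "polyfun I (\<lambda>x. (c \<cdot>\<^sub>m A x) $$ (i, j))"
    using ij by (auto intro!: polyfun_mult polyfun_const polymat_index[OF A])
qed (use polymat_carrier[OF A] in auto)

lemma polymat_transpose:
  assumes A: "polymat I n m A"
  shows "polymat I m n (\<lambda>x. transpose_mat (A x))"
proof (rule polymatI)
  fix i j assume ij: "i < m" "j < n"
  have "transpose_mat (A x) $$ (i, j) = A x $$ (j, i)" for x
    using ij polymat_carrier[OF A, of x] by simp
  then show "polyfun I (\<lambda>x. transpose_mat (A x) $$ (i, j))"
    using ij by (auto intro!: polymat_index[OF A])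
qed (use polymat_carrier[OF A] in auto)

lemma polymat_pow:
  assumes A: "polymat I n n A"
  shows "polymat I n n (\<lambda>x. A x ^\<^sub>m k)"
proof (induction k)
  case 0
  have "A x ^\<^sub>m 0 = 1\<^sub>m n" for x using polymat_carrier[OF A, of x] by simp
  then show ?case using polymat_const[of "1\<^sub>m n" n n I] by simp
qed (use polymat_mult[OF _ A] in simp)

lemma polyfun_det:
  assumes A: "polymat I n n A"
  shows "polyfun I (\<lambda>x. det (A x))"
  unfolding det_def'[OF polymat_carrier[OF A]]
  by (intro polyfun_sum polyfun_mult polyfun_prod polyfun_const polymat_index[OF A])
    (auto simp: permutes_in_image)

text \<open>Adjugates stay within polynomial families, as their entries are signed minors.\<close>

lemma polymat_adj:
  assumes A: "polymat I n n A"
  shows "polymat I n n (\<lambda>x. adj_mat (A x))"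
proof (rule polymatI)
  fix i j assume ij: "i < n" "j < n"
  have eq: "adj_mat (A x) $$ (i, j) = (-1) ^ (j + i) * det (mat_delete (A x) j i)" for x
    using ij polymat_carrier[OF A, of x] by (simp add: adj_mat_def cofactor_def)
  have "polymat I (n - 1) (n - 1) (\<lambda>x. mat_delete (A x) j i)"
  proof (rule polymatI)
    show "mat_delete (A x) j i \<in> carrier_mat (n - 1) (n - 1)" for x
      using mat_delete_carrier[OF polymat_carrier[OF A]] by simp
    fix k l assume kl: "k < n - 1" "l < n - 1"
    have "mat_delete (A x) j i $$ (k, l) = A x $$ (if k < j then k else Suc k, if l < i then l else Suc l)" for x
      using kl polymat_carrier[OF A, of x] by (simp add: mat_delete_def)
    then show "polyfun I (\<lambda>x. mat_delete (A x) j i $$ (k, l))"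
      using kl by (auto intro!: polymat_index[OF A])
  qed
  then show "polyfun I (\<lambda>x. adj_mat (A x) $$ (i, j))"
    unfolding eq by (intro polyfun_mult polyfun_const polyfun_det)
qed (use adj_mat(1)[OF polymat_carrier[OF A]] in auto)

lemma polyfun_poly_char_poly:
  assumes A: "polymat I n n A"
  shows "polyfun_poly I (\<lambda>x. char_poly (A x))"
proof -
  note c = polymat_carrier[OF A]
  have e: "polyfun_poly I (\<lambda>x. char_poly_matrix (A x) $$ (i, j))" if "i < n" "j < n" for i j
  proof -
    have "(\<lambda>x. char_poly_matrix (A x) $$ (i, j)) = (\<lambda>x. (if i = j then [:0, 1:] else 0) + [:- A x $$ (i, j):])"
      using that carrier_matD[OF c] by (auto simp: char_poly_matrix_def)
    moreover have "polyfun_poly I (\<lambda>x. [:- A x $$ (i, j):])"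
      using polyfun_mult[OF polyfun_const[of I "- 1"] polymat_index[OF A that]]
      by (intro polyfun_poly_pCons_0) simp
    ultimately show ?thesis by (simp only:) (intro polyfun_poly_add polyfun_poly_const)
  qed
  show ?thesis
    unfolding char_poly_def det_def'[OF char_poly_matrix_closed[OF c]]
    by (intro polyfun_poly_sum polyfun_poly_mult polyfun_poly_prod polyfun_poly_const e)
      (auto simp: permutes_in_image)
qed

section \<open>Generic spectral properties of polynomial families of matrices\<close>

definition distinct_eigenbasis :: "nat \<Rightarrow> complex mat \<Rightarrow> complex mat \<Rightarrow> (nat \<Rightarrow> complex) \<Rightarrow> bool" where
  "distinct_eigenbasis r Z X ev \<longleftrightarrow> X \<in> carrier_mat r r \<and> invertible_mat X \<and>
     Z * X = X * mat_diag r ev \<and> inj_on ev {..<r}"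

lemma ex_eigenbasis:
  assumes Z: "Z \<in> carrier_mat r r" and inj: "inj_on ev {..<r}" and ev: "\<And>k. k < r \<Longrightarrow> eigenvalue Z (ev k)"
  shows "\<exists>X. distinct_eigenbasis r Z X ev"
proof -
  obtain v where v: "\<And>k. k < r \<Longrightarrow> eigenvector Z (v k) (ev k)"
    using ev unfolding eigenvalue_def by metis
  have vc: "v k \<in> carrier_vec r" "v k \<noteq> 0\<^sub>v r" "Z *\<^sub>v v k = ev k \<cdot>\<^sub>v v k" if "k < r" for k
    using v[OF that] Z by (auto simp: eigenvector_def)
  define X where "X = Matrix.mat r r (\<lambda>(i, k). v k $ i)"
  have X: "X \<in> carrier_mat r r" by (simp add: X_def)
  have eq: "Z * X = X * mat_diag r ev"
  proof (rule eq_matI)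
    fix i k assume "i < dim_row (X * mat_diag r ev)" "k < dim_col (X * mat_diag r ev)"
    then have ik: "i < r" "k < r" using X by auto
    have "(Z * X) $$ (i, k) = (Z *\<^sub>v v k) $ i"
      unfolding mult_index[OF Z X ik] mult_vec_index[OF Z vc(1)[OF ik(2)] ik(1)] using ik by (simp add: X_def)
    also have "\<dots> = ev k * v k $ i" using vc[OF ik(2)] ik by simp
    finally show "(Z * X) $$ (i, k) = (X * mat_diag r ev) $$ (i, k)"
      unfolding mat_diag_mult_right[OF X] using ik by (simp add: X_def)
  qed (use Z X in auto)
  have "\<exists>q<r. X $$ (q, k) \<noteq> 0" if k: "k < r" for k
  proof (rule ccontr)
    assume "\<not> ?thesis"
    then have "v k = 0\<^sub>v r" using vc(1)[OF k] k by (intro eq_vecI) (auto simp: X_def)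
    then show False using vc(2)[OF k] by simp
  qed
  then have "invertible_mat X" using eigenvectors_invertible[OF Z X eq inj] by blast
  then show ?thesis using X eq inj unfolding distinct_eigenbasis_def by blast
qed

lemma distinct_eigenbasis_eigenvalue:
  assumes "distinct_eigenbasis r Z X ev" "Z \<in> carrier_mat r r" "k < r"
  shows "eigenvalue Z (ev k)"
proof -
  have X: "X \<in> carrier_mat r r" "invertible_mat X" and eq: "Z * X = X * mat_diag r ev"
    using assms by (auto simp: distinct_eigenbasis_def)
  have u: "unit_vec r k \<in> carrier_vec r" by simp
  have Xu: "X *\<^sub>v unit_vec r k \<in> carrier_vec r" using X by simp
  have "Z *\<^sub>v (X *\<^sub>v unit_vec r k) = (X * mat_diag r ev) *\<^sub>v unit_vec r k"
    using assoc_mult_mat_vec[OF assms(2) X(1) u] eq by simp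
  also have "\<dots> = ev k \<cdot>\<^sub>v (X *\<^sub>v unit_vec r k)"
  proof (rule eq_vecI)
    fix i assume "i < dim_vec (ev k \<cdot>\<^sub>v (X *\<^sub>v unit_vec r k))"
    then have i: "i < r" using X by simp
    have c: "X * mat_diag r ev \<in> carrier_mat r r" using X by simp
    have "((X * mat_diag r ev) *\<^sub>v unit_vec r k) $ i = (X * mat_diag r ev) $$ (i, k)"
      using X(1) i assms(3) by (simp add: scalar_prod_right_unit)
    also have "\<dots> = X $$ (i, k) * ev k" unfolding mat_diag_mult_right[OF X(1)] using i assms(3) by simp
    finally show "((X * mat_diag r ev) *\<^sub>v unit_vec r k) $ i = (ev k \<cdot>\<^sub>v (X *\<^sub>v unit_vec r k)) $ i"
      using X i assms(3) by (simp add: scalar_prod_right_unit)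
  qed (use X in auto)
  finally have "Z *\<^sub>v (X *\<^sub>v unit_vec r k) = ev k \<cdot>\<^sub>v (X *\<^sub>v unit_vec r k)" .
  moreover have "X *\<^sub>v unit_vec r k \<noteq> 0\<^sub>v r"
  proof
    assume "X *\<^sub>v unit_vec r k = 0\<^sub>v r"
    then have "\<exists>v. v \<in> carrier_vec r \<and> v \<noteq> 0\<^sub>v r \<and> X *\<^sub>v v = 0\<^sub>v r"
      using u unit_vec_nonzero[OF assms(3)] by blast
    then show False using det_0_iff_vec_prod_zero[OF X(1)] X(2) by (simp add: invertible_mat_iff_det[OF X(1)])
  qed
  ultimately show ?thesis
    using assms(2) Xu unfolding eigenvalue_def eigenvector_def by auto
qed

text \<open>For the monic characteristic polynomial this resultant is the discriminant up to sign.
  It vanishes iff the gcd with the derivative is not constant, which over the complex numbers means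
  a multiple root.\<close>

lemma distinct_eigenbasis_iff_coprime:
  assumes Z: "Z \<in> carrier_mat r r"
  shows "(\<exists>X ev. distinct_eigenbasis r Z X ev) \<longleftrightarrow>
    resultant (char_poly Z) (pderiv (char_poly Z)) \<noteq> 0"
proof -
  define \<chi> where "\<chi> = char_poly Z"
  have deg: "degree \<chi> = r" and mon: "coeff \<chi> r = 1" using degree_monic_char_poly[OF Z] by (auto simp: \<chi>_def)
  then have nz: "\<chi> \<noteq> 0" by auto
  have root: "eigenvalue Z a \<longleftrightarrow> poly \<chi> a = 0" for a
    using eigenvalue_root_char_poly[OF Z] by (simp add: \<chi>_def)
  have "resultant \<chi> (pderiv \<chi>) \<noteq> 0 \<longleftrightarrow> degree (gcd \<chi> (pderiv \<chi>)) = 0"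
    by (simp add: resultant_0_gcd)
  also have "\<dots> \<longleftrightarrow> rsquarefree \<chi>"
  proof
    assume d0: "degree (gcd \<chi> (pderiv \<chi>)) = 0"
    show "rsquarefree \<chi>"
      unfolding rsquarefree_roots
    proof (intro allI notI)
      fix a assume "poly \<chi> a = 0 \<and> poly (pderiv \<chi>) a = 0"
      then have "[:- a, 1:] dvd gcd \<chi> (pderiv \<chi>)" by (simp add: poly_eq_0_iff_dvd)
      moreover have "gcd \<chi> (pderiv \<chi>) \<noteq> 0" using nz by simp
      ultimately have "degree [:- a, 1:] \<le> degree (gcd \<chi> (pderiv \<chi>))" by (rule dvd_imp_degree_le)
      then show False using d0 by simp
    qed
  next
    assume sq: "rsquarefree \<chi>"
    show "degree (gcd \<chi> (pderiv \<chi>)) = 0"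
    proof (rule ccontr)
      assume "degree (gcd \<chi> (pderiv \<chi>)) \<noteq> 0"
      then have "\<not> constant (poly (gcd \<chi> (pderiv \<chi>)))" by (simp add: constant_degree)
      then obtain a where "poly (gcd \<chi> (pderiv \<chi>)) a = 0" using fundamental_theorem_of_algebra by blast
      then have "[:- a, 1:] dvd gcd \<chi> (pderiv \<chi>)" by (simp add: poly_eq_0_iff_dvd)
      then have "poly \<chi> a = 0" "poly (pderiv \<chi>) a = 0" by (auto simp: poly_eq_0_iff_dvd)
      then show False using sq by (simp add: rsquarefree_roots)
    qed
  qed
  also have "\<dots> \<longleftrightarrow> card {a. poly \<chi> a = 0} = r"
    using rsquarefree_card_degree[OF nz] deg by simp
  also have "\<dots> \<longleftrightarrow> (\<exists>X ev. distinct_eigenbasis r Z X ev)"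
  proof
    assume card: "card {a. poly \<chi> a = 0} = r"
    have fin: "finite {a. poly \<chi> a = 0}" by (rule poly_roots_finite[OF nz])
    obtain ev where ev: "bij_betw ev {..<r} {a. poly \<chi> a = 0}"
      using ex_bij_betw_nat_finite[OF fin] card by (auto simp: atLeast0LessThan)
    then have "inj_on ev {..<r}" "\<And>k. k < r \<Longrightarrow> eigenvalue Z (ev k)"
      unfolding root by (auto simp: bij_betw_def)
    then show "\<exists>X ev. distinct_eigenbasis r Z X ev" using ex_eigenbasis[OF Z] by blast
  next
    assume "\<exists>X ev. distinct_eigenbasis r Z X ev"
    then obtain X ev where b: "distinct_eigenbasis r Z X ev" by blast
    then have inj: "inj_on ev {..<r}" by (simp add: distinct_eigenbasis_def)
    have "ev ` {..<r} \<subseteq> {a. poly \<chi> a = 0}"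
      using distinct_eigenbasis_eigenvalue[OF b Z] by (auto simp: root)
    then have "r \<le> card {a. poly \<chi> a = 0}"
      using card_mono[OF poly_roots_finite[OF nz], of "ev ` {..<r}"] card_image[OF inj] by simp
    moreover have "card {a. poly \<chi> a = 0} \<le> r" using card_poly_roots_bound[OF nz] deg by simp
    ultimately show "card {a. poly \<chi> a = 0} = r" by simp
  qed
  finally show ?thesis by (simp add: \<chi>_def)
qed

lemma generic_distinct_eigenbasis:
  assumes A: "polymat I r r A" and ex: "distinct_eigenbasis r (A x0) X0 ev0"
  obtains P where "polyfun I P" "P x0 \<noteq> 0" "\<And>x. P x \<noteq> 0 \<Longrightarrow> \<exists>X ev. distinct_eigenbasis r (A x) X ev"
proof -
  define P where "P = (\<lambda>x. resultant (char_poly (A x)) (pderiv (char_poly (A x))))"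
  note c = polymat_carrier[OF A]
  \<comment> \<open>Both degrees are the same for all \<open>x\<close>, so the Sylvester matrix has
    a fixed format and its determinant is a polynomial function.\<close>
  have deg: "degree (char_poly (A x)) = r" "degree (pderiv (char_poly (A x))) = r - 1" for x
    using degree_monic_char_poly[OF c] by (auto simp: degree_pderiv)
  have "P = (\<lambda>x. det (sylvester_mat_sub r (r - 1) (char_poly (A x)) (pderiv (char_poly (A x)))))"
    unfolding P_def resultant_def sylvester_mat_def deg ..
  moreover have "polymat I (r + (r - 1)) (r + (r - 1)) (\<lambda>x. sylvester_mat_sub r (r - 1) (char_poly (A x)) (pderiv (char_poly (A x))))"
  proof (rule polymatI)
    fix i j assume ij: "i < r + (r - 1)" "j < r + (r - 1)"
    note ch = polyfun_polyD[OF polyfun_poly_char_poly[OF A]]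
    have pd: "polyfun I (\<lambda>x. coeff (pderiv (char_poly (A x))) k)" for k
      unfolding coeff_pderiv by (intro polyfun_mult polyfun_const ch)
    show "polyfun I (\<lambda>x. sylvester_mat_sub r (r - 1) (char_poly (A x)) (pderiv (char_poly (A x))) $$ (i, j))"
      unfolding sylvester_mat_sub_index[OF ij] by (intro polyfun_if polyfun_const ch pd)
  qed (rule sylvester_mat_sub_carrier)
  ultimately have P: "polyfun I P" using polyfun_det[of I "r + (r - 1)"] by simp
  have iff: "P x \<noteq> 0 \<longleftrightarrow> (\<exists>X ev. distinct_eigenbasis r (A x) X ev)" for x
    unfolding P_def by (rule distinct_eigenbasis_iff_coprime[OF c, symmetric])
  show thesis
  proof (rule that[OF P])
    show "P x0 \<noteq> 0" unfolding iff using ex by (intro exI)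
  qed (simp only: iff)
qed

text \<open>
  The trace is a covector on the space of the Kronecker product that pairs nontrivially with all
  products of eigenvectors of \<open>Z'\<close> and \<open>Z\<^sup>T\<close> iff it is cyclic for \<open>Z' \<otimes> I + s I \<otimes> Z\<^sup>T\<close>, provided that
  \<open>s\<close> separates the sums of eigenvalues. Cyclicity is the nonvanishing of one Krylov determinant.
\<close>

definition trace_row :: "nat \<Rightarrow> complex mat" where
  "trace_row r = Matrix.mat 1 (r * r) (\<lambda>(_, c). if c div r = c mod r then 1 else 0)"

definition kron_sum :: "nat \<Rightarrow> complex \<Rightarrow> complex mat \<Rightarrow> complex mat \<Rightarrow> complex mat" where
  "kron_sum r s Z Z' = kron Z' (1\<^sub>m r) + s \<cdot>\<^sub>m kron (1\<^sub>m r) (transpose_mat Z)"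

definition krylov :: "nat \<Rightarrow> complex \<Rightarrow> complex mat \<Rightarrow> complex mat \<Rightarrow> complex mat" where
  "krylov r s Z Z' = Matrix.mat (r * r) (r * r) (\<lambda>(i, c). (trace_row r * kron_sum r s Z Z' ^\<^sub>m i) $$ (0, c))"

lemma kron_sum_carrier:
  "Z \<in> carrier_mat r r \<Longrightarrow> Z' \<in> carrier_mat r r \<Longrightarrow> kron_sum r s Z Z' \<in> carrier_mat (r * r) (r * r)"
  by (simp add: kron_sum_def)

text \<open>The trace contracts the two tensor factors of a column. With \<open>Y = minv X\<close>
  the result is an entry of the change of basis.\<close>

lemma trace_row_kron:
  assumes X: "X \<in> carrier_mat r r" and Y: "Y \<in> carrier_mat r r" and c: "c < r * r"
  shows "(trace_row r * kron X (transpose_mat Y)) $$ (0, c) = (Y * X) $$ (c mod r, c div r)"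
proof -
  note c' = composite_split[OF c]
  have k: "kron X (transpose_mat Y) \<in> carrier_mat (r * r) (r * r)" using X Y by simp
  have t: "trace_row r \<in> carrier_mat 1 (r * r)" by (simp add: trace_row_def)
  have "(trace_row r * kron X (transpose_mat Y)) $$ (0, c) =
      (\<Sum>t<r * r. (if t div r = t mod r then X $$ (t div r, c div r) * Y $$ (c mod r, t mod r) else 0))"
    unfolding mult_index[OF t k less_one[THEN iffD2, OF refl] c]
    using X Y c c' composite_split by (intro sum.cong refl) (auto simp: kron_index trace_row_def)
  also have "\<dots> = (\<Sum>i<r. \<Sum>j<r. (if i = j then X $$ (i, c div r) * Y $$ (c mod r, j) else 0))"
    by (rule sum_composite)
  also have "\<dots> = (Y * X) $$ (c mod r, c div r)"
    unfolding mult_index[OF Y X c'(2,1)] by (intro sum.cong refl) (simp add: mult.commute)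
  finally show ?thesis .
qed

text \<open>The columns of \<open>V\<close> are eigenvectors of \<open>kron_sum\<close>. In this
  basis the Krylov matrix is therefore a Vandermonde matrix whose columns are scaled by the entries
  of the change of basis.\<close>

lemma krylov_eigenbasis:
  assumes Z: "Z \<in> carrier_mat r r" and Z': "Z' \<in> carrier_mat r r"
    and X: "distinct_eigenbasis r Z X ev" and X': "distinct_eigenbasis r Z' X' ev'"
  defines "V \<equiv> kron X' (transpose_mat (minv X))"
  shows "invertible_mat V" "V \<in> carrier_mat (r * r) (r * r)"
    "krylov r s Z Z' * V = Matrix.mat (r * r) (r * r)
       (\<lambda>(i, c). (minv X * X') $$ (c mod r, c div r) * (ev' (c div r) + s * ev (c mod r)) ^ i)"
proof -
  define m where "m = r * r"
  define Y where "Y = minv X"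
  have Xc: "X \<in> carrier_mat r r" "invertible_mat X" "Z * X = X * mat_diag r ev"
    and Xc': "X' \<in> carrier_mat r r" "invertible_mat X'" "Z' * X' = X' * mat_diag r ev'"
    using X X' by (auto simp: distinct_eigenbasis_def)
  note mY = minv[OF Xc(1,2), folded Y_def]
  have Yt: "transpose_mat Y \<in> carrier_mat r r" "invertible_mat (transpose_mat Y)"
    using mY(1) invertible_mat_transpose[OF mY(1)] invertible_mat_minv(1)[OF Xc(1,2)] by (auto simp: Y_def)
  show inv: "invertible_mat V" unfolding V_def Y_def[symmetric] by (rule kron_invertible(1)[OF Xc'(1) Yt(1) Xc'(2) Yt(2)])
  have V: "V \<in> carrier_mat m m" unfolding V_def Y_def[symmetric] m_def using Xc'(1) Yt(1) by simp
  then show "V \<in> carrier_mat (r * r) (r * r)" by (simp add: m_def)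
  have dg: "mat_diag r f \<in> carrier_mat r r" for f :: "nat \<Rightarrow> complex" by simp
  have YZ: "Y * Z = mat_diag r ev * Y"
  proof -
    have "Y * (Z * X) * Y = Y * Z"
      using mult_minv_cancel(3)[OF Xc(1,2), of "Y * Z" r] mY(1) Xc Z by (simp add: mat_assoc Y_def)
    moreover have "Y * (Z * X) * Y = mat_diag r ev * Y"
      unfolding Xc(3) Y_def using mult_minv_cancel(2)[OF Xc(1,2) dg] by simp
    ultimately show ?thesis by simp
  qed
  have tdiag: "transpose_mat (mat_diag r ev) = mat_diag r ev"
    by (intro eq_matI) (auto simp: mat_diag_index)
  have ZtYt: "transpose_mat Z * transpose_mat Y = transpose_mat Y * mat_diag r ev"
    using arg_cong[OF YZ, of transpose_mat] transpose_mult[OF mY(1) Z] transpose_mult[OF dg[of ev] mY(1)] tdiag by simp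
  define \<nu> where "\<nu> = (\<lambda>c. ev' (c div r) + s * ev (c mod r))"
  have L: "kron_sum r s Z Z' \<in> carrier_mat m m" using kron_sum_carrier[OF Z Z'] by (simp add: m_def)
  have LV: "kron_sum r s Z Z' * V = V * mat_diag m \<nu>"
  proof -
    have d: "mat_diag m \<nu> = kron (mat_diag r ev') (1\<^sub>m r) + s \<cdot>\<^sub>m kron (1\<^sub>m r) (mat_diag r ev)"
    proof (rule eq_matI)
      fix i j assume "i < dim_row (kron (mat_diag r ev') (1\<^sub>m r) + s \<cdot>\<^sub>m kron (1\<^sub>m r) (mat_diag r ev))"
        "j < dim_col (kron (mat_diag r ev') (1\<^sub>m r) + s \<cdot>\<^sub>m kron (1\<^sub>m r) (mat_diag r ev))"
      then have ij: "i < r * r" "j < r * r" by auto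
      have "i = j \<longleftrightarrow> i div r = j div r \<and> i mod r = j mod r" by (metis div_mult_mod_eq)
      then show "mat_diag m \<nu> $$ (i, j) = (kron (mat_diag r ev') (1\<^sub>m r) + s \<cdot>\<^sub>m kron (1\<^sub>m r) (mat_diag r ev)) $$ (i, j)"
        using ij composite_split[OF ij(1)] composite_split[OF ij(2)]
        by (auto simp: kron_index mat_diag_index m_def \<nu>_def)
    qed (auto simp: m_def)
    have k: "kron A B \<in> carrier_mat m m" if "A \<in> carrier_mat r r" "B \<in> carrier_mat r r" for A B
      using that by (simp add: m_def)
    have Zt: "transpose_mat Z \<in> carrier_mat r r" using Z by simp
    have "kron_sum r s Z Z' * V = kron Z' (1\<^sub>m r) * V + (s \<cdot>\<^sub>m kron (1\<^sub>m r) (transpose_mat Z)) * V"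
      unfolding kron_sum_def using k[OF Z' one_carrier_mat] k[OF one_carrier_mat Zt] V by (intro add_mult_distrib_mat) auto
    also have "\<dots> = kron Z' (1\<^sub>m r) * V + s \<cdot>\<^sub>m (kron (1\<^sub>m r) (transpose_mat Z) * V)"
      using mult_smult_assoc_mat[OF k[OF one_carrier_mat Zt] V] by simp
    also have "kron Z' (1\<^sub>m r) * V = V * kron (mat_diag r ev') (1\<^sub>m r)"
      unfolding V_def Y_def[symmetric] using Z' Xc' Yt by (simp add: kron_mult)
    also have "kron (1\<^sub>m r) (transpose_mat Z) * V = V * kron (1\<^sub>m r) (mat_diag r ev)"
      unfolding V_def Y_def[symmetric] using Z Xc' Yt ZtYt by (simp add: kron_mult)
    also have "s \<cdot>\<^sub>m (V * kron (1\<^sub>m r) (mat_diag r ev)) = V * (s \<cdot>\<^sub>m kron (1\<^sub>m r) (mat_diag r ev))"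
      using mult_smult_distrib[OF V k[OF one_carrier_mat dg]] by simp
    also have "V * kron (mat_diag r ev') (1\<^sub>m r) + V * (s \<cdot>\<^sub>m kron (1\<^sub>m r) (mat_diag r ev)) = V * mat_diag m \<nu>"
      unfolding d using k[OF dg one_carrier_mat] k[OF one_carrier_mat dg] V by (intro mult_add_distrib_mat[symmetric]) auto
    finally show ?thesis .
  qed
  have t: "trace_row r \<in> carrier_mat 1 m" by (simp add: trace_row_def m_def)
  have K: "krylov r s Z Z' \<in> carrier_mat m m" by (simp add: krylov_def m_def)
  have "krylov r s Z Z' * V = Matrix.mat m m (\<lambda>(i, c). (minv X * X') $$ (c mod r, c div r) * \<nu> c ^ i)"
  proof (rule eq_matI)
    fix i c assume "i < dim_row (Matrix.mat m m (\<lambda>(i, c). (minv X * X') $$ (c mod r, c div r) * \<nu> c ^ i))"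
      "c < dim_col (Matrix.mat m m (\<lambda>(i, c). (minv X * X') $$ (c mod r, c div r) * \<nu> c ^ i))"
    then have ic: "i < m" "c < m" by auto
    have Li: "kron_sum r s Z Z' ^\<^sub>m i \<in> carrier_mat m m" using L by simp
    have tLi: "trace_row r * kron_sum r s Z Z' ^\<^sub>m i \<in> carrier_mat 1 m" using t Li by simp
    have "(krylov r s Z Z' * V) $$ (i, c) = (trace_row r * kron_sum r s Z Z' ^\<^sub>m i * V) $$ (0, c)"
      unfolding mult_index[OF K V ic] mult_index[OF tLi V less_one[THEN iffD2, OF refl] ic(2)]
      using ic by (intro sum.cong refl) (simp add: krylov_def m_def)
    also have "\<dots> = (trace_row r * V * mat_diag m (\<lambda>k. \<nu> k ^ i)) $$ (0, c)"
      unfolding assoc_mult_mat[OF t Li V] eigenvectors_power[OF L V LV]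
      using assoc_mult_mat[OF t V mat_diag_dim, of "\<lambda>k. \<nu> k ^ i"] by simp
    also have "\<dots> = (trace_row r * V) $$ (0, c) * \<nu> c ^ i"
      unfolding mat_diag_mult_right[OF mult_carrier_mat[OF t V]] using ic by simp
    also have "(trace_row r * V) $$ (0, c) = (minv X * X') $$ (c mod r, c div r)"
      unfolding V_def using trace_row_kron[OF Xc'(1) mY(1)] ic by (simp add: m_def Y_def)
    finally show "(krylov r s Z Z' * V) $$ (i, c) =
        Matrix.mat m m (\<lambda>(i, c). (minv X * X') $$ (c mod r, c div r) * \<nu> c ^ i) $$ (i, c)"
      using ic by simp
  qed (use K V in auto)
  then show "krylov r s Z Z' * V = Matrix.mat (r * r) (r * r)
       (\<lambda>(i, c). (minv X * X') $$ (c mod r, c div r) * (ev' (c div r) + s * ev (c mod r)) ^ i)"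
    by (simp add: m_def \<nu>_def)
qed

lemma ex_separating_scalar:
  fixes ev ev' :: "nat \<Rightarrow> complex"
  assumes "inj_on ev {..<r}" "inj_on ev' {..<r}"
  obtains s where "inj_on (\<lambda>c. ev' (c div r) + s * ev (c mod r)) {..<r * r}"
proof -
  \<comment> \<open>These are the ratios at which two sums of eigenvalues can collide. Quadruples
    with \<open>c = d\<close> only contribute the value 0 of a division by zero.\<close>
  define B where "B = (\<lambda>(a, b, c, d). (ev' a - ev' b) / (ev c - ev d)) ` ({..<r} \<times> {..<r} \<times> {..<r} \<times> {..<r})"
  have "finite B" by (simp add: B_def)
  then obtain s where s: "s \<notin> B" using ex_new_if_finite[OF infinite_UNIV_char_0] by blast
  have "inj_on (\<lambda>c. ev' (c div r) + s * ev (c mod r)) {..<r * r}"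
  proof (rule inj_onI)
    fix x y assume xy: "x \<in> {..<r * r}" "y \<in> {..<r * r}"
      "ev' (x div r) + s * ev (x mod r) = ev' (y div r) + s * ev (y mod r)"
    have lt: "x div r < r" "x mod r < r" "y div r < r" "y mod r < r" using xy composite_split by auto
    have eq: "s * (ev (y mod r) - ev (x mod r)) = ev' (x div r) - ev' (y div r)"
      using xy(3) by (simp add: algebra_simps)
    have m: "x mod r = y mod r"
    proof (rule ccontr)
      assume "x mod r \<noteq> y mod r"
      then have "ev (y mod r) - ev (x mod r) \<noteq> 0" using assms(1) lt by (auto dest: inj_onD)
      then have "s = (ev' (x div r) - ev' (y div r)) / (ev (y mod r) - ev (x mod r))"
        using eq by (simp add: field_simps)
      then have "s \<in> B" unfolding B_def
        by (intro image_eqI[of _ _ "(x div r, y div r, y mod r, x mod r)"]) (use lt in auto)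
      then show False using s by simp
    qed
    then have "ev' (x div r) = ev' (y div r)" using eq by simp
    then have "x div r = y div r" using assms(2) lt by (auto dest: inj_onD)
    with m show "x = y" by (metis div_mult_mod_eq)
  qed
  then show thesis by (rule that)
qed

text \<open>Quantifying over all eigenbases removes any dependence on order and scaling. The
  condition is vacuous without simple spectra, so \<open>good_pairs\<close> asks for eigenbases
  separately.\<close>

definition transverse :: "nat \<Rightarrow> complex mat \<Rightarrow> complex mat \<Rightarrow> bool" where
  "transverse r Z Z' \<longleftrightarrow> (\<forall>X ev X' ev'. distinct_eigenbasis r Z X ev \<longrightarrow> distinct_eigenbasis r Z' X' ev' \<longrightarrow>
     (\<forall>j<r. \<forall>k<r. (minv X * X') $$ (j, k) \<noteq> 0))"

text \<open>A zero in the change of basis would be a zero column of the scaled Vandermonde matrix,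
  which is invertible.\<close>

lemma transverse_if_krylov:
  assumes Z: "Z \<in> carrier_mat r r" and Z': "Z' \<in> carrier_mat r r" and det: "det (krylov r s Z Z') \<noteq> 0"
  shows "transverse r Z Z'"
  unfolding transverse_def
proof (intro allI impI notI)
  fix X ev X' ev' j k
  assume b: "distinct_eigenbasis r Z X ev" "distinct_eigenbasis r Z' X' ev'" and jk: "j < r" "k < r"
    and z: "(minv X * X') $$ (j, k) = 0"
  define V where "V = kron X' (transpose_mat (minv X))"
  note kb = krylov_eigenbasis[OF Z Z' b, folded V_def]
  have K: "krylov r s Z Z' \<in> carrier_mat (r * r) (r * r)" by (simp add: krylov_def)
  have "invertible_mat (krylov r s Z Z' * V)"
    using kb(1,2) K det by (simp add: invertible_mat_mult_iff[of _ "r * r"] invertible_mat_iff_det[OF K])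
  moreover define M where "M = krylov r s Z Z' * V"
  ultimately have inv: "invertible_mat M" by simp
  have Mc: "M \<in> carrier_mat (r * r) (r * r)" using K kb(2) by (simp add: M_def)
  define c where "c = k * r + j"
  have c: "c < r * r" using jk by (auto simp: c_def intro: composite_less)
  have "(minv M * M) $$ (c, c) = 0"
    unfolding mult_index[OF minv(1)[OF Mc inv] Mc c c]
  proof (rule sum.neutral, rule ballI)
    fix t assume "t \<in> {..<r * r}"
    then have "M $$ (t, c) = 0" unfolding M_def kb(3) using c z jk by (simp add: c_def)
    then show "minv M $$ (c, t) * M $$ (t, c) = 0" by simp
  qed
  then show False using minv(3)[OF Mc inv] c by simp
qed

text \<open>With a separating scalar the Vandermonde nodes are distinct, and the column scalings are
  nonzero.\<close>

lemma ex_krylov_if_transverse: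
  assumes Z: "Z \<in> carrier_mat r r" and Z': "Z' \<in> carrier_mat r r"
    and b: "distinct_eigenbasis r Z X ev" "distinct_eigenbasis r Z' X' ev'"
    and W: "\<And>j k. j < r \<Longrightarrow> k < r \<Longrightarrow> (minv X * X') $$ (j, k) \<noteq> 0"
  shows "\<exists>s. det (krylov r s Z Z') \<noteq> 0"
proof -
  have inj: "inj_on ev {..<r}" "inj_on ev' {..<r}" using b by (auto simp: distinct_eigenbasis_def)
  obtain s where s: "inj_on (\<lambda>c. ev' (c div r) + s * ev (c mod r)) {..<r * r}"
    using ex_separating_scalar[OF inj] .
  define V where "V = kron X' (transpose_mat (minv X))"
  note kb = krylov_eigenbasis(1,2)[OF Z Z' b, folded V_def] krylov_eigenbasis(3)[OF Z Z' b, of s, folded V_def]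
  have K: "krylov r s Z Z' \<in> carrier_mat (r * r) (r * r)" by (simp add: krylov_def)
  define M where "M = krylov r s Z Z' * V"
  have Mc: "M \<in> carrier_mat (r * r) (r * r)" using K kb(2) by (simp add: M_def)
  have "det M \<noteq> 0"
  proof
    assume "det M = 0"
    then obtain v where v: "v \<in> carrier_vec (r * r)" "v \<noteq> 0\<^sub>v (r * r)" "M *\<^sub>v v = 0\<^sub>v (r * r)"
      using det_0_iff_vec_prod_zero[OF Mc] by blast
    have "(minv X * X') $$ (c mod r, c div r) * v $ c = 0" if c: "c < r * r" for c
    proof (rule vandermonde_zero[OF s _ c])
      fix i assume i: "i < r * r"
      have "0 = (M *\<^sub>v v) $ i" using v(3) i by simp
      also have "\<dots> = (\<Sum>c<r * r. (minv X * X') $$ (c mod r, c div r) * v $ c * (ev' (c div r) + s * ev (c mod r)) ^ i)"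
        unfolding mult_vec_index[OF Mc v(1) i] using i by (intro sum.cong refl) (simp add: M_def kb(3) mult_ac)
      finally show "(\<Sum>c<r * r. (minv X * X') $$ (c mod r, c div r) * v $ c * (ev' (c div r) + s * ev (c mod r)) ^ i) = 0"
        by simp
    qed
    then have "v $ c = 0" if "c < r * r" for c
      using that W[of "c mod r" "c div r"] composite_split[OF that] by auto
    then have "v = 0\<^sub>v (r * r)" using v(1) by (intro eq_vecI) auto
    then show False using v(2) by simp
  qed
  then have "det (krylov r s Z Z') \<noteq> 0"
    unfolding M_def det_mult[OF K kb(2)] by simp
  then show ?thesis by blast
qed

lemma generic_transverse:
  assumes A: "polymat I r r A" and A': "polymat I r r A'"
    and b: "distinct_eigenbasis r (A x0) X ev" "distinct_eigenbasis r (A' x0) X' ev'"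
    and W: "\<And>j k. j < r \<Longrightarrow> k < r \<Longrightarrow> (minv X * X') $$ (j, k) \<noteq> 0"
  obtains P where "polyfun I P" "P x0 \<noteq> 0" "\<And>x. P x \<noteq> 0 \<Longrightarrow> transverse r (A x) (A' x)"
proof -
  \<comment> \<open>The scalar is chosen at \<open>x0\<close> and kept for all \<open>x\<close>:
    passing from the determinant to transversality is possible for every scalar.\<close>
  obtain s where s: "det (krylov r s (A x0) (A' x0)) \<noteq> 0"
    using ex_krylov_if_transverse[OF polymat_carrier[OF A] polymat_carrier[OF A'] b W] by blast
  have one: "polymat I r r (\<lambda>_. 1\<^sub>m r)" by (rule polymat_const) simp
  have L: "polymat I (r * r) (r * r) (\<lambda>x. kron_sum r s (A x) (A' x))"
    unfolding kron_sum_def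
    by (intro polymat_add polymat_kron polymat_smult polymat_transpose A A' one)
  have t: "polymat I 1 (r * r) (\<lambda>_. trace_row r)" by (rule polymat_const) (simp add: trace_row_def)
  have "polymat I (r * r) (r * r) (\<lambda>x. krylov r s (A x) (A' x))"
  proof (rule polymatI)
    fix i j assume ij: "i < r * r" "j < r * r"
    then show "polyfun I (\<lambda>x. krylov r s (A x) (A' x) $$ (i, j))"
      using polymat_index[OF polymat_mult[OF t polymat_pow[OF L, of i]], of 0 j] by (simp add: krylov_def)
  qed (simp add: krylov_def)
  then have "polyfun I (\<lambda>x. det (krylov r s (A x) (A' x)))" by (rule polyfun_det)
  then show thesis
    using that[of "\<lambda>x. det (krylov r s (A x) (A' x))"] s
      transverse_if_krylov[OF polymat_carrier[OF A] polymat_carrier[OF A']] by blast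
qed

section \<open>Eigenvalues of multiplicity r and roots of the characteristic polynomial\<close>

lemma polyfun_root_coeff:
  fixes r :: nat and c :: "('i \<Rightarrow> complex) \<Rightarrow> complex poly"
  assumes c: "polyfun_poly I c" and r: "r > 0"
  shows "\<exists>h. polyfun I h \<and> (\<forall>x g. c x = g ^ r \<and> coeff g 0 = 1 \<longrightarrow> coeff g k = h x)"
proof (induction k rule: less_induct)
  case (less k)
  show ?case
  proof (cases k)
    case 0
    then show ?thesis by (intro exI[of _ "\<lambda>_. 1"]) (auto intro: polyfun_const)
  next
    case (Suc k')
    obtain h where h: "\<And>j. j < k \<Longrightarrow> polyfun I (h j)"
      "\<And>j x g. j < k \<Longrightarrow> c x = g ^ r \<Longrightarrow> coeff g 0 = 1 \<Longrightarrow> coeff g j = h j x"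
      using less.IH by metis
    text \<open>Solve the coefficient of \<open>g c' = r g' c\<close> at position \<open>k - 1\<close> for the leading unknown.\<close>
    define f where "f = (\<lambda>x. (\<Sum>i\<le>k'. (of_nat (Suc i) * coeff (c x) (Suc i)) * h (k' - i) x)
      - of_nat r * (\<Sum>i<k'. (of_nat (Suc i) * h (Suc i) x) * coeff (c x) (k' - i)))"
    have "polyfun I f"
      unfolding f_def using Suc
      by (intro polyfun_diff polyfun_mult polyfun_sum polyfun_const polyfun_polyD[OF c] h(1)) auto
    then have "polyfun I (\<lambda>x. (1 / (of_nat r * of_nat k)) * f x)" by (intro polyfun_mult polyfun_const)
    moreover have "coeff g k = (1 / (of_nat r * of_nat k)) * f x" if g: "c x = g ^ r" "coeff g 0 = 1" for x g
    proof -
      have "pderiv (c x) * g = Polynomial.smult (of_nat r) (pderiv g * c x)"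
      proof -
        obtain r' where "r = Suc r'" using r by (cases r) auto
        then show ?thesis unfolding g(1) pderiv_power by (simp add: mult_ac)
      qed
      then have "coeff (pderiv (c x) * g) k' = of_nat r * coeff (pderiv g * c x) k'" by simp
      then have 1: "(\<Sum>i\<le>k'. (of_nat (Suc i) * coeff (c x) (Suc i)) * coeff g (k' - i)) =
          of_nat r * (\<Sum>i\<le>k'. (of_nat (Suc i) * coeff g (Suc i)) * coeff (c x) (k' - i))"
        by (simp add: coeff_mult coeff_pderiv)
      define S where "S = (\<Sum>i<k'. (of_nat (Suc i) * coeff g (Suc i)) * coeff (c x) (k' - i))"
      \<comment> \<open>The constant coefficient of \<open>c x\<close> is 1 because that of
        \<open>g\<close> is, so the last summand, \<open>i = k'\<close>, contains the unknown
        \<open>coeff g k\<close> with the factor \<open>of_nat k\<close>.\<close>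
      have 2: "(\<Sum>i\<le>k'. (of_nat (Suc i) * coeff g (Suc i)) * coeff (c x) (k' - i)) = S + of_nat k * coeff g k"
        using g by (simp add: S_def lessThan_Suc_atMost[symmetric] Suc coeff_0_power)
      have "f x = (\<Sum>i\<le>k'. (of_nat (Suc i) * coeff (c x) (Suc i)) * coeff g (k' - i)) - of_nat r * S"
        unfolding f_def S_def using h(2)[OF _ g] Suc
        by (intro arg_cong2[of _ _ _ _ minus] arg_cong2[of _ _ _ _ times] sum.cong refl) auto
      then have "of_nat r * (of_nat k * coeff g k) = f x"
        unfolding 1 2 by (simp only: ring_distribs add_diff_cancel_left')
      moreover have "of_nat r * of_nat k \<noteq> (0 :: complex)" using r Suc by (simp del: of_nat_Suc)
      ultimately show ?thesis by (simp only: mult.assoc[symmetric]) (simp del: mult_eq_0_iff of_nat_mult add: eq_divide_imp mult.commute)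
    qed
    ultimately show ?thesis by blast
  qed
qed

lemma prod_composite: "(\<Prod>t<a * b. f (t div b) (t mod b)) = (\<Prod>i<a. \<Prod>j<b. f i (j :: nat))"
proof -
  have "(\<Prod>i<a. \<Prod>j<b. f i j) = (\<Prod>(i, j)\<in>{..<a} \<times> {..<b}. f i j)"
    by (rule prod.cartesian_product)
  also have "\<dots> = (\<Prod>t<a * b. f (t div b) (t mod b))"
    by (rule prod.reindex_bij_witness[of _ "\<lambda>t. (t div b, t mod b)" "\<lambda>(i, j). i * b + j"])
      (auto simp: composite_less composite_split)
  finally show ?thesis ..
qed

text \<open>Only the multiplicity pattern of the spectrum is recorded. The values may coincide or
  vanish, so the notion survives multiplication by any scalar.\<close>

definition uniform_spectrum :: "nat \<Rightarrow> complex mat \<Rightarrow> bool" where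
  "uniform_spectrum r N \<longleftrightarrow> (\<exists>G ev. G \<in> carrier_mat (r * r) (r * r) \<and> invertible_mat G \<and>
     N * G = G * kron (1\<^sub>m r) (mat_diag r ev))"

lemma char_poly_uniform_spectrum:
  assumes N: "N \<in> carrier_mat (r * r) (r * r)" and "uniform_spectrum r N"
  obtains q where "char_poly N = q ^ r" "degree q = r" "lead_coeff q = 1"
proof -
  define m where "m = r * r"
  obtain G ev where G: "G \<in> carrier_mat m m" "invertible_mat G" and eq: "N * G = G * kron (1\<^sub>m r) (mat_diag r ev)"
    using assms(2) by (auto simp: uniform_spectrum_def m_def)
  note N = N[folded m_def]
  define \<Lambda> where "\<Lambda> = kron (1\<^sub>m r) (mat_diag r ev)"
  have \<Lambda>: "\<Lambda> \<in> carrier_mat m m" by (simp add: \<Lambda>_def m_def)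
  note mG = minv[OF G]
  have "N = G * \<Lambda> * minv G"
    using mult_minv_cancel(3)[OF G N] eq by (simp add: \<Lambda>_def)
  then have "similar_mat_wit N \<Lambda> G (minv G)"
    using N \<Lambda> G mG by (intro similar_mat_witI[of _ _ m]) auto
  then have "char_poly N = char_poly \<Lambda>" by (intro char_poly_similar) (auto simp: similar_mat_def)
  also have "\<dots> = (\<Prod>a\<leftarrow>diag_mat \<Lambda>. [:- a, 1:])"
    by (rule char_poly_upper_triangular[OF \<Lambda>]) (use \<Lambda> in \<open>auto simp: \<Lambda>_def kron_one_diag m_def\<close>)
  also have "\<dots> = (\<Prod>x<m. [:- ev (x mod r), 1:])"
    using \<Lambda> unfolding diag_mat_def
    by (simp add: prod.list_conv_set_nth atLeast0LessThan) (intro prod.cong, auto simp: \<Lambda>_def kron_one_diag m_def)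
  also have "\<dots> = (\<Prod>k<r. [:- ev k, 1:]) ^ r"
    unfolding m_def using prod_composite[of "\<lambda>i j. [:- ev j, 1:]" r r] by simp
  finally show thesis
  proof (rule that)
    have nz: "(\<Prod>k<r. [:- ev k, 1:]) \<noteq> 0" by simp
    show "degree (\<Prod>k<r. [:- ev k, 1:]) = r" by (subst degree_prod_eq_sum_degree) auto
    show "lead_coeff (\<Prod>k<r. [:- ev k, 1:]) = 1" by (simp add: lead_coeff_prod)
  qed
qed

text \<open>
  If all eigenvalues have multiplicity \<open>r\<close>, then the constant coefficient of the characteristic
  polynomial is an \<open>r\<close>-th power, and the root is a polynomial in the entries of the matrix.
\<close>

lemma uniform_spectrum_det_power:
  assumes N: "polymat I (r * r) (r * r) N" and r: "r > 0"
  obtains s where "polyfun I s"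
    "\<And>x. uniform_spectrum r (N x) \<Longrightarrow> s x ^ r = (-1) ^ (r * r) * det (N x)"
proof -
  define m where "m = r * r"
  \<comment> \<open>Reflection makes the leading coefficient 1 the constant one, as
    \<open>polyfun_root_coeff\<close> requires. The constant coefficient of a root of degree
    \<open>r\<close> then sits at position \<open>r\<close>.\<close>
  define c where "c = (\<lambda>x. reflect_poly (char_poly (N x)))"
  note Nc = polymat_carrier[OF N, folded m_def]
  have ch: "degree (char_poly (N x)) = m" "coeff (char_poly (N x)) m = 1" for x
    using degree_monic_char_poly[OF Nc] by auto
  have "polyfun_poly I c"
    unfolding c_def
  proof (rule polyfun_polyI)
    fix k show "polyfun I (\<lambda>x. coeff (reflect_poly (char_poly (N x))) k)"
      unfolding coeff_reflect_poly ch
      by (intro polyfun_if polyfun_const polyfun_polyD[OF polyfun_poly_char_poly[OF N]])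
  qed
  from polyfun_root_coeff[OF this r, of r] obtain s where s: "polyfun I s"
    "\<And>x g. c x = g ^ r \<Longrightarrow> coeff g 0 = 1 \<Longrightarrow> coeff g r = s x" by blast
  show thesis
  proof (rule that[OF s(1)])
    fix x assume u: "uniform_spectrum r (N x)"
    obtain q where q: "char_poly (N x) = q ^ r" "degree q = r" "lead_coeff q = 1"
      using char_poly_uniform_spectrum[OF polymat_carrier[OF N] u] by blast
    have "c x = reflect_poly q ^ r" by (simp add: c_def q(1) reflect_poly_power)
    moreover have "coeff (reflect_poly q) 0 = 1" using q by (simp add: coeff_reflect_poly)
    ultimately have "coeff (reflect_poly q) r = s x" by (rule s(2))
    then have "s x = coeff q 0" using q(2) by (simp add: coeff_reflect_poly)
    then have "s x ^ r = coeff (char_poly (N x)) 0" by (simp add: q(1) coeff_0_power)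
    also have "\<dots> = det (- N x)"
    proof -
      have "char_matrix (N x) 0 = N x" using Nc[of x] by (intro eq_matI) (auto simp: char_matrix_def)
      then show ?thesis using char_poly_matrix[OF Nc[of x], of 0] by (simp add: poly_0_coeff_0)
    qed
    also have "- N x = (-1) \<cdot>\<^sub>m N x" by (intro eq_matI) auto
    also have "det ((-1) \<cdot>\<^sub>m N x) = (-1) ^ m * det (N x)" using Nc[of x] by simp
    finally show "s x ^ r = (-1) ^ (r * r) * det (N x)" by (simp add: m_def)
  qed
qed

section \<open>Genericity of the core\<close>

definition core_index :: "nat \<Rightarrow> nat \<Rightarrow> (nat \<times> nat \<times> nat) set" where
  "core_index n r = {..<n} \<times> {..<r} \<times> {..<r}"

lemma polymat_slice:
  assumes "a < n"
  shows "polymat (core_index n r) r r (\<lambda>Q. slice r Q a)"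
proof (rule polymatI)
  fix i j assume "i < r" "j < r"
  then show "polyfun (core_index n r) (\<lambda>Q. slice r Q a $$ (i, j))"
    using assms by (auto simp: slice_def core_index_def intro!: polyfun_coord)
qed simp

lemma polymat_slice_word:
  assumes "set as \<subseteq> {..<n}"
  shows "polymat (core_index n r) r r (\<lambda>Q. slice_word r (slice r Q) as)"
  using assms
proof (induction as)
  case Nil
  show ?case by (simp add: slice_word_def polymat_const)
next
  case (Cons a as)
  then show ?case
    using polymat_mult[OF polymat_slice[of a n r], of r "\<lambda>Q. slice_word r (slice r Q) as"]
    by (simp add: slice_word_def)
qed

lemma polymat_square_cols:
  assumes \<Gamma>: "\<Gamma> \<subseteq> {..<n}"
  shows "polymat (core_index n r) (r * r) (card \<Gamma>) (\<lambda>Q. square_cols n r (slice r Q) \<Gamma>)"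
proof (rule polymatI)
  fix i j assume ij: "i < r * r" "j < card \<Gamma>"
  show "polyfun (core_index n r) (\<lambda>Q. square_cols n r (slice r Q) \<Gamma> $$ (i, j))"
    unfolding square_cols_index[OF \<Gamma> ij]
    by (intro polymat_index[OF polymat_slice]) (use pick_less[OF \<Gamma> ij(2)] composite_split[OF ij(1)] in auto)
qed (rule square_cols_carrier[OF \<Gamma>])

lemma polyfun_det_slice:
  "a < n \<Longrightarrow> polyfun (core_index n r) (\<lambda>Q. det (slice r Q a))"
  by (rule polyfun_det[OF polymat_slice])

lemma polyfun_det_square_cols:
  assumes "\<Gamma> \<subseteq> {..<n}" "card \<Gamma> = r * r"
  shows "polyfun (core_index n r) (\<lambda>Q. det (square_cols n r (slice r Q) \<Gamma>))"
  using polymat_square_cols[OF assms(1), of r] assms(2) by (intro polyfun_det) simp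

lemma ex_det_slice_nonzero: "\<exists>Q. det (slice r Q a) \<noteq> 0"
proof -
  have "slice r (\<lambda>(a, i, j). if i = j then 1 else 0) a = 1\<^sub>m r"
    by (intro eq_matI) (auto simp: slice_def)
  then show ?thesis by (metis det_one zero_neq_one)
qed

lemma ex_det_square_cols_nonzero:
  assumes \<Gamma>: "\<Gamma> \<subseteq> {..<n}" "card \<Gamma> = r * r"
  shows "\<exists>Q. det (square_cols n r (slice r Q) \<Gamma>) \<noteq> 0"
proof -
  \<comment> \<open>The cardinality is the position of \<open>a\<close> in \<Gamma>. The slice at
    that position is the matrix unit whose vectorization is the unit vector of the same number, so
    the selected columns form the identity.\<close>
  define Q where "Q = (\<lambda>(a, i, j). if card {b \<in> \<Gamma>. b < a} = j * r + i then 1 else 0 :: complex)"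
  have "square_cols n r (slice r Q) \<Gamma> = 1\<^sub>m (r * r)"
  proof (rule eq_matI)
    fix c j assume "c < dim_row (1\<^sub>m (r * r) :: complex mat)" "j < dim_col (1\<^sub>m (r * r) :: complex mat)"
    then have cj: "c < r * r" "j < card \<Gamma>" using \<Gamma> by auto
    have "card {b \<in> \<Gamma>. b < pick \<Gamma> j} = j" using cj(2) by (intro card_pick) auto
    then show "square_cols n r (slice r Q) \<Gamma> $$ (c, j) = 1\<^sub>m (r * r) $$ (c, j)"
      unfolding square_cols_index[OF \<Gamma>(1) cj] using cj composite_split[OF cj(1)] \<Gamma>
      by (simp add: slice_def Q_def)
  qed (use square_cols_carrier[OF \<Gamma>(1), of r "slice r Q"] \<Gamma> in auto)
  then show ?thesis by (metis det_one zero_neq_one)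
qed

section \<open>Adjugates and the scaling of one slice\<close>

lemma adj_mat_eq_minv:
  assumes A: "A \<in> carrier_mat r r" "invertible_mat A"
  shows "adj_mat A = det A \<cdot>\<^sub>m minv A"
proof -
  note ad = adj_mat[OF A(1)] and m = minv[OF A]
  have "minv A * (A * adj_mat A) = minv A * (det A \<cdot>\<^sub>m 1\<^sub>m r)" using ad by simp
  then show ?thesis
    using mult_minv_cancel(2)[OF A ad(1)] m(1) by (simp add: mult_smult_distrib[OF m(1) one_carrier_mat])
qed

lemma adj_mat_smult:
  assumes A: "A \<in> carrier_mat r r"
  shows "adj_mat (c \<cdot>\<^sub>m A) = c ^ (r - 1) \<cdot>\<^sub>m adj_mat (A :: complex mat)"
proof (rule eq_matI)
  fix i j assume "i < dim_row (c ^ (r - 1) \<cdot>\<^sub>m adj_mat A)" "j < dim_col (c ^ (r - 1) \<cdot>\<^sub>m adj_mat A)"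
  then have ij: "i < r" "j < r" using adj_mat(1)[OF A] by auto
  have "mat_delete (c \<cdot>\<^sub>m A) j i = c \<cdot>\<^sub>m mat_delete A j i"
    using A ij by (intro eq_matI) (auto simp: mat_delete_def)
  moreover have "dim_col (mat_delete A j i) = r - 1" using A by simp
  ultimately show "adj_mat (c \<cdot>\<^sub>m A) $$ (i, j) = (c ^ (r - 1) \<cdot>\<^sub>m adj_mat A) $$ (i, j)"
    using A ij by (simp add: adj_mat_def cofactor_def)
qed (use adj_mat(1)[OF A] adj_mat(1)[of "c \<cdot>\<^sub>m A" r] A in auto)

lemma kron_one_smult: "kron (1\<^sub>m r) (c \<cdot>\<^sub>m A) = c \<cdot>\<^sub>m kron (1\<^sub>m r) (A :: complex mat)"
proof (rule eq_matI)
  fix i j assume "i < dim_row (c \<cdot>\<^sub>m kron (1\<^sub>m r) A)" "j < dim_col (c \<cdot>\<^sub>m kron (1\<^sub>m r) A)"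
  then have ij: "i < r * dim_row A" "j < r * dim_col A" by auto
  show "kron (1\<^sub>m r) (c \<cdot>\<^sub>m A) $$ (i, j) = (c \<cdot>\<^sub>m kron (1\<^sub>m r) A) $$ (i, j)"
    using ij composite_split[OF ij(1)] composite_split[OF ij(2)] by (simp add: kron_index)
qed auto

lemma det_mat_diag: "det (mat_diag n f) = (\<Prod>i<n. f i :: complex)"
proof -
  have "det (mat_diag n f) = prod_list (diag_mat (mat_diag n f))"
    by (rule det_upper_triangular[of _ n]) (auto simp: mat_diag_index)
  also have "\<dots> = (\<Prod>i<n. f i)"
    unfolding diag_mat_def by (simp add: prod.list_conv_set_nth atLeast0LessThan mat_diag_index)
  finally show ?thesis .
qed

definition scale_slice :: "nat \<Rightarrow> complex \<Rightarrow> core \<Rightarrow> core" where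
  "scale_slice b t Q = (\<lambda>(a, i, j). (if a = b then t else 1) * Q (a, i, j))"

lemma slice_scale: "slice r (scale_slice b t Q) a = (if a = b then t else 1) \<cdot>\<^sub>m slice r Q a"
  by (intro eq_matI) (auto simp: slice_def scale_slice_def)

lemma slice_word_scale:
  "slice_word r (slice r (scale_slice b t Q)) as = t ^ count_list as b \<cdot>\<^sub>m slice_word r (slice r Q) as"
proof (induction as)
  case Nil
  show ?case by (auto simp: slice_word_def intro!: eq_matI)
next
  case (Cons a as)
  have w: "slice_word r (slice r Q) as \<in> carrier_mat r r" "slice r Q a \<in> carrier_mat r r" by auto
  have "slice_word r (slice r (scale_slice b t Q)) (a # as) =
      ((if a = b then t else 1) \<cdot>\<^sub>m slice r Q a) * (t ^ count_list as b \<cdot>\<^sub>m slice_word r (slice r Q) as)"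
    unfolding Cons[symmetric] slice_scale[symmetric] by (simp add: slice_word_def)
  also have "\<dots> = (if a = b then t else 1) \<cdot>\<^sub>m (t ^ count_list as b \<cdot>\<^sub>m (slice r Q a * slice_word r (slice r Q) as))"
    by (subst mult_smult_assoc_mat[of _ r r _ r], simp, simp, subst mult_smult_distrib[of _ r r _ r]) auto
  also have "\<dots> = t ^ count_list (a # as) b \<cdot>\<^sub>m slice_word r (slice r Q) (a # as)"
    by (intro eq_matI) (auto simp: slice_word_def)
  finally show ?case .
qed

lemma det_square_cols_scale:
  assumes \<Gamma>: "\<Gamma> \<subseteq> {..<n}" "card \<Gamma> = r * r"
  shows "det (square_cols n r (slice r (scale_slice b t Q)) \<Gamma>) =
    (if b \<in> \<Gamma> then t else 1) * det (square_cols n r (slice r Q) \<Gamma>)"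
proof -
  define f where "f = (\<lambda>j. if pick \<Gamma> j = b then t else 1)"
  have V: "square_cols n r S \<Gamma> \<in> carrier_mat (r * r) (r * r)" for S
    using square_cols_carrier[OF \<Gamma>(1), of r S] \<Gamma>(2) by simp
  have "square_cols n r (slice r (scale_slice b t Q)) \<Gamma> = square_cols n r (slice r Q) \<Gamma> * mat_diag (r * r) f"
    unfolding mat_diag_mult_right[OF V] using V \<Gamma>
    by (intro eq_matI) (auto simp: square_cols_index[OF \<Gamma>(1)] scale_slice_def f_def slice_def composite_split mult.commute)
  then have "det (square_cols n r (slice r (scale_slice b t Q)) \<Gamma>) = det (square_cols n r (slice r Q) \<Gamma>) * (\<Prod>j<r * r. f j)"
    using det_mult[OF V mat_diag_dim] by (simp add: det_mat_diag)
  moreover have "(\<Prod>j<r * r. f j) = (if b \<in> \<Gamma> then t else 1)"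
  proof (cases "b \<in> \<Gamma>")
    case True
    define j0 where "j0 = card {a \<in> \<Gamma>. a < b}"
    have "finite \<Gamma>" using \<Gamma> finite_subset by blast
    have j0: "j0 < r * r" "pick \<Gamma> j0 = b"
      unfolding j0_def \<Gamma>(2)[symmetric] using True pick_card_in_set[OF True] \<open>finite \<Gamma>\<close>
      by (auto intro!: psubset_card_mono)
    have "f j = 1" if "j < r * r" "j \<noteq> j0" for j
    proof -
      have "card {a \<in> \<Gamma>. a < pick \<Gamma> j} = j" using that \<Gamma>(2) by (intro card_pick) auto
      then show ?thesis using that by (auto simp: f_def j0_def)
    qed
    then have "(\<Prod>j<r * r. f j) = f j0" using j0(1) by (subst prod.remove[of _ j0]) auto
    then show ?thesis using True j0 by (simp add: f_def)
  next
    case False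
    then have "f j = 1" if "j < r * r" for j
      using pick_less(2)[OF \<Gamma>(1), of j] that \<Gamma>(2) by (auto simp: f_def)
    then show ?thesis using False by simp
  qed
  ultimately show ?thesis by simp
qed

text \<open>
  Apart from a nonzero factor and the conjugation by an unfolding, \<open>adj_ratio\<close> is the matrix of the first
  step; adjugates in place of inverses make it a polynomial in the entries of the core.
\<close>

definition adj_ratio :: "nat \<Rightarrow> nat \<Rightarrow> core \<Rightarrow> nat list \<Rightarrow> nat list \<Rightarrow> nat set \<Rightarrow> nat set \<Rightarrow> complex mat" where
  "adj_ratio n r Q \<alpha> \<beta> \<Gamma> \<Gamma>' = kron (1\<^sub>m r) (slice_word r (slice r Q) \<alpha>) * square_cols n r (slice r Q) \<Gamma> *
    (adj_mat (square_cols n r (slice r Q) \<Gamma>') * kron (1\<^sub>m r) (adj_mat (slice_word r (slice r Q) \<beta>)))"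

text \<open>
  With different column sets the eigenvalues of the matrix of the first step do not all have
  multiplicity \<open>r\<close>: scale the slice of an index of only one of the sets by \<open>t\<close>. The determinant is then a
  power of \<open>t\<close> with exponent congruent to 1 modulo \<open>r\<close>, whereas it would have to be an \<open>r\<close>-th power.
\<close>

lemma generic_not_uniform_spectrum:
  assumes r: "r \<ge> 2" and \<Gamma>: "\<Gamma> \<subseteq> {..<n}" "card \<Gamma> = r * r" and \<Gamma>': "\<Gamma>' \<subseteq> {..<n}" "card \<Gamma>' = r * r"
    and ne: "\<Gamma> \<noteq> \<Gamma>'" and \<alpha>: "set \<alpha> \<subseteq> {..<n}" "set \<beta> \<subseteq> {..<n}"
  obtains P where "polyfun (core_index n r) P" "\<exists>Q. P Q \<noteq> 0" "\<And>Q. uniform_spectrum r (adj_ratio n r Q \<alpha> \<beta> \<Gamma> \<Gamma>') \<Longrightarrow> P Q = 0"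
proof -
  define N where "N = (\<lambda>Q. adj_ratio n r Q \<alpha> \<beta> \<Gamma> \<Gamma>')"
  define m where "m = r * r"
  define J where "J = core_index n r"
  have one: "polymat J r r (\<lambda>_. 1\<^sub>m r)" by (rule polymat_const) simp
  have V: "polymat J m m (\<lambda>Q. square_cols n r (slice r Q) \<Gamma>)" "polymat J m m (\<lambda>Q. square_cols n r (slice r Q) \<Gamma>')"
    using polymat_square_cols[OF \<Gamma>(1), of r] polymat_square_cols[OF \<Gamma>'(1), of r] \<Gamma> \<Gamma>' by (auto simp: m_def J_def)
  have K: "polymat J m m (\<lambda>Q. kron (1\<^sub>m r) (slice_word r (slice r Q) \<alpha>))"
    "polymat J m m (\<lambda>Q. kron (1\<^sub>m r) (adj_mat (slice_word r (slice r Q) \<beta>)))"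
    unfolding m_def J_def
    by (intro polymat_kron one[unfolded J_def] polymat_adj polymat_slice_word \<alpha>)+
  have N: "polymat J m m N"
    unfolding N_def adj_ratio_def by (intro polymat_mult[OF polymat_mult[OF K(1) V(1)] polymat_mult[OF polymat_adj[OF V(2)] K(2)]])
  obtain s where s: "polyfun J s" "\<And>Q. uniform_spectrum r (N Q) \<Longrightarrow> s Q ^ r = (-1) ^ m * det (N Q)"
    using uniform_spectrum_det_power[of J r N] N r unfolding m_def by auto
  define P where "P = (\<lambda>Q. s Q ^ r - (-1) ^ m * det (N Q))"
  have P: "polyfun J P"
    unfolding P_def by (intro polyfun_diff polyfun_power polyfun_mult polyfun_const polyfun_det[OF N] s(1))
  have "\<exists>Q. P Q \<noteq> 0"
  proof (rule ccontr)
    assume "\<not> ?thesis"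
    then have P0: "s Q ^ r = (-1) ^ m * det (N Q)" for Q by (simp add: P_def)
    have "finite \<Gamma>'" using \<Gamma>'(1) finite_subset by blast
    obtain b where b: "b \<in> \<Gamma>" "b \<notin> \<Gamma>'"
      using ne card_subset_eq[OF \<open>finite \<Gamma>'\<close>, of \<Gamma>] \<Gamma>(2) \<Gamma>'(2) by auto
    \<comment> \<open>A core at which all determinants behind \<open>C\<close> are nonzero; the sum
      type indexes both kinds of determinants in one finite family.\<close>
    define F where "F = (\<lambda>u Q. case u of Inl a \<Rightarrow> det (slice r Q a) | Inr G \<Rightarrow> det (square_cols n r (slice r Q) G))"
    have "\<exists>Q. \<forall>u \<in> Inl ` {..<n} \<union> Inr ` {\<Gamma>, \<Gamma>'}. F u Q \<noteq> 0"
    proof (rule polyfun_common_nonzero[where I = J])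
      show "polyfun J (F u)" if "u \<in> Inl ` {..<n} \<union> Inr ` {\<Gamma>, \<Gamma>'}" for u
        using that \<Gamma> \<Gamma>' polyfun_det_slice[of _ n r] polyfun_det_square_cols[of _ n r] by (auto simp: F_def J_def)
      show "\<exists>Q. F u Q \<noteq> 0" if "u \<in> Inl ` {..<n} \<union> Inr ` {\<Gamma>, \<Gamma>'}" for u
        using that \<Gamma> \<Gamma>' ex_det_slice_nonzero[of r] ex_det_square_cols_nonzero[of _ n r] by (auto simp: F_def)
    qed auto
    then obtain Q where Q: "\<And>a. a < n \<Longrightarrow> det (slice r Q a) \<noteq> 0"
      "det (square_cols n r (slice r Q) \<Gamma>) \<noteq> 0" "det (square_cols n r (slice r Q) \<Gamma>') \<noteq> 0"
      by (force simp: F_def)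
    define A where "A = slice_word r (slice r Q) \<alpha>"
    define B where "B = slice_word r (slice r Q) \<beta>"
    have inv: "invertible_mat (slice_word r (slice r Q) as)" if "set as \<subseteq> {..<n}" for as
      unfolding slice_word_def using that Q(1) by (intro invertible_mprod) (auto simp: invertible_mat_iff_det[of _ r])
    have A: "A \<in> carrier_mat r r" "invertible_mat A" and B: "B \<in> carrier_mat r r" "invertible_mat B"
      using inv \<alpha> by (auto simp: A_def B_def)
    have adj_nz: "det (adj_mat M) \<noteq> 0" if "M \<in> carrier_mat k k" "invertible_mat M" for M :: "complex mat" and k
      using adj_mat_eq_minv[OF that] invertible_mat_minv(1)[OF that] minv(1)[OF that] that
      by (simp add: invertible_mat_iff_det[of _ k])
    have kron_nz: "det (kron (1\<^sub>m r) M) \<noteq> 0" if "M \<in> carrier_mat r r" "det M \<noteq> 0" for M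
      using kron_invertible(1)[of "1\<^sub>m r" r M r] that kron_carrier[of "1\<^sub>m r" r r M r r]
      by (simp add: invertible_mat_iff_det[of M r] invertible_mat_iff_det[of "kron (1\<^sub>m r) M" "r * r"])
    define i where "i = count_list \<alpha> b"
    define j where "j = count_list \<beta> b"
    define C where "C = det (kron (1\<^sub>m r) A) * det (square_cols n r (slice r Q) \<Gamma>) *
      (det (adj_mat (square_cols n r (slice r Q) \<Gamma>')) * det (kron (1\<^sub>m r) (adj_mat B)))"
    have adjB: "adj_mat B \<in> carrier_mat r r" using adj_mat(1)[OF B(1)] .
    have Vc: "square_cols n r (slice r Q) \<Gamma>' \<in> carrier_mat m m" for Q using polymat_carrier[OF V(2)] .
    have "C \<noteq> 0"
      unfolding C_def using kron_nz[OF A(1)] kron_nz[OF adjB] A B adj_nz[OF B] Q(2,3) adj_nz[OF Vc[of Q]]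
        invertible_mat_iff_det[OF A(1)] invertible_mat_iff_det[OF Vc[of Q]] by simp
    \<comment> \<open>The words enter through Kronecker products of size \<open>r * r\<close>, and
      the adjugate of a scaled matrix has the factor to the power \<open>r - 1\<close>, so they
      contribute exponents divisible by \<open>r\<close>. The single extra factor is the column for
      \<open>b\<close> selected by \<Gamma>.\<close>
    have det_N: "det (N (scale_slice b t Q)) = t ^ (1 + r * (r * (i + (r - 1) * j))) * C" for t
    proof -
      let ?Q = "scale_slice b t Q"
      have "square_cols n r (slice r ?Q) \<Gamma>' = square_cols n r (slice r Q) \<Gamma>'"
      proof (rule eq_matI)
        fix k l assume "k < dim_row (square_cols n r (slice r Q) \<Gamma>')" "l < dim_col (square_cols n r (slice r Q) \<Gamma>')"
        then have kl: "k < r * r" "l < card \<Gamma>'" using Vc[of Q] \<Gamma>'(2) by (auto simp: m_def)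
        have "pick \<Gamma>' l \<noteq> b" using pick_less(2)[OF \<Gamma>'(1) kl(2)] b(2) by auto
        then show "square_cols n r (slice r ?Q) \<Gamma>' $$ (k, l) = square_cols n r (slice r Q) \<Gamma>' $$ (k, l)"
          unfolding square_cols_index[OF \<Gamma>'(1) kl] using composite_split[OF kl(1)]
          by (simp add: scale_slice_def slice_def)
      qed (use Vc[of Q] Vc[of ?Q] in auto)
      moreover have "det (kron (1\<^sub>m r) (slice_word r (slice r ?Q) \<alpha>)) = (t ^ i) ^ m * det (kron (1\<^sub>m r) A)"
        unfolding slice_word_scale kron_one_smult using carrier_matD(2)[OF A(1)] by (simp add: A_def i_def m_def)
      moreover have "det (kron (1\<^sub>m r) (adj_mat (slice_word r (slice r ?Q) \<beta>))) = ((t ^ j) ^ (r - 1)) ^ m * det (kron (1\<^sub>m r) (adj_mat B))"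
        unfolding slice_word_scale adj_mat_smult[OF slice_word_slice_carrier] kron_one_smult
        using adjB by (simp add: B_def j_def m_def)
      moreover have "det (square_cols n r (slice r ?Q) \<Gamma>) = t * det (square_cols n r (slice r Q) \<Gamma>)"
        using det_square_cols_scale[OF \<Gamma>] b(1) by simp
      moreover have "det (N ?Q) = det (kron (1\<^sub>m r) (slice_word r (slice r ?Q) \<alpha>)) * det (square_cols n r (slice r ?Q) \<Gamma>) *
        (det (adj_mat (square_cols n r (slice r ?Q) \<Gamma>')) * det (kron (1\<^sub>m r) (adj_mat (slice_word r (slice r ?Q) \<beta>))))"
        unfolding N_def adj_ratio_def
        by (simp only: det_mult[OF polymat_carrier[OF polymat_mult[OF K(1) V(1)]] polymat_carrier[OF polymat_mult[OF polymat_adj[OF V(2)] K(2)]]]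
          det_mult[OF polymat_carrier[OF K(1)] polymat_carrier[OF V(1)]]
          det_mult[OF polymat_carrier[OF polymat_adj[OF V(2)]] polymat_carrier[OF K(2)]])
      ultimately have "det (N ?Q) = (t ^ i) ^ m * t * ((t ^ j) ^ (r - 1)) ^ m * C"
        by (simp add: C_def mult_ac)
      also have "(t ^ i) ^ m * t * ((t ^ j) ^ (r - 1)) ^ m = t ^ (1 + r * (r * (i + (r - 1) * j)))"
        by (simp add: m_def algebra_simps flip: power_mult power_add)
      finally show ?thesis .
    qed
    have "\<exists>p. \<forall>t. scale_slice b t Q u = poly p t" for u
    proof (cases u)
      case (fields a k l)
      then show ?thesis
        by (intro exI[of _ "if a = b then [:0, Q u:] else [:Q u:]"]) (auto simp: scale_slice_def)
    qed
    then obtain p where p: "\<And>t. s (scale_slice b t Q) = poly p t"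
      using polyfun_curve[OF s(1), of "\<lambda>t. scale_slice b t Q"] by blast
    define e where "e = 1 + r * (r * (i + (r - 1) * j))"
    \<comment> \<open>Along the curve the identity becomes one of univariate polynomials in
      \<open>t\<close>, so degrees can be compared.\<close>
    have "poly (p ^ r) t = poly (monom ((-1) ^ m * C) e) t" for t
      using P0[of "scale_slice b t Q"] det_N[of t] by (simp add: p poly_monom e_def)
    then have "p ^ r = monom ((-1) ^ m * C) e" by (simp add: poly_eq_poly_eq_iff[symmetric] fun_eq_iff)
    then have "degree (p ^ r) = e" using \<open>C \<noteq> 0\<close> by (simp add: degree_monom_eq)
    moreover have "p \<noteq> 0" using \<open>degree (p ^ r) = e\<close> r by (auto simp: e_def power_0_left)
    ultimately have "r * degree p = e" by (simp add: degree_power_eq mult.commute)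
    then have "r dvd 1 + r * (r * (i + (r - 1) * j))" unfolding e_def by (metis dvd_triv_left)
    then have "r dvd 1" by (simp only: dvd_add_left_iff[OF dvd_triv_left])
    then show False using r by simp
  qed
  then show thesis using that[of P] P s(2) unfolding J_def P_def N_def by auto
qed

section \<open>Executability and correctness for a nondegenerate core\<close>

lemma distinct_eigenbasis_smult:
  assumes "distinct_eigenbasis r Z X ev" "Z \<in> carrier_mat r r" "c \<noteq> 0"
  shows "distinct_eigenbasis r (c \<cdot>\<^sub>m Z) X (\<lambda>k. c * ev k)"
proof -
  have X: "X \<in> carrier_mat r r" and eq: "Z * X = X * mat_diag r ev" and inj: "inj_on ev {..<r}"
    using assms(1) by (auto simp: distinct_eigenbasis_def)
  have "c \<cdot>\<^sub>m Z * X = c \<cdot>\<^sub>m (X * mat_diag r ev)"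
    using mult_smult_assoc_mat[OF assms(2) X] eq by simp
  also have "\<dots> = X * mat_diag r (\<lambda>k. c * ev k)"
    unfolding mat_diag_mult_right[OF X] by (intro eq_matI) auto
  moreover have "inj_on (\<lambda>k. c * ev k) {..<r}"
    using inj assms(3) by (auto simp: inj_on_def)
  ultimately show ?thesis using assms(1) by (auto simp: distinct_eigenbasis_def)
qed

lemma distinct_eigenbasis_nonzero:
  assumes b: "distinct_eigenbasis r Z X ev" and Z: "Z \<in> carrier_mat r r" "invertible_mat Z" and k: "k < r"
  shows "ev k \<noteq> 0"
proof -
  have X: "X \<in> carrier_mat r r" "invertible_mat X" and eq: "Z * X = X * mat_diag r ev"
    using b by (auto simp: distinct_eigenbasis_def)
  have "invertible_mat (X * mat_diag r ev)"
    unfolding eq[symmetric] using X Z by (simp add: invertible_mat_mult_iff[of _ r])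
  then have "invertible_mat (mat_diag r ev)" using invertible_mat_mult_iff[OF X(1) mat_diag_dim] by blast
  then show ?thesis using mat_diag_invertibleD k by blast
qed

text \<open>The eigenvectors for the kernel come from correcting \<open>K0\<close> by its component
  in the range of \<open>U\<close>. The result is annihilated by \<open>pinv U\<close>, while
  \<open>J\<close> does not see the correction; this makes an explicit inverse of the full
  eigenbasis available.\<close>

lemma eigvec_stackI:
  assumes U: "U \<in> carrier_mat n (r * r)" and L: "L \<in> carrier_mat (r * r) n" "L * U = 1\<^sub>m (r * r)"
    and J: "J \<in> carrier_mat (n - r * r) n" "J * U = 0\<^sub>m (n - r * r) (r * r)"
    and K0: "K0 \<in> carrier_mat n (n - r * r)" "J * K0 = 1\<^sub>m (n - r * r)" and le: "r * r \<le> n"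
    and Z: "Z \<in> carrier_mat r r" "invertible_mat Z" and b: "distinct_eigenbasis r Z X ev"
  shows "eigvec_stack n r (U * kron (1\<^sub>m r) Z * pinv U) (U * kron (1\<^sub>m r) X)"
proof -
  define m where "m = r * r"
  note U = U[folded m_def] and L = L[folded m_def] and J = J[folded m_def] and K0 = K0[folded m_def] and le = le[folded m_def]
  have X: "X \<in> carrier_mat r r" "invertible_mat X" and eq: "Z * X = X * mat_diag r ev" and inj: "inj_on ev {..<r}"
    using b by (auto simp: distinct_eigenbasis_def)
  note mX = minv[OF X]
  note pU = pinv_carrier[OF U] and pUU = pinv_left_inverse[OF U L]
  define I1 where "I1 = incl_left n m"
  define I2 where "I2 = incl_right n m"
  define T1 where "T1 = transpose_mat I1"
  define T2 where "T2 = transpose_mat I2"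
  have I: "I1 \<in> carrier_mat n m" "I2 \<in> carrier_mat n (n - m)" "T1 \<in> carrier_mat m n" "T2 \<in> carrier_mat (n - m) n"
    by (auto simp: I1_def I2_def T1_def T2_def)
  note io = incl_orthogonal[OF le, folded I1_def I2_def, folded T1_def T2_def]
  have T2T1: "I1 * T1 + I2 * T2 = 1\<^sub>m n"
  proof (rule eq_matI)
    fix i j assume "i < dim_row (1\<^sub>m n :: complex mat)" "j < dim_col (1\<^sub>m n :: complex mat)"
    then have ij: "i < n" "j < n" by auto
    have 1: "(I1 * T1) $$ (i, j) = (if i = j \<and> i < m then 1 else 0)"
    proof -
      have "(I1 * T1) $$ (i, j) = (\<Sum>t<m. if t = i then (if i = j then 1 else 0) else 0)"
        unfolding mult_index[OF I(1,3) ij] using ij by (intro sum.cong refl) (auto simp: T1_def I1_def incl_left_def)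
      then show ?thesis by simp
    qed
    have 2: "(I2 * T2) $$ (i, j) = (if i = j \<and> m \<le> i then 1 else 0)"
    proof -
      have "(I2 * T2) $$ (i, j) = (\<Sum>t<n - m. if t = i - m then (if i = j \<and> m \<le> i then 1 else 0) else 0)"
        unfolding mult_index[OF I(2,4) ij] using ij by (intro sum.cong refl) (auto simp: T2_def I2_def incl_right_def)
      then show ?thesis using ij by auto
    qed
    have "(I1 * T1 + I2 * T2) $$ (i, j) = (I1 * T1) $$ (i, j) + (I2 * T2) $$ (i, j)"
      using I ij by simp
    then show "(I1 * T1 + I2 * T2) $$ (i, j) = 1\<^sub>m n $$ (i, j)" using 1 2 ij by simp
  qed (use I in auto)
  define kX where "kX = kron (1\<^sub>m r) X"
  define kXi where "kXi = kron (1\<^sub>m r) (minv X)"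
  define kZ where "kZ = kron (1\<^sub>m r) Z"
  define \<Lambda> where "\<Lambda> = kron (1\<^sub>m r) (mat_diag r ev)"
  have k: "kX \<in> carrier_mat m m" "kXi \<in> carrier_mat m m" "kZ \<in> carrier_mat m m" "\<Lambda> \<in> carrier_mat m m"
    using X mX Z by (auto simp: kX_def kXi_def kZ_def \<Lambda>_def m_def)
  have kXX: "kXi * kX = 1\<^sub>m m" unfolding kX_def kXi_def using mX X by (simp add: kron_mult kron_one m_def)
  have kZX: "kZ * kX = kX * \<Lambda>" unfolding kX_def kZ_def \<Lambda>_def using X Z eq by (simp add: kron_mult)
  define K where "K = K0 - U * (pinv U * K0)"
  have K: "K \<in> carrier_mat n (n - m)" using K0 U pU by (auto simp: K_def)
  have UpK: "U * (pinv U * K0) \<in> carrier_mat n (n - m)" using K0 U pU by auto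
  have pUK: "pinv U * K = 0\<^sub>m m (n - m)"
  proof -
    have pK: "pinv U * K0 \<in> carrier_mat m (n - m)" using pU K0 by simp
    have "pinv U * (U * (pinv U * K0)) = pinv U * K0"
      unfolding assoc_mult_mat[OF pU U pK, symmetric] pUU by (rule left_mult_one_mat[OF pK])
    then show ?thesis unfolding K_def mult_minus_distrib_mat[OF pU K0(1) UpK] using pK by simp
  qed
  have JK: "J * K = 1\<^sub>m (n - m)"
  proof -
    have pK: "pinv U * K0 \<in> carrier_mat m (n - m)" using pU K0 by simp
    have "J * (U * (pinv U * K0)) = 0\<^sub>m (n - m) (n - m)"
      unfolding assoc_mult_mat[OF J(1) U pK, symmetric] J(2) by (rule left_mult_zero_mat[OF pK])
    then show ?thesis unfolding K_def mult_minus_distrib_mat[OF J(1) K0(1) UpK] using K0(2) by (auto intro!: eq_matI)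
  qed
  define P where "P = U * kX * T1 + K * T2"
  define P' where "P' = I1 * (kXi * pinv U) + I2 * J"
  define D where "D = I1 * (\<Lambda> * T1)"
  have P: "P \<in> carrier_mat n n" and P': "P' \<in> carrier_mat n n" and D: "D \<in> carrier_mat n n"
    using U k I K J pU by (auto simp: P_def P'_def D_def)
  have P1: "P * I1 = U * kX"
  proof -
    have "P * I1 = U * kX * T1 * I1 + K * T2 * I1"
      unfolding P_def using U k I K by (intro add_mult_distrib_mat[of _ n n]) auto
    also have "U * kX * T1 * I1 = U * kX" using U k I io by (simp add: mat_assoc)
    also have "K * T2 * I1 = 0\<^sub>m n m" using K I io by (simp add: mat_assoc)
    finally show ?thesis using U k by simp
  qed
  have P2: "P * I2 = K"
  proof -
    have "P * I2 = U * kX * T1 * I2 + K * T2 * I2"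
      unfolding P_def using U k I K by (intro add_mult_distrib_mat[of _ n n]) auto
    also have "U * kX * T1 * I2 = 0\<^sub>m n (n - m)" using U k I io by (simp add: mat_assoc)
    also have "K * T2 * I2 = K" using K I io by (simp add: mat_assoc)
    finally show ?thesis using K by simp
  qed
  have P'U: "P' * (U * kX) = I1"
  proof -
    have UX: "U * kX \<in> carrier_mat n m" using U k by simp
    have "P' * (U * kX) = I1 * (kXi * pinv U) * (U * kX) + I2 * J * (U * kX)"
      unfolding P'_def using U k I J pU by (intro add_mult_distrib_mat[of _ n n]) auto
    also have "I1 * (kXi * pinv U) * (U * kX) = I1 * (kXi * ((pinv U * U) * kX))"
      using U k I pU by (simp add: mat_assoc)
    also have "\<dots> = I1" unfolding pUU using k I kXX by simp
    also have "I2 * J * (U * kX) = I2 * ((J * U) * kX)" using U k I J(1) by (simp add: mat_assoc)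
    also have "\<dots> = 0\<^sub>m n m" unfolding J(2) using k I by simp
    finally show ?thesis using I by simp
  qed
  have P'K: "P' * K = I2"
  proof -
    have "P' * K = I1 * (kXi * pinv U) * K + I2 * J * K"
      unfolding P'_def using K k I J pU by (intro add_mult_distrib_mat[of _ n n]) auto
    also have "I1 * (kXi * pinv U) * K = I1 * (kXi * (pinv U * K))" using K k I pU by (simp add: mat_assoc)
    also have "\<dots> = 0\<^sub>m n (n - m)" unfolding pUK using k I by simp
    also have "I2 * J * K = I2 * (J * K)" using K I J(1) by (simp add: mat_assoc)
    also have "\<dots> = I2" unfolding JK using I by simp
    finally show ?thesis using I by simp
  qed
  have P'P: "P' * P = 1\<^sub>m n"
  proof -
    have "P' * P = P' * (U * kX * T1) + P' * (K * T2)"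
      unfolding P_def using P' U k I K by (intro mult_add_distrib_mat) auto
    also have "P' * (U * kX * T1) = P' * (U * kX) * T1" using P' U k I by (simp add: mat_assoc)
    also have "P' * (K * T2) = P' * K * T2" using P' K I by (simp add: mat_assoc)
    finally show ?thesis unfolding P'U P'K using T2T1 by simp
  qed
  have PP': "P * P' = 1\<^sub>m n" by (rule mat_mult_left_right_inverse[OF P' P P'P])
  define M where "M = U * kZ * pinv U"
  have M: "M \<in> carrier_mat n n" using U k pU by (auto simp: M_def)
  have MP: "M * P = P * D"
  proof -
    have "M * P = M * (U * kX * T1) + M * (K * T2)"
      unfolding P_def using M U k I K by (intro mult_add_distrib_mat) auto
    also have "M * (U * kX * T1) = U * (kZ * ((pinv U * U) * (kX * T1)))"
      unfolding M_def using U k I pU by (simp add: mat_assoc)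
    also have "\<dots> = U * ((kZ * kX) * T1)" unfolding pUU using U k I by (simp add: mat_assoc)
    also have "\<dots> = U * kX * (\<Lambda> * T1)" unfolding kZX using U k I by (simp add: mat_assoc)
    also have "\<dots> = P * D" unfolding D_def P1[symmetric] using P I k by (simp add: mat_assoc)
    also have "M * (K * T2) = U * (kZ * ((pinv U * K) * T2))"
      unfolding M_def using U k I pU K by (simp add: mat_assoc)
    also have "\<dots> = 0\<^sub>m n n" unfolding pUK using U k I by simp
    finally show ?thesis using P D by simp
  qed
  have "M = P * D * P'"
    unfolding MP[symmetric] assoc_mult_mat[OF M P P'] PP' using M by simp
  then have sim: "similar_mat_wit M D P P'"
    using M D P P' PP' P'P by (intro similar_mat_witI[of _ _ n]) auto
  have \<Lambda>T1: "(\<Lambda> * T1) $$ (i, j) = (if i = j then ev (i mod r) else 0)" if "i < m" "j < n" for i j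
  proof -
    have "(\<Lambda> * T1) $$ (i, j) = ev (i mod r) * T1 $$ (i, j)"
      unfolding \<Lambda>_def using that I by (intro kron_one_diag_mult) (auto simp: m_def)
    then show ?thesis using that le by (simp add: T1_def I1_def incl_left_def)
  qed
  have D_index: "D $$ (i, j) = (if i = j \<and> i < m then ev (i mod r) else 0)" if ij: "i < n" "j < n" for i j
  proof -
    have c: "\<Lambda> * T1 \<in> carrier_mat m n" using k I by simp
    have "D $$ (i, j) = (\<Sum>t<m. if t = i then (if i = j then ev (i mod r) else 0) else 0)"
      unfolding D_def mult_index[OF I(1) c ij] using ij by (intro sum.cong refl) (auto simp: I1_def incl_left_def \<Lambda>T1)
    then show ?thesis by simp
  qed
  have E: "U * kX = Matrix.mat n m (\<lambda>(i, c). P $$ (i, c))"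
    unfolding P1[symmetric] I1_def using mult_incl_left[OF le P] P carrier_matD[OF incl_carrier(1)] by (intro eq_matI) auto
  show ?thesis
    unfolding eigvec_stack_def
  proof (intro exI conjI)
    show "U * kron (1\<^sub>m r) Z * pinv U \<in> carrier_mat n n" using M by (simp add: M_def kZ_def)
    show "eigendecomposition (U * kron (1\<^sub>m r) Z * pinv U) P D P'"
      using sim D D_index unfolding eigendecomposition_def by (auto simp: M_def kZ_def diagonal_mat_def)
    show "inj_on ev {..<r}" by (rule inj)
    show "\<forall>k<r. ev k \<noteq> 0" using distinct_eigenbasis_nonzero[OF b Z] by blast
    show "\<forall>j<r. \<forall>k<r. D $$ (j * r + k, j * r + k) = ev k"
    proof (intro allI impI)
      fix j k assume "j < r" "k < r"
      then have "j * r + k < m" unfolding m_def by (rule composite_less)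
      then show "D $$ (j * r + k, j * r + k) = ev k" using D_index le \<open>k < r\<close> by simp
    qed
    show "\<forall>i\<in>{r * r..<n}. D $$ (i, i) = 0" using D_index by (auto simp: m_def)
    show "U * kron (1\<^sub>m r) X = Matrix.mat n (r * r) (\<lambda>(i, c). P $$ (i, c))"
      using E by (simp add: kX_def m_def)
  qed
qed

text \<open>\<open>J\<close> eliminates the lower rows of \<open>U\<close> by means of its
  invertible upper block. The unit vectors of the lower coordinates serve as
  \<open>K\<close>.\<close>

lemma ex_complement:
  assumes U: "U \<in> carrier_mat n m" and le: "m \<le> n" and R: "R \<in> carrier_mat m m"
    and RU: "R * (transpose_mat (incl_left n m) * U) = 1\<^sub>m m"
  shows "\<exists>J \<in> carrier_mat (n - m) n. \<exists>K \<in> carrier_mat n (n - m). J * U = 0\<^sub>m (n - m) m \<and> J * K = 1\<^sub>m (n - m)"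
proof -
  define I1 where "I1 = incl_left n m"
  define I2 where "I2 = incl_right n m"
  define T1 where "T1 = transpose_mat I1"
  define T2 where "T2 = transpose_mat I2"
  have I: "I1 \<in> carrier_mat n m" "I2 \<in> carrier_mat n (n - m)" "T1 \<in> carrier_mat m n" "T2 \<in> carrier_mat (n - m) n"
    by (auto simp: I1_def I2_def T1_def T2_def)
  note io = incl_orthogonal[OF le, folded I1_def I2_def, folded T1_def T2_def]
  define J where "J = T2 - T2 * (U * (R * T1))"
  have c: "T2 * (U * (R * T1)) \<in> carrier_mat (n - m) n" using I U R by auto
  have J: "J \<in> carrier_mat (n - m) n" unfolding J_def by (rule minus_carrier_mat[OF c])
  have "T2 * (U * (R * T1)) * U = T2 * (U * (R * (T1 * U)))" using I U R by (simp add: mat_assoc)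
  also have "\<dots> = T2 * U" using RU U I by (simp add: T1_def I1_def)
  finally have "J * U = 0\<^sub>m (n - m) m"
    unfolding J_def minus_mult_distrib_mat[OF I(4) c U] using I U by auto
  moreover have "T2 * (U * (R * T1)) * I2 = T2 * (U * (R * (T1 * I2)))" using I U R by (simp add: mat_assoc)
  then have "T2 * (U * (R * T1)) * I2 = 0\<^sub>m (n - m) (n - m)" using io I U R by simp
  then have "J * I2 = 1\<^sub>m (n - m)"
    unfolding J_def minus_mult_distrib_mat[OF I(4) c I(2)] using io by auto
  ultimately show ?thesis using J I by blast
qed

lemma eig_pair_structure:
  assumes st: "eigvec_stack n r (U * kron (1\<^sub>m r) Z * pinv U) E" and le: "r * r \<le> n"
    and U: "U \<in> carrier_mat n (r * r)" and L: "L \<in> carrier_mat (r * r) n" "L * U = 1\<^sub>m (r * r)"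
    and Z: "Z \<in> carrier_mat r r"
  obtains X K ev where "distinct_eigenbasis r Z X ev"
    "\<And>l. l < r \<Longrightarrow> K l \<in> carrier_mat r r" "\<And>l. l < r \<Longrightarrow> invertible_mat (K l)"
    "E = U * (kron (1\<^sub>m r) X * interleave r K)"
proof -
  have kZ: "kron (1\<^sub>m r) Z \<in> carrier_mat (r * r) (r * r)" using Z by simp
  obtain G ev where G: "G \<in> carrier_mat (r * r) (r * r)" "invertible_mat G" "E = U * G"
    "kron (1\<^sub>m r) Z * G = G * kron (1\<^sub>m r) (mat_diag r ev)" "inj_on ev {..<r}"
    using eigvec_stack_factor[OF st le U L kZ] by metis
  obtain X K where "X \<in> carrier_mat r r" "invertible_mat X" "Z * X = X * mat_diag r ev"
    "\<And>l. l < r \<Longrightarrow> K l \<in> carrier_mat r r" "\<And>l. l < r \<Longrightarrow> invertible_mat (K l)"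
    "G = kron (1\<^sub>m r) X * interleave r K"
    using eigenvectors_kron[OF Z G(1,2,4,5)] by metis
  then show thesis using that[of X ev K] G(3,5) unfolding distinct_eigenbasis_def by blast
qed

section \<open>The matrices of the first step and the runs on a nondegenerate core\<close>

definition pair_ratio :: "nat \<Rightarrow> core \<Rightarrow> nat list \<Rightarrow> nat list \<Rightarrow> complex mat" where
  "pair_ratio r Q \<alpha> \<beta> = slice_word r (slice r Q) \<alpha> * minv (slice_word r (slice r Q) \<beta>)"

definition word_invertible :: "nat \<Rightarrow> core \<Rightarrow> nat list \<Rightarrow> bool" where
  "word_invertible r Q \<alpha> \<longleftrightarrow> invertible_mat (slice_word r (slice r Q) \<alpha>)"

lemma pair_ratio_carrier:
  assumes "word_invertible r Q \<beta>"
  shows "pair_ratio r Q \<alpha> \<beta> \<in> carrier_mat r r"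
  unfolding pair_ratio_def
  using minv(1)[OF slice_word_slice_carrier assms[unfolded word_invertible_def]] slice_word_slice_carrier
  by (metis mult_carrier_mat)

lemma pair_ratio_invertible:
  assumes "word_invertible r Q \<alpha>" "word_invertible r Q \<beta>"
  shows "invertible_mat (pair_ratio r Q \<alpha> \<beta>)"
  unfolding pair_ratio_def
  using assms invertible_mat_minv(1)[OF slice_word_slice_carrier] minv(1)[OF slice_word_slice_carrier]
    invertible_mat_mult_iff[OF slice_word_slice_carrier]
  by (auto simp: word_invertible_def)

definition good_pairs :: "nat \<Rightarrow> nat list \<Rightarrow> nat list \<Rightarrow> nat list \<Rightarrow> nat list \<Rightarrow> core \<Rightarrow> bool" where
  "good_pairs r \<alpha> \<beta> \<alpha>' \<beta>' Q \<longleftrightarrow> word_invertible r Q \<beta> \<and> word_invertible r Q \<beta>' \<and>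
     (\<exists>X ev. distinct_eigenbasis r (pair_ratio r Q \<alpha> \<beta>) X ev) \<and>
     (\<exists>X' ev'. distinct_eigenbasis r (pair_ratio r Q \<alpha>' \<beta>') X' ev') \<and>
     transverse r (pair_ratio r Q \<alpha> \<beta>) (pair_ratio r Q \<alpha>' \<beta>')"

text \<open>\<open>U\<close> has full column rank and all factors to its right are invertible, so
  the pseudoinverse of the second tensor matrix splits. For equal column sets the two unfoldings in
  the middle cancel.\<close>

lemma step1_matrix:
  assumes T: "\<forall>as \<in> tuples n d. T as = tr_tensor r Q as" and d: "d \<ge> 3"
    and U: "U = unfold_angle n r (slice r Q)" and L: "L \<in> carrier_mat (r * r) n" "L * U = 1\<^sub>m (r * r)"
    and \<alpha>\<beta>: "\<alpha> \<in> tuples n (d - 2)" "\<beta> \<in> tuples n (d - 2)"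
    and \<Gamma>: "\<Gamma> \<subseteq> {..<n}" "card \<Gamma> = r\<^sup>2" and \<Gamma>': "\<Gamma>' \<subseteq> {..<n}" "card \<Gamma>' = r\<^sup>2"
    and V': "invertible_mat (square_cols n r (slice r Q) \<Gamma>')" and \<beta>: "word_invertible r Q \<beta>"
  shows "tensor_mat n T \<alpha> \<Gamma> * pinv (tensor_mat n T \<beta> \<Gamma>') =
    U * (kron (1\<^sub>m r) (slice_word r (slice r Q) \<alpha>) * square_cols n r (slice r Q) \<Gamma> *
      (minv (square_cols n r (slice r Q) \<Gamma>') * kron (1\<^sub>m r) (minv (slice_word r (slice r Q) \<beta>)))) * pinv U"
    and "\<Gamma> = \<Gamma>' \<Longrightarrow> tensor_mat n T \<alpha> \<Gamma> * pinv (tensor_mat n T \<beta> \<Gamma>') = U * kron (1\<^sub>m r) (pair_ratio r Q \<alpha> \<beta>) * pinv U"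
proof -
  define m where "m = r * r"
  let ?A = "slice_word r (slice r Q) \<alpha>" and ?B = "slice_word r (slice r Q) \<beta>"
  let ?V = "square_cols n r (slice r Q) \<Gamma>" and ?V' = "square_cols n r (slice r Q) \<Gamma>'"
  have V: "?V \<in> carrier_mat m m" "?V' \<in> carrier_mat m m"
    using square_cols_carrier[OF \<Gamma>(1), of r "slice r Q"] square_cols_carrier[OF \<Gamma>'(1), of r "slice r Q"] \<Gamma>(2) \<Gamma>'(2)
    by (auto simp: m_def power2_eq_square)
  have Uc: "U \<in> carrier_mat n m" by (simp add: U m_def)
  note L = L[folded m_def]
  have Bi: "?B \<in> carrier_mat r r" "invertible_mat ?B" using \<beta> by (auto simp: word_invertible_def)
  note mB = minv[OF Bi]
  have kA: "kron (1\<^sub>m r) ?A \<in> carrier_mat m m" and kB: "kron (1\<^sub>m r) ?B \<in> carrier_mat m m"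
    and kBi: "kron (1\<^sub>m r) (minv ?B) \<in> carrier_mat m m"
    using mB by (auto simp: m_def)
  note kBinv = kron_invertible[OF one_carrier_mat Bi(1) invertible_one Bi(2), unfolded minv_one]
  have d2: "d - 2 + 2 = d" using d by simp
  have T': "T as = tr_tensor r Q as" if "as \<in> tuples n (d - 2 + 2)" for as using T that unfolding d2 by blast
  have TA: "tensor_mat n T \<alpha> \<Gamma> = U * kron (1\<^sub>m r) ?A * ?V"
    unfolding U by (rule tensor_mat_tr_tensor[OF \<Gamma>(1) \<alpha>\<beta>(1) T'])
  have TB: "tensor_mat n T \<beta> \<Gamma>' = U * (kron (1\<^sub>m r) ?B * ?V')"
    unfolding assoc_mult_mat[OF Uc kB V(2), symmetric] unfolding U by (rule tensor_mat_tr_tensor[OF \<Gamma>'(1) \<alpha>\<beta>(2) T'])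
  have inv: "invertible_mat (kron (1\<^sub>m r) ?B * ?V')"
    using kBinv(1) V' invertible_mat_mult_iff[OF kB V(2)] by simp
  have kBV: "kron (1\<^sub>m r) ?B * ?V' \<in> carrier_mat m m" using kB V by simp
  have "pinv (tensor_mat n T \<beta> \<Gamma>') = minv ?V' * kron (1\<^sub>m r) (minv ?B) * pinv U"
    unfolding TB pinv_mult_invertible[OF Uc L kBV inv] minv_mult[OF kB V(2) kBinv(1) V'] kBinv(2) ..
  moreover have "U * K * X * (Y * K' * P) = U * (K * X * (Y * K')) * P"
    if "K \<in> carrier_mat m m" "X \<in> carrier_mat m m" "Y \<in> carrier_mat m m" "K' \<in> carrier_mat m m" "P \<in> carrier_mat m n"
    for K X Y K' P using that Uc by (simp add: mat_assoc)
  ultimately show eq: "tensor_mat n T \<alpha> \<Gamma> * pinv (tensor_mat n T \<beta> \<Gamma>') =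
    U * (kron (1\<^sub>m r) ?A * ?V * (minv ?V' * kron (1\<^sub>m r) (minv ?B))) * pinv U"
    unfolding TA using kA V kBi minv(1)[OF V(2) V'] pinv_carrier[OF Uc] by simp
  assume \<Gamma>\<Gamma>: "\<Gamma> = \<Gamma>'"
  have "kron (1\<^sub>m r) ?A * ?V * (minv ?V' * kron (1\<^sub>m r) (minv ?B)) = kron (1\<^sub>m r) ?A * (?V' * (minv ?V' * kron (1\<^sub>m r) (minv ?B)))"
    unfolding \<Gamma>\<Gamma> using assoc_mult_mat[OF kA V(2) mult_carrier_mat[OF minv(1)[OF V(2) V'] kBi]] by simp
  also have "\<dots> = kron (1\<^sub>m r) (pair_ratio r Q \<alpha> \<beta>)"
    unfolding mult_minv_cancel(1)[OF V(2) V' kBi] pair_ratio_def using mB carrier_matD[OF slice_word_slice_carrier] by (subst kron_mult) auto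
  finally show "tensor_mat n T \<alpha> \<Gamma> * pinv (tensor_mat n T \<beta> \<Gamma>') = U * kron (1\<^sub>m r) (pair_ratio r Q \<alpha> \<beta>) * pinv U"
    unfolding eq by simp
qed

lemma uniform_spectrum_smult:
  assumes M: "M \<in> carrier_mat (r * r) (r * r)" and "uniform_spectrum r M"
  shows "uniform_spectrum r (c \<cdot>\<^sub>m M)"
proof -
  obtain G ev where G: "G \<in> carrier_mat (r * r) (r * r)" "invertible_mat G"
    and eq: "M * G = G * kron (1\<^sub>m r) (mat_diag r ev)"
    using assms(2) by (auto simp: uniform_spectrum_def)
  have D: "kron (1\<^sub>m r) (mat_diag r ev) \<in> carrier_mat (r * r) (r * r)" by simp
  have s: "c \<cdot>\<^sub>m mat_diag r ev = mat_diag r (\<lambda>k. c * ev k)"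
    by (intro eq_matI) (auto simp: mat_diag_index)
  have "c \<cdot>\<^sub>m M * G = G * kron (1\<^sub>m r) (mat_diag r (\<lambda>k. c * ev k))"
    unfolding mult_smult_assoc_mat[OF M G(1)] eq s[symmetric] kron_one_smult mult_smult_distrib[OF G(1) D] ..
  then show ?thesis unfolding uniform_spectrum_def using G by blast
qed

lemma adj_ratio_eq:
  assumes \<Gamma>: "\<Gamma> \<subseteq> {..<n}" "card \<Gamma> = r * r" and \<Gamma>': "\<Gamma>' \<subseteq> {..<n}" "card \<Gamma>' = r * r"
    and V': "invertible_mat (square_cols n r (slice r Q) \<Gamma>')" and \<beta>: "word_invertible r Q \<beta>"
  shows "adj_ratio n r Q \<alpha> \<beta> \<Gamma> \<Gamma>' =
    (det (square_cols n r (slice r Q) \<Gamma>') * det (slice_word r (slice r Q) \<beta>)) \<cdot>\<^sub>m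
    (kron (1\<^sub>m r) (slice_word r (slice r Q) \<alpha>) * square_cols n r (slice r Q) \<Gamma> *
      (minv (square_cols n r (slice r Q) \<Gamma>') * kron (1\<^sub>m r) (minv (slice_word r (slice r Q) \<beta>))))"
proof -
  let ?A = "slice_word r (slice r Q) \<alpha>" and ?B = "slice_word r (slice r Q) \<beta>"
  let ?V = "square_cols n r (slice r Q) \<Gamma>" and ?V' = "square_cols n r (slice r Q) \<Gamma>'"
  have V: "?V \<in> carrier_mat (r * r) (r * r)" "?V' \<in> carrier_mat (r * r) (r * r)"
    using square_cols_carrier[OF \<Gamma>(1), of r "slice r Q"] square_cols_carrier[OF \<Gamma>'(1), of r "slice r Q"] \<Gamma>(2) \<Gamma>'(2)
    by auto
  have B: "?B \<in> carrier_mat r r" "invertible_mat ?B" using \<beta> by (auto simp: word_invertible_def)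
  have kA: "kron (1\<^sub>m r) ?A * ?V \<in> carrier_mat (r * r) (r * r)"
    using V(1) by (intro mult_carrier_mat[OF kron_carrier]) auto
  have kB: "kron (1\<^sub>m r) (minv ?B) \<in> carrier_mat (r * r) (r * r)" using minv(1)[OF B] by simp
  note mV = minv(1)[OF V(2) V']
  have "X * ((a \<cdot>\<^sub>m Y) * (b \<cdot>\<^sub>m Z)) = (a * b) \<cdot>\<^sub>m (X * (Y * Z))"
    if c: "X \<in> carrier_mat k k" "Y \<in> carrier_mat k k" "Z \<in> carrier_mat k k"
    for X Y Z :: "complex mat" and a b k
  proof -
    have "(a \<cdot>\<^sub>m Y) * (b \<cdot>\<^sub>m Z) = a \<cdot>\<^sub>m (b \<cdot>\<^sub>m (Y * Z))"
      using mult_smult_assoc_mat[OF c(2) smult_carrier_mat[OF c(3)]] mult_smult_distrib[OF c(2,3)] by simp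
    then have eq: "(a \<cdot>\<^sub>m Y) * (b \<cdot>\<^sub>m Z) = (a * b) \<cdot>\<^sub>m (Y * Z)" by (auto intro!: eq_matI)
    show ?thesis unfolding eq by (rule mult_smult_distrib[OF c(1) mult_carrier_mat[OF c(2,3)]])
  qed
  from this[OF kA mV kB] show ?thesis
    unfolding adj_ratio_def adj_mat_eq_minv[OF V(2) V'] adj_mat_eq_minv[OF B] kron_one_smult .
qed

lemma pick_lessThan: "j < k \<Longrightarrow> pick {..<k} j = j"
proof -
  assume j: "j < k"
  then have "pick {..<k} j \<in> {..<k}" by (intro pick_in_set_le) simp
  then have "{a \<in> {..<k}. a < pick {..<k} j} = {..<pick {..<k} j}" by auto
  moreover have "card {a \<in> {..<k}. a < pick {..<k} j} = j" using j by (intro card_pick) simp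
  ultimately show ?thesis by simp
qed

lemma tuples_set: "as \<in> tuples n l \<Longrightarrow> set as \<subseteq> {..<n}"
  by (simp add: tuples_def)

text \<open>The genericity conditions that do not relate the two pairs of tuples to each other. They
  cover all tuples and column sets at once, so the same core serves every run.\<close>

locale nondegenerate_core =
  fixes n r d :: nat and Q :: core
  assumes n: "r * r \<le> n" and d: "d \<ge> 3" and r: "r \<ge> 2"
    and det_slice: "\<And>a. a < n \<Longrightarrow> det (slice r Q a) \<noteq> 0"
    and det_square_cols: "\<And>\<Gamma>. \<Gamma> \<subseteq> {..<n} \<Longrightarrow> card \<Gamma> = r * r \<Longrightarrow> det (square_cols n r (slice r Q) \<Gamma>) \<noteq> 0"
    and not_uniform: "\<And>\<alpha> \<beta> \<Gamma> \<Gamma>'. \<alpha> \<in> tuples n (d - 2) \<Longrightarrow> \<beta> \<in> tuples n (d - 2) \<Longrightarrow>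
      \<Gamma> \<subseteq> {..<n} \<Longrightarrow> card \<Gamma> = r * r \<Longrightarrow> \<Gamma>' \<subseteq> {..<n} \<Longrightarrow> card \<Gamma>' = r * r \<Longrightarrow> \<Gamma> \<noteq> \<Gamma>' \<Longrightarrow>
      \<not> uniform_spectrum r (adj_ratio n r Q \<alpha> \<beta> \<Gamma> \<Gamma>')"
    and power_eigenbasis: "\<exists>X ev. distinct_eigenbasis r (slice r Q 0 ^\<^sub>m d) X ev"
begin

lemma slice_invertible: "a < n \<Longrightarrow> invertible_mat (slice r Q a)"
  using det_slice invertible_mat_iff_det[of "slice r Q a" r] by simp

lemma words_invertible: "set as \<subseteq> {..<n} \<Longrightarrow> word_invertible r Q as"
  unfolding word_invertible_def slice_word_def by (intro invertible_mprod) (auto intro: slice_invertible)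

lemma square_cols_invertible:
  assumes "\<Gamma> \<subseteq> {..<n}" "card \<Gamma> = r * r"
  shows "invertible_mat (square_cols n r (slice r Q) \<Gamma>)"
  using det_square_cols[OF assms] invertible_mat_iff_det[of "square_cols n r (slice r Q) \<Gamma>" "r * r"]
    square_cols_carrier[OF assms(1), of r "slice r Q"] assms(2) by simp

lemma generic_core: "\<Gamma> \<subseteq> {..<n} \<Longrightarrow> card \<Gamma> = r\<^sup>2 \<Longrightarrow> m < n \<Longrightarrow> generic_core n r d (slice r Q) \<Gamma> m"
  using slice_invertible square_cols_invertible d r by (intro generic_core.intro) (auto simp: power2_eq_square)

lemma left_inverse:
  obtains L where "L \<in> carrier_mat (r * r) n" "L * unfold_angle n r (slice r Q) = 1\<^sub>m (r * r)"
proof -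
  have "0 < r * r" using r by simp
  then have "0 < n" using n by (rule less_le_trans)
  have "generic_core n r d (slice r Q) {..<r * r} 0"
    by (rule generic_core) (use n \<open>0 < n\<close> in \<open>auto simp: power2_eq_square\<close>)
  from generic_core.left_inverse[OF this] that show thesis by blast
qed

lemma complement:
  obtains J K where "J \<in> carrier_mat (n - r * r) n" "K \<in> carrier_mat n (n - r * r)"
    "J * unfold_angle n r (slice r Q) = 0\<^sub>m (n - r * r) (r * r)" "J * K = 1\<^sub>m (n - r * r)"
proof -
  have \<Gamma>: "{..<r * r} \<subseteq> {..<n}" "card {..<r * r} = r * r" using n by auto
  have "row_selection n (r * r) {..<r * r} = transpose_mat (incl_left n (r * r))"
    by (intro eq_matI) (auto simp: row_selection_def incl_left_def pick_lessThan)
  then obtain R where "R \<in> carrier_mat (r * r) (r * r)"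
    "R * (transpose_mat (incl_left n (r * r)) * unfold_angle n r (slice r Q)) = 1\<^sub>m (r * r)"
    using row_selection_invertible[OF slice_carrier \<Gamma> square_cols_invertible[OF \<Gamma>]] by auto
  from ex_complement[OF unfold_angle_carrier n this] that show thesis by blast
qed

end

locale blostr_run = nondegenerate_core +
  fixes T :: "nat list \<Rightarrow> complex" and c :: blostr_choice
  assumes T: "\<forall>as \<in> tuples n d. T as = tr_tensor r Q as" and valid: "valid_choice n r d c"
begin

lemma idx: "idx_alpha c \<in> tuples n (d - 2)" "idx_beta c \<in> tuples n (d - 2)"
    "idx_alpha' c \<in> tuples n (d - 2)" "idx_beta' c \<in> tuples n (d - 2)" "idx_m c < n"
  and cols: "cols_alpha c \<subseteq> {..<n}" "cols_beta c \<subseteq> {..<n}" "cols_alpha' c \<subseteq> {..<n}" "cols_beta' c \<subseteq> {..<n}"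
    "cols_gamma c \<subseteq> {..<n}"
  and card_cols: "card (cols_alpha c) = r\<^sup>2" "card (cols_beta c) = r\<^sup>2" "card (cols_alpha' c) = r\<^sup>2"
    "card (cols_beta' c) = r\<^sup>2" "card (cols_gamma c) = r\<^sup>2"
  using valid by (auto simp: valid_choice_def)

lemma pair_matrix:
  assumes \<alpha>\<beta>: "\<alpha> \<in> tuples n (d - 2)" "\<beta> \<in> tuples n (d - 2)"
    and \<Gamma>: "\<Gamma> \<subseteq> {..<n}" "card \<Gamma> = r\<^sup>2"
  shows "tensor_mat n T \<alpha> \<Gamma> * pinv (tensor_mat n T \<beta> \<Gamma>) =
    unfold_angle n r (slice r Q) * kron (1\<^sub>m r) (pair_ratio r Q \<alpha> \<beta>) * pinv (unfold_angle n r (slice r Q))"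
proof -
  obtain L where L: "L \<in> carrier_mat (r * r) n" "L * unfold_angle n r (slice r Q) = 1\<^sub>m (r * r)"
    using left_inverse .
  have "invertible_mat (square_cols n r (slice r Q) \<Gamma>)"
    using square_cols_invertible \<Gamma> by (simp add: power2_eq_square)
  from step1_matrix(2)[OF T d refl L \<alpha>\<beta> \<Gamma> \<Gamma> this words_invertible[OF tuples_set[OF \<alpha>\<beta>(2)]] refl]
  show ?thesis .
qed

text \<open>A stack would give a uniform spectrum to the square matrix between \<open>U\<close> and
  \<open>pinv U\<close>, hence to its multiple \<open>adj_ratio\<close>. So every run that passes
  the first step uses equal column sets within each pair.\<close>

lemma eigvec_stack_cols_eq:
  assumes \<alpha>\<beta>: "\<alpha> \<in> tuples n (d - 2)" "\<beta> \<in> tuples n (d - 2)"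
    and \<Gamma>: "\<Gamma> \<subseteq> {..<n}" "card \<Gamma> = r\<^sup>2" and \<Gamma>': "\<Gamma>' \<subseteq> {..<n}" "card \<Gamma>' = r\<^sup>2"
    and st: "eigvec_stack n r (tensor_mat n T \<alpha> \<Gamma> * pinv (tensor_mat n T \<beta> \<Gamma>')) E"
  shows "\<Gamma> = \<Gamma>'"
proof (rule ccontr)
  assume ne: "\<Gamma> \<noteq> \<Gamma>'"
  obtain L where L: "L \<in> carrier_mat (r * r) n" "L * unfold_angle n r (slice r Q) = 1\<^sub>m (r * r)"
    using left_inverse .
  note card = \<Gamma>(2)[unfolded power2_eq_square] \<Gamma>'(2)[unfolded power2_eq_square]
  note V' = square_cols_invertible[OF \<Gamma>'(1) card(2)] and \<beta> = words_invertible[OF tuples_set[OF \<alpha>\<beta>(2)]]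
  let ?M = "kron (1\<^sub>m r) (slice_word r (slice r Q) \<alpha>) * square_cols n r (slice r Q) \<Gamma> *
    (minv (square_cols n r (slice r Q) \<Gamma>') * kron (1\<^sub>m r) (minv (slice_word r (slice r Q) \<beta>)))"
  have Vc: "square_cols n r (slice r Q) \<Gamma> \<in> carrier_mat (r * r) (r * r)" "square_cols n r (slice r Q) \<Gamma>' \<in> carrier_mat (r * r) (r * r)"
    using square_cols_carrier[OF \<Gamma>(1), of r "slice r Q"] square_cols_carrier[OF \<Gamma>'(1), of r "slice r Q"] card by auto
  have M: "?M \<in> carrier_mat (r * r) (r * r)"
    using Vc minv(1)[OF Vc(2) V'] minv(1)[OF slice_word_slice_carrier \<beta>[unfolded word_invertible_def]]
    by (intro mult_carrier_mat[of _ _ "r * r"]) auto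
  obtain G ev where "G \<in> carrier_mat (r * r) (r * r)" "invertible_mat G" "E = unfold_angle n r (slice r Q) * G"
    "?M * G = G * kron (1\<^sub>m r) (mat_diag r ev)" "inj_on ev {..<r}" "\<And>k. k < r \<Longrightarrow> ev k \<noteq> 0"
    by (rule eigvec_stack_factor[OF st[unfolded step1_matrix(1)[OF T d refl L \<alpha>\<beta> \<Gamma> \<Gamma>' V' \<beta>]] n unfold_angle_carrier L M])
      blast
  then have "uniform_spectrum r ?M" unfolding uniform_spectrum_def by blast
  then have "uniform_spectrum r (adj_ratio n r Q \<alpha> \<beta> \<Gamma> \<Gamma>')"
    unfolding adj_ratio_eq[OF \<Gamma>(1) card(1) \<Gamma>'(1) card(2) V' \<beta>] by (rule uniform_spectrum_smult[OF M])
  then show False using not_uniform[OF \<alpha>\<beta> \<Gamma>(1) card(1) \<Gamma>'(1) card(2) ne] by simp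
qed

lemma step2_data:
  assumes st: "step1 n r T c E E'"
  obtains L X ev X' ev' K K' where
    "distinct_eigenbasis r (pair_ratio r Q (idx_alpha c) (idx_beta c)) X ev"
    "distinct_eigenbasis r (pair_ratio r Q (idx_alpha' c) (idx_beta' c)) X' ev'"
    "step2_setting n r (unfold_angle n r (slice r Q)) L X X' K K' E E'"
proof -
  obtain L where L: "L \<in> carrier_mat (r * r) n" "L * unfold_angle n r (slice r Q) = 1\<^sub>m (r * r)"
    using left_inverse .
  note Z = pair_ratio_carrier[OF words_invertible[OF tuples_set]]
  have s: "eigvec_stack n r (tensor_mat n T (idx_alpha c) (cols_alpha c) * pinv (tensor_mat n T (idx_beta c) (cols_beta c))) E"
    "eigvec_stack n r (tensor_mat n T (idx_alpha' c) (cols_alpha' c) * pinv (tensor_mat n T (idx_beta' c) (cols_beta' c))) E'"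
    using st by (auto simp: step1_def)
  have eq: "cols_beta c = cols_alpha c" "cols_beta' c = cols_alpha' c"
    using eigvec_stack_cols_eq[OF idx(1,2) cols(1) card_cols(1) cols(2) card_cols(2) s(1)]
      eigvec_stack_cols_eq[OF idx(3,4) cols(3) card_cols(3) cols(4) card_cols(4) s(2)] by auto
  note s = s[unfolded eq pair_matrix[OF idx(1,2) cols(1) card_cols(1)] pair_matrix[OF idx(3,4) cols(3) card_cols(3)]]
  obtain X K ev where X: "distinct_eigenbasis r (pair_ratio r Q (idx_alpha c) (idx_beta c)) X ev"
    "\<And>l. l < r \<Longrightarrow> K l \<in> carrier_mat r r" "\<And>l. l < r \<Longrightarrow> invertible_mat (K l)"
    "E = unfold_angle n r (slice r Q) * (kron (1\<^sub>m r) X * interleave r K)"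
    by (rule eig_pair_structure[OF s(1) n unfold_angle_carrier L Z[OF idx(2)]]) blast
  obtain X' K' ev' where X': "distinct_eigenbasis r (pair_ratio r Q (idx_alpha' c) (idx_beta' c)) X' ev'"
    "\<And>l. l < r \<Longrightarrow> K' l \<in> carrier_mat r r" "\<And>l. l < r \<Longrightarrow> invertible_mat (K' l)"
    "E' = unfold_angle n r (slice r Q) * (kron (1\<^sub>m r) X' * interleave r K')"
    by (rule eig_pair_structure[OF s(2) n unfold_angle_carrier L Z[OF idx(4)]]) blast
  have "step2_setting n r (unfold_angle n r (slice r Q)) L X X' K K' E E'"
    by (rule step2_setting.intro) (use X X' L r in \<open>auto simp: distinct_eigenbasis_def\<close>)
  then show thesis using that X(1) X'(1) by blast
qed

lemma hat_cores_gauge: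
  assumes st: "step1 n r T c E E'" and def2: "step2_defined r E E'"
  obtains A where "gauged_cores n r d (slice r Q) (cols_gamma c) (idx_m c) (hat_cores n r d T c E E') A"
proof -
  define S where "S = slice r Q"
  define m where "m = idx_m c"
  define \<Gamma> where "\<Gamma> = cols_gamma c"
  have S: "S a \<in> carrier_mat r r" for a by (simp add: S_def)
  obtain L X ev X' ev' K K' where
    "distinct_eigenbasis r (pair_ratio r Q (idx_alpha c) (idx_beta c)) X ev"
    "distinct_eigenbasis r (pair_ratio r Q (idx_alpha' c) (idx_beta' c)) X' ev'"
    and s: "step2_setting n r (unfold_angle n r S) L X X' K K' E E'"
    using step2_data[OF st] unfolding S_def .
  from s interpret s: step2_setting n r "unfold_angle n r S" L X X' K K' E E' "minv X * X'" .
  have nz: "(minv X * X') $$ (l, 0) \<noteq> 0" if "l < r" for l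
    using s.step2_defined_iff def2 that by blast
  obtain A B where AB: "A \<in> carrier_mat r r" "B \<in> carrier_mat r r" "invertible_mat A" "invertible_mat B"
    and Q1: "\<And>a. a < n \<Longrightarrow> first_core r E E' a = minv A * S a * B"
  proof -
    show ?thesis by (rule s.first_core_gauge[OF nz S refl], assumption) (fact that)
  qed
  note A = AB(1,3) and B = AB(2,4)
  have gc: "generic_core n r d S \<Gamma> m"
    unfolding S_def \<Gamma>_def m_def by (rule generic_core[OF cols(5) card_cols(5) idx(5)])
  then interpret g: generic_core n r d S \<Gamma> m .
  define Smat where "Smat = tensor_mat n T (replicate (d - 2) m) \<Gamma>"
  have "replicate (d - 2) m \<in> tuples n (d - 2)" using idx(5) by (auto simp: tuples_def m_def)
  moreover have "T as = tr_tensor r Q as" if "as \<in> tuples n (d - 2 + 2)" for as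
  proof -
    have "d - 2 + 2 = d" using d by simp
    then show ?thesis using T that by simp
  qed
  ultimately have Smat: "Smat = unfold_angle n r S * kron (1\<^sub>m r) (S m ^\<^sub>m (d - 2)) * square_cols n r S \<Gamma>"
    using tensor_mat_tr_tensor[OF g.\<Gamma>(1), of "replicate (d - 2) m" "d - 2" T r Q]
      slice_word_replicate[of S m r "d - 2", OF S] unfolding Smat_def S_def by simp
  define G where "G = (\<lambda>i. if i = 0 then A else if i = 1 then B else S m ^\<^sub>m (d - i) * A)"
  define H where "H = hat_cores n r d T c E E'"
  have H: "H = cores n r Smat m \<Gamma> (first_core r E E') (d - 1)"
    by (simp add: H_def hat_cores_def Smat_def m_def \<Gamma>_def)
  have G: "G i \<in> carrier_mat r r \<and> invertible_mat (G i)" for i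
  proof -
    note p = pow_invertible[OF S g.inv_S[OF g.m], of "d - i"]
    have "S m ^\<^sub>m (d - i) * A \<in> carrier_mat r r" using p(1) A(1) by (rule mult_carrier_mat)
    moreover have "invertible_mat (S m ^\<^sub>m (d - i) * A)" using p A invertible_mat_mult_iff by blast
    ultimately show ?thesis using A B by (simp add: G_def)
  qed
  have "slice_prod r H as = minv A * slice_word r S as * A" if as: "as \<in> tuples n d" for as
  proof -
    have len: "length as = d" and lt: "\<And>i. i < d \<Longrightarrow> as ! i < n"
      using as nth_mem by (fastforce simp: tuples_def)+
    have "slice_prod r H as = minv (G 0) * slice_word r S as * G (length as)"
    proof (rule slice_prod_telescope)
      show "length H = length as" using d len by (simp add: H)
      show "(H ! i) (as ! i) = minv (G i) * S (as ! i) * G (Suc i)" if "i < length as" for i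
        unfolding H G_def using g.cores_gauge[OF A B Q1 Smat, of "d - 1" i "as ! i"] that len lt d by simp
    qed (use G S in auto)
    \<comment> \<open>At index \<open>d\<close> the power of \<open>S m\<close> is the identity, so
      the last gauge is again \<open>A\<close>.\<close>
    moreover have "G (length as) = A" using d len A(1) S[of m] by (simp add: G_def)
    ultimately show ?thesis by (simp add: G_def)
  qed
  then have "gauged_cores n r d S \<Gamma> m H A"
    by (intro gauged_cores.intro[OF gc] gauged_cores_axioms.intro A)
  then show thesis using that unfolding S_def \<Gamma>_def m_def H_def by blast
qed

lemma output_gauge_equiv:
  assumes "blostr_output n r d T c R"
  shows "gauge_equiv n r d (slice r Q) R"
proof -
  obtain E E' Y D Y' where st: "step1 n r T c E E'" "step2_defined r E E'"
    and eig: "eigendecomposition (slice_prod r (hat_cores n r d T c E E') (replicate d 0)) Y D Y'"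
    and s5: "step5 n r d (hat_cores n r d T c E E') Y D Y' R"
    using assms unfolding blostr_output_def Let_def by blast
  obtain A where "gauged_cores n r d (slice r Q) (cols_gamma c) (idx_m c) (hat_cores n r d T c E E') A"
    using hat_cores_gauge[OF st] .
  then interpret g: gauged_cores n r d "slice r Q" "cols_gamma c" "idx_m c" "hat_cores n r d T c E E'" A .
  obtain k where k: "invertible_mat (Y * root_diag r d D k * Y')"
    "R = bar_core r d (hat_cores n r d T c E E') (Y * root_diag r d D k * Y')"
    "\<And>as. as \<in> tuples n d \<Longrightarrow> slice_prod r (hat_cores n r d T c E E') as = slice_prod r (replicate d R) as"
    using s5 unfolding step5_def Let_def by blast
  have "replicate d 0 \<in> tuples n d" using g.m by (auto simp: tuples_def)
  from g.H[OF this] have "slice_prod r (hat_cores n r d T c E E') (replicate d 0) \<in> carrier_mat r r"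
    using mult_carrier_mat[OF mult_carrier_mat[OF minv(1)[OF g.A] slice_word_slice_carrier] g.A(1)] by simp
  from similar_mat_witD2[OF this] eig have "Y \<in> carrier_mat r r" "Y' \<in> carrier_mat r r"
    by (auto simp: eigendecomposition_def)
  then have "Y * root_diag r d D k * Y' \<in> carrier_mat r r"
    by (intro mult_carrier_mat[of _ r r]) (auto simp: root_diag_def)
  from g.output_gauge[OF this k] show ?thesis .
qed

lemma completes:
  assumes cols_eq: "cols_alpha c = cols_beta c" "cols_alpha' c = cols_beta' c"
    and good: "good_pairs r (idx_alpha c) (idx_beta c) (idx_alpha' c) (idx_beta' c) Q"
  shows "blostr_completes n r d T c"
proof -
  obtain L where L: "L \<in> carrier_mat (r * r) n" "L * unfold_angle n r (slice r Q) = 1\<^sub>m (r * r)"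
    using left_inverse .
  obtain J K where JK: "J \<in> carrier_mat (n - r * r) n" "K \<in> carrier_mat n (n - r * r)"
    "J * unfold_angle n r (slice r Q) = 0\<^sub>m (n - r * r) (r * r)" "J * K = 1\<^sub>m (n - r * r)"
    using complement .
  have ex: "\<exists>E. eigvec_stack n r (tensor_mat n T \<alpha> \<Gamma> * pinv (tensor_mat n T \<beta> \<Gamma>)) E"
    if \<alpha>\<beta>: "\<alpha> \<in> tuples n (d - 2)" "\<beta> \<in> tuples n (d - 2)" and \<Gamma>: "\<Gamma> \<subseteq> {..<n}" "card \<Gamma> = r\<^sup>2"
      and b: "\<exists>X ev. distinct_eigenbasis r (pair_ratio r Q \<alpha> \<beta>) X ev" for \<alpha> \<beta> \<Gamma>
  proof -
    note w = words_invertible[OF tuples_set[OF \<alpha>\<beta>(1)]] words_invertible[OF tuples_set[OF \<alpha>\<beta>(2)]]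
    obtain X ev where "distinct_eigenbasis r (pair_ratio r Q \<alpha> \<beta>) X ev" using b by blast
    from eigvec_stackI[OF unfold_angle_carrier L JK(1,3,2,4) n pair_ratio_carrier[OF w(2)] pair_ratio_invertible[OF w] this]
    show ?thesis unfolding pair_matrix[OF \<alpha>\<beta> \<Gamma>] by blast
  qed
  have "\<exists>E E'. step1 n r T c E E'"
    unfolding step1_def cols_eq
    using ex[OF idx(1,2) cols(2) card_cols(2)] ex[OF idx(3,4) cols(4) card_cols(4)] good
    unfolding good_pairs_def by blast
  moreover have def2: "step2_defined r E E'" if st: "step1 n r T c E E'" for E E'
  proof -
    obtain L X ev X' ev' K K' where
      b: "distinct_eigenbasis r (pair_ratio r Q (idx_alpha c) (idx_beta c)) X ev"
        "distinct_eigenbasis r (pair_ratio r Q (idx_alpha' c) (idx_beta' c)) X' ev'"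
      and s: "step2_setting n r (unfold_angle n r (slice r Q)) L X X' K K' E E'"
      using step2_data[OF st] .
    have "0 < r" using r by simp
    then show ?thesis
      unfolding step2_setting.step2_defined_iff[OF s] using good b unfolding good_pairs_def transverse_def by blast
  qed
  moreover have "(\<exists>Y D Y'. eigendecomposition (slice_prod r (hat_cores n r d T c E E') (replicate d 0)) Y D Y') \<and>
    (\<forall>Y D Y'. eigendecomposition (slice_prod r (hat_cores n r d T c E E') (replicate d 0)) Y D Y' \<longrightarrow>
      (\<exists>R. step5 n r d (hat_cores n r d T c E E') Y D Y' R))" if st: "step1 n r T c E E'" for E E'
  proof -
    obtain A where "gauged_cores n r d (slice r Q) (cols_gamma c) (idx_m c) (hat_cores n r d T c E E') A"
      using hat_cores_gauge[OF st def2[OF st]] .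
    then interpret g: gauged_cores n r d "slice r Q" "cols_gamma c" "idx_m c" "hat_cores n r d T c E E'" A .
    obtain X ev where "distinct_eigenbasis r (slice r Q 0 ^\<^sub>m d) X ev" using power_eigenbasis by blast
    then have X: "X \<in> carrier_mat r r" "invertible_mat X" "slice r Q 0 ^\<^sub>m d * X = X * mat_diag r ev" "inj_on ev {..<r}"
      by (auto simp: distinct_eigenbasis_def)
    show ?thesis using g.ex_output[OF X] by blast
  qed
  ultimately show ?thesis
    unfolding blostr_completes_def steps12_executable_def Let_def by blast
qed

end

section \<open>Almost every core\<close>

lemma core_lebesgue_eq: "core_lebesgue n r = Pi\<^sub>M (core_index n r) (\<lambda>_. lborel)"
  by (simp add: core_lebesgue_def core_index_def)

lemma AE_core_nonzero:
  assumes "polyfun (core_index n r) f" "f Q0 \<noteq> 0"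
  shows "AE Q in core_lebesgue n r. f Q \<noteq> 0"
  unfolding core_lebesgue_eq by (rule polyfun_AE_nonzero[OF _ assms]) (simp add: core_index_def)

lemma finite_tuples: "finite (tuples n l)"
  using finite_lists_length_eq[of "{..<n}" l] by (simp add: tuples_def conj_commute)

lemma distinct_eigenbasis_smultD:
  assumes b: "distinct_eigenbasis r (c \<cdot>\<^sub>m Z) X ev" and Z: "Z \<in> carrier_mat r r" and c: "c \<noteq> 0"
  shows "distinct_eigenbasis r Z X (\<lambda>k. 1 / c * ev k)"
proof -
  have "(1 / c) \<cdot>\<^sub>m (c \<cdot>\<^sub>m Z) = Z" using c by (intro eq_matI) auto
  then show ?thesis using distinct_eigenbasis_smult[OF b, of "1 / c"] Z c by simp
qed

lemma transverse_smultD: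
  assumes "transverse r (c \<cdot>\<^sub>m Z) (c' \<cdot>\<^sub>m Z')" "Z \<in> carrier_mat r r" "Z' \<in> carrier_mat r r" "c \<noteq> 0" "c' \<noteq> 0"
  shows "transverse r Z Z'"
  using assms distinct_eigenbasis_smult unfolding transverse_def by meson

definition adj_pair :: "nat \<Rightarrow> core \<Rightarrow> nat list \<Rightarrow> nat list \<Rightarrow> complex mat" where
  "adj_pair r Q \<alpha> \<beta> = slice_word r (slice r Q) \<alpha> * adj_mat (slice_word r (slice r Q) \<beta>)"

lemma polymat_adj_pair:
  assumes "set \<alpha> \<subseteq> {..<n}" "set \<beta> \<subseteq> {..<n}"
  shows "polymat (core_index n r) r r (\<lambda>Q. adj_pair r Q \<alpha> \<beta>)"
  unfolding adj_pair_def by (intro polymat_mult[where m = r] polymat_adj polymat_slice_word assms)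

lemma adj_pair_eq:
  assumes "word_invertible r Q \<beta>"
  shows "adj_pair r Q \<alpha> \<beta> = det (slice_word r (slice r Q) \<beta>) \<cdot>\<^sub>m pair_ratio r Q \<alpha> \<beta>"
proof -
  note B = slice_word_slice_carrier assms[unfolded word_invertible_def]
  show ?thesis
    unfolding adj_pair_def pair_ratio_def adj_mat_eq_minv[OF B]
    by (rule mult_smult_distrib[OF slice_word_slice_carrier minv(1)[OF B]])
qed

text \<open>\<open>adj_pair\<close> is polynomial and, where the words for \<beta> and \<beta>' are
  invertible, a nonzero multiple of \<open>pair_ratio\<close>; eigenbases and transversality ignore
  such factors. One good core therefore makes all polynomials involved nonzero.\<close>

lemma AE_good_pairs:
  assumes idx: "\<alpha> \<in> tuples n l" "\<beta> \<in> tuples n l" "\<alpha>' \<in> tuples n l" "\<beta>' \<in> tuples n l"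
    and good: "good_pairs r \<alpha> \<beta> \<alpha>' \<beta>' Q0"
  shows "AE Q in core_lebesgue n r. good_pairs r \<alpha> \<beta> \<alpha>' \<beta>' Q"
proof -
  note sets = idx[THEN tuples_set]
  define \<delta> where "\<delta> = (\<lambda>Q. det (slice_word r (slice r Q) \<beta>))"
  define \<delta>' where "\<delta>' = (\<lambda>Q. det (slice_word r (slice r Q) \<beta>'))"
  have wi: "word_invertible r Q \<beta> \<longleftrightarrow> \<delta> Q \<noteq> 0" "word_invertible r Q \<beta>' \<longleftrightarrow> \<delta>' Q \<noteq> 0" for Q
    by (auto simp: word_invertible_def \<delta>_def \<delta>'_def invertible_mat_iff_det[OF slice_word_slice_carrier])
  have poly_\<delta>: "polyfun (core_index n r) \<delta>" "polyfun (core_index n r) \<delta>'"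
    unfolding \<delta>_def \<delta>'_def using sets by (auto intro!: polyfun_det[of _ r] polymat_slice_word)
  note A = polymat_adj_pair[OF sets(1,2), of r] and A' = polymat_adj_pair[OF sets(3,4), of r]
  obtain X ev X' ev' where w: "word_invertible r Q0 \<beta>" "word_invertible r Q0 \<beta>'"
    and b: "distinct_eigenbasis r (pair_ratio r Q0 \<alpha> \<beta>) X ev" "distinct_eigenbasis r (pair_ratio r Q0 \<alpha>' \<beta>') X' ev'"
    and W: "\<And>j k. j < r \<Longrightarrow> k < r \<Longrightarrow> (minv X * X') $$ (j, k) \<noteq> 0"
    using good unfolding good_pairs_def transverse_def by metis
  have eq: "adj_pair r Q \<alpha> \<beta> = \<delta> Q \<cdot>\<^sub>m pair_ratio r Q \<alpha> \<beta>" "adj_pair r Q \<alpha>' \<beta>' = \<delta>' Q \<cdot>\<^sub>m pair_ratio r Q \<alpha>' \<beta>'"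
    if "\<delta> Q \<noteq> 0" "\<delta>' Q \<noteq> 0" for Q
    using adj_pair_eq that wi unfolding \<delta>_def \<delta>'_def by auto
  have \<delta>0: "\<delta> Q0 \<noteq> 0" "\<delta>' Q0 \<noteq> 0" using w wi by auto
  have b': "distinct_eigenbasis r (adj_pair r Q0 \<alpha> \<beta>) X (\<lambda>k. \<delta> Q0 * ev k)"
    "distinct_eigenbasis r (adj_pair r Q0 \<alpha>' \<beta>') X' (\<lambda>k. \<delta>' Q0 * ev' k)"
    unfolding eq[OF \<delta>0] using distinct_eigenbasis_smult[OF b(1) pair_ratio_carrier[OF w(1)] \<delta>0(1)]
      distinct_eigenbasis_smult[OF b(2) pair_ratio_carrier[OF w(2)] \<delta>0(2)] by auto
  obtain P1 where P1: "polyfun (core_index n r) P1" "P1 Q0 \<noteq> 0"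
    "\<And>Q. P1 Q \<noteq> 0 \<Longrightarrow> \<exists>X ev. distinct_eigenbasis r (adj_pair r Q \<alpha> \<beta>) X ev"
    using generic_distinct_eigenbasis[OF A b'(1)] by blast
  obtain P2 where P2: "polyfun (core_index n r) P2" "P2 Q0 \<noteq> 0"
    "\<And>Q. P2 Q \<noteq> 0 \<Longrightarrow> \<exists>X ev. distinct_eigenbasis r (adj_pair r Q \<alpha>' \<beta>') X ev"
    using generic_distinct_eigenbasis[OF A' b'(2)] by blast
  obtain P3 where P3: "polyfun (core_index n r) P3" "P3 Q0 \<noteq> 0"
    "\<And>Q. P3 Q \<noteq> 0 \<Longrightarrow> transverse r (adj_pair r Q \<alpha> \<beta>) (adj_pair r Q \<alpha>' \<beta>')"
    using generic_transverse[OF A A' b' W] by blast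
  have imp: "good_pairs r \<alpha> \<beta> \<alpha>' \<beta>' Q"
    if nz: "\<delta> Q \<noteq> 0" "\<delta>' Q \<noteq> 0" and P: "P1 Q \<noteq> 0" "P2 Q \<noteq> 0" "P3 Q \<noteq> 0" for Q
  proof -
    have w: "word_invertible r Q \<beta>" "word_invertible r Q \<beta>'" using nz wi by auto
    note c = pair_ratio_carrier[OF w(1), of \<alpha>] pair_ratio_carrier[OF w(2), of \<alpha>']
    show ?thesis
      unfolding good_pairs_def
      using w P1(3)[OF P(1)] P2(3)[OF P(2)] P3(3)[OF P(3)] distinct_eigenbasis_smultD[OF _ c(1) nz(1)]
        distinct_eigenbasis_smultD[OF _ c(2) nz(2)] transverse_smultD[OF _ c nz] unfolding eq[OF nz] by blast
  qed
  from AE_core_nonzero[OF poly_\<delta>(1) \<delta>0(1)] AE_core_nonzero[OF poly_\<delta>(2) \<delta>0(2)]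
    AE_core_nonzero[OF P1(1,2)] AE_core_nonzero[OF P2(1,2)] AE_core_nonzero[OF P3(1,2)]
  show ?thesis by eventually_elim (rule imp)
qed

definition core_of :: "slices \<Rightarrow> core" where
  "core_of S = (\<lambda>(a, i, j). S a $$ (i, j))"

lemma slice_core_of: "S a \<in> carrier_mat r r \<Longrightarrow> slice r (core_of S) a = S a"
  by (intro eq_matI) (auto simp: slice_def core_of_def)

lemma AE_power_eigenbasis:
  assumes n: "0 < n" and d: "0 < d"
  shows "AE Q in core_lebesgue n r. \<exists>X ev. distinct_eigenbasis r (slice r Q 0 ^\<^sub>m d) X ev"
proof -
  \<comment> \<open>Distinct positive integers keep distinct d-th powers, so a diagonal slice with
    these entries is a witness.\<close>
  define f where "f = (\<lambda>k. complex_of_nat (Suc k))"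
  define Q0 where "Q0 = core_of (\<lambda>_. mat_diag r f)"
  have pow: "mat_diag r f ^\<^sub>m i = mat_diag r (\<lambda>k. f k ^ i)" for i
    by (induction i) (auto simp: mat_diag_diag mult.commute)
  have "inj_on (\<lambda>k. f k ^ d) {..<r}"
  proof (rule inj_onI)
    fix x y assume "f x ^ d = f y ^ d"
    then have "Suc x ^ d = Suc y ^ d" unfolding f_def of_nat_power[symmetric] of_nat_eq_iff .
    then show "x = y" using d by (simp add: power_eq_iff_eq_base del: power_Suc)
  qed
  then have "distinct_eigenbasis r (slice r Q0 0 ^\<^sub>m d) (1\<^sub>m r) (\<lambda>k. f k ^ d)"
    unfolding Q0_def slice_core_of[OF mat_diag_dim] pow by (simp add: distinct_eigenbasis_def)
  then obtain P where "polyfun (core_index n r) P" "P Q0 \<noteq> 0"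
    "\<And>Q. P Q \<noteq> 0 \<Longrightarrow> \<exists>X ev. distinct_eigenbasis r (slice r Q 0 ^\<^sub>m d) X ev"
    using generic_distinct_eigenbasis[OF polymat_pow[OF polymat_slice[OF n]]] by blast
  then show ?thesis using AE_core_nonzero[of n r P Q0] by (auto elim: eventually_mono)
qed

lemma AE_nondegenerate_core:
  assumes n: "r * r \<le> n" and d: "d \<ge> 3" and r: "r \<ge> 2"
  shows "AE Q in core_lebesgue n r. nondegenerate_core n r d Q"
proof -
  define G where "G = {\<Gamma>. \<Gamma> \<subseteq> {..<n} \<and> card \<Gamma> = r * r}"
  have finG: "finite G" unfolding G_def by (rule finite_subset[of _ "Pow {..<n}"]) auto
  have "0 < r * r" using r by simp
  then have n0: "0 < n" using n by (rule less_le_trans)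
  have "AE Q in core_lebesgue n r. \<forall>a \<in> {..<n}. det (slice r Q a) \<noteq> 0"
    using ex_det_slice_nonzero[of r] AE_core_nonzero[OF polyfun_det_slice, of _ n r] by (intro AE_finite_allI) auto
  moreover have "AE Q in core_lebesgue n r. \<forall>\<Gamma> \<in> G. det (square_cols n r (slice r Q) \<Gamma>) \<noteq> 0"
  proof (rule AE_finite_allI[OF finG])
    fix \<Gamma> assume "\<Gamma> \<in> G"
    then have \<Gamma>: "\<Gamma> \<subseteq> {..<n}" "card \<Gamma> = r * r" by (auto simp: G_def)
    show "AE Q in core_lebesgue n r. det (square_cols n r (slice r Q) \<Gamma>) \<noteq> 0"
      using ex_det_square_cols_nonzero[OF \<Gamma>] AE_core_nonzero[OF polyfun_det_square_cols[OF \<Gamma>]] by blast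
  qed
  moreover have "AE Q in core_lebesgue n r. \<forall>\<alpha> \<in> tuples n (d - 2). \<forall>\<beta> \<in> tuples n (d - 2). \<forall>\<Gamma> \<in> G. \<forall>\<Gamma>' \<in> G.
    \<Gamma> \<noteq> \<Gamma>' \<longrightarrow> \<not> uniform_spectrum r (adj_ratio n r Q \<alpha> \<beta> \<Gamma> \<Gamma>')"
  proof (intro AE_finite_allI finG finite_tuples)
    fix \<alpha> \<beta> \<Gamma> \<Gamma>' assume "\<alpha> \<in> tuples n (d - 2)" "\<beta> \<in> tuples n (d - 2)" "\<Gamma> \<in> G" "\<Gamma>' \<in> G"
    then have c: "set \<alpha> \<subseteq> {..<n}" "set \<beta> \<subseteq> {..<n}" "\<Gamma> \<subseteq> {..<n}" "card \<Gamma> = r * r" "\<Gamma>' \<subseteq> {..<n}" "card \<Gamma>' = r * r"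
      by (auto simp: G_def tuples_def)
    show "AE Q in core_lebesgue n r. \<Gamma> \<noteq> \<Gamma>' \<longrightarrow> \<not> uniform_spectrum r (adj_ratio n r Q \<alpha> \<beta> \<Gamma> \<Gamma>')"
    proof (cases "\<Gamma> = \<Gamma>'")
      case False
      obtain P Q0 where P: "polyfun (core_index n r) P" "P Q0 \<noteq> 0"
        "\<And>Q. uniform_spectrum r (adj_ratio n r Q \<alpha> \<beta> \<Gamma> \<Gamma>') \<Longrightarrow> P Q = 0"
        using generic_not_uniform_spectrum[OF r c(3-6) False c(1,2)] by metis
      from AE_core_nonzero[OF P(1,2)] show ?thesis by eventually_elim (use P(3) in blast)
    qed simp
  qed
  moreover have "AE Q in core_lebesgue n r. \<exists>X ev. distinct_eigenbasis r (slice r Q 0 ^\<^sub>m d) X ev"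
    using AE_power_eigenbasis n0 d by simp
  ultimately show ?thesis
  proof eventually_elim
    case (elim Q)
    show ?case by (rule nondegenerate_core.intro) (use n d r elim in \<open>auto simp: G_def\<close>)
  qed
qed

section \<open>From executability on one core to good pairs\<close>

lemma distinct_eigenbasis_permute:
  assumes b: "distinct_eigenbasis r Z X ev" and Z: "Z \<in> carrier_mat r r"
    and \<sigma>: "bij_betw \<sigma> {..<r} {..<r}"
  shows "distinct_eigenbasis r Z (Matrix.mat r r (\<lambda>(i, t). X $$ (i, \<sigma> t))) (ev \<circ> \<sigma>)"
proof -
  have X: "X \<in> carrier_mat r r" "invertible_mat X" and eq: "Z * X = X * mat_diag r ev" and inj: "inj_on ev {..<r}"
    using b by (auto simp: distinct_eigenbasis_def)
  note mX = minv[OF X]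
  define X' where "X' = Matrix.mat r r (\<lambda>(i, t). X $$ (i, \<sigma> t))"
  define Y' where "Y' = Matrix.mat r r (\<lambda>(t, j). minv X $$ (\<sigma> t, j))"
  have X': "X' \<in> carrier_mat r r" and Y': "Y' \<in> carrier_mat r r" by (auto simp: X'_def Y'_def)
  have \<sigma>r: "\<sigma> t < r" if "t < r" for t using \<sigma> that by (auto simp: bij_betw_def)
  have "X' * Y' = 1\<^sub>m r"
  proof (rule eq_matI)
    fix i j assume "i < dim_row (1\<^sub>m r :: complex mat)" "j < dim_col (1\<^sub>m r :: complex mat)"
    then have ij: "i < r" "j < r" by auto
    have "(X' * Y') $$ (i, j) = (\<Sum>t<r. X $$ (i, \<sigma> t) * minv X $$ (\<sigma> t, j))"
      unfolding mult_index[OF X' Y' ij] using ij by (intro sum.cong refl) (simp add: X'_def Y'_def)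
    also have "\<dots> = (\<Sum>t<r. X $$ (i, t) * minv X $$ (t, j))"
      by (rule sum.reindex_bij_betw[OF \<sigma>])
    also have "\<dots> = 1\<^sub>m r $$ (i, j)" unfolding mult_index[OF X(1) mX(1) ij, symmetric] mX(2) ..
    finally show "(X' * Y') $$ (i, j) = 1\<^sub>m r $$ (i, j)" .
  qed (use X' Y' in auto)
  then have "invertible_mat X'" by (rule invertible_mat_and_minv(1)[OF X' Y'])
  moreover have "Z * X' = X' * mat_diag r (ev \<circ> \<sigma>)"
  proof (rule eq_matI)
    fix i j assume "i < dim_row (X' * mat_diag r (ev \<circ> \<sigma>))" "j < dim_col (X' * mat_diag r (ev \<circ> \<sigma>))"
    then have ij: "i < r" "j < r" using X' by auto
    have "(Z * X') $$ (i, j) = (Z * X) $$ (i, \<sigma> j)"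
      unfolding mult_index[OF Z X' ij] mult_index[OF Z X(1) ij(1) \<sigma>r[OF ij(2)]]
      using ij by (intro sum.cong refl) (simp add: X'_def)
    also have "\<dots> = X $$ (i, \<sigma> j) * ev (\<sigma> j)"
      unfolding eq mat_diag_mult_right[OF X(1)] using ij \<sigma>r by simp
    also have "\<dots> = (X' * mat_diag r (ev \<circ> \<sigma>)) $$ (i, j)"
      unfolding mat_diag_mult_right[OF X'] using ij by (simp add: X'_def)
    finally show "(Z * X') $$ (i, j) = (X' * mat_diag r (ev \<circ> \<sigma>)) $$ (i, j)" .
  qed (use X' Z in auto)
  moreover have "inj_on (ev \<circ> \<sigma>) {..<r}" using inj \<sigma> by (auto simp: bij_betw_def intro: comp_inj_on)
  ultimately show ?thesis using X' unfolding X'_def distinct_eigenbasis_def by blast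
qed

text \<open>One pair of eigenbases suffices, because the Krylov determinant does not refer to
  eigenbases.\<close>

lemma transverseI:
  assumes "Z \<in> carrier_mat r r" "Z' \<in> carrier_mat r r"
    and "distinct_eigenbasis r Z X ev" "distinct_eigenbasis r Z' X' ev'"
    and "\<And>j k. j < r \<Longrightarrow> k < r \<Longrightarrow> (minv X * X') $$ (j, k) \<noteq> 0"
  shows "transverse r Z Z'"
  using ex_krylov_if_transverse[OF assms] transverse_if_krylov[OF assms(1,2)] by blast

text \<open>
  The stack has rank \<open>r\<^sup>2\<close>, so all factors of the matrices have full rank.
\<close>

lemma eigvec_stack_nondegenerate:
  assumes st: "eigvec_stack n r (tensor_mat n (tr_tensor r Q) \<alpha> \<Gamma> * pinv (tensor_mat n (tr_tensor r Q) \<beta> \<Gamma>)) E"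
    and \<alpha>\<beta>: "\<alpha> \<in> tuples n l" "\<beta> \<in> tuples n l" and \<Gamma>: "\<Gamma> \<subseteq> {..<n}" "card \<Gamma> = r\<^sup>2" and n: "r * r \<le> n"
  shows "word_invertible r Q \<alpha>" "word_invertible r Q \<beta>" "invertible_mat (square_cols n r (slice r Q) \<Gamma>)"
    and "\<exists>L \<in> carrier_mat (r * r) n. L * unfold_angle n r (slice r Q) = 1\<^sub>m (r * r)"
    and "\<exists>J \<in> carrier_mat (n - r * r) n. \<exists>K \<in> carrier_mat n (n - r * r).
      J * unfold_angle n r (slice r Q) = 0\<^sub>m (n - r * r) (r * r) \<and> J * K = 1\<^sub>m (n - r * r)"
proof -
  define m where "m = r * r"
  define U where "U = unfold_angle n r (slice r Q)"
  define kA where "kA = kron (1\<^sub>m r) (slice_word r (slice r Q) \<alpha>)"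
  define kB where "kB = kron (1\<^sub>m r) (slice_word r (slice r Q) \<beta>)"
  define V where "V = square_cols n r (slice r Q) \<Gamma>"
  define X where "X = pinv (tensor_mat n (tr_tensor r Q) \<beta> \<Gamma>)"
  have U: "U \<in> carrier_mat n m" by (simp add: U_def m_def)
  have V: "V \<in> carrier_mat m m"
    using square_cols_carrier[OF \<Gamma>(1), of r "slice r Q"] \<Gamma>(2) by (simp add: V_def m_def power2_eq_square)
  have k: "kA \<in> carrier_mat m m" "kB \<in> carrier_mat m m"
    by (simp_all add: kA_def kB_def m_def)
  have TA: "tensor_mat n (tr_tensor r Q) \<alpha> \<Gamma> = U * kA * V" and TB: "tensor_mat n (tr_tensor r Q) \<beta> \<Gamma> = U * kB * V"
    unfolding U_def kA_def kB_def V_def by (rule tensor_mat_tr_tensor[OF \<Gamma>(1) _ refl], rule \<alpha>\<beta>)+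
  have TBc: "U * kB * V \<in> carrier_mat n m" using U k V by auto
  have X: "X \<in> carrier_mat m n" and XTX: "X * (U * kB * V) * X = X"
    using pinv_carrier[OF TBc] is_pinv_pinv[OF TBc] by (auto simp: X_def TB is_pinv_def)
  obtain R J K ev where E: "E \<in> carrier_mat n m" and R: "R \<in> carrier_mat m n" "R * E = 1\<^sub>m m"
    and J: "J \<in> carrier_mat (n - m) n" "J * E = 0\<^sub>m (n - m) m" and K: "K \<in> carrier_mat n (n - m)" "J * K = 1\<^sub>m (n - m)"
    and ME: "U * kA * V * X * E = E * kron (1\<^sub>m r) (mat_diag r ev)" and ev: "\<And>k. k < r \<Longrightarrow> ev k \<noteq> 0"
    using eigvec_stackD[OF st n] unfolding TA X_def[symmetric] m_def by metis
  define \<Lambda> where "\<Lambda> = kron (1\<^sub>m r) (mat_diag r ev)"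
  have \<Lambda>: "\<Lambda> \<in> carrier_mat m m" by (simp add: \<Lambda>_def m_def)
  have "invertible_mat \<Lambda>"
    unfolding \<Lambda>_def using mat_diag_invertible[of r ev] ev by (intro kron_invertible(1)) auto
  note m\<Lambda> = minv[OF \<Lambda> this]
  define XE where "XE = X * E"
  have XE: "XE \<in> carrier_mat m m" using X E by (simp add: XE_def)
  \<comment> \<open>\<open>E\<close> is \<open>U\<close> times this product of square factors. Its
    left inverse makes \<open>Y\<close> invertible, and with it every factor.\<close>
  define Y where "Y = kA * (V * (XE * minv \<Lambda>))"
  have Yc: "Y \<in> carrier_mat m m" using k V XE m\<Lambda> by (auto simp: Y_def)
  have "U * Y = U * kA * V * X * E * minv \<Lambda>"
    unfolding Y_def XE_def using U k V X E m\<Lambda>(1) by (simp add: mat_assoc)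
  also have "\<dots> = E" unfolding ME \<Lambda>_def[symmetric] by (rule mult_minv_cancel(3)[OF \<Lambda> \<open>invertible_mat \<Lambda>\<close> E])
  finally have UY: "U * Y = E" .
  have RU: "R * U \<in> carrier_mat m m" using R(1) U by simp
  have RUY: "R * U * Y = 1\<^sub>m m" unfolding assoc_mult_mat[OF R(1) U Yc] UY by (rule R(2))
  have YRU: "Y * (R * U) = 1\<^sub>m m" by (rule mat_mult_left_right_inverse[OF RU Yc RUY])
  have iY: "invertible_mat Y" by (rule invertible_mat_and_minv(1)[OF Yc RU YRU])
  have VX: "V * (XE * minv \<Lambda>) \<in> carrier_mat m m" "XE * minv \<Lambda> \<in> carrier_mat m m" using V XE m\<Lambda>(1) by auto
  have inv: "invertible_mat kA" "invertible_mat V" "invertible_mat XE"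
    using iY unfolding Y_def invertible_mat_mult_iff[OF k(1) VX(1)] invertible_mat_mult_iff[OF V VX(2)]
      invertible_mat_mult_iff[OF XE m\<Lambda>(1)] by auto
  have XT: "X * (U * kB * V) \<in> carrier_mat m m" using X TBc by simp
  \<comment> \<open>The Penrose equation for \<open>X\<close>, applied to \<open>E\<close>. As
    \<open>XE\<close> is invertible, \<open>X\<close> is a left inverse of the second tensor matrix,
    which makes \<open>kB\<close> invertible too.\<close>
  have "X * (U * kB * V) * XE = XE"
    using arg_cong[OF XTX, of "\<lambda>A. A * E"] assoc_mult_mat[OF XT X E] by (simp add: XE_def)
  then have "X * (U * kB * V) = XE * minv XE"
    using mult_minv_cancel(3)[OF XE inv(3) XT] by simp
  then have "X * U * (kB * V) = 1\<^sub>m m"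
    using minv(2)[OF XE inv(3)] X U k V by (simp add: mat_assoc)
  moreover have XU: "X * U \<in> carrier_mat m m" and kV: "kB * V \<in> carrier_mat m m" using X U k V by auto
  ultimately have "kB * V * (X * U) = 1\<^sub>m m" using mat_mult_left_right_inverse[OF XU kV] by blast
  then have "invertible_mat (kB * V)" by (rule invertible_mat_and_minv(1)[OF kV XU])
  then have "invertible_mat kB" using invertible_mat_mult_iff[OF k(2) V] by simp
  then show "word_invertible r Q \<alpha>" "word_invertible r Q \<beta>"
    using inv(1) invertible_kron_oneD[OF slice_word_slice_carrier] unfolding word_invertible_def kA_def kB_def by blast+
  show "invertible_mat (square_cols n r (slice r Q) \<Gamma>)" using inv(2) by (simp add: V_def)
  have "Y * R * U = 1\<^sub>m m" unfolding assoc_mult_mat[OF Yc R(1) U] by (rule YRU)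
  then show "\<exists>L \<in> carrier_mat (r * r) n. L * unfold_angle n r (slice r Q) = 1\<^sub>m (r * r)"
    using mult_carrier_mat[OF Yc R(1)] unfolding U_def m_def by blast
  have "U = E * minv Y" unfolding UY[symmetric] by (rule mult_minv_cancel(3)[OF Yc iY U, symmetric])
  then have "J * U = J * E * minv Y" using assoc_mult_mat[OF J(1) E minv(1)[OF Yc iY]] by simp
  also have "\<dots> = 0\<^sub>m (n - m) m" unfolding J(2) using minv(1)[OF Yc iY] by simp
  finally show "\<exists>J \<in> carrier_mat (n - r * r) n. \<exists>K \<in> carrier_mat n (n - r * r).
      J * unfold_angle n r (slice r Q) = 0\<^sub>m (n - r * r) (r * r) \<and> J * K = 1\<^sub>m (n - r * r)"
    using J(1) K unfolding U_def m_def by blast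
qed

text \<open>Executability ranges over all eigenvectors and all orders of the eigenvalues. Each pair
  of eigenbases of the two ratios occurs as a possible outcome of the first step, and each column of
  the change of basis becomes the first one for a suitable order.\<close>

lemma good_pairs_if_executable:
  assumes ex: "steps12_executable n r (tr_tensor r Q) c" and valid: "valid_choice n r d c"
    and cols: "cols_alpha c = cols_beta c" "cols_alpha' c = cols_beta' c"
    and n: "r * r \<le> n" and d: "d \<ge> 3" and r: "r \<ge> 2"
  shows "good_pairs r (idx_alpha c) (idx_beta c) (idx_alpha' c) (idx_beta' c) Q"
proof -
  define U where "U = unfold_angle n r (slice r Q)"
  have U: "U \<in> carrier_mat n (r * r)" by (simp add: U_def)
  define Z where "Z = pair_ratio r Q (idx_alpha c) (idx_beta c)"
  define Z' where "Z' = pair_ratio r Q (idx_alpha' c) (idx_beta' c)"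
  have idx: "idx_alpha c \<in> tuples n (d - 2)" "idx_beta c \<in> tuples n (d - 2)"
      "idx_alpha' c \<in> tuples n (d - 2)" "idx_beta' c \<in> tuples n (d - 2)"
    and \<Gamma>: "cols_beta c \<subseteq> {..<n}" "card (cols_beta c) = r\<^sup>2" and \<Gamma>': "cols_beta' c \<subseteq> {..<n}" "card (cols_beta' c) = r\<^sup>2"
    using valid by (auto simp: valid_choice_def)
  obtain E E' where "step1 n r (tr_tensor r Q) c E E'" using ex by (auto simp: steps12_executable_def)
  then have E: "eigvec_stack n r (tensor_mat n (tr_tensor r Q) (idx_alpha c) (cols_beta c) *
      pinv (tensor_mat n (tr_tensor r Q) (idx_beta c) (cols_beta c))) E"
    and E': "eigvec_stack n r (tensor_mat n (tr_tensor r Q) (idx_alpha' c) (cols_beta' c) *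
      pinv (tensor_mat n (tr_tensor r Q) (idx_beta' c) (cols_beta' c))) E'"
    by (auto simp: step1_def cols)
  note nd = eigvec_stack_nondegenerate[OF E idx(1,2) \<Gamma> n] and nd' = eigvec_stack_nondegenerate[OF E' idx(3,4) \<Gamma>' n]
  obtain L where L: "L \<in> carrier_mat (r * r) n" "L * U = 1\<^sub>m (r * r)" using nd(4) unfolding U_def by blast
  obtain J K where JK: "J \<in> carrier_mat (n - r * r) n" "K \<in> carrier_mat n (n - r * r)"
    "J * U = 0\<^sub>m (n - r * r) (r * r)" "J * K = 1\<^sub>m (n - r * r)" using nd(5) unfolding U_def by blast
  have Z: "Z \<in> carrier_mat r r" "invertible_mat Z" and Z': "Z' \<in> carrier_mat r r" "invertible_mat Z'"
    using pair_ratio_carrier[OF nd(2)] pair_ratio_carrier[OF nd'(2)] pair_ratio_invertible[OF nd(1,2)]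
      pair_ratio_invertible[OF nd'(1,2)] by (auto simp: Z_def Z'_def)
  note eq = step1_matrix(2)[OF ballI[OF refl] d U_def L idx(1,2) \<Gamma> \<Gamma> nd(3,2) refl, folded Z_def]
    and eq' = step1_matrix(2)[OF ballI[OF refl] d U_def L idx(3,4) \<Gamma>' \<Gamma>' nd'(3,2) refl, folded Z'_def]
  obtain X0 ev0 where X0: "distinct_eigenbasis r Z X0 ev0"
    using eig_pair_structure[OF E[unfolded eq] n U L Z(1)] by metis
  obtain X0' ev0' where X0': "distinct_eigenbasis r Z' X0' ev0'"
    using eig_pair_structure[OF E'[unfolded eq'] n U L Z'(1)] by metis
  \<comment> \<open>The stacks with trivial basis choices in the eigenspaces are legitimate
    outcomes, so the second step must be defined for them.\<close>
  have first: "(minv X * X') $$ (j, 0) \<noteq> 0"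
    if b: "distinct_eigenbasis r Z X ev" "distinct_eigenbasis r Z' X' ev'" and j: "j < r" for X ev X' ev' j
  proof -
    have X: "X \<in> carrier_mat r r" "invertible_mat X" and X': "X' \<in> carrier_mat r r"
      using b by (auto simp: distinct_eigenbasis_def)
    note E1 = eigvec_stackI[OF U L JK(1,3,2,4) n Z b(1)] and E1' = eigvec_stackI[OF U L JK(1,3,2,4) n Z' b(2)]
    have "step1 n r (tr_tensor r Q) c (U * kron (1\<^sub>m r) X) (U * kron (1\<^sub>m r) X')"
      unfolding step1_def cols eq eq' using E1 E1' by blast
    then have "step2_defined r (U * kron (1\<^sub>m r) X) (U * kron (1\<^sub>m r) X')"
      using ex by (simp add: steps12_executable_def)
    moreover have "step2_setting n r U L X X' (\<lambda>_. 1\<^sub>m r) (\<lambda>_. 1\<^sub>m r) (U * kron (1\<^sub>m r) X) (U * kron (1\<^sub>m r) X')"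
      using U L X X' r right_mult_one_mat[OF kron_carrier[OF one_carrier_mat X(1)]]
        right_mult_one_mat[OF kron_carrier[OF one_carrier_mat X']]
      by (intro step2_setting.intro) (simp_all add: interleave_one)
    ultimately show ?thesis using step2_setting.step2_defined_iff j by blast
  qed
  have "transverse r Z Z'"
    unfolding transverse_def
  proof (intro allI impI)
    fix X ev X' ev' j k
    assume b: "distinct_eigenbasis r Z X ev" "distinct_eigenbasis r Z' X' ev'" and jk: "j < r" "k < r"
    \<comment> \<open>The transposition of 0 and \<open>k\<close> moves column \<open>k\<close> of
      the change of basis to the front.\<close>
    define \<sigma> where "\<sigma> = (\<lambda>t. if t = 0 then k else if t = k then 0 else t)"
    have r0: "0 < r" using r by simp
    have "bij_betw \<sigma> {..<r} {..<r}"
      by (rule bij_betw_byWitness[of _ \<sigma>]) (use jk r0 in \<open>auto simp: \<sigma>_def\<close>)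
    note b' = distinct_eigenbasis_permute[OF b(2) Z'(1) this]
    have c: "minv X \<in> carrier_mat r r" "X' \<in> carrier_mat r r"
      using b minv(1) by (auto simp: distinct_eigenbasis_def)
    have "(minv X * Matrix.mat r r (\<lambda>(i, t). X' $$ (i, \<sigma> t))) $$ (j, 0) = (minv X * X') $$ (j, k)"
      unfolding mult_index[OF c jk] mult_index[OF c(1) mat_carrier jk(1) r0]
      using r0 by (intro sum.cong refl) (simp add: \<sigma>_def)
    then show "(minv X * X') $$ (j, k) \<noteq> 0" using first[OF b(1) b' jk(1)] by simp
  qed
  then show ?thesis
    unfolding good_pairs_def Z_def[symmetric] Z'_def[symmetric] using nd(2) nd'(2) X0 X0' by blast
qed

section \<open>A core with good pairs for separated indices\<close>

lemma minv_mat_diag: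
  assumes "\<And>k. k < r \<Longrightarrow> f k \<noteq> (0 :: complex)"
  shows "minv (mat_diag r f) = mat_diag r (\<lambda>k. 1 / f k)"
proof -
  have "mat_diag r (\<lambda>k. f k * (1 / f k)) = 1\<^sub>m r"
    using assms by (intro eq_matI) (auto simp: mat_diag_index)
  then show ?thesis by (intro invertible_mat_and_minv(2)[of _ r]) auto
qed

lemma slice_word_one_diag:
  assumes "\<And>a. a \<in> set as \<Longrightarrow> S a = (if a = e then mat_diag r f else 1\<^sub>m r)"
  shows "slice_word r S as = mat_diag r (\<lambda>k. f k ^ count_list as e)"
  using assms
proof (induction as)
  case (Cons a as)
  have "slice_word r S (a # as) = S a * mat_diag r (\<lambda>k. f k ^ count_list as e)"
    using Cons by (simp add: slice_word_def)
  then show ?case using Cons.prems[of a] left_mult_one_mat[OF mat_diag_dim] by simp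
qed (simp add: slice_word_def)

text \<open>Since \<open>e'\<close> occurs only once, the word is \<open>D u * G * D v\<close> with
  a free slice \<open>G\<close> at \<open>e'\<close>, and this can be solved for \<open>G\<close>.
  Words that avoid \<open>e'\<close> remain diagonal.\<close>

lemma ex_core_word:
  assumes M: "M \<in> carrier_mat r r" and e': "count_list as e' = 1" and f: "\<And>k. k < r \<Longrightarrow> f k \<noteq> (0 :: complex)"
  shows "\<exists>Q. (\<forall>bs. e' \<notin> set bs \<longrightarrow> slice_word r (slice r Q) bs = mat_diag r (\<lambda>k. f k ^ count_list bs e)) \<and>
    slice_word r (slice r Q) as = M"
proof -
  have "e' \<in> set as" using e' count_notin[of e' as] by force
  then obtain u v where as: "as = u @ e' # v" and u: "e' \<notin> set u" using split_list_first by metis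
  then have v: "e' \<notin> set v" using e' by (auto simp: count_list_0_iff)
  define D where "D = (\<lambda>bs. mat_diag r (\<lambda>k. f k ^ count_list bs e))"
  have D: "D bs \<in> carrier_mat r r" "invertible_mat (D bs)" for bs
    unfolding D_def using f by (auto intro!: mat_diag_invertible)
  define G where "G = minv (D u) * (M * minv (D v))"
  note mu = minv(1)[OF D[of u]] and mv = minv(1)[OF D[of v]]
  have Mv: "M * minv (D v) \<in> carrier_mat r r" using M mv by (rule mult_carrier_mat)
  have G: "G \<in> carrier_mat r r" unfolding G_def using mu Mv by (rule mult_carrier_mat)
  define S where "S = (\<lambda>a. if a = e' then G else if a = e then mat_diag r f else 1\<^sub>m r)"
  have S: "S a \<in> carrier_mat r r" for a using G by (simp add: S_def)
  have slice: "slice r (core_of S) = S" by (rule ext) (rule slice_core_of[OF S])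
  have word: "slice_word r S bs = D bs" if "e' \<notin> set bs" for bs
    unfolding D_def by (rule slice_word_one_diag) (use that in \<open>auto simp: S_def\<close>)
  have Se: "S e' = G" by (simp add: S_def)
  have GD: "G * D v = minv (D u) * (M * minv (D v) * D v)"
    unfolding G_def by (rule assoc_mult_mat[OF mu Mv D(1)])
  have "slice_word r S as = mprod r (map S u @ map S (e' # v))"
    by (simp only: slice_word_def as map_append)
  also have "\<dots> = mprod r (map S u) * mprod r (map S (e' # v))"
    by (rule mprod_append) (use S in auto)
  also have "\<dots> = slice_word r S u * (S e' * slice_word r S v)"
    by (simp only: slice_word_def mprod_Cons list.map)
  also have "\<dots> = D u * (minv (D u) * (M * minv (D v) * D v))"
    unfolding word[OF u] word[OF v] Se GD ..
  also have "M * minv (D v) * D v = M" by (rule mult_minv_cancel(4)[OF D M])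
  also have "D u * (minv (D u) * M) = M" by (rule mult_minv_cancel(1)[OF D M])
  finally have "slice_word r S as = M" .
  then show ?thesis using word unfolding D_def by (intro exI[of _ "core_of S"]) (simp add: slice)
qed

text \<open>The index \<open>e\<close> makes the first ratio diagonal with distinct entries, and the
  free slice at \<open>e'\<close>, absent from the first pair, lets the second ratio be any
  prescribed invertible matrix \<open>N\<close>.\<close>

lemma ex_good_pairs_if_separated:
  assumes "separated c"
  shows "\<exists>Q. good_pairs r (idx_alpha c) (idx_beta c) (idx_alpha' c) (idx_beta' c) Q"
proof -
  define \<alpha> where "\<alpha> = idx_alpha c"
  define \<beta> where "\<beta> = idx_beta c"
  define \<alpha>' where "\<alpha>' = idx_alpha' c"
  define \<beta>' where "\<beta>' = idx_beta' c"
  obtain e e' where e: "count_list (\<alpha> @ \<beta>) e = 1" and e': "count_list (\<alpha>' @ \<beta>') e' = 1" "e' \<notin> set (\<alpha> @ \<beta>)"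
    using assms unfolding separated_def \<alpha>_def \<beta>_def \<alpha>'_def \<beta>'_def by blast
  define f where "f = (\<lambda>k. complex_of_nat (Suc k))"
  have f: "f k \<noteq> 0" for k unfolding f_def by (simp del: of_nat_Suc)
  have inj: "inj_on f {..<r}" by (auto simp: f_def inj_on_def simp del: of_nat_Suc)
  define D where "D = (\<lambda>i. mat_diag r (\<lambda>k. f k ^ i))"
  have D: "D i \<in> carrier_mat r r" "invertible_mat (D i)" for i
    unfolding D_def using f by (auto intro!: mat_diag_invertible)
  have D_eq: "mat_diag r (\<lambda>k. f k ^ i) = D i" for i by (simp add: D_def)
  text \<open>All entries of \<open>X'\<close> are nonzero, so its columns are transverse to the standard basis.\<close>
  define X' where "X' = Matrix.mat r r (\<lambda>(i, j). if i = j then 2 else (1 :: complex))"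
  have X': "X' \<in> carrier_mat r r" by (simp add: X'_def)
  have "invertible_mat X'"
  proof -
    \<comment> \<open>\<open>X'\<close> is the identity plus the all-ones matrix. By the
      Sherman-Morrison formula its inverse is the identity minus \<open>q\<close> times the all-ones
      matrix.\<close>
    define q where "q = 1 / (of_nat r + 1 :: complex)"
    have "of_nat r + 1 \<noteq> (0 :: complex)" using of_nat_neq_0[of r] by (simp add: add.commute)
    then have q: "of_nat r * q + q = 1" by (simp add: q_def field_simps)
    define Y where "Y = Matrix.mat r r (\<lambda>(i, j). (if i = j then 1 else 0) - q)"
    have Y: "Y \<in> carrier_mat r r" by (simp add: Y_def)
    have "X' * Y = 1\<^sub>m r"
    proof (rule eq_matI)
      fix i j assume "i < dim_row (1\<^sub>m r :: complex mat)" "j < dim_col (1\<^sub>m r :: complex mat)"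
      then have ij: "i < r" "j < r" by auto
      have "(X' * Y) $$ (i, j) =
          (\<Sum>t<r. (if t = j then 1 else 0) - q + (if t = i then (if i = j then 1 else 0) - q else 0))"
        unfolding mult_index[OF X' Y ij] using ij by (intro sum.cong refl) (auto simp: X'_def Y_def)
      also have "\<dots> = 1 - of_nat r * q + ((if i = j then 1 else 0) - q)"
        using ij by (simp add: sum.distrib sum_subtractf)
      also have "\<dots> = 1 - (of_nat r * q + q) + (if i = j then 1 else 0)" by (simp add: algebra_simps)
      finally show "(X' * Y) $$ (i, j) = 1\<^sub>m r $$ (i, j)" unfolding q using ij by simp
    qed (use X' Y in auto)
    then show ?thesis by (rule invertible_mat_and_minv(1)[OF X' Y])
  qed
  note mX' = minv[OF X' this]
  define N where "N = X' * mat_diag r f * minv X'"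
  have X'f: "X' * mat_diag r f \<in> carrier_mat r r" using X' by simp
  have N: "N \<in> carrier_mat r r" unfolding N_def using X'f mX'(1) by (rule mult_carrier_mat)
  have "N * X' = X' * mat_diag r f"
    unfolding N_def by (rule mult_minv_cancel(4)[OF X' \<open>invertible_mat X'\<close> X'f])
  then have bN: "distinct_eigenbasis r N X' f"
    using X' \<open>invertible_mat X'\<close> inj by (simp add: distinct_eigenbasis_def)
  have "invertible_mat (mat_diag r f)" by (rule mat_diag_invertible) (rule f)
  then have "invertible_mat (X' * mat_diag r f)"
    using invertible_mat_mult_iff[OF X' mat_diag_dim, of f] \<open>invertible_mat X'\<close> by blast
  then have iN: "invertible_mat N"
    unfolding N_def using invertible_mat_mult_iff[OF X'f mX'(1)]
      invertible_mat_minv(1)[OF X' \<open>invertible_mat X'\<close>] by blast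
  note mN = minv(1)[OF N iN] and imN = invertible_mat_minv[OF N iN]
  \<comment> \<open>The index \<open>e'\<close> lies in exactly one of the two words. That word is
    prescribed as \<open>N\<close> or its inverse times the diagonal value of the other one.\<close>
  have "\<exists>Q. (\<forall>bs. e' \<notin> set bs \<longrightarrow> slice_word r (slice r Q) bs = D (count_list bs e)) \<and>
    word_invertible r Q \<beta>' \<and> pair_ratio r Q \<alpha>' \<beta>' = N"
  proof (cases "count_list \<beta>' e' = 0")
    case True
    then have "count_list \<alpha>' e' = 1" using e'(1) by simp
    define j where "j = count_list \<beta>' e"
    obtain Q where Q: "\<forall>bs. e' \<notin> set bs \<longrightarrow> slice_word r (slice r Q) bs = D (count_list bs e)"
      "slice_word r (slice r Q) \<alpha>' = N * D j"
      using ex_core_word[where f = f and e = e, OF mult_carrier_mat[OF N D(1)[of j]] \<open>count_list \<alpha>' e' = 1\<close> f, unfolded D_eq] by metis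
    have \<beta>': "slice_word r (slice r Q) \<beta>' = D j" using Q(1) True by (simp add: count_list_0_iff j_def)
    have "pair_ratio r Q \<alpha>' \<beta>' = N"
      unfolding pair_ratio_def Q(2) \<beta>' by (rule mult_minv_cancel(3)[OF D N])
    moreover have "word_invertible r Q \<beta>'" unfolding word_invertible_def \<beta>' by (rule D(2))
    ultimately show ?thesis using Q(1) by blast
  next
    case False
    then have c: "count_list \<beta>' e' = 1" "count_list \<alpha>' e' = 0" using e'(1) by simp_all
    define i where "i = count_list \<alpha>' e"
    obtain Q where Q: "\<forall>bs. e' \<notin> set bs \<longrightarrow> slice_word r (slice r Q) bs = D (count_list bs e)"
      "slice_word r (slice r Q) \<beta>' = minv N * D i"
      using ex_core_word[where f = f and e = e, OF mult_carrier_mat[OF mN D(1)[of i]] c(1) f, unfolded D_eq] by metis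
    have \<alpha>': "slice_word r (slice r Q) \<alpha>' = D i" using Q(1) c(2) by (simp add: count_list_0_iff i_def)
    have "pair_ratio r Q \<alpha>' \<beta>' = N"
      unfolding pair_ratio_def Q(2) \<alpha>' minv_mult[OF mN D(1) imN(1) D(2)] imN(2) by (rule mult_minv_cancel(1)[OF D N])
    moreover have "word_invertible r Q \<beta>'"
      unfolding word_invertible_def Q(2) using invertible_mat_mult_iff[OF mN D(1)] imN(1) D(2) by simp
    ultimately show ?thesis using Q(1) by blast
  qed
  then obtain Q where Q: "\<And>bs. e' \<notin> set bs \<Longrightarrow> slice_word r (slice r Q) bs = D (count_list bs e)"
    "word_invertible r Q \<beta>'" "pair_ratio r Q \<alpha>' \<beta>' = N" by blast
  have \<alpha>\<beta>: "slice_word r (slice r Q) \<alpha> = D (count_list \<alpha> e)" "slice_word r (slice r Q) \<beta> = D (count_list \<beta> e)"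
    using Q(1) e'(2) by auto
  \<comment> \<open>As \<open>e\<close> occurs once in the first pair, the entries are those of
    \<open>f\<close> or their reciprocals, and so distinct.\<close>
  define g where "g = (\<lambda>k. f k ^ count_list \<alpha> e * (1 / f k ^ count_list \<beta> e))"
  have "pair_ratio r Q \<alpha> \<beta> = mat_diag r g"
    unfolding pair_ratio_def \<alpha>\<beta> unfolding D_def g_def using f by (simp add: minv_mat_diag)
  moreover have "inj_on g {..<r}"
  proof (cases "count_list \<alpha> e = 0")
    case True
    then have "count_list \<beta> e = 1" using e by simp
    then show ?thesis using True inj f by (simp add: g_def inj_on_def)
  next
    case False
    then have "count_list \<alpha> e = 1" "count_list \<beta> e = 0" using e by simp_all
    then show ?thesis using inj by (simp add: g_def inj_on_def)
  qed
  ultimately have b: "distinct_eigenbasis r (pair_ratio r Q \<alpha> \<beta>) (1\<^sub>m r) g"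
    by (simp add: distinct_eigenbasis_def)
  have w: "word_invertible r Q \<beta>" unfolding word_invertible_def \<alpha>\<beta> by (rule D(2))
  have "transverse r (pair_ratio r Q \<alpha> \<beta>) (pair_ratio r Q \<alpha>' \<beta>')"
    unfolding Q(3)
  proof (rule transverseI[OF pair_ratio_carrier[OF w] N b bN])
    fix j k assume "j < r" "k < r"
    then show "(minv (1\<^sub>m r) * X') $$ (j, k) \<noteq> 0"
      unfolding minv_one left_mult_one_mat[OF X'] by (simp add: X'_def)
  qed
  then have "good_pairs r \<alpha> \<beta> \<alpha>' \<beta>' Q"
    unfolding good_pairs_def using w Q(2) b bN unfolding Q(3) by blast
  then show ?thesis unfolding \<alpha>_def \<beta>_def \<alpha>'_def \<beta>'_def by blast
qed

theorem theorem2: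
  fixes n r d :: nat and \<mu> :: "core measure"
  assumes "d \<ge> 3" and "r \<ge> 2" and "n \<ge> r\<^sup>2"
    and "prob_space \<mu>"
    and "sets \<mu> = sets (core_lebesgue n r)"
    and "absolutely_continuous (core_lebesgue n r) \<mu>"
  shows "AE Q in \<mu>. \<forall>T c.
           (\<forall>as \<in> tuples n d. T as = tr_tensor r Q as) \<and> valid_choice n r d c \<longrightarrow>
             (\<forall>R. blostr_output n r d T c R \<longrightarrow> gauge_equiv n r d (slice r Q) R) \<and>
             (cols_alpha c = cols_beta c \<and> cols_alpha' c = cols_beta' c \<and>
              (separated c \<or> (\<exists>Q\<^sub>0. steps12_executable n r (tr_tensor r Q\<^sub>0) c)) \<longrightarrow>
                blostr_completes n r d T c)"
proof -
  note d = assms(1) and r = assms(2)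
  have n: "r * r \<le> n" using assms(3) by (simp add: power2_eq_square)
  let ?I = "tuples n (d - 2)"
  \<comment> \<open>Only finitely many tuples occur, so one null set serves all runs. The
    implication keeps tuples for which no core is good from imposing a condition.\<close>
  have "AE Q in core_lebesgue n r. \<forall>\<alpha> \<in> ?I. \<forall>\<beta> \<in> ?I. \<forall>\<alpha>' \<in> ?I. \<forall>\<beta>' \<in> ?I.
    (\<exists>Q\<^sub>0. good_pairs r \<alpha> \<beta> \<alpha>' \<beta>' Q\<^sub>0) \<longrightarrow> good_pairs r \<alpha> \<beta> \<alpha>' \<beta>' Q"
  proof (intro AE_finite_allI finite_tuples)
    fix \<alpha> \<beta> \<alpha>' \<beta>' assume idx: "\<alpha> \<in> ?I" "\<beta> \<in> ?I" "\<alpha>' \<in> ?I" "\<beta>' \<in> ?I"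
    show "AE Q in core_lebesgue n r. (\<exists>Q\<^sub>0. good_pairs r \<alpha> \<beta> \<alpha>' \<beta>' Q\<^sub>0) \<longrightarrow> good_pairs r \<alpha> \<beta> \<alpha>' \<beta>' Q"
      using AE_good_pairs[OF idx, of r] by (cases "\<exists>Q\<^sub>0. good_pairs r \<alpha> \<beta> \<alpha>' \<beta>' Q\<^sub>0") auto
  qed
  with AE_nondegenerate_core[OF n d r]
  have "AE Q in core_lebesgue n r. nondegenerate_core n r d Q \<and> (\<forall>\<alpha> \<in> ?I. \<forall>\<beta> \<in> ?I. \<forall>\<alpha>' \<in> ?I. \<forall>\<beta>' \<in> ?I.
    (\<exists>Q\<^sub>0. good_pairs r \<alpha> \<beta> \<alpha>' \<beta>' Q\<^sub>0) \<longrightarrow> good_pairs r \<alpha> \<beta> \<alpha>' \<beta>' Q)"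
    by (rule AE_conjI)
  from absolutely_continuous_AE[OF assms(5,6) this] show ?thesis
  proof (rule eventually_mono, intro allI impI)
    fix Q T c
    assume Q: "nondegenerate_core n r d Q \<and> (\<forall>\<alpha> \<in> ?I. \<forall>\<beta> \<in> ?I. \<forall>\<alpha>' \<in> ?I. \<forall>\<beta>' \<in> ?I.
        (\<exists>Q\<^sub>0. good_pairs r \<alpha> \<beta> \<alpha>' \<beta>' Q\<^sub>0) \<longrightarrow> good_pairs r \<alpha> \<beta> \<alpha>' \<beta>' Q)"
      and Tc: "(\<forall>as \<in> tuples n d. T as = tr_tensor r Q as) \<and> valid_choice n r d c"
    then interpret run: blostr_run n r d Q T c
      by (intro blostr_run.intro blostr_run_axioms.intro) auto
    have "blostr_completes n r d T c"
      if cols: "cols_alpha c = cols_beta c" "cols_alpha' c = cols_beta' c"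
        and ex: "separated c \<or> (\<exists>Q\<^sub>0. steps12_executable n r (tr_tensor r Q\<^sub>0) c)"
    proof (rule run.completes[OF cols])
      \<comment> \<open>Either alternative supplies one good core, and the almost everywhere
        statement carries the property over to \<open>Q\<close>.\<close>
      have "\<exists>Q\<^sub>0. good_pairs r (idx_alpha c) (idx_beta c) (idx_alpha' c) (idx_beta' c) Q\<^sub>0"
        using ex ex_good_pairs_if_separated[of c r] good_pairs_if_executable[OF _ run.valid cols n d r] by blast
      then show "good_pairs r (idx_alpha c) (idx_beta c) (idx_alpha' c) (idx_beta' c) Q"
        using Q run.idx by blast
    qed
    then show "(\<forall>R. blostr_output n r d T c R \<longrightarrow> gauge_equiv n r d (slice r Q) R) \<and>
      (cols_alpha c = cols_beta c \<and> cols_alpha' c = cols_beta' c \<and>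
        (separated c \<or> (\<exists>Q\<^sub>0. steps12_executable n r (tr_tensor r Q\<^sub>0) c)) \<longrightarrow> blostr_completes n r d T c)"
      using run.output_gauge_equiv by blast
  qed
qed

end
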